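(* Let $\beta>0$, let $(\gamma_n)_n$ be real numbers with $\gamma_n>(n-1)\beta/2$ and $\gamma_n/n\to\infty$, and let $(b_n)_n$ be a sequence of positive reals with $b_n\to\infty$, $b_n/n\to0$ and $$\frac{n\beta}{2\sqrt{b_n\gamma_n}}\xrightarrow[n\to\infty]{}\xi\in[0,\infty).$$ Let $\mu_n$ be the random spectral measure of the rescaled Laguerre ensemble (defined in the context) and $$\nu_n=\sqrt{\frac{n\beta}{2b_n}}\,(\mu_n-\mu_{sc}).$$ Then the sequence of moment sequences $m(\nu_n)=(m_k(\nu_n))_{k\ge1}$ satisfies a large deviation principle in $\mathbb R^{\mathbb N}$ (with the product topology) with speed $b_n$ and good rate function $$\mathcal I(m)=\frac12\sum_{k=0}^\infty\left(\int q_k(x)\,d(\sigma_m-\rho_\xi)(x)\right)^2,$$ where $q_k$, $k\ge0$, are the normalized (orthonormal) polynomials with respect to $\mu_{sc}$, $\rho_\xi$ is the signed measure with Lebesgue density $\frac{\xi}{2\pi}\frac{x(x^2-3)}{\sqrt{4-x^2}}\mathbf 1_{[-2,2]}(x)$, and $\sigma_m$ is any measure in $\mathcal M_0^f$ with moment sequence $m$.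
   Context: Laguerre ensemble: $(\lambda_1,\dots,\lambda_n)$ has joint Lebesgue density proportional to $\prod_{1\le i<j\le n}|\lambda_i-\lambda_j|^\beta\prod_{i=1}^n\lambda_i^{\gamma_n-(n-1)\beta/2-1}e^{-\lambda_i/2}\mathbf 1_{\{\lambda_i>0\}}$. Spectral measure: $\mu_n=\sum_{i=1}^nw_i\delta_{\tilde\lambda_i}$ with $\tilde\lambda_i=\frac{1}{\sqrt{2\gamma_nn\beta}}(\lambda_i-2\gamma_n)$, where $(w_1,\dots,w_n)$ is independent of the eigenvalues and Dirichlet distributed on the standard simplex with homogeneous parameter $\beta/2$, i.e. $w_n=1-w_1-\dots-w_{n-1}$ and $(w_1,\dots,w_{n-1})$ has density $\frac{\Gamma(n\beta/2)}{\Gamma(\beta/2)^n}[w_1\cdots w_{n-1}(1-w_1-\dots-w_{n-1})]^{\beta/2-1}$ (on the set where all $w_i>0$ and $w_1+\dots+w_{n-1}<1$). $\mu_{sc}$ is the semicircle law with density $\frac1{2\pi}\sqrt{4-x^2}\,\mathbf 1_{[-2,2]}(x)$. $\mathcal M_0^f$ is the set of all signed Borel measures on $\mathbb R$ with finite variation, total mass zero and finite moments of all orders; $m_k(\nu)=\int x^k\,d\nu(x)$ and $m(\nu)=(m_k(\nu))_{k\ge1}\in\mathbb R^{\mathbb N}$. Every $m\in\mathbb R^{\mathbb N}$ is the moment sequence of some (non-unique) element of $\mathcal M_0^f$; the choice of $\sigma_m$ does not matter in $\mathcal I(m)$. Large deviation principle (LDP): for a Hausdorff topological space $\mathbb X$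 with Borel $\sigma$-algebra, $\mathcal I:\mathbb X\to[0,\infty]$ lower semicontinuous and positive reals $a_n\to\infty$, $\mathbb X$-valued random variables $(X_n)$ satisfy an LDP with speed $a_n$ and rate function $\mathcal I$ if $\limsup_n\frac1{a_n}\log P(X_n\in C)\le-\inf_{x\in C}\mathcal I(x)$ for all closed $C\subset\mathbb X$ and $\liminf_n\frac1{a_n}\log P(X_n\in O)\ge-\inf_{x\in O}\mathcal I(x)$ for all open $O\subset\mathbb X$. The rate function is good if all level sets $\{\mathcal I\le c\}$, $c\ge0$, are compact. *)

theory Defs
  imports "HOL-Probability.Probability" "HOL-Computational_Algebra.Polynomial"
begin

section \<open>Large deviation principles\<close>

definition elog :: "real \<Rightarrow> ereal" where
  "elog p = (if p \<le> 0 then - \<infinity> else ereal (ln p))"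

text \<open>Sequences are indexed by \<open>n \<ge> 1\<close>, and \<open>X n\<close> may live on its own
  probability space \<open>M n\<close>. Lower semicontinuity of \<open>I\<close> is stated through its sublevel sets.\<close>

definition ldp ::
  "(nat \<Rightarrow> 'w measure) \<Rightarrow> (nat \<Rightarrow> 'w \<Rightarrow> 'x::t2_space) \<Rightarrow> (nat \<Rightarrow> real) \<Rightarrow> ('x \<Rightarrow> ennreal) \<Rightarrow> bool" where
  "ldp M X a I \<longleftrightarrow>
     (\<forall>n\<ge>1. prob_space (M n) \<and> X n \<in> M n \<rightarrow>\<^sub>M borel) \<and>
     (\<forall>n\<ge>1. 0 < a n) \<and> filterlim a at_top sequentially \<and>
     (\<forall>c. closed {x. I x \<le> c}) \<and>
     (\<forall>C. closed C \<longrightarrow>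
        limsup (\<lambda>n. ereal (1 / a n) * elog (measure (M n) {\<omega> \<in> space (M n). X n \<omega> \<in> C}))
          \<le> - enn2ereal (INF x\<in>C. I x)) \<and>
     (\<forall>U. open U \<longrightarrow>
        liminf (\<lambda>n. ereal (1 / a n) * elog (measure (M n) {\<omega> \<in> space (M n). X n \<omega> \<in> U}))
          \<ge> - enn2ereal (INF x\<in>U. I x))"

definition good_rate_function :: "('x::t2_space \<Rightarrow> ennreal) \<Rightarrow> bool" where
  "good_rate_function I \<longleftrightarrow> (\<forall>c\<ge>0. compact {x. I x \<le> ennreal c})"


section \<open>Signed Borel measures on the real line\<close>

text \<open>A signed measure is a real-valued, countably additive set function on the Borel sets
  (its values on other sets are irrelevant).\<close>

definition signed_measure :: "(real set \<Rightarrow> real) \<Rightarrow> bool" where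
  "signed_measure \<nu> \<longleftrightarrow> \<nu> {} = 0 \<and>
     (\<forall>A :: nat \<Rightarrow> real set. range A \<subseteq> sets borel \<and> disjoint_family A \<longrightarrow>
        (\<lambda>i. \<nu> (A i)) sums \<nu> (\<Union>i. A i))"

text \<open>Jordan decomposition: the positive part of \<open>\<nu>\<close> is
  \<open>A \<mapsto> sup {\<nu> B | B \<subseteq> A}\<close>. Negative values of \<open>\<nu> B\<close> are truncated to \<open>0\<close> by
  \<^const>\<open>ennreal\<close>, which is harmless because \<open>B = {}\<close> contributes \<open>0\<close> anyway.\<close>

definition jordan_pos :: "(real set \<Rightarrow> real) \<Rightarrow> real measure" where
  "jordan_pos \<nu> =
     measure_of UNIV (sets borel) (\<lambda>A. SUP B\<in>{B \<in> sets borel. B \<subseteq> A}. ennreal (\<nu> B))"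

definition jordan_neg :: "(real set \<Rightarrow> real) \<Rightarrow> real measure" where
  "jordan_neg \<nu> = jordan_pos (\<lambda>A. - \<nu> A)"

definition signed_integrable :: "(real set \<Rightarrow> real) \<Rightarrow> (real \<Rightarrow> real) \<Rightarrow> bool" where
  "signed_integrable \<nu> f \<longleftrightarrow> integrable (jordan_pos \<nu>) f \<and> integrable (jordan_neg \<nu>) f"

definition signed_integral :: "(real set \<Rightarrow> real) \<Rightarrow> (real \<Rightarrow> real) \<Rightarrow> real" where
  "signed_integral \<nu> f = (\<integral>x. f x \<partial>jordan_pos \<nu>) - (\<integral>x. f x \<partial>jordan_neg \<nu>)"

definition moment :: "nat \<Rightarrow> (real set \<Rightarrow> real) \<Rightarrow> real" where
  "moment k \<nu> = signed_integral \<nu> (\<lambda>x. x ^ k)"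

text \<open>Moment sequences start with the first moment, so coordinate \<open>k\<close> is the moment of
  order \<open>k + 1\<close>. The type \<^typ>\<open>nat \<Rightarrow> real\<close> carries the product topology.\<close>

definition moments :: "(real set \<Rightarrow> real) \<Rightarrow> nat \<Rightarrow> real" where
  "moments \<nu> = (\<lambda>k. moment (Suc k) \<nu>)"

definition M0f :: "(real set \<Rightarrow> real) set" where
  "M0f = {\<nu>. signed_measure \<nu> \<and>
             emeasure (jordan_pos \<nu>) UNIV + emeasure (jordan_neg \<nu>) UNIV < \<infinity> \<and>
             \<nu> UNIV = 0 \<and>
             (\<forall>k. signed_integrable \<nu> (\<lambda>x. x ^ k))}"


section \<open>Semicircle law and associated objects\<close>

definition semicircle :: "real measure" where
  "semicircle =
     density lborel (\<lambda>x. ennreal (1 / (2 * pi) * sqrt (4 - x\<^sup>2) * indicator {-2..2} x))"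

text \<open>Orthonormal polynomials are unique up to sign; no sign is chosen here, so that a
  statement about all such \<open>q\<close> covers every normalization convention.\<close>

definition orthonormal_polynomials :: "real measure \<Rightarrow> (nat \<Rightarrow> real poly) \<Rightarrow> bool" where
  "orthonormal_polynomials \<mu> q \<longleftrightarrow>
     (\<forall>k. degree (q k) = k) \<and>
     (\<forall>j k. integrable \<mu> (\<lambda>x. poly (q j) x * poly (q k) x) \<and>
        (\<integral>x. poly (q j) x * poly (q k) x \<partial>\<mu>) = (if j = k then 1 else 0))"

definition rho :: "real \<Rightarrow> real set \<Rightarrow> real" where
  "rho \<xi> A =
     (\<integral>x. indicator A x * (\<xi> / (2 * pi) * (x * (x\<^sup>2 - 3) / sqrt (4 - x\<^sup>2)) * indicator {-2..2} x) \<partial>lborel)"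


section \<open>Spectral measure of the rescaled Laguerre ensemble\<close>

definition laguerre_weight :: "real \<Rightarrow> real \<Rightarrow> nat \<Rightarrow> (nat \<Rightarrow> real) \<Rightarrow> real" where
  "laguerre_weight \<beta> g n l =
     (\<Prod>j\<in>{1..n}. \<Prod>i\<in>{1..<j}. \<bar>l i - l j\<bar> powr \<beta>) *
     (\<Prod>i\<in>{1..n}. l i powr (g - (real n - 1) * \<beta> / 2 - 1) * exp (- l i / 2) * indicator {0<..} (l i))"

text \<open>The constant \<open>c\<close> is determined by \<open>M\<close> being a probability space.\<close>

definition laguerre_ensemble ::
  "real \<Rightarrow> real \<Rightarrow> nat \<Rightarrow> 'w measure \<Rightarrow> (nat \<Rightarrow> 'w \<Rightarrow> real) \<Rightarrow> bool" where
  "laguerre_ensemble \<beta> g n M L \<longleftrightarrow>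
     (\<exists>c>0. distributed M (\<Pi>\<^sub>M i\<in>{1..n}. lborel) (\<lambda>\<omega>. \<lambda>i\<in>{1..n}. L i \<omega>)
        (\<lambda>l. ennreal (c * laguerre_weight \<beta> g n l)))"

definition dirichlet_density :: "real \<Rightarrow> nat \<Rightarrow> (nat \<Rightarrow> real) \<Rightarrow> real" where
  "dirichlet_density \<beta> n v =
     (if (\<forall>i\<in>{1..<n}. 0 < v i) \<and> (\<Sum>i\<in>{1..<n}. v i) < 1
      then Gamma (real n * \<beta> / 2) / Gamma (\<beta> / 2) ^ n *
           ((\<Prod>i\<in>{1..<n}. v i) * (1 - (\<Sum>i\<in>{1..<n}. v i))) powr (\<beta> / 2 - 1)
      else 0)"

definition dirichlet_weights ::
  "real \<Rightarrow> nat \<Rightarrow> 'w measure \<Rightarrow> (nat \<Rightarrow> 'w \<Rightarrow> real) \<Rightarrow> bool" where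
  "dirichlet_weights \<beta> n M W \<longleftrightarrow>
     distributed M (\<Pi>\<^sub>M i\<in>{1..<n}. lborel) (\<lambda>\<omega>. \<lambda>i\<in>{1..<n}. W i \<omega>)
       (\<lambda>v. ennreal (dirichlet_density \<beta> n v)) \<and>
     (AE \<omega> in M. W n \<omega> = 1 - (\<Sum>i\<in>{1..<n}. W i \<omega>))"

definition rescale :: "real \<Rightarrow> real \<Rightarrow> nat \<Rightarrow> real \<Rightarrow> real" where
  "rescale \<beta> g n l = (l - 2 * g) / sqrt (2 * g * real n * \<beta>)"

text \<open>\<open>indicat_real A x\<close> is the mass that the Dirac measure at \<open>x\<close> gives to \<open>A\<close>.\<close>

definition spectral_measure ::
  "real \<Rightarrow> real \<Rightarrow> nat \<Rightarrow> (nat \<Rightarrow> real) \<Rightarrow> (nat \<Rightarrow> real) \<Rightarrow> real set \<Rightarrow> real" where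
  "spectral_measure \<beta> g n l w A = (\<Sum>i\<in>{1..n}. w i * indicat_real A (rescale \<beta> g n (l i)))"

definition nu ::
  "real \<Rightarrow> real \<Rightarrow> real \<Rightarrow> nat \<Rightarrow> (nat \<Rightarrow> real) \<Rightarrow> (nat \<Rightarrow> real) \<Rightarrow> real set \<Rightarrow> real" where
  "nu \<beta> g b n l w A =
     sqrt (real n * \<beta> / (2 * b)) * (spectral_measure \<beta> g n l w A - measure semicircle A)"

text \<open>\<open>\<sigma>\<close> picks, for every moment sequence, a signed measure with these moments.\<close>

definition rate_function ::
  "real \<Rightarrow> (nat \<Rightarrow> real poly) \<Rightarrow> ((nat \<Rightarrow> real) \<Rightarrow> real set \<Rightarrow> real) \<Rightarrow> (nat \<Rightarrow> real) \<Rightarrow> ennreal" where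
  "rate_function \<xi> q \<sigma> m =
     ennreal (1 / 2) *
     (\<Sum>k. ennreal ((signed_integral (\<lambda>A. \<sigma> m A - rho \<xi> A) (poly (q k)))\<^sup>2))"

end

theory Submission
 imports Defs "HOL-Computational_Algebra.Formal_Power_Series"
begin

text \<open>The moments of the spectral measure \<open>\<Sum>i w\<^sub>i \<delta>(\<lambda>\<^sub>i)\<close> are the coefficients of a rational function
\<open>q / p\<close> with \<open>p = \<Prod>i (1 - \<lambda>\<^sub>i X)\<close>, and this function is a finite Stieltjes continued fraction with
\<open>2 n - 1\<close> positive entries. In the entries as new variables, the Laguerre density times the Dirichlet
density becomes a product of gamma densities (\<open>moment_law\<close>): the change of variables from weights to
coefficients of \<open>q\<close> and the one from atoms to coefficients of \<open>p\<close> have the Vandermonde product as Jacobian,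
the one from coefficients to entries has a monomial as Jacobian, and the density itself is a function of the entries because
the product of the weights times the squared Vandermonde product is a monomial in the entries (\<open>atoms_GP\<close>).

So everything is a function of independent gamma variables \<open>z\<^sub>1, z\<^sub>2, \<dots>\<close>, the entries read from the outermost one.
Write \<open>z\<^sub>j\<^sub>+\<^sub>1 = 2 k + 2 sqrt (k b\<^sub>n) t\<^sub>j\<close> with \<open>k = \<gamma>\<^sub>n\<close> for even \<open>j\<close> and \<open>k = n \<beta> / 2\<close> for odd \<open>j\<close>. The density
of \<open>t\<^sub>j\<close> is proportional to \<open>exp (b\<^sub>n \<phi>\<^sub>n)\<close> with \<open>\<phi>\<^sub>n\<close> concave and \<open>\<phi>\<^sub>n(t) \<longlongrightarrow> - t\<^sup>2 / 2\<close> locally uniformly,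
so each \<open>t\<^sub>j\<close> has Gaussian large deviations with speed \<open>b\<^sub>n\<close> (locale \<open>gamma_scaling\<close>).

The integral of the orthonormal (Chebyshev) polynomial of degree \<open>k\<close> against the rescaled spectral measure is
the corner entry of that polynomial applied to the Jacobi matrix of the measure. The rescaled Jacobi matrix is a perturbation of order
\<open>\<epsilon>\<^sub>n = sqrt (2 b\<^sub>n / (n \<beta>))\<close> of the free one, and \<open>1 / \<epsilon>\<^sub>n\<close> is the factor in \<open>\<nu>\<^sub>n\<close>. To first
order the corner entry of the polynomial of degree \<open>k\<close> sees a single entry of the perturbation
(\<open>jcheb_linear\<close>, \<open>dal_first\<close>), namely \<open>t\<^sub>k\<^sub>-\<^sub>1\<close>, plus \<open>\<xi>\<close> if \<open>k \<ge> 3\<close> is odd. That shift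
is the integral of the polynomial against \<open>\<rho>\<^sub>\<xi>\<close> (\<open>rho_chb\<close>). Hence the Chebyshev coordinates of
\<open>\<nu>\<^sub>n - \<rho>\<^sub>\<xi>\<close> are the \<open>t\<^sub>j\<close> up to an error that vanishes uniformly on bounded sets
(\<open>chebyshev_moment_asymptotics\<close>), and they satisfy the large deviation principle with rate
\<open>(\<Sum>k y\<^sub>k\<^sup>2) / 2\<close> (locale \<open>asymptotic_product\<close>). Moment sequences and Chebyshev coordinates are related by a triangular
homeomorphism, under which this rate is the asserted rate function (\<open>rate_function_quad_rate\<close>).\<close>

type_synonym rseq = "nat => real"

lemmas measurable_seqI = measurable_coordinatewise_then_product

section \<open>Continued fractions and measures with positive atoms\<close>

text \<open>Polynomials are normalised to constant coefficient \<open>1\<close>, so the parameters are reciprocal roots: this is the form in which denominators of generating functions appear.\<close>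
definition linprod :: "rseq => nat => real poly" where
 "linprod a m = (\<Prod>l<m. [:1, - a l:])"

lemma poly_linprod: "poly (linprod a m) x = (\<Prod>l<m. 1 - a l * x)"
 by (simp add: linprod_def poly_prod mult.commute)

lemma linprod_0 [simp]: "linprod a 0 = 1" by (simp add: linprod_def)

lemma linprod_Suc: "linprod a (Suc m) = linprod a m * [:1, - a m:]"
 by (simp add: linprod_def)

lemma degree_linprod_le: "degree (linprod a m) <= m"
proof (induction m)
 case (Suc m)
 have "degree (linprod a (Suc m)) <= degree (linprod a m) + degree [:1, - a m:]"
  unfolding linprod_Suc by (rule degree_mult_le)
 also have "... <= Suc m" using Suc by simp
 finally show ?case .
qed simp

lemma coeff_linprod_top: "coeff (linprod a m) m = (\<Prod>l<m. - a l)"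
proof (induction m)
 case (Suc m)
 have "coeff (linprod a m) (Suc m) = 0"
  by (rule coeff_eq_0) (use degree_linprod_le[of a m] in simp)
 then show ?case using Suc by (simp add: linprod_Suc mult.commute)
qed simp

lemma coeff_linprod_0: "coeff (linprod a m) 0 = 1"
 by (induction m) (simp_all add: linprod_Suc coeff_mult)

lemma coeff_linprod_1: "coeff (linprod a m) 1 = - (\<Sum>l<m. a l)"
proof (induction m)
 case (Suc m)
 then show ?case using coeff_linprod_0[of a m] by (simp add: linprod_Suc coeff_pCons)
qed simp

lemma poly_eq_by_points:
 fixes p q :: "real poly"
 assumes "degree p <= m" "degree q <= m" "finite A" "card A > m" "!!x. x \<in> A ==> poly p x = poly q x"
 shows "p = q"
proof (rule ccontr)
 assume "p ~= q"
 then have "p - q ~= 0" by simp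
 have "card A <= card {x. poly (p - q) x = 0}"
  using assms(5) poly_roots_finite[OF \<open>p - q ~= 0\<close>] by (intro card_mono) auto
 also have "... <= degree (p - q)" by (rule card_poly_roots_bound) fact
 also have "... <= m" using assms(1,2) by (intro degree_diff_le)
 finally show False using assms(4) by simp
qed

lemma strict_chain:
 fixes X :: rseq
 assumes "!!j. j < m ==> X j < X (Suc j)" "i < k" "k <= m"
 shows "X i < X k"
 using assms(2,3)
proof (induction k)
 case (Suc k)
 then show ?case using assms(1)[of k] by (cases "i = k") auto
qed simp

text \<open>The intermediate value theorem yields as many roots as the degree allows, one between any two consecutive sign points; so these are all the roots, and they interlace with the sign points.\<close>
lemma alternating_signs_roots:
 fixes f :: "real poly" and X :: rseq
 assumes deg: "degree f <= m" and f0: "coeff f 0 = 1" and X0: "X 0 >= 0"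
  and inc: "!!j. j < m ==> X j < X (Suc j)"
  and sg: "!!j. j <= m ==> poly f (X j) * (-1) ^ j > 0"
 shows "\<exists>r. (\<forall>j<m. X j < r j & r j < X (Suc j)) & f = linprod (\<lambda>j. 1 / r j) m"
proof -
 have "\<exists>r. X j < r & r < X (Suc j) & poly f r = 0" if "j < m" for j
 proof (cases "even j")
  case True
  have "poly f (X j) > 0" "poly f (X (Suc j)) < 0"
   using sg[of j] sg[of "Suc j"] True that by auto
  then show ?thesis using poly_IVT_neg[OF inc[OF that]] by auto
 next
  case False
  have "poly f (X j) < 0" "poly f (X (Suc j)) > 0"
   using sg[of j] sg[of "Suc j"] False that by auto
  then show ?thesis using poly_IVT_pos[OF inc[OF that]] by auto
 qed
 then obtain r where r: "!!j. j < m ==> X j < r j & r j < X (Suc j) & poly f (r j) = 0"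
  by metis
 have Xmono: "X i <= X k" if "i <= k" "k <= m" for i k
  using strict_chain[of m X i k] inc that by (cases "i = k") (auto simp: less_imp_le)
 have rpos: "r j > 0" if "j < m" for j
  using r[OF that] Xmono[of 0 j] X0 that by linarith
 have rinc: "r i < r k" if "i < k" "k < m" for i k
  using r[of i] r[of k] Xmono[of "Suc i" k] that by fastforce
 have inj: "inj_on r {..<m}"
  by (rule linorder_inj_onI) (use rinc in force)+
 have r0: "0 \<notin> r ` {..<m}" using rpos by force
 have "f = linprod (\<lambda>j. 1 / r j) m"
 proof (rule poly_eq_by_points[where A = "insert 0 (r ` {..<m})" and m = m])
  show "card (insert 0 (r ` {..<m})) > m"
   using r0 by (simp add: card_image[OF inj])
  fix x assume "x \<in> insert 0 (r ` {..<m})"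
  then consider "x = 0" | j where "j < m" "x = r j" by auto
  then show "poly f x = poly (linprod (\<lambda>j. 1 / r j) m) x"
  proof cases
   case 1
   then show ?thesis using f0 coeff_linprod_0 by (simp add: poly_0_coeff_0)
  next
   case 2
   have "poly (linprod (\<lambda>j. 1 / r j) m) x = 0"
    unfolding poly_linprod using 2 rpos[of j] by (intro prod_zero bexI[of _ j]) auto
   then show ?thesis using r[of j] 2 by simp
  qed
 qed (use deg degree_linprod_le in auto)
 then show ?thesis using r by blast
qed

lemma eventually_sign_at_top:
 fixes f :: "real poly"
 assumes "degree f <= m" "coeff f m * s > 0"
 shows "\<exists>x>y. poly f x * s > 0"
proof -
 have "coeff f m ~= 0" using assms by auto
 then have d: "degree f = m" using assms(1) le_degree by (metis le_antisym)
 have l: "lead_coeff (smult s f) > 0" using assms d by (cases "s = 0") (auto simp: mult.commute)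
 obtain n where n: "!!x. x >= n ==> lead_coeff (smult s f) <= poly (smult s f) x"
  using poly_pinfty_gt_lc[OF l] by blast
 have "poly (smult s f) (max n (y + 1)) > 0" using n[of "max n (y+1)"] l by simp
 then show ?thesis by (intro exI[of _ "max n (y + 1)"]) (auto simp: mult.commute)
qed

text \<open>Exactly the \<open>k\<close> factors with a root to the left of \<open>x\<close> are negative.\<close>
lemma sign_linprod:
 fixes tau :: rseq
 assumes "k <= m" "x > 0" "!!j. j < k ==> 0 < tau j & tau j < x" "!!j. k <= j ==> j < m ==> x < tau j"
 shows "poly (linprod (\<lambda>j. 1 / tau j) m) x * (-1) ^ k > 0"
proof -
 have "(\<Prod>l<m. 1 - x / tau l) = (\<Prod>l<k. 1 - x / tau l) * (\<Prod>l\<in>{k..<m}. 1 - x / tau l)"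
  using assms(1) by (simp add: lessThan_atLeast0 prod.atLeastLessThan_concat)
 moreover have "(\<Prod>l<k. 1 - x / tau l) * (-1) ^ k = (\<Prod>l<k. x / tau l - 1)"
 proof -
  have "(\<Prod>l<k. 1 - x / tau l) * (\<Prod>l<k. -1) = (\<Prod>l<k. x / tau l - 1)"
   by (subst prod.distrib[symmetric]) simp
  then show ?thesis by simp
 qed
 moreover have "(\<Prod>l<k. x / tau l - 1) > 0"
  using assms(3) by (intro prod_pos) auto
 moreover have "(\<Prod>l\<in>{k..<m}. 1 - x / tau l) > 0"
 proof (intro prod_pos ballI)
  fix i assume "i \<in> {k..<m}"
  then have "x < tau i" using assms(4) by auto
  then show "0 < 1 - x / tau i" using assms(2) by auto
 qed
 ultimately have "0 < ((\<Prod>l<k. 1 - x / tau l) * (-1) ^ k) * (\<Prod>l\<in>{k..<m}. 1 - x / tau l)"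
  by simp
 also have "... = poly (linprod (\<lambda>j. 1 / tau j) m) x * (-1) ^ k"
  unfolding poly_linprod by (simp add: \<open>(\<Prod>l<m. 1 - x / tau l) = _\<close> mult_ac)
 finally show ?thesis .
qed

lemma sign_top_linprod:
 fixes tau :: rseq
 assumes "!!j. j < m ==> 0 < tau j"
 shows "coeff (linprod (\<lambda>j. 1 / tau j) m) m * (-1) ^ m > 0"
proof -
 have "(\<Prod>l<m. - (1 / tau l)) * (-1) ^ m = (\<Prod>l<m. - (1 / tau l)) * (\<Prod>l<m. -1)" by simp
 also have "... = (\<Prod>l<m. 1 / tau l)" by (subst prod.distrib[symmetric]) simp
 also have "... > 0" using assms by (intro prod_pos) auto
 finally show ?thesis by (simp add: coeff_linprod_top)
qed

text \<open>The roots of \<open>f\<close> (even indices) and of \<open>g\<close> (odd indices) strictly interlace on the positive axis, starting with a root of \<open>f\<close>.\<close>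
definition interl :: "rseq => nat => real poly => real poly => bool" where
 "interl tau i f g \<longleftrightarrow> tau 0 > 0 & (\<forall>j. Suc j < i --> tau j < tau (Suc j)) &
   f = linprod (\<lambda>l. 1 / tau (2 * l)) ((i + 1) div 2) & g = linprod (\<lambda>l. 1 / tau (2 * l + 1)) (i div 2)"

lemma interl_mono:
 assumes "interl tau i f g" "j < k" "k < i"
 shows "tau j < tau k"
 using strict_chain[of "i - 1" tau j k] assms by (auto simp: interl_def)

lemma interl_pos:
 assumes "interl tau i f g" "k < i"
 shows "tau k > 0"
 using interl_mono[OF assms(1), of 0 k] assms by (cases "k = 0") (auto simp: interl_def)

lemma interl_sign_right:
 assumes I: "interl tau i f g" and l: "2 * l < i"
 shows "poly g (tau (2 * l)) * (-1) ^ l > 0"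
proof -
 have g: "g = linprod (\<lambda>l. 1 / tau (2 * l + 1)) (i div 2)" using I by (simp add: interl_def)
 show ?thesis
  unfolding g
  by (rule sign_linprod) (use l interl_mono[OF I] interl_pos[OF I] in auto)
qed

lemma interl_sign_left:
 assumes I: "interl tau i f g" and l: "2 * l + 1 < i"
 shows "poly f (tau (2 * l + 1)) * (-1) ^ (Suc l) > 0"
proof -
 have f: "f = linprod (\<lambda>l. 1 / tau (2 * l)) ((i + 1) div 2)" using I by (simp add: interl_def)
 show ?thesis
  unfolding f
  by (rule sign_linprod) (use l interl_mono[OF I] interl_pos[OF I] in auto)
qed

lemma interl_root_left:
 assumes "interl tau i f g" "2 * l < i"
 shows "poly f (tau (2 * l)) = 0"
proof -
 have "f = linprod (\<lambda>l. 1 / tau (2 * l)) ((i + 1) div 2)" using assms by (simp add: interl_def)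
 then show ?thesis using assms(2) interl_pos[OF assms]
  by (simp only: poly_linprod) (intro prod_zero bexI[of _ l], auto)
qed

lemma interl_root_right:
 assumes "interl tau i f g" "2 * l + 1 < i"
 shows "poly g (tau (2 * l + 1)) = 0"
proof -
 have "g = linprod (\<lambda>l. 1 / tau (2 * l + 1)) (i div 2)" using assms by (simp add: interl_def)
 then show ?thesis using assms(2) interl_pos[OF assms]
  by (simp only: poly_linprod) (intro prod_zero bexI[of _ l], auto)
qed

lemma interl_degree:
 assumes "interl tau i f g"
 shows "degree f <= (i + 1) div 2" "degree g <= i div 2" "coeff f 0 = 1" "coeff g 0 = 1"
 using assms by (auto simp: interl_def degree_linprod_le coeff_linprod_0)

text \<open>At the roots of \<open>f\<close> the new polynomial equals \<open>- y x g(x)\<close>, whose signs alternate because \<open>g\<close> interlaces \<open>f\<close>. With the value \<open>1\<close> at the origin and the sign at infinity this forces one new root in each gap.\<close>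
lemma interl_up:
 assumes I: "interl tau i f g" and y: "y > 0"
 shows "\<exists>tau'. interl tau' (Suc i) (f - smult y (pCons 0 g)) f & (\<forall>l. tau' (2 * l + 1) = tau (2 * l))"
proof -
 define f' where "f' = f - smult y (pCons 0 g)"
 define m where "m = (i + 2) div 2"
 note d = interl_degree[OF I]
 have deg: "degree f' <= m"
 proof -
  have "degree (smult y (pCons 0 g)) <= Suc (degree g)"
   by (metis degree_pCons_le degree_smult_le le_trans)
  then show ?thesis unfolding f'_def m_def using d(1,2) by (intro degree_diff_le) auto
 qed
 have val: "poly f' x = poly f x - y * x * poly g x" for x by (simp add: f'_def)
 have "\<exists>z. even i --> z > (if i = 0 then 0 else tau (i - 2)) & poly f' z * (-1) ^ m > 0"
 proof (cases "even i")
  case True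
  have "coeff f m = 0" using d(1) True by (intro coeff_eq_0) (auto simp: m_def)
  then have "coeff f' m = - y * coeff g (i div 2)" using True by (auto simp: f'_def m_def coeff_pCons)
  moreover have "coeff g (i div 2) * (-1) ^ (i div 2) > 0"
  proof -
   have g: "g = linprod (\<lambda>l. 1 / tau (2 * l + 1)) (i div 2)" using I by (simp add: interl_def)
   show ?thesis unfolding g by (rule sign_top_linprod) (use interl_pos[OF I] in auto)
  qed
  moreover have "m = Suc (i div 2)" by (simp add: m_def)
  ultimately have "coeff f' m * (-1) ^ m > 0" using y by (simp add: mult.assoc)
  from eventually_sign_at_top[OF deg this] show ?thesis by blast
 qed simp
 then obtain z where z: "even i ==> z > (if i = 0 then 0 else tau (i - 2))" "even i ==> poly f' z * (-1) ^ m > 0"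
  by blast
 define X where "X j = (if j = 0 then 0 else if 2 * (j - 1) < i then tau (2 * (j - 1)) else z)" for j
 have "\<exists>r. (\<forall>j<m. X j < r j & r j < X (Suc j)) & f' = linprod (\<lambda>j. 1 / r j) m"
 proof (rule alternating_signs_roots[OF deg])
  show f'0: "coeff f' 0 = 1" using d by (simp add: f'_def)
  show "X 0 >= 0" by (simp add: X_def)
  show "X j < X (Suc j)" if "j < m" for j
  proof (cases "2 * j < i")
   case True
   then show ?thesis using interl_pos[OF I, of 0] interl_mono[OF I, of "2 * (j - 1)" "2 * j"]
    by (auto simp: X_def)
  next
   case False
   then have ev: "even i" "j = i div 2" using that unfolding m_def by presburger+
   then show ?thesis using z(1) by (auto simp: X_def right_diff_distrib' elim!: evenE)
  qed
  show "poly f' (X j) * (-1) ^ j > 0" if "j <= m" for j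
  proof (cases j)
   case 0
   then show ?thesis using f'0 by (simp add: X_def poly_0_coeff_0)
  next
   case (Suc l)
   show ?thesis
   proof (cases "2 * l < i")
    case True
    have "poly f' (tau (2 * l)) * (-1) ^ Suc l = y * tau (2 * l) * (poly g (tau (2 * l)) * (-1) ^ l)"
     using interl_root_left[OF I True] by (simp add: val)
    also have "... > 0" using interl_sign_right[OF I True] interl_pos[OF I True] y by simp
    finally show ?thesis using True Suc by (simp add: X_def)
   next
    case False
    then have "even i" "j = m" using that Suc unfolding m_def by presburger+
    moreover have "X j = z" using False Suc by (simp add: X_def)
    ultimately show ?thesis using z(2) by simp
   qed
  qed
 qed
 then obtain r where r: "!!j. j < m ==> X j < r j & r j < X (Suc j)" "f' = linprod (\<lambda>j. 1 / r j) m" by blast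
 define tau' where "tau' k = (if even k then r (k div 2) else tau (k - 1))" for k
 have "interl tau' (Suc i) f' f"
  unfolding interl_def
 proof (intro conjI allI impI)
  show "0 < tau' 0" using r(1)[of 0] by (simp add: tau'_def X_def m_def)
  show "tau' j < tau' (Suc j)" if "Suc j < Suc i" for j
  proof (cases "even j")
   case True
   then obtain l where l: "j = 2 * l" by (elim evenE)
   then show ?thesis using r(1)[of l] that by (auto simp: tau'_def X_def m_def)
  next
   case False
   then obtain l where l: "j = 2 * l + 1" by (elim oddE)
   then show ?thesis using r(1)[of "Suc l"] that by (auto simp: tau'_def X_def m_def)
  qed
  show "f' = linprod (\<lambda>l. 1 / tau' (2 * l)) ((Suc i + 1) div 2)"
   unfolding r(2) m_def by (simp add: tau'_def)
  show "f = linprod (\<lambda>l. 1 / tau' (2 * l + 1)) (Suc i div 2)"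
   using I by (simp add: tau'_def interl_def)
 qed
 moreover have "\<forall>l. tau' (2 * l + 1) = tau (2 * l)" by (simp add: tau'_def)
 ultimately show ?thesis unfolding f'_def by blast
qed

text \<open>The converse step: \<open>y\<close> is forced by the linear coefficients and then \<open>h = (f - f') / (y X)\<close>. The signs of \<open>f'\<close> at the roots of \<open>f\<close> show that \<open>h\<close> interlaces \<open>f\<close>.\<close>
lemma interl_down:
 assumes I: "interl tau' (Suc i) f' f"
 shows "\<exists>tau y h. y > 0 & interl tau i f h & f' = f - smult y (pCons 0 h)"
proof -
 note d = interl_degree[OF I]
 define m where "m = i div 2"
 \<comment> \<open>Comparison of the linear coefficients in \<open>f' = f - y X h\<close> with \<open>h(0) = 1\<close>.\<close>
 define y where "y = coeff f 1 - coeff f' 1"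
 have y: "y > 0"
 proof -
  have f: "f = linprod (\<lambda>l. 1 / tau' (2 * l + 1)) ((i + 1) div 2)"
   and f': "f' = linprod (\<lambda>l. 1 / tau' (2 * l)) ((i + 2) div 2)"
   using I by (simp_all add: interl_def)
  have p: "1 / tau' (2 * l) > 0" if "l < (i + 2) div 2" for l
   using interl_pos[OF I, of "2 * l"] that by simp
  have "y = (\<Sum>l<(i + 2) div 2. 1 / tau' (2 * l)) - (\<Sum>l<(i + 1) div 2. 1 / tau' (2 * l + 1))"
   unfolding y_def f f' coeff_linprod_1 by simp
  moreover have "(\<Sum>l<(i + 1) div 2. 1 / tau' (2 * l + 1)) < (\<Sum>l<(i + 2) div 2. 1 / tau' (2 * l))"
  proof (cases "i = 0")
   case True
   then show ?thesis using p[of 0] by simp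
  next
   case False
   have "(\<Sum>l<(i + 1) div 2. 1 / tau' (2 * l + 1)) < (\<Sum>l<(i + 1) div 2. 1 / tau' (2 * l))"
   proof (rule sum_strict_mono)
    fix l assume "l \<in> {..<(i + 1) div 2}"
    then have "tau' (2 * l) < tau' (2 * l + 1)" "tau' (2 * l) > 0"
     using interl_mono[OF I, of "2 * l" "2 * l + 1"] interl_pos[OF I, of "2 * l"] by auto
    then show "1 / tau' (2 * l + 1) < 1 / tau' (2 * l)" by (intro divide_strict_left_mono) auto
   qed (use False in \<open>auto simp: lessThan_empty_iff\<close>)
   also have "... <= (\<Sum>l<(i + 2) div 2. 1 / tau' (2 * l))"
    by (rule sum_mono2) (use p in \<open>auto simp: less_imp_le\<close>)
   finally show ?thesis .
  qed
  ultimately show ?thesis by simp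
 qed
 obtain c h0 where ch: "f - f' = pCons c h0" by (rule pCons_cases)
 have "c = 0" using d(3,4) arg_cong[OF ch, of "\<lambda>p. coeff p 0"] by simp
 define h where "h = smult (1 / y) h0"
 have f'eq: "f' = f - smult y (pCons 0 h)"
  using ch \<open>c = 0\<close> y by (simp add: h_def algebra_simps)
 have ch1: "coeff h k = (coeff f (Suc k) - coeff f' (Suc k)) / y" for k
  using y by (simp add: f'eq)
 have h0: "coeff h 0 = 1" using y unfolding ch1 by (simp add: y_def)
 have deg: "degree h <= m"
 proof (rule degree_le, intro allI impI)
  fix k assume "m < k"
  then have "coeff f (Suc k) = 0" "coeff f' (Suc k) = 0"
   using d(1,2) by (auto intro!: coeff_eq_0 simp: m_def)
  then show "coeff h k = 0" by (simp add: ch1)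
 qed
 have val: "poly f' x = poly f x - y * x * poly h x" for x by (simp add: f'eq)
 have "\<exists>z. even i --> z > (if i = 0 then 0 else tau' (i - 1)) & poly h z * (-1) ^ m > 0"
 proof (cases "even i")
  case True
  have "coeff f (Suc m) = 0" using d(2) True by (intro coeff_eq_0) (auto simp: m_def)
  then have "coeff h m = - coeff f' (Suc m) / y" by (simp add: ch1)
  moreover have "coeff f' (Suc m) * (-1) ^ (Suc m) > 0"
  proof -
   have g: "f' = linprod (\<lambda>l. 1 / tau' (2 * l)) (Suc m)" using I by (simp add: interl_def m_def)
   show ?thesis unfolding g by (rule sign_top_linprod) (use interl_pos[OF I] in \<open>auto simp: m_def\<close>)
  qed
  moreover have "(- c / y) * s = c * (- s) / y" for c s :: real by simp
  ultimately have "coeff h m * (-1) ^ m > 0" using y by (simp only: power_Suc) (simp add: divide_pos_pos divide_neg_pos)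
  from eventually_sign_at_top[OF deg this] show ?thesis by blast
 qed simp
 then obtain z where z: "even i ==> z > (if i = 0 then 0 else tau' (i - 1))" "even i ==> poly h z * (-1) ^ m > 0"
  by blast
 define X where "X j = (if 2 * j < i then tau' (2 * j + 1) else z)" for j
 have "\<exists>r. (\<forall>j<m. X j < r j & r j < X (Suc j)) & h = linprod (\<lambda>j. 1 / r j) m"
 proof (rule alternating_signs_roots[OF deg h0])
  show "X 0 >= 0" using interl_pos[OF I, of 1] z(1) by (auto simp: X_def split: if_splits)
  show "X j < X (Suc j)" if "j < m" for j
  proof (cases "2 * Suc j < i")
   case True
   then show ?thesis using interl_mono[OF I, of "2 * j + 1" "2 * j + 3"]
    by (auto simp: X_def numeral_3_eq_3)
  next
   case False
   then have ev: "even i" "i = 2 * Suc j" using that unfolding m_def by presburger+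
   then show ?thesis using z(1) by (auto simp: X_def)
  qed
  show "poly h (X j) * (-1) ^ j > 0" if "j <= m" for j
  proof (cases "2 * j < i")
   case True
   then have 2: "2 * j + 1 < Suc i" by simp
   let ?x = "tau' (2 * j + 1)"
   have "y * ?x * (poly h ?x * (-1) ^ j) = poly f' ?x * (-1) ^ Suc j"
    using interl_root_right[OF I 2] by (simp add: val)
   also have "... > 0" by (rule interl_sign_left[OF I 2])
   finally have "0 < y * ?x * (poly h ?x * (-1) ^ j)" .
   moreover have "y * ?x > 0" using interl_pos[OF I 2] y by simp
   ultimately have "0 < poly h ?x * (-1) ^ j" by (rule zero_less_mult_pos)
   then show ?thesis using True by (simp only: X_def if_True)
  next
   case False
   then have "even i" "j = m" using that unfolding m_def by presburger+
   moreover have "X j = z" using False by (simp add: X_def)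
   ultimately show ?thesis using z(2) by simp
  qed
 qed
 then obtain r where r: "!!j. j < m ==> X j < r j & r j < X (Suc j)" "h = linprod (\<lambda>j. 1 / r j) m" by blast
 define tau where "tau k = (if even k then (if k < i then tau' (k + 1) else 1) else r (k div 2))" for k
 have "interl tau i f h"
  unfolding interl_def
 proof (intro conjI allI impI)
  show "0 < tau 0" using interl_pos[OF I, of 1] by (simp add: tau_def)
  show "tau j < tau (Suc j)" if "Suc j < i" for j
  proof (cases "even j")
   case True
   then obtain l where l: "j = 2 * l" by (elim evenE)
   then show ?thesis using r(1)[of l] that by (auto simp: tau_def X_def m_def)
  next
   case False
   then obtain l where l: "j = 2 * l + 1" by (elim oddE)
   then show ?thesis using r(1)[of l] that by (auto simp: tau_def X_def m_def numeral_3_eq_3)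
  qed
  show "h = linprod (\<lambda>l. 1 / tau (2 * l + 1)) (i div 2)"
   unfolding r(2) m_def by (simp add: tau_def)
  have "f = linprod (\<lambda>l. 1 / tau' (2 * l + 1)) ((i + 1) div 2)" using I by (simp add: interl_def)
  also have "... = linprod (\<lambda>l. 1 / tau (2 * l)) ((i + 1) div 2)"
   unfolding linprod_def by (intro prod.cong) (auto simp: tau_def)
  finally show "f = linprod (\<lambda>l. 1 / tau (2 * l)) ((i + 1) div 2)" .
 qed
 then show ?thesis using y f'eq by blast
qed


text \<open>With \<open>p = GP y (N + 1)\<close> and \<open>q = GP y N\<close> the quotient \<open>q / p\<close> is the Stieltjes continued fraction \<open>1 / (1 - y\<^sub>N\<^sub>-\<^sub>1 X / (1 - y\<^sub>N\<^sub>-\<^sub>2 X / \<dots>))\<close>. Numbering the entries from the innermost one makes the recursion independent of \<open>N\<close>.\<close>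
fun GP :: "rseq => nat => real poly" where
 "GP y 0 = 1"
| "GP y (Suc 0) = 1"
| "GP y (Suc (Suc i)) = GP y (Suc i) - smult (y i) (pCons 0 (GP y i))"

lemma GP_cong: "(!!j. Suc j < i ==> y j = y' j) ==> GP y i = GP y' i"
 by (induction y i rule: GP.induct) auto

text \<open>The product is the resultant of the two polynomials up to normalisation. It is computed one step at a time, since at a root of \<open>GP y (i + 1)\<close> the next polynomial reduces to \<open>- y\<^sub>i X GP y i\<close>.\<close>
lemma interl_GP:
 assumes "!!i. i < N ==> y i > 0"
 shows "\<exists>tau. interl tau N (GP y (Suc N)) (GP y N) &
  (\<Prod>l<(N + 1) div 2. \<Prod>j<N div 2. \<bar>1 / tau (2 * l) - 1 / tau (2 * j + 1)\<bar>) = (\<Prod>i<N. y i ^ ((i + 1) div 2))"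
 using assms
proof (induction N)
 case 0
 show ?case by (intro exI[of _ "\<lambda>_. 1"]) (simp add: interl_def)
next
 case (Suc N)
 then obtain tau where I: "interl tau N (GP y (Suc N)) (GP y N)" and
  P: "(\<Prod>l<(N + 1) div 2. \<Prod>j<N div 2. \<bar>1 / tau (2 * l) - 1 / tau (2 * j + 1)\<bar>) = (\<Prod>i<N. y i ^ ((i + 1) div 2))"
  by auto
 have y: "y N > 0" using Suc by simp
 define a where "a = (\<lambda>j. 1 / tau (2 * j))"
 define b where "b = (\<lambda>j. 1 / tau (2 * j + 1))"
 obtain tau' where I': "interl tau' (Suc N) (GP y (Suc (Suc N))) (GP y (Suc N))" and o: "!!l. tau' (2 * l + 1) = tau (2 * l)"
  using interl_up[OF I y] by auto
 define a' where "a' = (\<lambda>j. 1 / tau' (2 * j))"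
 have g2: "GP y (Suc (Suc N)) = linprod a' ((N + 2) div 2)"
 proof -
  have "GP y (Suc (Suc N)) = linprod (\<lambda>l. 1 / tau' (2 * l)) ((Suc N + 1) div 2)"
   using I' unfolding interl_def by blast
  moreover have "Suc N + 1 = N + 2" by simp
  ultimately show ?thesis unfolding a'_def by (simp only:)
 qed
 have g1: "GP y (Suc N) = linprod a ((N + 1) div 2)" using I by (simp add: interl_def a_def)
 have g0: "GP y N = linprod b (N div 2)" using I by (simp add: interl_def b_def)
 have ev: "(\<Prod>l<m. \<bar>c l - x\<bar>) = x ^ m * \<bar>poly (linprod c m) (1 / x)\<bar>" if "x > 0" for c :: rseq and x m
 proof -
  have "x ^ m * \<bar>poly (linprod c m) (1 / x)\<bar> = (\<Prod>l<m. x * \<bar>1 - c l / x\<bar>)"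
   by (simp add: poly_linprod abs_prod prod.distrib)
  also have "... = (\<Prod>l<m. \<bar>c l - x\<bar>)"
  proof (rule prod.cong)
   fix l
   have "x * \<bar>1 - c l / x\<bar> = \<bar>x * (1 - c l / x)\<bar>" using that by (simp add: abs_mult)
   also have "x * (1 - c l / x) = x - c l" using that by (simp add: field_simps)
   finally show "x * \<bar>1 - c l / x\<bar> = \<bar>c l - x\<bar>" by simp
  qed simp
  finally show ?thesis by simp
 qed
 have apos: "a j > 0" if "j < (N + 1) div 2" for j
  using interl_pos[OF I, of "2 * j"] that by (simp add: a_def)
 have "(\<Prod>l<(Suc N + 1) div 2. \<Prod>j<Suc N div 2. \<bar>1 / tau' (2 * l) - 1 / tau' (2 * j + 1)\<bar>)
   = (\<Prod>j<(N + 1) div 2. \<Prod>l<(N + 2) div 2. \<bar>a' l - a j\<bar>)"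
  unfolding o by (subst prod.swap) (simp add: a'_def a_def)
 also have "... = (\<Prod>j<(N + 1) div 2. y N * (\<Prod>l<N div 2. \<bar>a j - b l\<bar>))"
 proof (rule prod.cong)
  fix j assume "j \<in> {..<(N + 1) div 2}"
  then have j: "j < (N + 1) div 2" by simp
  have r: "poly (GP y (Suc N)) (1 / a j) = 0"
   using interl_root_left[OF I, of j] j by (simp add: a_def)
  have "(\<Prod>l<(N + 2) div 2. \<bar>a' l - a j\<bar>) = a j ^ ((N + 2) div 2) * \<bar>poly (GP y (Suc (Suc N))) (1 / a j)\<bar>"
   unfolding g2 by (rule ev[OF apos[OF j]])
  also have "poly (GP y (Suc (Suc N))) (1 / a j) = - (y N / a j * poly (GP y N) (1 / a j))"
   using r by simp
  also have "a j ^ ((N + 2) div 2) * \<bar>- (y N / a j * poly (GP y N) (1 / a j))\<bar>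
    = y N * (a j ^ (N div 2) * \<bar>poly (GP y N) (1 / a j)\<bar>)"
   using apos[OF j] y by (simp add: abs_mult)
  also have "a j ^ (N div 2) * \<bar>poly (GP y N) (1 / a j)\<bar> = (\<Prod>l<N div 2. \<bar>b l - a j\<bar>)"
   unfolding g0 by (rule ev[OF apos[OF j], symmetric])
  finally show "(\<Prod>l<(N + 2) div 2. \<bar>a' l - a j\<bar>) = y N * (\<Prod>l<N div 2. \<bar>a j - b l\<bar>)"
   by (simp add: abs_minus_commute)
 qed simp
 also have "... = y N ^ ((N + 1) div 2) * (\<Prod>i<N. y i ^ ((i + 1) div 2))"
  using P by (simp add: prod.distrib a_def b_def)
 finally show ?case using I' by (intro exI[of _ tau']) (simp add: mult.commute)
qed

lemma interl_imp_GP: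
 assumes "interl tau N f g"
 shows "\<exists>y. (\<forall>i<N. y i > 0) & f = GP y (Suc N) & g = GP y N"
 using assms
proof (induction N arbitrary: f g tau)
 case 0
 then show ?case by (auto simp: interl_def)
next
 case (Suc N)
 obtain tau' z h where z: "z > 0" "interl tau' N g h" "f = g - smult z (pCons 0 h)"
  using interl_down[OF Suc.prems] by blast
 obtain y where y: "\<forall>i<N. y i > 0" "g = GP y (Suc N)" "h = GP y N" using Suc.IH[OF z(2)] by blast
 define y' where "y' = y(N := z)"
 have "GP y' (Suc N) = GP y (Suc N)" "GP y' N = GP y N"
  by (rule GP_cong; simp add: y'_def)+
 moreover have "y' N = z" "\<forall>i<N. y' i > 0" using y by (auto simp: y'_def)
 ultimately show ?case using y z by (intro exI[of _ y']) (auto simp: less_Suc_eq)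
qed

lemma GP_degree: "degree (GP y i) <= i div 2"
proof (induction y i rule: GP.induct)
 case (3 y i)
 have "degree (smult (y i) (pCons 0 (GP y i))) <= Suc (degree (GP y i))"
  by (metis degree_pCons_le degree_smult_le le_trans)
 then show ?case using 3 by (auto intro!: degree_diff_le)
qed auto

lemma GP_coeff_0 [simp]: "coeff (GP y i) 0 = 1"
 by (induction y i rule: GP.induct) auto

lemma GP_coeff_1: "coeff (GP y (Suc i)) 1 = - (\<Sum>j<i. y j)"
proof (induction i)
 case (Suc i)
 then show ?case by (cases i) (simp_all add: one_pCons)
qed simp

lemma GP_coeff_top: "coeff (GP y (2 * k)) k = (\<Prod>i<k. - y (2 * i))"
proof (induction k)
 case (Suc k)
 have "coeff (GP y (Suc (2 * k))) (Suc k) = 0"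
  using GP_degree[of y "Suc (2 * k)"] by (intro coeff_eq_0) simp
 then show ?case using Suc by simp
qed simp

text \<open>Denominator and numerator of \<open>\<Sum>i w\<^sub>i / (1 - \<lambda>\<^sub>i X)\<close>, the generating function of the moments of \<open>\<Sum>i w\<^sub>i \<delta>(\<lambda>\<^sub>i)\<close>.\<close>
definition PPp :: "rseq => nat => real poly" where
 "PPp lam n = (\<Prod>i\<in>{1..n}. [:1, - lam i:])"

definition QQp :: "rseq => rseq => nat => real poly" where
 "QQp lam w n = (\<Sum>i\<in>{1..n}. smult (w i) (\<Prod>j\<in>{1..n} - {i}. [:1, - lam j:]))"

lemma PPp_linprod: "PPp lam n = linprod (\<lambda>l. lam (Suc l)) n"
 unfolding PPp_def linprod_def by (rule prod.reindex_bij_witness[of _ Suc "\<lambda>i. i - 1"]) auto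

lemma degree_prod_lin: "finite A ==> degree (\<Prod>j\<in>A. [:1, - lam j :: real:]) <= card A"
proof (induction A rule: finite_induct)
 case (insert x A)
 have "degree ([:1, - lam x:] * (\<Prod>j\<in>A. [:1, - lam j:])) <= degree [:1, - lam x:] + degree (\<Prod>j\<in>A. [:1, - lam j:])"
  by (rule degree_mult_le)
 also have "... <= Suc (card A)" using insert by simp
 finally show ?case using insert by simp
qed simp

lemma degree_QQp: "degree (QQp lam w n) <= n - 1"
 unfolding QQp_def
proof (rule degree_sum_le)
 fix i assume "i \<in> {1..n}"
 then have c: "card ({1..n} - {i}) = n - 1" by simp
 have "degree (smult (w i) (\<Prod>j\<in>{1..n} - {i}. [:1, - lam j:])) <= degree (\<Prod>j\<in>{1..n} - {i}. [:1, - lam j:])"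
  by (rule degree_smult_le)
 also have "... <= card ({1..n} - {i})" by (rule degree_prod_lin) simp
 also have "... = n - 1" by (rule c)
 finally show "degree (smult (w i) (\<Prod>j\<in>{1..n} - {i}. [:1, - lam j:])) <= n - 1" .
qed simp

lemma poly_PPp: "poly (PPp lam n) x = (\<Prod>i\<in>{1..n}. 1 - lam i * x)"
 by (simp add: PPp_def poly_prod mult.commute)

lemma poly_QQp: "poly (QQp lam w n) x = (\<Sum>i\<in>{1..n}. w i * (\<Prod>j\<in>{1..n} - {i}. 1 - lam j * x))"
 by (simp add: QQp_def poly_sum poly_prod mult.commute)

abbreviation offdiag :: "rseq => nat => nat => real" where
 "offdiag lam n i \<equiv> (\<Prod>j\<in>{1..n} - {i}. 1 - lam j / lam i)"

lemma poly_QQp_atom: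
 assumes "i \<in> {1..n}" "lam i ~= 0"
 shows "poly (QQp lam w n) (1 / lam i) = w i * offdiag lam n i"
proof -
 have "poly (QQp lam w n) (1 / lam i) = (\<Sum>k\<in>{1..n}. if k = i then w i * offdiag lam n i else 0)"
  unfolding poly_QQp
 proof (rule sum.cong)
  fix k assume k: "k \<in> {1..n}"
  show "w k * (\<Prod>j\<in>{1..n} - {k}. 1 - lam j * (1 / lam i))
    = (if k = i then w i * offdiag lam n i else 0)"
  proof (cases "k = i")
   case False
   have "(\<Prod>j\<in>{1..n} - {k}. 1 - lam j * (1 / lam i)) = 0"
    using assms False by (intro prod_zero bexI[of _ i]) auto
   then show ?thesis using False by simp
  qed simp
 qed simp
 also have "... = w i * offdiag lam n i" using assms by simp
 finally show ?thesis .
qed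

lemma coeff_QQp_0: "coeff (QQp lam w n) 0 = (\<Sum>i\<in>{1..n}. w i)"
 using poly_QQp[of lam w n 0] by (simp add: poly_0_coeff_0)

lemma sign_other_atoms:
 fixes lam s :: rseq
 assumes inj: "inj_on lam {1..n}" and pos: "!!i. i \<in> {1..n} ==> lam i > 0"
  and inc: "!!j k. j < k ==> k < n ==> s j < s k"
  and im: "(\<lambda>i. 1 / lam i) ` {1..n} = s ` {..<n}" and i: "i \<in> {1..n}" and l: "l < n" "1 / lam i = s l"
 shows "offdiag lam n i * (-1) ^ l > 0"
proof -
 have injs: "inj_on s {..<n}"
  using inc by (metis inj_onI lessThan_iff less_irrefl nat_neq_iff)
 have inj1: "inj_on (\<lambda>i. 1 / lam i) {1..n}"
 proof (rule inj_onI)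
  fix x y assume xy: "x \<in> {1..n}" "y \<in> {1..n}" and "1 / lam x = 1 / lam y"
  then have "lam x = lam y" by simp
  then show "x = y" using xy by (rule inj_onD[OF inj])
 qed
 have spos: "s j > 0" if "j < n" for j
 proof -
  have "s j \<in> (\<lambda>i. 1 / lam i) ` {1..n}" unfolding im using that by (intro imageI) simp
  then obtain i where "i \<in> {1..n}" "s j = 1 / lam i" by (elim imageE)
  then show ?thesis using pos[of i] by simp
 qed
 have "offdiag lam n i = (\<Prod>x\<in>(\<lambda>i. 1 / lam i) ` ({1..n} - {i}). 1 - s l / x)"
  by (subst prod.reindex[OF inj_on_subset[OF inj1]]) (auto simp: l(2)[symmetric])
 also have "(\<lambda>i. 1 / lam i) ` ({1..n} - {i}) = s ` ({..<n} - {l})"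
  using inj_on_image_set_diff[OF inj1, of "{1..n}" "{i}"] inj_on_image_set_diff[OF injs, of "{..<n}" "{l}"] im i l
  by auto
 also have "(\<Prod>x\<in>s ` ({..<n} - {l}). 1 - s l / x) = (\<Prod>j\<in>{..<n} - {l}. 1 - s l / s j)"
  by (subst prod.reindex[OF inj_on_subset[OF injs]]) auto
 also have "{..<n} - {l} = {..<l} \<union> {Suc l..<n}" using l by auto
 also have "(\<Prod>j\<in>{..<l} \<union> {Suc l..<n}. 1 - s l / s j)
   = (\<Prod>j<l. 1 - s l / s j) * (\<Prod>j\<in>{Suc l..<n}. 1 - s l / s j)"
  by (rule prod.union_disjoint) auto
 finally have e: "offdiag lam n i = (\<Prod>j<l. 1 - s l / s j) * (\<Prod>j\<in>{Suc l..<n}. 1 - s l / s j)" .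
 have "(\<Prod>j<l. 1 - s l / s j) * (-1) ^ l = (\<Prod>j<l. 1 - s l / s j) * (\<Prod>j<l. -1)" by simp
 also have "... = (\<Prod>j<l. s l / s j - 1)" by (subst prod.distrib[symmetric]) simp
 also have "... > 0"
 proof (intro prod_pos ballI)
  fix j assume "j \<in> {..<l}"
  then show "0 < s l / s j - 1" using inc[of j l] spos[of j] l by auto
 qed
 finally have 1: "(\<Prod>j<l. 1 - s l / s j) * (-1) ^ l > 0" .
 have 2: "(\<Prod>j\<in>{Suc l..<n}. 1 - s l / s j) > 0"
 proof (intro prod_pos ballI)
  fix j assume "j \<in> {Suc l..<n}"
  then show "0 < 1 - s l / s j" using inc[of l j] spos[of j] l by auto
 qed
 from mult_pos_pos[OF 1 2] show ?thesis unfolding e by (simp add: mult_ac)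
qed


lemma sorted_enumeration:
 fixes A :: "real set"
 assumes "finite A"
 shows "\<exists>s. (\<forall>j k. j < k --> k < card A --> s j < s k) & A = s ` {..<card A}"
proof -
 let ?xs = "sorted_list_of_set A"
 have l: "length ?xs = card A" by simp
 have "\<forall>j k. j < k --> k < card A --> ?xs ! j < ?xs ! k"
  using strict_sorted_list_of_set[of A] by (simp add: sorted_wrt_iff_nth_less)
 moreover have "A = (\<lambda>i. ?xs ! i) ` {..<card A}"
  using assms set_sorted_list_of_set[OF assms] by (auto simp: in_set_conv_nth image_iff l lessThan_def set_conv_nth)
 ultimately show ?thesis by (intro exI[of _ "\<lambda>i. ?xs ! i"]) auto
qed

lemma prod_linear_cong_image:
 fixes a b :: rseq
 assumes "inj_on a A" "inj_on b B" "a ` A = b ` B"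
 shows "(\<Prod>i\<in>A. h (a i)) = (\<Prod>i\<in>B. h (b i))"
 using prod.reindex[OF assms(1), of h] prod.reindex[OF assms(2), of h] assms(3) by (simp add: comp_def)

lemma inj_on_inverse_real: "inj_on lam A ==> inj_on (\<lambda>i. 1 / lam i :: real) A"
 by (metis (mono_tags, lifting) div_by_1 divide_divide_eq_right inj_on_def mult.left_neutral)

text \<open>At the reciprocal of an atom only one summand of the numerator survives; as the weights are positive, its sign alternates along the sorted atoms, so the numerator has one root between any two consecutive poles.\<close>
lemma interl_of_atoms:
 assumes n: "n >= 1" and inj: "inj_on lam {1..n}" and pos: "!!i. i \<in> {1..n} ==> lam i > 0"
  and w: "!!i. i \<in> {1..n} ==> w i > 0" and w1: "(\<Sum>i\<in>{1..n}. w i) = 1"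
 shows "\<exists>tau. interl tau (2 * n - 1) (PPp lam n) (QQp lam w n)"
proof -
 define A where "A = (\<lambda>i. 1 / lam i) ` {1..n}"
 have inj1: "inj_on (\<lambda>i. 1 / lam i) {1..n}" by (rule inj_on_inverse_real[OF inj])
 have cA: "card A = n" "finite A" unfolding A_def card_image[OF inj1] by simp_all
 obtain s where inc: "!!j k. j < k ==> k < n ==> s j < s k" and im: "A = s ` {..<n}"
  using sorted_enumeration[OF cA(2)] cA(1) by auto
 have injs: "inj_on s {..<n}"
  using inc by (metis inj_onI lessThan_iff less_irrefl nat_neq_iff)
 have sA: "\<exists>i\<in>{1..n}. s l = 1 / lam i" if "l < n" for l
 proof -
  have "s l \<in> A" unfolding im using that by simp
  then show ?thesis unfolding A_def by blast
 qed
 have spos: "s l > 0" if "l < n" for l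
  using sA[OF that] pos by auto
 have PP: "PPp lam n = linprod (\<lambda>l. 1 / s l) n"
 proof -
  have "(\<Prod>i\<in>{1..n}. [:1, - (1 / (1 / lam i)):]) = (\<Prod>l\<in>{..<n}. [:1, - (1 / s l):])"
   by (rule prod_linear_cong_image[OF inj1 injs, of "\<lambda>x. [:1, - (1 / x):]"]) (use im in \<open>simp add: A_def\<close>)
  then show ?thesis by (simp add: PPp_def linprod_def)
 qed
 have "\<exists>r. (\<forall>j<n - 1. s j < r j & r j < s (Suc j)) & QQp lam w n = linprod (\<lambda>j. 1 / r j) (n - 1)"
 proof (rule alternating_signs_roots)
  show "degree (QQp lam w n) <= n - 1" by (rule degree_QQp)
  show "coeff (QQp lam w n) 0 = 1" using w1 by (simp add: coeff_QQp_0)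
  show "0 <= s 0" using spos[of 0] n by simp
  show "s j < s (Suc j)" if "j < n - 1" for j using inc[of j "Suc j"] that by simp
  show "0 < poly (QQp lam w n) (s j) * (-1) ^ j" if "j <= n - 1" for j
  proof -
   have jn: "j < n" using that n by simp
   obtain i where i: "i \<in> {1..n}" "s j = 1 / lam i" using sA[OF jn] by blast
   have "poly (QQp lam w n) (1 / lam i) * (-1) ^ j
     = w i * ((\<Prod>k\<in>{1..n} - {i}. 1 - lam k / lam i) * (-1) ^ j)"
    using poly_QQp_atom[where lam = lam, OF i(1)] pos[OF i(1)] by simp
   also have "... > 0"
    by (intro mult_pos_pos w[OF i(1)] sign_other_atoms[where s = s, OF inj pos inc im[unfolded A_def] i(1) jn i(2)[symmetric]])
   finally show ?thesis unfolding i(2) .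
  qed
 qed
 then obtain r where r: "!!j. j < n - 1 ==> s j < r j & r j < s (Suc j)" "QQp lam w n = linprod (\<lambda>j. 1 / r j) (n - 1)"
  by blast
 define tau where "tau k = (if even k then s (k div 2) else r (k div 2))" for k
 have "interl tau (2 * n - 1) (PPp lam n) (QQp lam w n)"
  unfolding interl_def
 proof (intro conjI allI impI)
  show "0 < tau 0" using spos[of 0] n by (simp add: tau_def)
  show "tau j < tau (Suc j)" if "Suc j < 2 * n - 1" for j
  proof (cases "even j")
   case True
   then obtain l where "j = 2 * l" by (elim evenE)
   then show ?thesis using r(1)[of l] that by (auto simp: tau_def)
  next
   case False
   then obtain l where "j = 2 * l + 1" by (elim oddE)
   then show ?thesis using r(1)[of l] that by (auto simp: tau_def)
  qed
  have e: "(2 * n - 1 + 1) div 2 = n" "(2 * n - 1) div 2 = n - 1" using n by auto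
  show "PPp lam n = linprod (\<lambda>l. 1 / tau (2 * l)) ((2 * n - 1 + 1) div 2)" unfolding e PP by (simp add: tau_def)
  show "QQp lam w n = linprod (\<lambda>l. 1 / tau (2 * l + 1)) ((2 * n - 1) div 2)" unfolding e r(2) by (simp add: tau_def)
 qed
 then show ?thesis by blast
qed

lemma interl_poles:
 assumes n: "n >= 1" and I: "interl tau (2 * n - 1) f g"
 shows "f = linprod (\<lambda>l. 1 / tau (2 * l)) n" "g = linprod (\<lambda>l. 1 / tau (2 * l + 1)) (n - 1)"
  "inj_on (\<lambda>l. tau (2 * l)) {..<n}" "!!l. l < n ==> tau (2 * l) > 0"
  "!!j k. j < k ==> k < n ==> tau (2 * j) < tau (2 * k)"
proof -
 have e: "(2 * n - 1 + 1) div 2 = n" "(2 * n - 1) div 2 = n - 1" using n by auto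
 show "f = linprod (\<lambda>l. 1 / tau (2 * l)) n" "g = linprod (\<lambda>l. 1 / tau (2 * l + 1)) (n - 1)"
  using I unfolding interl_def e by blast+
 show inc: "!!j k. j < k ==> k < n ==> tau (2 * j) < tau (2 * k)"
  by (rule interl_mono[OF I]) auto
 show "!!l. l < n ==> tau (2 * l) > 0" by (rule interl_pos[OF I]) auto
 show "inj_on (\<lambda>l. tau (2 * l)) {..<n}"
  using inc by (metis (mono_tags, lifting) inj_onI lessThan_iff less_irrefl nat_neq_iff)
qed

text \<open>Partial fractions: the residue at a pole has the sign of the numerator over the product of the differences, and interlacing makes both alternate together, so all weights are positive.\<close>
lemma atoms_of_interl:
 assumes n: "n >= 1" and I: "interl tau (2 * n - 1) f g"
 shows "\<exists>lam w. inj_on lam {1..n} & (\<forall>i\<in>{1..n}. lam i > 0) & (\<forall>i\<in>{1..n}. w i > 0) &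
   f = PPp lam n & g = QQp lam w n"
proof -
 note P = interl_poles[OF n I]
 define lam where "lam i = 1 / tau (2 * (i - 1))" for i
 have pos: "lam i > 0" if "i \<in> {1..n}" for i using P(4)[of "i - 1"] that by (auto simp: lam_def)
 have inj: "inj_on lam {1..n}"
 proof (rule inj_onI)
  fix x y assume xy: "x \<in> {1..n}" "y \<in> {1..n}" "lam x = lam y"
  then have "tau (2 * (x - 1)) = tau (2 * (y - 1))" by (simp add: lam_def)
  then have "x - 1 = y - 1" using xy by (intro inj_onD[OF P(3)]) auto
  then show "x = y" using xy by auto
 qed
 define w where "w i = poly g (1 / lam i) / offdiag lam n i" for i
 have im: "(\<lambda>i. 1 / lam i) ` {1..n} = (\<lambda>l. tau (2 * l)) ` {..<n}"
 proof -
  have "(\<lambda>i. 1 / lam i) ` {1..n} = (\<lambda>i. tau (2 * (i - 1))) ` {1..n}" by (simp add: lam_def)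
  also have "... = (\<lambda>l. tau (2 * l)) ` ((\<lambda>i. i - 1) ` {1..n})" by (simp add: image_image)
  also have "(\<lambda>i. i - 1) ` {1..n} = {..<n}"
   by (force simp: image_iff Bex_def intro: exI[of _ "Suc _"])
  finally show ?thesis .
 qed
 have dpos: "offdiag lam n i * (-1) ^ (i - 1) > 0" if "i \<in> {1..n}" for i
  by (rule sign_other_atoms[where s = "\<lambda>l. tau (2 * l)", OF inj pos P(5) im that]) (use that in \<open>auto simp: lam_def\<close>)
 have gpos: "poly g (1 / lam i) * (-1) ^ (i - 1) > 0" if "i \<in> {1..n}" for i
  using interl_sign_right[OF I, of "i - 1"] that by (auto simp: lam_def)
 have w: "w i > 0" if "i \<in> {1..n}" for i
 proof -
  have "w i = (poly g (1 / lam i) * (-1) ^ (i - 1)) / (offdiag lam n i * (-1) ^ (i - 1))"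
   by (simp add: w_def)
  then show ?thesis using divide_pos_pos[OF gpos[OF that] dpos[OF that]] by simp
 qed
 have f: "f = PPp lam n" unfolding PPp_linprod P(1) by (simp add: lam_def)
 have "g = QQp lam w n"
 proof (rule poly_eq_by_points[where m = "n - 1" and A = "(\<lambda>i. 1 / lam i) ` {1..n}"])
  show "degree g <= n - 1" unfolding P(2) by (rule degree_linprod_le)
  show "degree (QQp lam w n) <= n - 1" by (rule degree_QQp)
  show "n - 1 < card ((\<lambda>i. 1 / lam i) ` {1..n})"
   unfolding card_image[OF inj_on_inverse_real[OF inj]] using n by simp
  fix x assume "x \<in> (\<lambda>i. 1 / lam i) ` {1..n}"
  then obtain i where i: "i \<in> {1..n}" "x = 1 / lam i" by blast
  have "offdiag lam n i ~= 0"
   using dpos[OF i(1)] by (metis less_irrefl mult_zero_left)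
  moreover have "poly (QQp lam w n) (1 / lam i) = w i * offdiag lam n i"
   by (rule poly_QQp_atom[where lam = lam, OF i(1)]) (use pos[OF i(1)] in simp)
  ultimately show "poly g x = poly (QQp lam w n) x" by (simp add: i(2) w_def)
 qed simp
 then show ?thesis using f inj pos w by blast
qed

lemma prod_offdiag_square:
 fixes lam :: rseq
 shows "(\<Prod>i\<in>{1..n}. \<Prod>j\<in>{1..n} - {i}. \<bar>lam i - lam j\<bar>) = (\<Prod>j\<in>{1..n}. \<Prod>i\<in>{1..<j}. \<bar>lam i - lam j\<bar>)\<^sup>2"
proof -
 have "(\<Prod>i\<in>{1..n}. \<Prod>j\<in>{1..n} - {i}. \<bar>lam i - lam j\<bar>)
   = (\<Prod>i\<in>{1..n}. (\<Prod>j\<in>{1..<i}. \<bar>lam i - lam j\<bar>) * (\<Prod>j\<in>{i<..n}. \<bar>lam i - lam j\<bar>))"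
 proof (rule prod.cong)
  fix i assume "i \<in> {1..n}"
  then have u: "{1..n} - {i} = {1..<i} \<union> {i<..n}" by auto
  show "(\<Prod>j\<in>{1..n} - {i}. \<bar>lam i - lam j\<bar>) = (\<Prod>j\<in>{1..<i}. \<bar>lam i - lam j\<bar>) * (\<Prod>j\<in>{i<..n}. \<bar>lam i - lam j\<bar>)"
   unfolding u by (rule prod.union_disjoint) auto
 qed simp
 also have "... = (\<Prod>i\<in>{1..n}. \<Prod>j\<in>{1..<i}. \<bar>lam i - lam j\<bar>) * (\<Prod>i\<in>{1..n}. \<Prod>j\<in>{i<..n}. \<bar>lam i - lam j\<bar>)"
  by (rule prod.distrib)
 also have "(\<Prod>i\<in>{1..n}. \<Prod>j\<in>{i<..n}. \<bar>lam i - lam j\<bar>) = (\<Prod>j\<in>{1..n}. \<Prod>i\<in>{1..<j}. \<bar>lam i - lam j\<bar>)"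
  unfolding prod.Sigma[OF finite_atLeastAtMost, OF ballI[OF finite_greaterThanAtMost]]
   prod.Sigma[OF finite_atLeastAtMost, OF ballI[OF finite_atLeastLessThan]]
  by (rule prod.reindex_bij_witness[of _ "\<lambda>(a, b). (b, a)" "\<lambda>(a, b). (b, a)"]) auto
 finally show ?thesis by (simp add: power2_eq_square abs_minus_commute)
qed

text \<open>Trace, determinant and resultant: the linear and the leading coefficient of the denominator give the sum and the product of the atoms. The values of the numerator at the poles multiply to the product of the weights times the squared Vandermonde product, and the same product is the resultant computed in \<open>interl_GP\<close>.\<close>
lemma atoms_GP:
 assumes n: "n >= 1" and inj: "inj_on lam {1..n}"
  and P: "PPp lam n = GP y (2 * n)" and Q: "QQp lam w n = GP y (2 * n - 1)"
  and y: "!!i. i < 2 * n - 1 ==> y i > 0"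
 shows "\<forall>i\<in>{1..n}. lam i > 0" "\<forall>i\<in>{1..n}. w i > 0"
  "(\<Prod>i\<in>{1..n}. lam i) = (\<Prod>i<n. y (2 * i))"
  "(\<Sum>i\<in>{1..n}. lam i) = (\<Sum>i<2 * n - 1. y i)"
  "(\<Prod>i\<in>{1..n}. w i) * (\<Prod>j\<in>{1..n}. \<Prod>i\<in>{1..<j}. \<bar>lam i - lam j\<bar>)\<^sup>2 = (\<Prod>i<2 * n - 1. y i ^ ((i + 1) div 2))"
proof -
 have S: "Suc (2 * n - 1) = 2 * n" using n by simp
 obtain tau where I: "interl tau (2 * n - 1) (PPp lam n) (QQp lam w n)" and
  R: "(\<Prod>l<(2 * n - 1 + 1) div 2. \<Prod>j<(2 * n - 1) div 2. \<bar>1 / tau (2 * l) - 1 / tau (2 * j + 1)\<bar>)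
   = (\<Prod>i<2 * n - 1. y i ^ ((i + 1) div 2))"
  using interl_GP[of "2 * n - 1" y] y unfolding S P Q by blast
 have e: "(2 * n - 1 + 1) div 2 = n" "(2 * n - 1) div 2 = n - 1" using n by auto
 note PO = interl_poles[OF n I]
 have top: "(\<Prod>i\<in>{1..n}. - lam i) = (\<Prod>l<n. - (1 / tau (2 * l)))"
  using coeff_linprod_top[of "\<lambda>l. lam (Suc l)" n] coeff_linprod_top[of "\<lambda>l. 1 / tau (2 * l)" n]
  unfolding PPp_linprod[symmetric] PO(1)[symmetric]
  by (simp add: prod.atLeast1_atMost_eq)
 have nz: "lam i ~= 0" if "i \<in> {1..n}" for i
 proof
  assume "lam i = 0"
  then have "(\<Prod>i\<in>{1..n}. - lam i) = 0" using that by (intro prod_zero bexI[of _ i]) auto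
  moreover have "(\<Prod>l<n. - (1 / tau (2 * l))) ~= 0"
  proof -
   have "tau (2 * l) ~= 0" if "l < n" for l using PO(4)[OF that] by simp
   then show ?thesis by (auto simp: prod_zero_iff)
  qed
  ultimately show False using top by argo
 qed
 have root: "\<exists>l<n. 1 / lam i = tau (2 * l)" if i: "i \<in> {1..n}" for i
 proof -
  have "poly (PPp lam n) (1 / lam i) = 0"
   unfolding poly_PPp using i nz[OF i] by (intro prod_zero bexI[of _ i]) auto
  then have "(\<Prod>l<n. 1 - 1 / tau (2 * l) * (1 / lam i)) = 0"
   unfolding PO(1) poly_linprod .
  then obtain l where l: "l < n" "1 - 1 / tau (2 * l) * (1 / lam i) = 0" by (auto simp: prod_zero_iff)
  then have "1 / lam i = tau (2 * l)" using PO(4)[OF l(1)] nz[OF i] by (simp add: field_simps)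
  then show ?thesis using l by blast
 qed
 have pos: "lam i > 0" if i: "i \<in> {1..n}" for i
 proof -
  obtain l where "l < n" "1 / lam i = tau (2 * l)" using root[OF i] by blast
  then have "1 / lam i > 0" using PO(4) by simp
  then show ?thesis by simp
 qed
 then show "\<forall>i\<in>{1..n}. lam i > 0" by blast
 have inj1: "inj_on (\<lambda>i. 1 / lam i) {1..n}" by (rule inj_on_inverse_real[OF inj])
 have im: "(\<lambda>i. 1 / lam i) ` {1..n} = (\<lambda>l. tau (2 * l)) ` {..<n}"
 proof (rule card_subset_eq)
  show "(\<lambda>i. 1 / lam i) ` {1..n} \<subseteq> (\<lambda>l. tau (2 * l)) ` {..<n}"
   using root by (intro image_subsetI) (metis imageI lessThan_iff)
  show "card ((\<lambda>i. 1 / lam i) ` {1..n}) = card ((\<lambda>l. tau (2 * l)) ` {..<n})"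
   unfolding card_image[OF inj1] card_image[OF PO(3)] by simp
 qed simp
 have w: "w i > 0" if i: "i \<in> {1..n}" for i
 proof -
  obtain l where l: "l < n" "1 / lam i = tau (2 * l)" using root[OF i] by blast
  have 1: "offdiag lam n i * (-1) ^ l > 0"
   by (rule sign_other_atoms[where s = "\<lambda>l. tau (2 * l)", OF inj pos PO(5) im i l])
  have "0 < poly (QQp lam w n) (tau (2 * l)) * (-1) ^ l" by (rule interl_sign_right[OF I]) (use l in auto)
  also have "... = w i * (offdiag lam n i * (-1) ^ l)"
   unfolding l(2)[symmetric] poly_QQp_atom[where lam = lam, OF i nz[OF i]] by simp
  finally show ?thesis using 1 by (rule zero_less_mult_pos2)
 qed
 then show "\<forall>i\<in>{1..n}. w i > 0" by blast
 have "coeff (PPp lam n) n = (\<Prod>i\<in>{1..n}. - lam i)"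
  unfolding PPp_linprod coeff_linprod_top by (simp add: prod.atLeast1_atMost_eq)
 then have "(\<Prod>i\<in>{1..n}. - lam i) = (\<Prod>i<n. - y (2 * i))" unfolding P GP_coeff_top by simp
 then have "(\<Prod>i\<in>{1..n}. - lam i) * (\<Prod>i\<in>{1..n}. -1) = (\<Prod>i<n. - y (2 * i)) * (\<Prod>i<n. -1)" by simp
 then show "(\<Prod>i\<in>{1..n}. lam i) = (\<Prod>i<n. y (2 * i))" unfolding prod.distrib[symmetric] by simp
 have "- (\<Sum>i\<in>{1..n}. lam i) = coeff (PPp lam n) 1"
  unfolding PPp_linprod coeff_linprod_1 by (simp add: sum.atLeast1_atMost_eq)
 also have "... = coeff (GP y (Suc (2 * n - 1))) 1" unfolding P S ..
 also have "... = - (\<Sum>i<2 * n - 1. y i)" by (rule GP_coeff_1)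
 finally show "(\<Sum>i\<in>{1..n}. lam i) = (\<Sum>i<2 * n - 1. y i)" by simp
 define b where "b j = 1 / tau (2 * j + 1)" for j
 have "(\<Prod>i<2 * n - 1. y i ^ ((i + 1) div 2)) = (\<Prod>l<n. (\<lambda>x. \<Prod>j<n - 1. \<bar>1 / x - b j\<bar>) (tau (2 * l)))"
  unfolding R[symmetric] e b_def ..
 also have "... = (\<Prod>i\<in>{1..n}. (\<lambda>x. \<Prod>j<n - 1. \<bar>1 / x - b j\<bar>) (1 / lam i))"
  by (rule prod_linear_cong_image[OF PO(3) inj1 im[symmetric]])
 also have "... = (\<Prod>i\<in>{1..n}. w i * (\<Prod>j\<in>{1..n} - {i}. \<bar>lam i - lam j\<bar>))"
 proof (rule prod.cong)
  fix i assume i: "i \<in> {1..n}"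
  have "(\<Prod>j<n - 1. \<bar>lam i - b j\<bar>) = (\<Prod>j<n - 1. lam i * \<bar>1 - b j * (1 / lam i)\<bar>)"
  proof (rule prod.cong)
   fix j
   have "lam i * \<bar>1 - b j * (1 / lam i)\<bar> = \<bar>lam i * (1 - b j * (1 / lam i))\<bar>"
    using pos[OF i] by (simp add: abs_mult)
   also have "lam i * (1 - b j * (1 / lam i)) = lam i - b j" using pos[OF i] by (simp add: field_simps)
   finally show "\<bar>lam i - b j\<bar> = lam i * \<bar>1 - b j * (1 / lam i)\<bar>" by simp
  qed simp
  also have "... = lam i ^ (n - 1) * \<bar>poly (QQp lam w n) (1 / lam i)\<bar>"
   unfolding PO(2) poly_linprod b_def by (simp add: prod.distrib abs_prod)
  also have "... = w i * (lam i ^ (n - 1) * (\<Prod>j\<in>{1..n} - {i}. \<bar>1 - lam j / lam i\<bar>))"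
   unfolding poly_QQp_atom[where lam = lam, OF i nz[OF i]] using w[OF i] by (simp add: abs_mult abs_prod)
  also have "lam i ^ (n - 1) * (\<Prod>j\<in>{1..n} - {i}. \<bar>1 - lam j / lam i\<bar>) = (\<Prod>j\<in>{1..n} - {i}. lam i * \<bar>1 - lam j / lam i\<bar>)"
   using i by (simp add: prod.distrib)
  also have "... = (\<Prod>j\<in>{1..n} - {i}. \<bar>lam i - lam j\<bar>)"
  proof (rule prod.cong)
   fix j
   have "lam i * \<bar>1 - lam j / lam i\<bar> = \<bar>lam i * (1 - lam j / lam i)\<bar>"
    using pos[OF i] by (simp add: abs_mult)
   also have "lam i * (1 - lam j / lam i) = lam i - lam j" using pos[OF i] by (simp add: field_simps)
   finally show "lam i * \<bar>1 - lam j / lam i\<bar> = \<bar>lam i - lam j\<bar>" .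
  qed simp
  finally show "(\<Prod>j<n - 1. \<bar>1 / (1 / lam i) - b j\<bar>) = w i * (\<Prod>j\<in>{1..n} - {i}. \<bar>lam i - lam j\<bar>)" by simp
 qed simp
 also have "... = (\<Prod>i\<in>{1..n}. w i) * (\<Prod>j\<in>{1..n}. \<Prod>i\<in>{1..<j}. \<bar>lam i - lam j\<bar>)\<^sup>2"
  unfolding prod.distrib prod_offdiag_square ..
 finally show "(\<Prod>i\<in>{1..n}. w i) * (\<Prod>j\<in>{1..n}. \<Prod>i\<in>{1..<j}. \<bar>lam i - lam j\<bar>)\<^sup>2 = (\<Prod>i<2 * n - 1. y i ^ ((i + 1) div 2))"
  by simp
qed

section \<open>Integration over finitely many coordinates of a sequence\<close>

abbreviation lebs :: "nat set => rseq measure" where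
 "lebs J \<equiv> (\<Pi>\<^sub>M i\<in>J. lborel)"

text \<open>The coordinates in \<open>J\<close> are integrated and the others are read off from \<open>a\<close>. All numbers of variables share the type of real sequences, so that changes of variables can be proved by induction on the number of variables.\<close>
definition LI :: "nat set => (rseq => ennreal) => rseq => ennreal" where
 "LI J f a = (\<integral>\<^sup>+x. f (\<lambda>i. if i \<in> J then x i else a i) \<partial>(lebs J))"

lemma sigma_finite_PiM_lborel: "finite J ==> sigma_finite_measure (lebs J)"
proof -
 assume "finite J"
 interpret finite_product_sigma_finite "\<lambda>_. lborel :: real measure" J
  by standard fact
 show ?thesis by (rule sigma_finite_measure_axioms)
qed

lemma merge_seq_measurable [measurable]:
 "(\<lambda>(a, x). (\<lambda>i. if i \<in> J then x i else a i))
   \<in> (borel :: rseq measure) \<Otimes>\<^sub>M (lebs J) \<rightarrow>\<^sub>M borel"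
 unfolding case_prod_unfold
proof (rule measurable_seqI)
 fix i
 have "(\<lambda>x. fst x i) \<in> borel_measurable ((borel :: rseq measure) \<Otimes>\<^sub>M (lebs J))"
  by (rule measurable_compose[OF measurable_fst measurable_product_coordinates])
 moreover have "i \<in> J ==> (\<lambda>x. snd x i) \<in> borel_measurable ((borel :: rseq measure) \<Otimes>\<^sub>M (lebs J))"
  by measurable
 ultimately show "(\<lambda>x. if i \<in> J then snd x i else fst x i)
    \<in> borel_measurable ((borel :: rseq measure) \<Otimes>\<^sub>M (lebs J))"
  by (cases "i \<in> J") simp_all
qed

lemma merge_measurable:
 assumes f: "f \<in> M \<rightarrow>\<^sub>M (borel :: rseq measure)" and g: "g \<in> M \<rightarrow>\<^sub>M (lebs J)"
 shows "(\<lambda>w. (\<lambda>i. if i \<in> J then g w i else f w i)) \<in> M \<rightarrow>\<^sub>M borel"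
proof -
 have "(\<lambda>w. (f w, g w)) \<in> M \<rightarrow>\<^sub>M borel \<Otimes>\<^sub>M (lebs J)"
  using f g by (rule measurable_Pair)
 from measurable_compose[OF this merge_seq_measurable[of J]] show ?thesis by simp
qed

lemma fun_upd_seq_measurable [measurable (raw)]:
 assumes [measurable]: "f \<in> M \<rightarrow>\<^sub>M (borel :: rseq measure)" "g \<in> borel_measurable M"
 shows "(\<lambda>x. (f x)(k := g x)) \<in> M \<rightarrow>\<^sub>M (borel :: rseq measure)"
 apply (rule measurable_seqI)
 subgoal for i by (cases "i = k") (simp_all add: assms measurable_compose[OF assms(1) measurable_product_coordinates])
 done

lemma LI_measurable_pair:
 assumes "finite J" and f: "case_prod f \<in> borel_measurable (N \<Otimes>\<^sub>M borel)"
 shows "(\<lambda>(c, a). LI J (f c) a) \<in> borel_measurable (N \<Otimes>\<^sub>M borel)"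
proof -
 interpret sigma_finite_measure "lebs J"
  by (rule sigma_finite_PiM_lborel) fact
 have 1: "(\<lambda>w. (fst (fst w), (\<lambda>i. if i \<in> J then snd w i else snd (fst w) i)))
   \<in> (N \<Otimes>\<^sub>M borel) \<Otimes>\<^sub>M (lebs J) \<rightarrow>\<^sub>M N \<Otimes>\<^sub>M borel"
 proof (rule measurable_Pair)
  show "(\<lambda>w. fst (fst w)) \<in> (N \<Otimes>\<^sub>M borel) \<Otimes>\<^sub>M (lebs J) \<rightarrow>\<^sub>M N"
   by measurable
  show "(\<lambda>w. (\<lambda>i. if i \<in> J then snd w i else snd (fst w) i))
    \<in> (N \<Otimes>\<^sub>M borel) \<Otimes>\<^sub>M (lebs J) \<rightarrow>\<^sub>M borel"
   by (rule merge_measurable) measurable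
 qed
 have m: "(\<lambda>w. f (fst (fst w)) (\<lambda>i. if i \<in> J then snd w i else snd (fst w) i))
   \<in> borel_measurable ((N \<Otimes>\<^sub>M borel) \<Otimes>\<^sub>M (lebs J))"
  using measurable_compose[OF 1 f] by simp
 then have "(\<lambda>(w, x). f (fst w) (\<lambda>i. if i \<in> J then x i else snd w i))
   \<in> borel_measurable ((N \<Otimes>\<^sub>M borel) \<Otimes>\<^sub>M (lebs J))"
  by (simp add: case_prod_unfold)
 then have "(\<lambda>w. \<integral>\<^sup>+x. f (fst w) (\<lambda>i. if i \<in> J then x i else snd w i)
   \<partial>(lebs J)) \<in> borel_measurable (N \<Otimes>\<^sub>M borel)"
  by (rule borel_measurable_nn_integral)
 then show ?thesis by (simp add: case_prod_unfold LI_def)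
qed

lemma LI_measurable_param:
 assumes "finite J" and f: "(\<lambda>w. f (fst w) (snd w)) \<in> borel_measurable (N \<Otimes>\<^sub>M borel)"
  and g: "g \<in> N \<rightarrow>\<^sub>M borel"
 shows "(\<lambda>c. LI J (f c) (g c)) \<in> borel_measurable N"
proof -
 have 1: "(\<lambda>(c, a). LI J (f c) a) \<in> borel_measurable (N \<Otimes>\<^sub>M borel)"
  by (rule LI_measurable_pair[OF assms(1)], unfold case_prod_unfold, rule assms(2))
 have 2: "(\<lambda>c. (c, g c)) \<in> N \<rightarrow>\<^sub>M N \<Otimes>\<^sub>M borel"
  by (rule measurable_Pair[OF measurable_ident_sets[OF refl] g])
 show ?thesis using measurable_compose[OF 2 1] by (simp only: split_conv)
qed

lemma LI_measurable [measurable]: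
 assumes "finite J" and [measurable]: "f \<in> borel_measurable borel"
 shows "LI J f \<in> borel_measurable borel"
proof -
 have "(\<lambda>w. f (snd w)) \<in> borel_measurable (borel \<Otimes>\<^sub>M borel)"
  by (rule measurable_compose[OF measurable_snd assms(2)])
 from LI_measurable_param[OF assms(1) this measurable_ident_sets[OF refl]] show ?thesis .
qed

lemma seq_pair_measurable:
 assumes f: "f \<in> borel_measurable (borel :: rseq measure)"
 shows "(\<lambda>x. f (\<lambda>i. if i \<in> J then x i else a i)) \<in> borel_measurable (lebs J)"
proof -
 have "(\<lambda>x. (\<lambda>i. if i \<in> J then x i else a i)) \<in> (lebs J) \<rightarrow>\<^sub>M borel"
  by (rule merge_measurable) measurable
 from measurable_compose[OF this f] show ?thesis by simp
qed

lemma LI_empty [simp]: "LI {} f a = f a"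
 by (simp add: LI_def PiM_empty nn_integral_count_space_finite)

lemma LI_cong:
 assumes "!!b. (!!i. i \<notin> J ==> b i = a i) ==> f b = g b"
 shows "LI J f a = LI J g a"
 unfolding LI_def by (intro nn_integral_cong assms) auto

lemma LI_cong_base:
 assumes "!!b b'. (!!i. i \<notin> J ==> b i = a i) ==> (!!i. i \<notin> J ==> b' i = a' i)
   ==> (!!i. i \<in> J ==> b i = b' i) ==> f b = g b'"
 shows "LI J f a = LI J g a'"
 unfolding LI_def by (intro nn_integral_cong assms) auto

lemma product_sigma_finite_lborel: "product_sigma_finite (\<lambda>_. lborel :: real measure)"
 by standard

lemma LI_insert_out:
 assumes "finite J" "k \<notin> J" and f: "f \<in> borel_measurable borel"
 shows "LI (insert k J) f a = (\<integral>\<^sup>+x. LI J f (a(k := x)) \<partial>lborel)"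
 unfolding LI_def
 apply (subst product_sigma_finite.product_nn_integral_insert_rev[OF product_sigma_finite_lborel assms(1,2)])
 subgoal using seq_pair_measurable[OF f, of "insert k J" a] by simp
 apply (intro nn_integral_cong arg_cong[where f=f] ext)
 using assms(2) by auto

lemma LI_insert_in:
 assumes "finite J" "k \<notin> J" and f: "f \<in> borel_measurable borel"
 shows "LI (insert k J) f a = LI J (\<lambda>b. \<integral>\<^sup>+x. f (b(k := x)) \<partial>lborel) a"
 unfolding LI_def
 apply (subst product_sigma_finite.product_nn_integral_insert[OF product_sigma_finite_lborel assms(1,2)])
 subgoal using seq_pair_measurable[OF f, of "insert k J" a] by simp
 apply (intro nn_integral_cong arg_cong[where f=f] ext)
 using assms(2) by auto

lemma LI_cmult:
 assumes f: "f \<in> borel_measurable borel"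
 shows "LI J (\<lambda>b. c * f b) a = c * LI J f a"
 unfolding LI_def by (rule nn_integral_cmult) (rule seq_pair_measurable[OF f])

lemma LI_commute_lborel:
 fixes f :: "real => rseq => ennreal"
 assumes J: "finite J" and f: "(\<lambda>w. f (fst w) (snd w)) \<in> borel_measurable (lborel \<Otimes>\<^sub>M borel)"
 shows "(\<integral>\<^sup>+x. LI J (f x) a \<partial>lborel) = LI J (\<lambda>b. \<integral>\<^sup>+x. f x b \<partial>lborel) a"
proof -
 interpret J: sigma_finite_measure "lebs J"
  by (rule sigma_finite_PiM_lborel) fact
 interpret pair_sigma_finite "lebs J" "lborel :: real measure" ..
 have 1: "(\<lambda>w. (snd w, (\<lambda>i. if i \<in> J then fst w i else a i)))
   \<in> (lebs J) \<Otimes>\<^sub>M lborel \<rightarrow>\<^sub>M (lborel :: real measure) \<Otimes>\<^sub>M borel"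
  by (rule measurable_Pair[OF measurable_snd merge_measurable[OF measurable_const measurable_fst]]) simp
 show ?thesis
  unfolding LI_def
  apply (rule Fubini'[symmetric, of "\<lambda>y x. f x (\<lambda>i. if i \<in> J then y i else a i)", symmetric])
  using measurable_compose[OF 1 f] by (simp add: case_prod_unfold)
qed

lemma LI_commute:
 assumes I: "finite I" and J: "finite J"
  and f: "(\<lambda>w. f (fst w) (snd w)) \<in> borel_measurable (borel \<Otimes>\<^sub>M borel)"
 shows "LI I (\<lambda>p. LI J (f p) b) a = LI J (\<lambda>q. LI I (\<lambda>p. f p q) a) b"
proof -
 interpret I: sigma_finite_measure "lebs I"
  by (rule sigma_finite_PiM_lborel) fact
 interpret J: sigma_finite_measure "lebs J"
  by (rule sigma_finite_PiM_lborel) fact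
 interpret pair_sigma_finite "lebs I" "lebs J" ..
 have 1: "(\<lambda>w. ((\<lambda>i. if i \<in> I then fst w i else a i), (\<lambda>i. if i \<in> J then snd w i else b i)))
   \<in> (lebs I) \<Otimes>\<^sub>M (lebs J) \<rightarrow>\<^sub>M (borel :: (nat=>real) measure) \<Otimes>\<^sub>M borel"
  by (rule measurable_Pair[OF merge_measurable[OF measurable_const measurable_fst]
     merge_measurable[OF measurable_const measurable_snd]]) simp_all
 show ?thesis
  unfolding LI_def
  apply (rule Fubini'[symmetric])
  using measurable_compose[OF 1 f] by (simp add: case_prod_unfold)
qed

text \<open>Each coordinate is scaled by \<open>c\<close> and translated by an amount that depends only on earlier and on fixed coordinates; integrating the last coordinate first leaves one-dimensional affine substitutions.\<close>
lemma LI_triangular: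
 fixes h :: "nat => rseq => real" and c :: real
 assumes c: "c ~= 0" and f: "f \<in> borel_measurable borel"
  and h: "!!i. h i \<in> borel_measurable borel"
  and dep: "!!i a b. k <= i ==> i < m ==> (!!j. j < i \<or> m <= j ==> a j = b j) ==> h i a = h i b"
  and "k <= m"
 shows "ennreal (\<bar>c\<bar> ^ (m - k)) * LI {k..<m} (\<lambda>a. f (\<lambda>i. if i \<in> {k..<m} then c * a i + h i a else a i)) a0
   = LI {k..<m} f a0"
proof -
 have "ennreal (\<bar>c\<bar> ^ (l - k)) * LI {k..<l} (\<lambda>a. g (\<lambda>i. if i \<in> {k..<l} then c * a i + h i a else a i)) a0
   = LI {k..<l} g a0" if "k <= l" "l <= m" "g \<in> borel_measurable borel" for l g a0
  using that
 proof (induction l arbitrary: g a0 rule: dec_induct)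
  case base
  then show ?case by simp
 next
  case (step l)
  have [measurable]: "g \<in> borel_measurable borel" by fact
  define T where "T = (\<lambda>l a i. if i \<in> {k..<l} then c * a i + h i a else a i)"
  have [measurable]: "h i \<in> borel_measurable borel" for i by (rule h)
  have Tm [measurable]: "T l \<in> borel \<rightarrow>\<^sub>M borel" for l
   unfolding T_def
   apply (rule measurable_seqI)
   subgoal for i by (cases "i \<in> {k..<l}") simp_all
   done
  have ins: "{k..<Suc l} = insert l {k..<l}" using step by auto
  have upd: "T (Suc l) (a(l := x)) = (T l a)(l := h l a + c * x)" for a x
  proof
   fix i
   have 1: "h i (a(l := x)) = h i a" if "k <= i" "i <= l"
    using that step.prems step.hyps by (intro dep) auto
   show "T (Suc l) (a(l := x)) i = ((T l a)(l := h l a + c * x)) i"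
    using 1 step by (auto simp: T_def less_Suc_eq)
  qed
  have "LI {k..<Suc l} (\<lambda>a. g (T (Suc l) a)) a0
    = LI {k..<l} (\<lambda>a. \<integral>\<^sup>+x. g ((T l a)(l := h l a + c * x)) \<partial>lborel) a0"
   unfolding ins by (subst LI_insert_in) (simp_all add: upd)
  also have "ennreal \<bar>c\<bar> * ... = LI {k..<l} (\<lambda>a. \<integral>\<^sup>+x. g ((T l a)(l := x)) \<partial>lborel) a0"
  proof (subst LI_cmult[symmetric])
   show "(\<lambda>a. \<integral>\<^sup>+ x. g ((T l a)(l := h l a + c * x)) \<partial>lborel) \<in> borel_measurable borel"
    by measurable
   show "LI {k..<l} (\<lambda>b. ennreal \<bar>c\<bar> * (\<integral>\<^sup>+ x. g ((T l b)(l := h l b + c * x)) \<partial>lborel)) a0 =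
    LI {k..<l} (\<lambda>a. \<integral>\<^sup>+ x. g ((T l a)(l := x)) \<partial>lborel) a0"
    apply (rule LI_cong)
    subgoal for b using nn_integral_real_affine[of "\<lambda>x. g ((T l b)(l := x))" c "h l b"] c
     by simp
    done
  qed
  finally have A: "ennreal \<bar>c\<bar> * LI {k..<Suc l} (\<lambda>a. g (T (Suc l) a)) a0
    = LI {k..<l} (\<lambda>a. (\<lambda>b. \<integral>\<^sup>+x. g (b(l := x)) \<partial>lborel) (T l a)) a0" .
  have mb: "(\<lambda>b. \<integral>\<^sup>+x. g (b(l := x)) \<partial>lborel) \<in> borel_measurable borel"
   by measurable
  have "ennreal (\<bar>c\<bar> ^ (l - k)) * LI {k..<l} (\<lambda>a. (\<lambda>b. \<integral>\<^sup>+x. g (b(l := x)) \<partial>lborel) (T l a)) a0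
    = LI {k..<l} (\<lambda>b. \<integral>\<^sup>+x. g (b(l := x)) \<partial>lborel) a0"
   unfolding T_def by (rule step.IH[OF _ mb]) (use step.prems in simp)
  also have "... = LI {k..<Suc l} g a0"
   unfolding ins by (rule LI_insert_in[symmetric]) simp_all
  finally have B: "ennreal (\<bar>c\<bar> ^ (l - k)) * LI {k..<l} (\<lambda>a. (\<lambda>b. \<integral>\<^sup>+x. g (b(l := x)) \<partial>lborel) (T l a)) a0
    = LI {k..<Suc l} g a0" .
  have E: "ennreal (\<bar>c\<bar> ^ (Suc l - k)) * X = ennreal (\<bar>c\<bar> ^ (l - k)) * (ennreal \<bar>c\<bar> * X)" for X
   using step.hyps by (simp add: Suc_diff_le ennreal_mult mult.assoc mult.commute mult.left_commute)
  have "ennreal (\<bar>c\<bar> ^ (Suc l - k)) * LI {k..<Suc l} (\<lambda>a. g (T (Suc l) a)) a0 = LI {k..<Suc l} g a0"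
   unfolding E A B ..
  then show ?case unfolding T_def .
 qed
 from this[of m f a0] assms show ?thesis by simp
qed

lemma LI_shift:
 assumes f: "f \<in> borel_measurable borel" and "k <= m"
 shows "LI {Suc k..<Suc m} f a
   = LI {k..<m} (\<lambda>b. f (\<lambda>i. if i \<in> {Suc k..<Suc m} then b (i - 1) else a i)) b0"
 using assms(2,1)
proof (induction m arbitrary: f a b0 rule: dec_induct)
 case base
 then show ?case by simp
next
 case (step m)
 note [measurable] = step.prems
 have ins: "{Suc k..<Suc (Suc m)} = insert (Suc m) {Suc k..<Suc m}" "{k..<Suc m} = insert m {k..<m}"
  using step by auto
 have m1: "(\<lambda>b. f (\<lambda>i. if i \<in> {Suc k..<Suc (Suc m)} then b (i - 1) else a i)) \<in> borel_measurable borel"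
 proof (rule measurable_compose[OF _ step.prems], rule measurable_seqI)
  fix i show "(\<lambda>x. if i \<in> {Suc k..<Suc (Suc m)} then x (i - 1) else a i) \<in> borel_measurable borel"
   by (cases "i \<in> {Suc k..<Suc (Suc m)}") simp_all
 qed
 have "LI {Suc k..<Suc (Suc m)} f a = (\<integral>\<^sup>+x. LI {Suc k..<Suc m} f (a(Suc m := x)) \<partial>lborel)"
  unfolding ins by (rule LI_insert_out) auto
 also have "... = (\<integral>\<^sup>+x. LI {k..<m} (\<lambda>b. f (\<lambda>i. if i \<in> {Suc k..<Suc m} then b (i - 1) else (a(Suc m := x)) i)) (b0(m:=x)) \<partial>lborel)"
  by (intro nn_integral_cong step.IH) measurable
 also have "... = (\<integral>\<^sup>+x. LI {k..<m} (\<lambda>b. f (\<lambda>i. if i \<in> {Suc k..<Suc (Suc m)} then b (i - 1) else a i)) (b0(m := x)) \<partial>lborel)"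
 proof (intro nn_integral_cong LI_cong arg_cong[where f=f] ext)
  fix x and b :: rseq and i assume b: "!!i. i \<notin> {k..<m} ==> b i = (b0(m := x)) i"
  then have "b m = x" by simp
  then show "(if i \<in> {Suc k..<Suc m} then b (i - 1) else (a(Suc m := x)) i) =
     (if i \<in> {Suc k..<Suc (Suc m)} then b (i - 1) else a i)"
   using step.hyps by (cases "i = Suc m") (auto split: if_splits)
 qed
 also have "... = LI {k..<Suc m} (\<lambda>b. f (\<lambda>i. if i \<in> {Suc k..<Suc (Suc m)} then b (i - 1) else a i)) b0"
  unfolding ins(2) by (subst LI_insert_out) (use m1 in \<open>auto simp: ins(2)\<close>)
 finally show ?case .
qed

section \<open>The area formula for polynomials on the line\<close>

text \<open>Critical points are excluded; they do not contribute to the integrals below.\<close>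
abbreviation fiber :: "real poly => real => real => real => real set" where
 "fiber p a b y \<equiv> {x. a < x & x < b & poly p x = y & poly (pderiv p) x ~= 0}"

abbreviation pullback_integral :: "(real => ennreal) => real poly => real => real => ennreal" where
 "pullback_integral h p a b \<equiv> (\<integral>\<^sup>+x. h (poly p x) * ennreal \<bar>poly (pderiv p) x\<bar> * indicator {a<..<b} x \<partial>lborel)"

abbreviation fiber_integral :: "(real => ennreal) => real poly => real => real => ennreal" where
 "fiber_integral h p a b \<equiv> (\<integral>\<^sup>+y. h y * ennreal (of_nat (card (fiber p a b y))) \<partial>lborel)"

lemma area_poly_monotone:
 fixes p :: "real poly"
 assumes h: "h \<in> borel_measurable borel" and ab: "a < b"
  and nz: "!!x. a < x ==> x < b ==> poly (pderiv p) x > 0"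
 shows "(\<lambda>y. ennreal (of_nat (card (fiber p a b y)))) \<in> borel_measurable borel"
  and "pullback_integral h p a b
   = fiber_integral h p a b"
proof -
 have inc: "poly p x < poly p y" if "a <= x" "x < y" "y <= b" for x y
 proof -
  note t = that
  obtain z where z: "x < z" "z < y" "poly p y - poly p x = (y - x) * poly (pderiv p) z"
   using poly_MVT[OF t(2), of p] by blast
  have "poly (pderiv p) z > 0" using nz z that by simp
  then have "(y - x) * poly (pderiv p) z > 0" using that by simp
  then show ?thesis using z by simp
 qed
 have card: "card (fiber p a b y)
   = (if y \<in> {poly p a<..<poly p b} then 1 else 0)" for y
 proof (cases "y \<in> {poly p a<..<poly p b}")
  case True
  then have "\<exists>x>a. x < b & poly (p - [:y:]) x = 0"
   by (intro poly_IVT_pos ab) auto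
  then obtain x where x: "a < x" "x < b" "poly p x = y" by auto
  have "(fiber p a b y) = {x}"
  proof (intro equalityI subsetI)
   fix z assume "z \<in> (fiber p a b y)"
   then show "z \<in> {x}" using x inc[of z x] inc[of x z] by (cases z x rule: linorder_cases) auto
  qed (use x nz[of x] in auto)
  then show ?thesis using True by simp
 next
  case False
  have "(fiber p a b y) = {}"
   using False inc[of a] inc[of _ b] by fastforce
  then show ?thesis using False by (simp only: card.empty if_False)
 qed
 have meas: "(\<lambda>y. ennreal (of_nat (card (fiber p a b y))))
   = indicator {poly p a<..<poly p b}"
  unfolding card by (auto simp: fun_eq_iff split: split_indicator)
 show "(\<lambda>y. ennreal (of_nat (card (fiber p a b y)))) \<in> borel_measurable borel"
  unfolding meas by simp
 have nn: "poly (pderiv p) x >= 0" if x: "x \<in> {a..b}" for x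
 proof (rule ccontr)
  assume neg: "~ poly (pderiv p) x >= 0"
  have "isCont (poly (pderiv p)) x" by simp
  then obtain d where d: "d > 0" "!!z. \<bar>z - x\<bar> < d ==> \<bar>poly (pderiv p) z - poly (pderiv p) x\<bar> < - poly (pderiv p) x"
   using neg unfolding continuous_at_eps_delta dist_real_def by (metis neg_0_less_iff_less not_le)
  obtain z where z: "a < z" "z < b" "\<bar>z - x\<bar> < d"
  proof (cases "x = b")
   case True
   then show ?thesis using that[of "max ((a+b)/2) (b - d/2)"] ab d(1) by (auto simp: max_def abs_if field_simps)
  next
   case False
   then show ?thesis using that[of "min ((x+b)/2) (x + d/2)"] ab d(1) x by (auto simp: min_def abs_if field_simps)
  qed
  then show False using nz[OF z(1,2)] d(2)[OF z(3)] neg by simp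
 qed
 have "pullback_integral h p a b
   = (\<integral>\<^sup>+x. h (poly p x) * ennreal (poly (pderiv p) x) * indicator {a..b} x \<partial>lborel)"
 proof (rule nn_integral_cong_AE)
  have "AE x in lborel. x ~= a & x ~= b" by (intro AE_conjI AE_lborel_singleton)
  then show "AE x in lborel. h (poly p x) * ennreal \<bar>poly (pderiv p) x\<bar> * indicator {a<..<b} x
    = h (poly p x) * ennreal (poly (pderiv p) x) * indicator {a..b} x"
   by eventually_elim (use nn in \<open>auto split: split_indicator\<close>)
 qed
 also have "... = (\<integral>\<^sup>+x. h x * indicator {poly p a..poly p b} x \<partial>lborel)"
  by (rule nn_integral_substitution_aux[symmetric]) (use h ab nn in \<open>auto intro!: poly_DERIV continuous_intros\<close>)
 also have "... = (\<integral>\<^sup>+x. h x * indicator {poly p a<..<poly p b} x \<partial>lborel)"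
 proof (rule nn_integral_cong_AE)
  have "AE x in lborel. x ~= poly p a & x ~= poly p b" by (intro AE_conjI AE_lborel_singleton)
  then show "AE x in lborel. h x * indicator {poly p a..poly p b} x = h x * indicator {poly p a<..<poly p b} x"
   by eventually_elim (auto split: split_indicator)
 qed
 finally show "pullback_integral h p a b
   = fiber_integral h p a b"
  unfolding fun_cong[OF meas] .
qed

text \<open>The derivative has constant sign, so the polynomial is injective on the interval and the formula is the substitution rule.\<close>
lemma area_poly_noncritical:
 fixes p :: "real poly"
 assumes h: "h \<in> borel_measurable borel" and ab: "a < b"
  and nz: "!!x. a < x ==> x < b ==> poly (pderiv p) x ~= 0"
 shows "(\<lambda>y. ennreal (of_nat (card (fiber p a b y)))) \<in> borel_measurable borel
  & pullback_integral h p a b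
   = fiber_integral h p a b"
proof -
 define m where "m = (a + b) / 2"
 have m: "a < m" "m < b" using ab by (auto simp: m_def)
 have same: "poly (pderiv p) x * poly (pderiv p) m > 0" if x: "a < x" "x < b" for x
 proof (rule ccontr)
  assume "~ poly (pderiv p) x * poly (pderiv p) m > 0"
  then have neg: "poly (pderiv p) x * poly (pderiv p) m < 0" using nz[OF x] nz[OF m] by (simp add: not_less le_less)
  then have "x ~= m" by auto
  have "\<exists>z. a < z & z < b & poly (pderiv p) z = 0"
  proof (cases "x < m")
   case True
   have "poly (pderiv p) x < 0 & poly (pderiv p) m > 0 \<or> poly (pderiv p) x > 0 & poly (pderiv p) m < 0"
    using neg by (auto simp: mult_less_0_iff)
   then show ?thesis using poly_IVT_pos[OF True, of "pderiv p"] poly_IVT_neg[OF True, of "pderiv p"] x m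
    by (meson less_trans)
  next
   case False
   then have "m < x" using \<open>x ~= m\<close> by simp
   have "poly (pderiv p) x < 0 & poly (pderiv p) m > 0 \<or> poly (pderiv p) x > 0 & poly (pderiv p) m < 0"
    using neg by (auto simp: mult_less_0_iff)
   then show ?thesis using poly_IVT_pos[OF \<open>m < x\<close>, of "pderiv p"] poly_IVT_neg[OF \<open>m < x\<close>, of "pderiv p"] x m
    by (meson less_trans)
  qed
  then show False using nz by blast
 qed
 show ?thesis
 proof (cases "poly (pderiv p) m > 0")
  case True
  then have "poly (pderiv p) x > 0" if "a < x" "x < b" for x
   using same[OF that] by (simp add: zero_less_mult_iff)
  from area_poly_monotone[OF h ab this] show ?thesis by blast
 next
  case False
  then have neg: "poly (pderiv (- p)) x > 0" if "a < x" "x < b" for x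
   using same[OF that] nz[OF m] by (auto simp: pderiv_minus zero_less_mult_iff)
  have h': "(\<lambda>y. h (- y)) \<in> borel_measurable borel" using h by measurable
  note A = area_poly_monotone[OF h' ab neg]
  have e: "{x. a < x & x < b & poly (- p) x = y & poly (pderiv (- p)) x ~= 0}
   = {x. a < x & x < b & poly p x = - y & poly (pderiv p) x ~= 0}" for y
   by (auto simp: pderiv_minus)
  define C where "C y = ennreal (of_nat (card (fiber p a b y)))" for y
  have "(\<lambda>y. C (- y)) \<in> borel_measurable borel" using A(1) unfolding e C_def .
  then have "(\<lambda>y. C (- (- y))) \<in> borel_measurable borel" by measurable
  then have Cm: "C \<in> borel_measurable borel" by simp
  have "pullback_integral h p a b
    = (\<integral>\<^sup>+y. h (- y) * C (- y) \<partial>lborel)"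
   using A(2) unfolding e C_def[symmetric] by (simp add: pderiv_minus)
  also have "... = (\<integral>\<^sup>+y. h y * C y \<partial>lborel)"
   using nn_integral_real_affine[of "\<lambda>y. h y * C y" "-1" 0] h Cm by simp
  finally show ?thesis using Cm unfolding C_def by simp
 qed
qed

text \<open>Induction on the number of critical points: each of them splits the interval into two with fewer critical points, and fibres add up.\<close>
lemma area_poly_interval:
 fixes p :: "real poly"
 assumes h: "h \<in> borel_measurable borel" and p: "pderiv p ~= 0"
 shows "a < b ==> (\<lambda>y. ennreal (of_nat (card (fiber p a b y)))) \<in> borel_measurable borel
  & pullback_integral h p a b
   = fiber_integral h p a b"
proof (induction "card {x. a < x & x < b & poly (pderiv p) x = 0}" arbitrary: a b rule: less_induct)
 case less
 have p0: "p ~= 0" using p by auto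
 have fin: "finite {x. poly (pderiv p) x = 0}" by (rule poly_roots_finite[OF p])
 have fin2: "finite (fiber p a b y)" for a b y
 proof -
  have "p - [:y:] ~= 0" using p by auto
  from poly_roots_finite[OF this] show ?thesis by (rule rev_finite_subset) auto
 qed
 show ?case
 proof (cases "\<exists>c. a < c & c < b & poly (pderiv p) c = 0")
  case False
  then show ?thesis by (intro area_poly_noncritical[OF h less.prems]) auto
 next
  case True
  then obtain c where c: "a < c" "c < b" "poly (pderiv p) c = 0" by blast
  define C where "C a b y = card (fiber p a b y)" for a b y
  have 1: "card {x. a < x & x < c & poly (pderiv p) x = 0} < card {x. a < x & x < b & poly (pderiv p) x = 0}"
   using c by (intro psubset_card_mono rev_finite_subset[OF fin]) auto
  have 2: "card {x. c < x & x < b & poly (pderiv p) x = 0} < card {x. a < x & x < b & poly (pderiv p) x = 0}"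
   using c by (intro psubset_card_mono rev_finite_subset[OF fin]) auto
  note I1 = less.hyps[OF 1 c(1)] and I2 = less.hyps[OF 2 c(2)]
  note I1 = I1[folded C_def] and I2 = I2[folded C_def]
  note [measurable] = conjunct1[OF I1] conjunct1[OF I2] h
  have C: "C a b y = C a c y + C c b y" for y
  proof -
   have "(fiber p a b y)
    = {x. a < x & x < c & poly p x = y & poly (pderiv p) x ~= 0} \<union> {x. c < x & x < b & poly p x = y & poly (pderiv p) x ~= 0}"
    (is "?A = ?B \<union> ?D")
   proof (intro equalityI subsetI)
    fix x assume x: "x \<in> ?A"
    then have "x ~= c" using c by auto
    then show "x \<in> ?B \<union> ?D" using x by (cases "x < c") auto
   qed (use c in auto)
   moreover have "card (?B \<union> ?D) = card ?B + card ?D"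
    by (rule card_Un_disjoint[OF fin2 fin2]) auto
   ultimately show ?thesis unfolding C_def by (simp only:)
  qed
  have Ce: "ennreal (of_nat (C a b y)) = ennreal (of_nat (C a c y)) + ennreal (of_nat (C c b y))" for y
   unfolding C by (simp only: of_nat_add ennreal_plus of_nat_0_le_iff)
  have "pullback_integral h p a b
   = (\<integral>\<^sup>+x. h (poly p x) * ennreal \<bar>poly (pderiv p) x\<bar> * indicator {a<..<c} x
      + h (poly p x) * ennreal \<bar>poly (pderiv p) x\<bar> * indicator {c<..<b} x \<partial>lborel)"
   using c by (intro nn_integral_cong) (auto split: split_indicator)
  also have "... = (\<integral>\<^sup>+x. h (poly p x) * ennreal \<bar>poly (pderiv p) x\<bar> * indicator {a<..<c} x \<partial>lborel)
   + (\<integral>\<^sup>+x. h (poly p x) * ennreal \<bar>poly (pderiv p) x\<bar> * indicator {c<..<b} x \<partial>lborel)"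
  proof (rule nn_integral_add)
   have [measurable]: "(\<lambda>x. poly q x) \<in> borel_measurable borel" for q :: "real poly"
    by (intro borel_measurable_continuous_onI continuous_intros)
   show "(\<lambda>x. h (poly p x) * ennreal \<bar>poly (pderiv p) x\<bar> * indicator {a<..<c} x) \<in> borel_measurable lborel"
    by measurable
   show "(\<lambda>x. h (poly p x) * ennreal \<bar>poly (pderiv p) x\<bar> * indicator {c<..<b} x) \<in> borel_measurable lborel"
    by measurable
  qed
  also have "... = (\<integral>\<^sup>+y. h y * ennreal (of_nat (C a c y)) \<partial>lborel) + (\<integral>\<^sup>+y. h y * ennreal (of_nat (C c b y)) \<partial>lborel)"
   using I1 I2 by simp
  also have "... = (\<integral>\<^sup>+y. h y * ennreal (of_nat (C a b y)) \<partial>lborel)"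
   unfolding Ce by (subst nn_integral_add[symmetric]) (simp_all add: distrib_left)
  finally have r: "pullback_integral h p a b
   = (\<integral>\<^sup>+y. h y * ennreal (of_nat (C a b y)) \<partial>lborel)" .
  have "(\<lambda>y. ennreal (of_nat (C a b y))) \<in> borel_measurable borel"
   unfolding Ce by measurable
  with r show ?thesis unfolding C_def by blast
 qed
qed

text \<open>The intervals \<open>(- k, k)\<close> exhaust the line, and monotone convergence applies on both sides.\<close>
lemma area_poly:
 fixes p :: "real poly"
 assumes h: "h \<in> borel_measurable borel" and p: "pderiv p ~= 0"
  and N: "!!y. h y ~= 0 ==> card {x. poly p x = y & poly (pderiv p) x ~= 0} = N"
 shows "(\<integral>\<^sup>+x. h (poly p x) * ennreal \<bar>poly (pderiv p) x\<bar> \<partial>lborel) = of_nat N * (\<integral>\<^sup>+y. h y \<partial>lborel)"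
proof -
 define C where "C k y = card {x. - real (Suc k) < x & x < real (Suc k) & poly p x = y & poly (pderiv p) x ~= 0}" for k y
 have fin: "finite {x. poly p x = y & poly (pderiv p) x ~= 0}" for y
 proof -
  have "p - [:y:] ~= 0" using p by auto
  from poly_roots_finite[OF this] show ?thesis by (rule rev_finite_subset) auto
 qed
 have I: "(\<lambda>y. ennreal (of_nat (C k y))) \<in> borel_measurable borel"
  "(\<integral>\<^sup>+x. h (poly p x) * ennreal \<bar>poly (pderiv p) x\<bar> * indicator {- real (Suc k)<..<real (Suc k)} x \<partial>lborel)
   = (\<integral>\<^sup>+y. h y * ennreal (of_nat (C k y)) \<partial>lborel)" for k
  using area_poly_interval[OF h p, of "- real (Suc k)" "real (Suc k)"] unfolding C_def by auto
 note [measurable] = h I(1)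
 have [measurable]: "(\<lambda>x. poly q x) \<in> borel_measurable borel" for q :: "real poly"
  by (intro borel_measurable_continuous_onI continuous_intros)
 have Cmono: "C k y <= C l y" if "k <= l" for k l y
  unfolding C_def by (rule card_mono[OF rev_finite_subset[OF fin[of y]]]) (use that in auto)
 have L: "(SUP k. (\<integral>\<^sup>+x. h (poly p x) * ennreal \<bar>poly (pderiv p) x\<bar> * indicator {- real (Suc k)<..<real (Suc k)} x \<partial>lborel))
  = (\<integral>\<^sup>+x. h (poly p x) * ennreal \<bar>poly (pderiv p) x\<bar> \<partial>lborel)"
 proof (subst nn_integral_monotone_convergence_SUP[symmetric])
  show "incseq (\<lambda>k x. h (poly p x) * ennreal \<bar>poly (pderiv p) x\<bar> * indicator {- real (Suc k)<..<real (Suc k)} x)"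
   by (auto simp: incseq_def le_fun_def split: split_indicator)
  show "(\<integral>\<^sup>+x. (SUP k. h (poly p x) * ennreal \<bar>poly (pderiv p) x\<bar> * indicator {- real (Suc k)<..<real (Suc k)} x) \<partial>lborel)
   = (\<integral>\<^sup>+x. h (poly p x) * ennreal \<bar>poly (pderiv p) x\<bar> \<partial>lborel)"
  proof (rule nn_integral_cong)
   fix x :: real
   obtain k where k: "\<bar>x\<bar> < real k" using reals_Archimedean2 by blast
   show "(SUP k. h (poly p x) * ennreal \<bar>poly (pderiv p) x\<bar> * indicator {- real (Suc k)<..<real (Suc k)} x)
    = h (poly p x) * ennreal \<bar>poly (pderiv p) x\<bar>"
   proof (rule antisym)
    show "h (poly p x) * ennreal \<bar>poly (pderiv p) x\<bar> <= (SUP k. h (poly p x) * ennreal \<bar>poly (pderiv p) x\<bar> * indicator {- real (Suc k)<..<real (Suc k)} x)"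
     by (rule SUP_upper2[of k]) (use k in \<open>auto split: split_indicator\<close>)
   qed (auto intro!: SUP_least split: split_indicator)
  qed
 qed measurable
 have R: "(SUP k. (\<integral>\<^sup>+y. h y * ennreal (of_nat (C k y)) \<partial>lborel)) = (\<integral>\<^sup>+y. of_nat N * h y \<partial>lborel)"
 proof (subst nn_integral_monotone_convergence_SUP[symmetric])
  show "incseq (\<lambda>k y. h y * ennreal (of_nat (C k y)))"
   using Cmono by (auto simp: incseq_def le_fun_def intro!: mult_left_mono)
  show "(\<integral>\<^sup>+y. (SUP k. h y * ennreal (of_nat (C k y))) \<partial>lborel) = (\<integral>\<^sup>+y. of_nat N * h y \<partial>lborel)"
  proof (rule nn_integral_cong)
   fix y :: real
   show "(SUP k. h y * ennreal (of_nat (C k y))) = of_nat N * h y"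
   proof (cases "h y = 0")
    case False
    let ?F = "{x. poly p x = y & poly (pderiv p) x ~= 0}"
    have le: "C k y <= N" for k
     unfolding C_def N[OF False, symmetric] by (rule card_mono[OF fin]) auto
    obtain k where k: "!!x. x \<in> ?F ==> \<bar>x\<bar> < real k"
    proof -
     obtain K where "!!x. x \<in> ?F ==> \<bar>x\<bar> <= K"
      using finite_imp_bounded[OF fin[of y]] unfolding bounded_real by blast
     moreover obtain k where "K < real k" using reals_Archimedean2 by blast
     ultimately show ?thesis using that[of k] by force
    qed
    have "{x. - real (Suc k) < x & x < real (Suc k) & poly p x = y & poly (pderiv p) x ~= 0} = ?F"
     using k by (force simp: abs_less_iff)
    then have Ck: "C k y = N" unfolding C_def using N[OF False] by simp
    show ?thesis
    proof (rule antisym)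
     show "of_nat N * h y <= (SUP k. h y * ennreal (of_nat (C k y)))"
      by (rule SUP_upper2[of k]) (simp_all add: Ck mult.commute ennreal_of_nat_eq_real_of_nat)
     show "(SUP k. h y * ennreal (of_nat (C k y))) <= of_nat N * h y"
      by (rule SUP_least)
        (use le in \<open>auto simp: mult.commute ennreal_of_nat_eq_real_of_nat intro!: mult_left_mono\<close>)
    qed
   qed simp
  qed
 qed measurable
 show ?thesis using L R unfolding I(2) by (simp add: nn_integral_cmult)
qed

section \<open>From atoms and weights to coefficients\<close>

definition e0 :: rseq where "e0 = (\<lambda>i. if i = 0 then 1 else 0)"

text \<open>Multiplication of a coefficient sequence by \<open>1 - l X\<close>.\<close>
definition mulp :: "real => rseq => nat => real" where
 "mulp l p = (\<lambda>k. p k - l * (if k = 0 then 0 else p (k - 1)))"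

text \<open>The value of the reversed polynomial of formal degree \<open>n\<close>: its roots are the atoms themselves instead of their reciprocals.\<close>
definition ev :: "nat => rseq => real => real" where
 "ev n p x = (\<Sum>k\<le>n. p k * x ^ (n - k))"

definition PP :: "rseq => nat => nat => real" where
 "PP lam n = coeff (PPp lam n)"

definition QQ :: "rseq => rseq => nat => nat => real" where
 "QQ lam w n = coeff (QQp lam w n)"

text \<open>The Vandermonde product.\<close>
definition van :: "nat => rseq => real" where
 "van n lam = (\<Prod>j\<in>{1..n}. \<Prod>i\<in>{1..<j}. \<bar>lam i - lam j\<bar>)"

lemma coeff_mult_linear: "coeff (p * [:1, - l:]) = mulp l (coeff p)" for l :: real
proof
 fix k
 have "p * [:1, - l:] = p + pCons 0 (smult (- l) p)" by simp
 then show "coeff (p * [:1, - l:]) k = mulp l (coeff p) k"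
  by (cases k) (simp_all only: coeff_add coeff_pCons, simp_all add: mulp_def)
qed

lemma PP_0: "PP lam 0 = e0"
 by (auto simp: PP_def PPp_def e0_def fun_eq_iff coeff_1)

lemma PPp_Suc: "PPp lam (Suc n) = PPp lam n * [:1, - lam (Suc n):]"
 unfolding PPp_def by (simp add: mult.commute)

lemma PP_Suc: "PP lam (Suc n) = mulp (lam (Suc n)) (PP lam n)"
 unfolding PP_def PPp_Suc coeff_mult_linear ..

lemma QQ_0: "QQ lam w 0 = (\<lambda>_. 0)"
 by (simp add: QQ_def QQp_def fun_eq_iff)

lemma QQp_Suc: "QQp lam w (Suc n) = QQp lam w n * [:1, - lam (Suc n):] + smult (w (Suc n)) (PPp lam n)"
proof -
 have s: "{1..Suc n} = insert (Suc n) {1..n}" by auto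
 have "(\<Sum>i\<in>{1..n}. smult (w i) (\<Prod>j\<in>{1..Suc n} - {i}. [:1, - lam j:]))
   = (\<Sum>i\<in>{1..n}. smult (w i) (\<Prod>j\<in>{1..n} - {i}. [:1, - lam j:]) * [:1, - lam (Suc n):])"
 proof (rule sum.cong)
  fix i assume "i \<in> {1..n}"
  then have u: "{1..Suc n} - {i} = insert (Suc n) ({1..n} - {i})" by auto
  show "smult (w i) (\<Prod>j\<in>{1..Suc n} - {i}. [:1, - lam j:])
    = smult (w i) (\<Prod>j\<in>{1..n} - {i}. [:1, - lam j:]) * [:1, - lam (Suc n):]"
   unfolding u by (subst prod.insert) (simp_all add: mult.commute del: mult_pCons_left mult_pCons_right)
 qed simp
 also have "... = QQp lam w n * [:1, - lam (Suc n):]" unfolding QQp_def sum_distrib_right ..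
 finally have 1: "(\<Sum>i\<in>{1..n}. smult (w i) (\<Prod>j\<in>{1..Suc n} - {i}. [:1, - lam j:])) = QQp lam w n * [:1, - lam (Suc n):]" .
 have u: "{1..Suc n} - {Suc n} = {1..n}" by auto
 have "QQp lam w (Suc n) = smult (w (Suc n)) (\<Prod>j\<in>{1..Suc n} - {Suc n}. [:1, - lam j:])
   + (\<Sum>i\<in>{1..n}. smult (w i) (\<Prod>j\<in>{1..Suc n} - {i}. [:1, - lam j:]))"
  unfolding QQp_def by (subst (1) s, subst sum.insert) auto
 then show ?thesis unfolding 1 u PPp_def by (simp only: add.commute)
qed

lemma QQ_Suc: "QQ lam w (Suc n) = (\<lambda>k. mulp (lam (Suc n)) (QQ lam w n) k + w (Suc n) * PP lam n k)"
 unfolding QQ_def QQp_Suc PP_def by (simp only: fun_eq_iff coeff_add coeff_smult coeff_mult_linear) simp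

lemma PP_cong: "(!!i. i \<in> {1..n} ==> lam i = lam' i) ==> PP lam n = PP lam' n"
 unfolding PP_def PPp_def by (rule arg_cong[of _ _ coeff], rule prod.cong) auto

lemma QQ_cong: "(!!i. i \<in> {1..n} ==> w i = w' i) ==> QQ lam w n = QQ lam w' n"
 unfolding QQ_def QQp_def by (rule arg_cong[of _ _ coeff], rule sum.cong) auto

lemma PP_at_0: "PP lam n 0 = 1"
 unfolding PP_def PPp_linprod by (rule coeff_linprod_0)

lemma QQ_at_0: "QQ lam w n 0 = (\<Sum>i\<in>{1..n}. w i)"
 unfolding QQ_def by (rule coeff_QQp_0)

lemma PP_high: "k > n ==> PP lam n k = 0"
 unfolding PP_def PPp_linprod using degree_linprod_le[of "\<lambda>l. lam (Suc l)" n] by (intro coeff_eq_0) simp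

lemma QQ_high: "k >= n ==> QQ lam w n k = 0"
proof (cases n)
 case (Suc m)
 assume "k >= n"
 then show ?thesis unfolding QQ_def using degree_QQp[of lam w n] Suc by (intro coeff_eq_0) simp
qed (simp add: QQ_0)

lemma ev_mulp:
 assumes "p (Suc n) = 0"
 shows "ev (Suc n) (mulp l p) x = (x - l) * ev n p x"
proof -
 have 1: "(\<Sum>k\<le>Suc n. p k * x ^ (Suc n - k)) = x * (\<Sum>k\<le>n. p k * x ^ (n - k))"
  using assms by (simp add: sum_distrib_left Suc_diff_le mult_ac)
 have 2: "(\<Sum>k\<le>Suc n. l * (if k = 0 then 0 else p (k - 1)) * x ^ (Suc n - k)) = l * (\<Sum>k\<le>n. p k * x ^ (n - k))"
  by (subst sum.atMost_Suc_shift) (simp add: sum_distrib_left mult_ac)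
 have e: "ev (Suc n) (mulp l p) x = (\<Sum>k\<le>Suc n. p k * x ^ (Suc n - k)) - (\<Sum>k\<le>Suc n. l * (if k = 0 then 0 else p (k - 1)) * x ^ (Suc n - k))"
  unfolding ev_def mulp_def left_diff_distrib sum_subtractf ..
 show ?thesis unfolding e 1 2 by (simp add: ev_def algebra_simps)
qed

lemma ev_PP: "ev n (PP lam n) x = (\<Prod>i\<in>{1..n}. x - lam i)"
proof (induction n)
 case 0 then show ?case by (simp add: ev_def PP_0 e0_def)
next
 case (Suc n)
 then show ?case unfolding PP_Suc ev_mulp[where p = "PP lam n", OF PP_high[OF lessI]] by simp
qed

lemma van_Suc: "van (Suc n) lam = van n lam * \<bar>ev n (PP lam n) (lam (Suc n))\<bar>"
proof -
 have "(\<Prod>i\<in>{1..<Suc n}. \<bar>lam i - lam (Suc n)\<bar>) = \<bar>ev n (PP lam n) (lam (Suc n))\<bar>"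
  unfolding ev_PP abs_prod by (rule prod.cong) (auto simp: abs_minus_commute)
 then show ?thesis by (simp add: van_def)
qed

lemma van_cong: "(!!i. i \<in> {1..n} ==> lam i = lam' i) ==> van n lam = van n lam'"
 unfolding van_def by (intro prod.cong) auto

lemma van_pos: "inj_on lam {1..n} ==> van n lam > 0"
 unfolding van_def
proof (intro prod_pos ballI)
 fix j i assume inj: "inj_on lam {1..n}" and ij: "j \<in> {1..n}" "i \<in> {1..<j}"
 then have "lam i ~= lam j" using inj_onD[OF inj, of i j] by auto
 then show "0 < \<bar>lam i - lam j\<bar>" by simp
qed

lemma seq_coord_measurable: "f \<in> M \<rightarrow>\<^sub>M (borel :: rseq measure) ==> (\<lambda>x. f x i) \<in> borel_measurable M"
 by (rule measurable_compose[OF _ measurable_product_coordinates])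

lemma snd_coord_measurable [measurable]: "(\<lambda>w. snd w (i :: nat) :: real) \<in> borel_measurable (M \<Otimes>\<^sub>M borel)"
 by (rule seq_coord_measurable[OF measurable_snd])

lemma fst_coord_measurable [measurable]: "(\<lambda>w. fst w (i :: nat) :: real) \<in> borel_measurable (borel \<Otimes>\<^sub>M M)"
 by (rule seq_coord_measurable[OF measurable_fst])

lemma mulp_measurable [measurable (raw)]:
 assumes [measurable]: "l \<in> borel_measurable M" and p: "p \<in> M \<rightarrow>\<^sub>M (borel :: rseq measure)"
 shows "(\<lambda>x. mulp (l x) (p x)) \<in> M \<rightarrow>\<^sub>M borel"
proof (rule measurable_seqI)
 fix k
 have [measurable]: "(\<lambda>x. p x i) \<in> borel_measurable M" for i by (rule seq_coord_measurable[OF p])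
 show "(\<lambda>x. mulp (l x) (p x) k) \<in> borel_measurable M" by (cases "k = 0") (simp_all add: mulp_def)
qed

lemma ev_measurable [measurable (raw)]:
 assumes [measurable]: "l \<in> borel_measurable M" and p: "p \<in> M \<rightarrow>\<^sub>M (borel :: rseq measure)"
 shows "(\<lambda>x. ev n (p x) (l x)) \<in> borel_measurable M"
proof -
 have [measurable]: "(\<lambda>x. p x i) \<in> borel_measurable M" for i by (rule seq_coord_measurable[OF p])
 show ?thesis unfolding ev_def by measurable
qed

lemma PP_measurable [measurable (raw)]:
 assumes lam: "lam \<in> M \<rightarrow>\<^sub>M (borel :: rseq measure)"
 shows "(\<lambda>x. PP (lam x) n) \<in> M \<rightarrow>\<^sub>M borel"
proof (induction n)
 case 0 then show ?case by (simp add: PP_0)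
next
 case (Suc n)
 show ?case unfolding PP_Suc by (rule mulp_measurable[OF seq_coord_measurable[OF lam] Suc])
qed

lemma QQ_measurable [measurable (raw)]:
 assumes lam: "lam \<in> M \<rightarrow>\<^sub>M (borel :: rseq measure)" and w: "w \<in> M \<rightarrow>\<^sub>M (borel :: rseq measure)"
 shows "(\<lambda>x. QQ (lam x) (w x) n) \<in> M \<rightarrow>\<^sub>M borel"
proof (induction n)
 case 0 then show ?case by (simp add: QQ_0)
next
 case (Suc n)
 note m = mulp_measurable[OF seq_coord_measurable[OF lam] Suc, of "Suc n"]
 show ?case unfolding QQ_Suc
 proof (rule measurable_seqI)
  fix k
  have [measurable]: "(\<lambda>x. mulp (lam x (Suc n)) (QQ (lam x) (w x) n) k) \<in> borel_measurable M"
   by (rule seq_coord_measurable[OF m])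
  have [measurable]: "(\<lambda>x. w x (Suc n)) \<in> borel_measurable M" by (rule seq_coord_measurable[OF w])
  have [measurable]: "(\<lambda>x. PP (lam x) n k) \<in> borel_measurable M"
   by (rule seq_coord_measurable[OF PP_measurable[OF lam]])
  show "(\<lambda>x. mulp (lam x (Suc n)) (QQ (lam x) (w x) n) k + w x (Suc n) * PP (lam x) n k) \<in> borel_measurable M"
   by measurable
 qed
qed

lemma van_measurable [measurable (raw)]:
 assumes lam: "lam \<in> M \<rightarrow>\<^sub>M (borel :: rseq measure)"
 shows "(\<lambda>x. van n (lam x)) \<in> borel_measurable M"
proof -
 have [measurable]: "(\<lambda>x. lam x i) \<in> borel_measurable M" for i by (rule seq_coord_measurable[OF lam])
 show ?thesis unfolding van_def by measurable
qed

text \<open>Adding an atom at \<open>l\<close> with the missing mass \<open>s - q\<^sub>0\<close> to a measure with denominator \<open>p'\<close> and numerator \<open>q\<close> multiplies \<open>q\<close> by \<open>1 - l X\<close> and adds \<open>(s - q\<^sub>0) p'\<close>. This is an affine map of the coefficients, and its determinant is the reversed denominator at \<open>l\<close>.\<close>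
lemma weights_step:
 fixes p' :: rseq
 assumes H: "H \<in> borel_measurable borel" and p0: "p' 0 = 1" and ph: "!!k. k > n ==> p' k = 0"
  and nz: "ev n p' l ~= 0"
 shows "ennreal \<bar>ev n p' l\<bar> * LI {0..<n} (\<lambda>q. H (\<lambda>k. mulp l q k + (s - q 0) * p' k)) (\<lambda>_. 0)
  = LI {1..<Suc n} H ((\<lambda>_. 0)(0 := s))"
proof (cases "n = 0")
 case True
 then have "p' = e0" using p0 ph by (auto simp: e0_def fun_eq_iff)
 then have "(\<lambda>k. mulp l (\<lambda>_. 0) k + (s - 0) * p' k) = (\<lambda>_. 0)(0 := s)"
  by (auto simp: mulp_def e0_def)
 moreover have "ev n p' l = 1" using True \<open>p' = e0\<close> by (simp add: ev_def e0_def)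
 ultimately show ?thesis using True by simp
next
 case False
 note [measurable] = H
 define z :: rseq where "z = (\<lambda>_. 0)"
 define E where "E = ev n p' l"
 define F where "F q = H (\<lambda>k. mulp l q k + (s - q 0) * p' k)" for q
 have mlin [measurable]: "(\<lambda>q. (\<lambda>k. mulp l q k + (s - q 0) * p' k)) \<in> borel \<rightarrow>\<^sub>M (borel :: rseq measure)"
 proof (rule measurable_seqI)
  fix k
  have [measurable]: "(\<lambda>q. mulp l q k) \<in> borel_measurable (borel :: rseq measure)"
   by (rule seq_coord_measurable) measurable
  show "(\<lambda>q. mulp l q k + (s - q 0) * p' k) \<in> borel_measurable (borel :: rseq measure)" by measurable
 qed
 have Fm [measurable]: "F \<in> borel_measurable borel" unfolding F_def by measurable
 define top where "top a = (\<Sum>k\<in>{1..<n}. a k * l ^ (n - k))" for a :: rseq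
 have [measurable]: "top \<in> borel_measurable borel" unfolding top_def by measurable
 define cut where "cut a = (\<lambda>k. if k = 0 then s else if k < n then a k else 0)" for a :: rseq
 have [measurable]: "cut \<in> borel \<rightarrow>\<^sub>M borel"
  unfolding cut_def
 proof (rule measurable_seqI)
  fix k show "(\<lambda>a. if k = 0 then s else if k < n then a k else 0) \<in> borel_measurable (borel :: rseq measure)"
   by (cases "k = 0"; cases "k < n") simp_all
 qed
 define f where "f x a = H ((cut a)(n := (s - x) * E - s * l ^ n - top a))" for x a
 have fm: "(\<lambda>w. f (fst w) (snd w)) \<in> borel_measurable (lborel \<Otimes>\<^sub>M borel)"
  unfolding f_def by measurable
 have fm3: "(\<lambda>w. f (snd w) (fst w)) \<in> borel_measurable (borel \<Otimes>\<^sub>M lborel)"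
  unfolding f_def by measurable
 then have fm4 [measurable]: "(\<lambda>a. \<integral>\<^sup>+x. f x a \<partial>lborel) \<in> borel_measurable borel"
  by (intro lborel.borel_measurable_nn_integral) (simp add: case_prod_unfold)
 have fm2 [measurable]: "f x \<in> borel_measurable borel" for x
  unfolding f_def by measurable
 define h where "h x i a = - l * a (i - 1) + (s - x) * p' i" for x :: real and i :: nat and a :: rseq
 define T where "T x a = (\<lambda>i. if i \<in> {1..<n} then 1 * a i + h x i a else a i)" for x a
 have tri: "LI {1..<n} F (z(0 := x)) = LI {1..<n} (f x) (z(0 := x))" for x
 proof -
  have "LI {1..<n} F (z(0 := x)) = LI {1..<n} (\<lambda>a. f x (T x a)) (z(0 := x))"
  proof (rule LI_cong)
   fix q :: rseq assume q: "!!i. i \<notin> {1..<n} ==> q i = (z(0 := x)) i"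
   have q0: "q 0 = x" using q[of 0] by simp
   have qh: "q k = 0" if "k >= n" for k using q[of k] that False by (simp add: z_def)
   define g where "g = (\<lambda>k. mulp l q k + (s - q 0) * p' k)"
   have g0: "g 0 = s" using q0 p0 by (simp add: g_def mulp_def)
   have gT: "g k = T x q k" if "k \<in> {1..<n}" for k
    using that q0 by (simp add: g_def mulp_def T_def h_def)
   have gh: "g k = 0" if "k > n" for k
    using that qh[of k] qh[of "k - 1"] ph by (simp add: g_def mulp_def)
   obtain n' where n': "n = Suc n'" using False by (cases n) auto
   have "ev n g l = ev n (mulp l q) l + (s - x) * E"
    unfolding g_def ev_def E_def q0 by (simp add: distrib_right sum.distrib sum_distrib_left mult.assoc)
   also have "ev n (mulp l q) l = 0" unfolding n' using ev_mulp[of q n' l l] qh n' by simp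
   finally have 1: "ev n g l = (s - x) * E" by simp
   have "{..n} = insert 0 (insert n {1..<n})" using False by auto
   then have "ev n g l = s * l ^ n + (g n + (\<Sum>k\<in>{1..<n}. g k * l ^ (n - k)))"
    unfolding ev_def using False g0 by simp
   also have "(\<Sum>k\<in>{1..<n}. g k * l ^ (n - k)) = top (T x q)" unfolding top_def using gT by simp
   finally have gn: "g n = (s - x) * E - s * l ^ n - top (T x q)" using 1 by simp
   have "g = (cut (T x q))(n := (s - x) * E - s * l ^ n - top (T x q))"
   proof
    fix k
    show "g k = ((cut (T x q))(n := (s - x) * E - s * l ^ n - top (T x q))) k"
     using g0 gT[of k] gh[of k] gn False by (cases "k = 0"; cases "k = n"; cases "k < n") (auto simp: cut_def)
   qed
   then show "F q = f x (T x q)" unfolding F_def f_def g_def by simp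
  qed
  also have "... = LI {1..<n} (f x) (z(0 := x))"
  proof -
   have hm: "h x i \<in> borel_measurable borel" for i unfolding h_def by measurable
   have "ennreal (\<bar>1\<bar> ^ (n - 1)) * LI {1..<n} (\<lambda>a. f x (\<lambda>i. if i \<in> {1..<n} then 1 * a i + h x i a else a i)) (z(0 := x))
    = LI {1..<n} (f x) (z(0 := x))"
    by (rule LI_triangular[OF _ fm2 hm]) (use False in \<open>auto simp: h_def\<close>)
   then show ?thesis unfolding T_def by simp
  qed
  finally show ?thesis .
 qed
 have base: "LI {1..<n} (f x) (z(0 := x)) = LI {1..<n} (f x) (z(0 := s))" for x
 proof (rule LI_cong_base)
  fix b b' :: rseq assume "!!i. i \<in> {1..<n} ==> b i = b' i"
  then have "cut b = cut b'" "top b = top b'" by (auto simp: cut_def top_def fun_eq_iff)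
  then show "f x b = f x b'" by (simp add: f_def)
 qed
 have "{0..<n} = insert 0 {1..<n}" using False by auto
 then have "LI {0..<n} F z = (\<integral>\<^sup>+x. LI {1..<n} F (z(0 := x)) \<partial>lborel)"
  by (simp only:) (rule LI_insert_out, auto)
 also have "... = (\<integral>\<^sup>+x. LI {1..<n} (f x) (z(0 := s)) \<partial>lborel)" unfolding tri base ..
 also have "... = LI {1..<n} (\<lambda>a. \<integral>\<^sup>+x. f x a \<partial>lborel) (z(0 := s))"
  by (rule LI_commute_lborel[OF _ fm]) simp
 finally have "ennreal \<bar>E\<bar> * LI {0..<n} F z = LI {1..<n} (\<lambda>a. ennreal \<bar>E\<bar> * (\<integral>\<^sup>+x. f x a \<partial>lborel)) (z(0 := s))"
  by (simp only:) (rule LI_cmult[symmetric], rule fm4)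
 also have "... = LI {1..<n} (\<lambda>a. \<integral>\<^sup>+y. H (a(n := y)) \<partial>lborel) (z(0 := s))"
 proof (rule LI_cong)
  fix a :: rseq assume a: "!!i. i \<notin> {1..<n} ==> a i = (z(0 := s)) i"
  have cut: "(cut a)(n := y) = a(n := y)" for y
   using a by (auto simp: cut_def fun_eq_iff z_def)
  have e: "s * E - s * l ^ n - top a + (- E) * x = (s - x) * E - s * l ^ n - top a" for x
   by (simp add: algebra_simps)
  have "(\<lambda>y. H (a(n := y))) \<in> borel_measurable borel" by measurable
  from nn_integral_real_affine[OF this, of "- E" "s * E - s * l ^ n - top a"] nz
  show "ennreal \<bar>E\<bar> * (\<integral>\<^sup>+x. f x a \<partial>lborel) = (\<integral>\<^sup>+y. H (a(n := y)) \<partial>lborel)"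
   unfolding e f_def cut by (simp add: E_def)
 qed
 also have "... = LI (insert n {1..<n}) H (z(0 := s))"
  by (rule LI_insert_in[symmetric]) auto
 also have "insert n {1..<n} = {1..<Suc n}" using False by auto
 finally show ?thesis unfolding E_def F_def z_def .
qed

text \<open>For fixed atoms the numerator is affine in the weights. Adding the atoms one at a time, the determinants of \<open>weights_step\<close> multiply up to the Vandermonde product. The last weight is determined by the total mass \<open>s\<close>.\<close>
lemma weights_to_coeffs:
 assumes H: "H \<in> borel_measurable borel" and inj: "inj_on lam {1..Suc n}"
 shows "ennreal (van (Suc n) lam) *
   LI {1..<Suc n} (\<lambda>u. H (QQ lam (u(Suc n := s - (\<Sum>i\<in>{1..n}. u i))) (Suc n))) (\<lambda>_. 0)
  = LI {1..<Suc n} H ((\<lambda>_. 0)(0 := s))"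
 using assms
proof (induction n arbitrary: H s)
 case 0
 have q: "QQ lam ((\<lambda>_. 0)(Suc 0 := s - (\<Sum>i\<in>{1..0}. 0))) (Suc 0) = (\<lambda>_. 0)(0 := s)"
  unfolding QQ_Suc QQ_0 PP_0 by (auto simp: mulp_def e0_def fun_eq_iff)
 have v: "van (Suc 0) lam = 1" by (simp add: van_def)
 have e: "{1..<Suc 0} = {}" by simp
 show ?case unfolding v e LI_empty q by simp
next
 case (Suc n)
 note [measurable] = Suc.prems(1)
 define l where "l = lam (Suc (Suc n))"
 define p' where "p' = PP lam (Suc n)"
 define H' where "H' q = H (\<lambda>k. mulp l q k + (s - q 0) * p' k)" for q
 have mlin [measurable]: "(\<lambda>q. (\<lambda>k. mulp l q k + (s - q 0) * p' k)) \<in> borel \<rightarrow>\<^sub>M (borel :: rseq measure)"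
 proof (rule measurable_seqI)
  fix k
  have [measurable]: "(\<lambda>q. mulp l q k) \<in> borel_measurable (borel :: rseq measure)"
   by (rule seq_coord_measurable) measurable
  show "(\<lambda>q. mulp l q k + (s - q 0) * p' k) \<in> borel_measurable (borel :: rseq measure)" by measurable
 qed
 have H'm [measurable]: "H' \<in> borel_measurable borel" unfolding H'_def by measurable
 have injn: "inj_on lam {1..Suc n}" using Suc.prems(2) by (rule inj_on_subset) auto
 have nz: "ev (Suc n) p' l ~= 0"
 proof -
  have "lam (Suc (Suc n)) ~= lam i" if "i \<in> {1..Suc n}" for i
   using inj_onD[OF Suc.prems(2), of "Suc (Suc n)" i] that by auto
  then show ?thesis unfolding p'_def ev_PP l_def by (auto simp: prod_zero_iff)
 qed
 have step: "H (QQ lam (u(Suc (Suc n) := s - (\<Sum>i\<in>{1..Suc n}. u i))) (Suc (Suc n))) = H' (QQ lam u (Suc n))" for u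
 proof -
  have "QQ lam (u(Suc (Suc n) := s - (\<Sum>i\<in>{1..Suc n}. u i))) (Suc n) = QQ lam u (Suc n)"
   by (rule QQ_cong) auto
  then show ?thesis unfolding QQ_Suc[of _ _ "Suc n"] H'_def l_def p'_def QQ_at_0 by simp
 qed
 have m1 [measurable]: "(\<lambda>u. H' (QQ lam u (Suc n))) \<in> borel_measurable borel"
  by (rule measurable_compose[OF QQ_measurable H'm]) simp_all
 define G where "G s' u = H' (QQ lam (u(Suc n := s' - (\<Sum>i\<in>{1..n}. u i))) (Suc n))" for s' and u :: rseq
 have Gm: "(\<lambda>w. G (fst w) (snd w)) \<in> borel_measurable (lborel \<Otimes>\<^sub>M borel)"
  unfolding G_def by (rule measurable_compose[OF QQ_measurable H'm]) measurable
 have i2: "{1..<Suc (Suc n)} = insert (Suc n) {1..<Suc n}" by auto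
 have "LI {1..<Suc (Suc n)} (\<lambda>u. H' (QQ lam u (Suc n))) (\<lambda>_. 0)
  = LI {1..<Suc n} (\<lambda>u. \<integral>\<^sup>+x. H' (QQ lam (u(Suc n := x)) (Suc n)) \<partial>lborel) (\<lambda>_. 0)"
  unfolding i2 by (rule LI_insert_in) (auto intro: m1)
 also have "... = LI {1..<Suc n} (\<lambda>u. \<integral>\<^sup>+s'. G s' u \<partial>lborel) (\<lambda>_. 0)"
 proof (rule LI_cong)
  fix u :: rseq
  have "(\<lambda>x. H' (QQ lam (u(Suc n := x)) (Suc n))) \<in> borel_measurable borel"
   by (rule measurable_compose[OF QQ_measurable H'm]) measurable
  from nn_integral_real_affine[OF this, of 1 "- (\<Sum>i\<in>{1..n}. u i)"]
  show "(\<integral>\<^sup>+x. H' (QQ lam (u(Suc n := x)) (Suc n)) \<partial>lborel) = (\<integral>\<^sup>+s'. G s' u \<partial>lborel)"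
   unfolding G_def by (simp add: add.commute[of "- _"])
 qed
 also have "... = (\<integral>\<^sup>+s'. LI {1..<Suc n} (G s') (\<lambda>_. 0) \<partial>lborel)"
  by (rule LI_commute_lborel[OF _ Gm, symmetric]) simp
 finally have "ennreal (van (Suc n) lam) * LI {1..<Suc (Suc n)} (\<lambda>u. H' (QQ lam u (Suc n))) (\<lambda>_. 0)
   = (\<integral>\<^sup>+s'. ennreal (van (Suc n) lam) * LI {1..<Suc n} (G s') (\<lambda>_. 0) \<partial>lborel)"
  by (simp only:) (rule nn_integral_cmult[symmetric], rule LI_measurable_param, use Gm in auto)
 also have "... = (\<integral>\<^sup>+s'. LI {1..<Suc n} H' ((\<lambda>_. 0)(0 := s')) \<partial>lborel)"
  unfolding G_def by (intro nn_integral_cong Suc.IH[OF H'm injn])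
 also have "... = LI (insert 0 {1..<Suc n}) H' (\<lambda>_. 0)"
  by (rule LI_insert_out[symmetric]) auto
 also have "insert 0 {1..<Suc n} = {0..<Suc n}" by auto
 finally have A: "ennreal (van (Suc n) lam) * LI {1..<Suc (Suc n)} (\<lambda>u. H' (QQ lam u (Suc n))) (\<lambda>_. 0)
   = LI {0..<Suc n} H' (\<lambda>_. 0)" .
 have B: "ennreal \<bar>ev (Suc n) p' l\<bar> * LI {0..<Suc n} H' (\<lambda>_. 0) = LI {1..<Suc (Suc n)} H ((\<lambda>_. 0)(0 := s))"
  unfolding H'_def by (rule weights_step[OF Suc.prems(1) _ _ nz]) (simp_all add: p'_def PP_at_0 PP_high)
 have "ennreal (van (Suc (Suc n)) lam) = ennreal \<bar>ev (Suc n) p' l\<bar> * ennreal (van (Suc n) lam)"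
  unfolding van_Suc[of "Suc n"] p'_def l_def
  by (subst ennreal_mult[symmetric]) (use van_pos[OF injn] in \<open>auto simp: mult.commute\<close>)
 then show ?case unfolding step by (simp only: mult.assoc A B)
qed


text \<open>If all coefficients but the last are fixed, a root \<open>x\<close> of the reversed polynomial of degree \<open>n + 1\<close> determines the last coefficient, which is then \<open>EP n a x\<close>. Exchanging one root for the last coefficient is therefore the substitution of the area formula.\<close>
definition EP :: "nat => rseq => real poly" where
 "EP n a = - (\<Sum>j\<le>n. monom (a j) (Suc n - j))"

lemma poly_EP: "poly (EP n a) x = - (\<Sum>j\<le>n. a j * x ^ (Suc n - j))"
 by (simp add: EP_def poly_sum poly_monom)

lemma pderiv_sum_poly: "pderiv (\<Sum>j\<in>A. f j) = (\<Sum>j\<in>A. pderiv (f j))"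
 by (induction A rule: infinite_finite_induct) (simp_all add: pderiv_add)

lemma poly_pderiv_EP: "poly (pderiv (EP n a)) x = - (\<Sum>j\<le>n. real (Suc n - j) * a j * x ^ (n - j))"
 by (simp add: EP_def poly_sum poly_monom pderiv_minus pderiv_sum_poly pderiv_monom)

lemma ev_Suc_EP: "ev (Suc n) p x = p (Suc n) - poly (EP n p) x"
 by (simp add: ev_def poly_EP)

lemma EP_cong: "(!!j. j <= n ==> a j = b j) ==> EP n a = EP n b"
 unfolding EP_def by (intro arg_cong[of _ _ uminus] sum.cong) auto

lemma pderiv_EP_nonzero: "a 0 ~= 0 ==> pderiv (EP n a) ~= 0"
proof
 assume a: "a 0 ~= 0" and z: "pderiv (EP n a) = 0"
 have "coeff (EP n a) (Suc n) = - (\<Sum>j\<le>n. if j = 0 then a 0 else 0)"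
  unfolding EP_def coeff_minus coeff_sum
  by (intro arg_cong[of _ _ uminus] sum.cong) (auto simp: coeff_monom)
 also have "... = - a 0" by simp
 finally have "coeff (pderiv (EP n a)) n ~= 0" using a by (simp add: coeff_pderiv)
 then show False using z by simp
qed

lemma EP_linear_factor:
 assumes "!!k. k > n ==> p k = 0"
 shows "poly (EP n (mulp l p)) l = mulp l p (Suc n)" "poly (pderiv (EP n (mulp l p))) l = - ev n p l"
proof -
 define R where "R = (\<Sum>k\<le>n. monom (p k) (n - k))"
 have R: "poly R x = ev n p x" for x by (simp add: R_def ev_def poly_sum poly_monom)
 have "poly (EP n (mulp l p)) x = poly ([:mulp l p (Suc n):] - [:- l, 1:] * R) x" for x
  using ev_Suc_EP[of n "mulp l p" x] ev_mulp[of p n l x] assms[of "Suc n"] by (simp add: R algebra_simps)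
 then have e: "EP n (mulp l p) = [:mulp l p (Suc n):] - [:- l, 1:] * R"
  by (simp add: poly_eq_poly_eq_iff[symmetric] fun_eq_iff del: mult_pCons_left)
 show "poly (EP n (mulp l p)) l = mulp l p (Suc n)" unfolding e by simp
 have "pderiv (EP n (mulp l p)) = - (R + [:- l, 1:] * pderiv R)"
  unfolding e pderiv_diff pderiv_mult by (simp add: pderiv_pCons del: mult_pCons_left)
 then show "poly (pderiv (EP n (mulp l p))) l = - ev n p l" by (simp add: R)
qed

lemma mulp_inj: "mulp l p = mulp l q ==> p = q"
proof
 fix k assume e: "mulp l p = mulp l q"
 show "p k = q k"
 proof (induction k)
  case 0 then show ?case using fun_cong[OF e, of 0] by (simp add: mulp_def)
 next
  case (Suc k) then show ?case using fun_cong[OF e, of "Suc k"] by (simp add: mulp_def)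
 qed
qed

text \<open>The \<open>n + 1\<close> distinct roots are simple, hence not critical.\<close>
lemma fiber_card:
 assumes inj: "inj_on \<rho> {1..Suc n}" and a: "a(Suc n := y) = PP \<rho> (Suc n)"
 shows "card {x. poly (EP n a) x = y & poly (pderiv (EP n a)) x ~= 0} = Suc n"
proof -
 define Pi where "Pi = (\<Prod>i\<in>{1..Suc n}. [:- \<rho> i, 1:])"
 have EPc: "EP n (a(Suc n := y)) = EP n a" by (rule EP_cong) auto
 have "poly (EP n a) x = poly ([:y:] - Pi) x" for x
 proof -
  have "ev (Suc n) (a(Suc n := y)) x = y - poly (EP n a) x"
   unfolding ev_Suc_EP EPc by simp
  moreover have "ev (Suc n) (a(Suc n := y)) x = poly Pi x"
   unfolding a ev_PP Pi_def poly_prod by (simp del: prod.cl_ivl_Suc)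
  ultimately show ?thesis by simp
 qed
 then have e: "EP n a = [:y:] - Pi"
  by (simp add: poly_eq_poly_eq_iff[symmetric] fun_eq_iff)
 have "{x. poly (EP n a) x = y & poly (pderiv (EP n a)) x ~= 0} = \<rho> ` {1..Suc n}"
 proof (intro equalityI subsetI)
  fix x assume "x \<in> {x. poly (EP n a) x = y & poly (pderiv (EP n a)) x ~= 0}"
  then have "poly Pi x = 0" unfolding e by simp
  then obtain i where "i \<in> {1..Suc n}" "x - \<rho> i = 0"
   unfolding Pi_def poly_prod by (auto simp: prod_zero_iff simp del: prod.cl_ivl_Suc)
  then show "x \<in> \<rho> ` {1..Suc n}" by auto
 next
  fix x assume "x \<in> \<rho> ` {1..Suc n}"
  then obtain k where k: "k \<in> {1..Suc n}" "x = \<rho> k" by blast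
  define R where "R = (\<Prod>i\<in>{1..Suc n} - {k}. [:- \<rho> i, 1:])"
  have Pi: "Pi = [:- \<rho> k, 1:] * R" unfolding Pi_def R_def by (rule prod.remove) (use k in auto)
  have "poly Pi x = 0" unfolding Pi k(2) by simp
  moreover have "poly (pderiv Pi) x = poly R x"
   unfolding Pi pderiv_mult k(2) by (simp add: pderiv_pCons)
  moreover have "poly R x ~= 0"
  proof -
   have "\<rho> k - \<rho> i ~= 0" if "i \<in> {1..Suc n} - {k}" for i
    using inj_onD[OF inj, of k i] that k by auto
   then show ?thesis unfolding R_def poly_prod k(2) by (auto simp: prod_zero_iff)
  qed
  ultimately show "x \<in> {x. poly (EP n a) x = y & poly (pderiv (EP n a)) x ~= 0}"
   unfolding e by (simp add: pderiv_diff)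
 qed
 then show ?thesis using card_image[OF inj] by simp
qed

lemma remove_root:
 assumes inj: "inj_on \<rho> {1..Suc n}" and e: "mulp x p = PP \<rho> (Suc n)" and h: "!!k. k > n ==> p k = 0"
 shows "\<exists>\<rho>'. inj_on \<rho>' {1..n} & p = PP \<rho>' n"
proof -
 have "ev (Suc n) (mulp x p) x = 0" using ev_mulp[of p n x x] h by simp
 then obtain k where k: "k \<in> {1..Suc n}" "x = \<rho> k"
  unfolding e ev_PP by (auto simp: prod_zero_iff simp del: prod.cl_ivl_Suc)
 define t where "t i = (if i = k then Suc n else if i = Suc n then k else i)" for i
 define \<rho>' where "\<rho>' i = \<rho> (t i)" for i
 have tt: "t (t i) = i" for i by (auto simp: t_def)
 have ti: "t i \<in> {1..Suc n}" if "i \<in> {1..Suc n}" for i using that k by (auto simp: t_def)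
 have "PPp \<rho>' (Suc n) = PPp \<rho> (Suc n)"
  unfolding PPp_def \<rho>'_def by (rule prod.reindex_bij_witness[of _ t t]) (use tt ti in auto)
 then have "mulp x p = PP \<rho>' (Suc n)" unfolding e PP_def by simp
 also have "... = mulp x (PP \<rho>' n)" unfolding PP_Suc by (simp add: \<rho>'_def t_def k(2))
 finally have "p = PP \<rho>' n" by (rule mulp_inj)
 moreover have "inj_on \<rho>' {1..n}"
 proof (rule inj_onI)
  fix i j assume ij: "i \<in> {1..n}" "j \<in> {1..n}" "\<rho>' i = \<rho>' j"
  then have "t i = t j" using ti unfolding \<rho>'_def by (intro inj_onD[OF inj]) auto
  then show "i = j" using tt by metis
 qed
 ultimately show ?thesis by blast
qed

text \<open>The elementary symmetric functions have the Vandermonde product as Jacobian, and each unordered set of atoms arises from \<open>n!\<close> orderings. In the induction the last atom is exchanged for the last coefficient by the area formula, where the fibre consists of the \<open>n + 1\<close> possible choices of that atom. The hypothesis \<open>vanish\<close> restricts the integrand to polynomials with distinct real roots.\<close>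
lemma poles_to_coeffs:
 assumes H: "H \<in> borel_measurable borel"
  and vanish: "!!p. p 0 = 1 ==> (!!k. k > n ==> p k = 0) ==> H p ~= 0 ==> \<exists>\<rho>. inj_on \<rho> {1..n} & p = PP \<rho> n"
 shows "LI {1..<Suc n} (\<lambda>lam. H (PP lam n) * ennreal (van n lam)) (\<lambda>_. 0) = of_nat (fact n) * LI {1..<Suc n} H e0"
 using assms
proof (induction n arbitrary: H)
 case 0
 have "{1..<Suc 0} = {}" by simp
 then show ?case by (simp add: PP_0 van_def)
next
 case (Suc n)
 note [measurable] = Suc.prems(1)
 define H' where "H' x p = H (mulp x p) * ennreal \<bar>ev n p x\<bar>" for x p
 have H'm [measurable]: "H' x \<in> borel_measurable borel" for x unfolding H'_def by measurable
 define F where "F lam = H (PP lam (Suc n)) * ennreal (van (Suc n) lam)" for lam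
 have [measurable]: "F \<in> borel_measurable borel" unfolding F_def by measurable
 have i2: "{1..<Suc (Suc n)} = insert (Suc n) {1..<Suc n}" by auto
 have vnn: "van n lam >= 0" for lam unfolding van_def by (intro prod_nonneg) auto
 have "LI {1..<Suc (Suc n)} F (\<lambda>_. 0) = (\<integral>\<^sup>+x. LI {1..<Suc n} F ((\<lambda>_. 0)(Suc n := x)) \<partial>lborel)"
  unfolding i2 by (rule LI_insert_out) auto
 also have "... = (\<integral>\<^sup>+x. LI {1..<Suc n} (\<lambda>lam. H' x (PP lam n) * ennreal (van n lam)) (\<lambda>_. 0) \<partial>lborel)"
 proof (intro nn_integral_cong LI_cong_base)
  fix x :: real and b b' :: rseq
  assume b: "!!i. i \<notin> {1..<Suc n} ==> b i = ((\<lambda>_. 0)(Suc n := x)) i" "!!i. i \<in> {1..<Suc n} ==> b i = b' i"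
  have bx: "b (Suc n) = x" using b(1)[of "Suc n"] by simp
  have c: "PP b n = PP b' n" "van n b = van n b'" by (intro PP_cong van_cong; use b(2) in auto)+
  show "F b = H' x (PP b' n) * ennreal (van n b')"
   unfolding F_def H'_def PP_Suc van_Suc bx c using vnn
   by (simp add: ennreal_mult mult_ac)
 qed
 also have "... = (\<integral>\<^sup>+x. of_nat (fact n) * LI {1..<Suc n} (H' x) e0 \<partial>lborel)"
 proof (intro nn_integral_cong Suc.IH H'm)
  fix x and p :: rseq assume p: "p 0 = 1" "!!k. n < k ==> p k = 0" "H' x p ~= 0"
  have "H (mulp x p) ~= 0" using p(3) by (auto simp: H'_def)
  moreover have "mulp x p 0 = 1" using p(1) by (simp add: mulp_def)
  moreover have "mulp x p k = 0" if "k > Suc n" for k using p(2)[of k] p(2)[of "k - 1"] that by (simp add: mulp_def)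
  ultimately obtain \<rho> where "inj_on \<rho> {1..Suc n}" "mulp x p = PP \<rho> (Suc n)" using Suc.prems(2) by blast
  then show "\<exists>\<rho>. inj_on \<rho> {1..n} & p = PP \<rho> n" using p(2) by (rule remove_root)
 qed
 also have "... = of_nat (fact n) * (\<integral>\<^sup>+x. LI {1..<Suc n} (H' x) e0 \<partial>lborel)"
 proof (rule nn_integral_cmult)
  have "(\<lambda>w. H' (fst w) (snd w)) \<in> borel_measurable (lborel \<Otimes>\<^sub>M borel)"
   unfolding H'_def by measurable
  then show "(\<lambda>x. LI {1..<Suc n} (H' x) e0) \<in> borel_measurable lborel"
   by (rule LI_measurable_param[rotated]) simp_all
 qed
 also have "(\<integral>\<^sup>+x. LI {1..<Suc n} (H' x) e0 \<partial>lborel) = of_nat (Suc n) * LI {1..<Suc (Suc n)} H e0"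
 proof -
  define f where "f x a = H (a(Suc n := poly (EP n a) x)) * ennreal \<bar>poly (pderiv (EP n a)) x\<bar>" for x a
  have fm: "(\<lambda>w. f (fst w) (snd w)) \<in> borel_measurable (lborel \<Otimes>\<^sub>M borel)"
   unfolding f_def poly_EP poly_pderiv_EP by measurable
  have fm2 [measurable]: "f x \<in> borel_measurable borel" for x
   unfolding f_def poly_EP poly_pderiv_EP by measurable
  have tri: "LI {1..<Suc n} (H' x) e0 = LI {1..<Suc n} (f x) e0" for x
  proof -
   define h where "h i a = - x * a (i - 1)" for i :: nat and a :: rseq
   have hm: "h i \<in> borel_measurable borel" for i unfolding h_def by measurable
   have "LI {1..<Suc n} (H' x) e0 = LI {1..<Suc n} (\<lambda>a. f x (\<lambda>i. if i \<in> {1..<Suc n} then 1 * a i + h i a else a i)) e0"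
   proof (rule LI_cong)
    fix p assume "!!i. i \<notin> {1..<Suc n} ==> p i = e0 i"
    then have p: "p 0 = 1" "!!k. k > n ==> p k = 0" by (auto simp: e0_def)
    let ?a = "\<lambda>i. if i \<in> {1..<Suc n} then 1 * p i + h i p else p i"
    have E: "EP n ?a = EP n (mulp x p)" by (rule EP_cong) (auto simp: mulp_def h_def)
    have u: "?a(Suc n := mulp x p (Suc n)) = mulp x p"
    proof
     fix k show "(?a(Suc n := mulp x p (Suc n))) k = mulp x p k"
      using p(2)[of k] p(2)[of "k - 1"] by (cases "k = 0"; cases "k <= n") (auto simp: mulp_def h_def)
    qed
    have v1: "poly (EP n (mulp x p)) x = mulp x p (Suc n)" by (rule EP_linear_factor(1)) (rule p(2))
    have v2: "poly (pderiv (EP n (mulp x p))) x = - ev n p x" by (rule EP_linear_factor(2)) (rule p(2))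
    show "H' x p = f x ?a" unfolding f_def E v1 v2 u H'_def abs_minus_cancel ..
   qed
   also have "... = LI {1..<Suc n} (f x) e0"
    using LI_triangular[where c = 1 and h = h and k = 1 and m = "Suc n" and f = "f x", OF _ fm2 hm, of e0]
    by (auto simp: h_def)
   finally show ?thesis .
  qed
  have "(\<integral>\<^sup>+x. LI {1..<Suc n} (H' x) e0 \<partial>lborel) = LI {1..<Suc n} (\<lambda>a. \<integral>\<^sup>+x. f x a \<partial>lborel) e0"
   unfolding tri by (rule LI_commute_lborel[OF _ fm]) simp
  also have "... = LI {1..<Suc n} (\<lambda>a. of_nat (Suc n) * (\<integral>\<^sup>+y. H (a(Suc n := y)) \<partial>lborel)) e0"
  proof (rule LI_cong)
   fix a assume "!!i. i \<notin> {1..<Suc n} ==> a i = e0 i"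
   then have a: "a 0 = 1" "!!k. k > n ==> a k = 0" by (auto simp: e0_def)
   show "(\<integral>\<^sup>+x. f x a \<partial>lborel) = of_nat (Suc n) * (\<integral>\<^sup>+y. H (a(Suc n := y)) \<partial>lborel)"
    unfolding f_def
   proof (rule area_poly)
    show "(\<lambda>y. H (a(Suc n := y))) \<in> borel_measurable borel" by measurable
    show "pderiv (EP n a) ~= 0" by (rule pderiv_EP_nonzero) (simp add: a)
    fix y assume y: "H (a(Suc n := y)) ~= 0"
    have "\<exists>\<rho>. inj_on \<rho> {1..Suc n} & a(Suc n := y) = PP \<rho> (Suc n)"
     by (rule Suc.prems(2)[OF _ _ y]) (use a in auto)
    then show "card {x. poly (EP n a) x = y & poly (pderiv (EP n a)) x ~= 0} = Suc n"
     using fiber_card by blast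
   qed
  qed
  also have "... = of_nat (Suc n) * LI {1..<Suc n} (\<lambda>a. \<integral>\<^sup>+y. H (a(Suc n := y)) \<partial>lborel) e0"
   by (rule LI_cmult) measurable
  also have "LI {1..<Suc n} (\<lambda>a. \<integral>\<^sup>+y. H (a(Suc n := y)) \<partial>lborel) e0 = LI {1..<Suc (Suc n)} H e0"
   unfolding i2 by (rule LI_insert_in[symmetric]) auto
  finally show ?thesis .
 qed
 finally have fin: "LI {1..<Suc (Suc n)} F (\<lambda>_. 0) = of_nat (fact n) * (of_nat (Suc n) * LI {1..<Suc (Suc n)} H e0)" .
 have fs: "(of_nat (fact (Suc n)) :: ennreal) = of_nat (fact n) * of_nat (Suc n)"
  by (metis fact_Suc of_nat_mult mult.commute of_nat_id)
 show ?case using fin unfolding fs mult.assoc F_def .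
qed

section \<open>From coefficients to the entries of the continued fraction\<close>

text \<open>One step of the division algorithm: if \<open>p = q - y X h\<close> with \<open>h\<close> normalised to constant coefficient \<open>1\<close>, then \<open>y = q\<^sub>1 - p\<^sub>1\<close> and \<open>h = hh p q\<close>. The function \<open>zz\<close> below collects the successive values of \<open>y\<close>, and \<open>stepp\<close> inverts the step.\<close>
definition hh :: "rseq => rseq => nat => real" where
 "hh p q = (\<lambda>k. (q (Suc k) - p (Suc k)) / (q 1 - p 1))"

fun zz :: "nat => rseq => rseq => real" where
 "zz 0 p q = q 1 - p 1"
| "zz (Suc j) p q = zz j q (hh p q)"

definition stepp :: "real => rseq => rseq => nat => real" where
 "stepp y q h = (\<lambda>k. q k - y * (if k = 0 then 0 else h (k - 1)))"

definition G :: "rseq => nat => nat => real" where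
 "G y i = coeff (GP y i)"

lemma G_0: "G y 0 = e0" and G_1: "G y (Suc 0) = e0"
 by (auto simp: G_def e0_def fun_eq_iff coeff_1)

lemma G_step: "G y (Suc (Suc i)) = stepp (y i) (G y (Suc i)) (G y i)"
proof
 fix k show "G y (Suc (Suc i)) k = stepp (y i) (G y (Suc i)) (G y i) k"
  by (cases k) (simp_all add: G_def stepp_def)
qed

lemma G_cong: "(!!j. Suc j < i ==> y j = y' j) ==> G y i = G y' i"
 unfolding G_def by (rule arg_cong[of _ _ coeff], rule GP_cong) auto

lemma hh_measurable [measurable (raw)]:
 assumes p: "p \<in> M \<rightarrow>\<^sub>M (borel :: rseq measure)" and q: "q \<in> M \<rightarrow>\<^sub>M (borel :: rseq measure)"
 shows "(\<lambda>x. hh (p x) (q x)) \<in> M \<rightarrow>\<^sub>M borel"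
 unfolding hh_def
proof (rule measurable_seqI)
 fix k
 have [measurable]: "(\<lambda>x. p x i) \<in> borel_measurable M" "(\<lambda>x. q x i) \<in> borel_measurable M" for i
  by (rule seq_coord_measurable[OF p], rule seq_coord_measurable[OF q])
 show "(\<lambda>x. (q x (Suc k) - p x (Suc k)) / (q x 1 - p x 1)) \<in> borel_measurable M" by measurable
qed

lemma zz_measurable [measurable (raw)]:
 assumes "p \<in> M \<rightarrow>\<^sub>M (borel :: rseq measure)" "q \<in> M \<rightarrow>\<^sub>M (borel :: rseq measure)"
 shows "(\<lambda>x. zz j (p x) (q x)) \<in> borel_measurable M"
 using assms
proof (induction j arbitrary: p q)
 case 0
 have [measurable]: "(\<lambda>x. p x i) \<in> borel_measurable M" "(\<lambda>x. q x i) \<in> borel_measurable M" for i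
  by (rule seq_coord_measurable[OF 0(1)], rule seq_coord_measurable[OF 0(2)])
 show ?case by simp
next
 case (Suc j)
 show ?case unfolding zz.simps by (rule Suc.IH[OF Suc.prems(2) hh_measurable[OF Suc.prems]])
qed

lemma stepp_measurable [measurable (raw)]:
 assumes [measurable]: "y \<in> borel_measurable M" and p: "p \<in> M \<rightarrow>\<^sub>M (borel :: rseq measure)" and q: "q \<in> M \<rightarrow>\<^sub>M (borel :: rseq measure)"
 shows "(\<lambda>x. stepp (y x) (p x) (q x)) \<in> M \<rightarrow>\<^sub>M borel"
 unfolding stepp_def
proof (rule measurable_seqI)
 fix k
 have [measurable]: "(\<lambda>x. p x i) \<in> borel_measurable M" "(\<lambda>x. q x i) \<in> borel_measurable M" for i
  by (rule seq_coord_measurable[OF p], rule seq_coord_measurable[OF q])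
 show "(\<lambda>x. p x k - y x * (if k = 0 then 0 else q x (k - 1))) \<in> borel_measurable M"
  by (cases "k = 0") simp_all
qed

lemma G_measurable [measurable (raw)]:
 assumes y: "y \<in> M \<rightarrow>\<^sub>M (borel :: rseq measure)"
 shows "(\<lambda>x. G (y x) i) \<in> M \<rightarrow>\<^sub>M borel"
proof (induction i rule: less_induct)
 case (less i)
 consider "i = 0" | "i = 1" | j where "i = Suc (Suc j)" by (metis One_nat_def not0_implies_Suc)
 then show ?case
 proof cases
  case (3 j)
  show ?thesis unfolding 3 G_step
   by (rule stepp_measurable[OF seq_coord_measurable[OF y] less less]) (simp_all add: 3)
 qed (simp_all add: G_0 G_1)
qed

text \<open>One step of the division algorithm exchanges the coefficients of the denominator for its first entry \<open>y\<close> and the coefficients of \<open>h\<close>. This is triangular, and each of the remaining coefficients contributes a factor \<open>y\<close> to the Jacobian.\<close>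
lemma coeffs_to_fraction:
 assumes H: "(\<lambda>w. H (fst w) (snd w)) \<in> borel_measurable ((borel :: rseq measure) \<Otimes>\<^sub>M (borel :: rseq measure))"
 shows "LI {1..<Suc (N div 2)} (\<lambda>q. LI {1..<Suc (Suc N div 2)} (\<lambda>p. if \<forall>j<N. zz j p q > 0 then H p q else 0) e0) e0
  = LI {..<N} (\<lambda>y. if \<forall>i<N. y i > 0 then ennreal (\<Prod>i<N. y i ^ (i div 2)) * H (G y (Suc N)) (G y N) else 0) a"
 using H
proof (induction N arbitrary: H a)
 case 0
 have "{1..<Suc 0} = {}" by simp
 then show ?case by (simp add: G_0 G_1)
next
 case (Suc N)
 define m where "m = N div 2"
 define d where "d = Suc N div 2"
 have dm: "d <= Suc m" "Suc (Suc N) div 2 = Suc m" by (auto simp: d_def m_def)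
 have Hc: "(\<lambda>x. H (f x) (g x)) \<in> borel_measurable M"
  if "f \<in> M \<rightarrow>\<^sub>M borel" "g \<in> M \<rightarrow>\<^sub>M borel" for f g and M :: "'z measure"
  using measurable_compose[OF measurable_Pair[OF that] Suc.prems] by simp
 have Hc3: "(\<lambda>x. H (f x) (g x)) \<in> borel_measurable M"
  if "f \<in> M \<rightarrow>\<^sub>M borel" "g \<in> M \<rightarrow>\<^sub>M borel" for f g and M :: "((real \<times> rseq) \<times> rseq) measure"
  using measurable_compose[OF measurable_Pair[OF that] Suc.prems] by simp
 have Hc2: "(\<lambda>x. H (f x) (g x)) \<in> borel_measurable M"
  if "f \<in> M \<rightarrow>\<^sub>M borel" "g \<in> M \<rightarrow>\<^sub>M borel" for f g and M :: "(rseq \<times> rseq) measure"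
  using measurable_compose[OF measurable_Pair[OF that] Suc.prems] by simp
 have Hc1: "(\<lambda>x. H (f x) (g x)) \<in> borel_measurable M"
  if "f \<in> M \<rightarrow>\<^sub>M borel" "g \<in> M \<rightarrow>\<^sub>M borel" for f g and M :: "rseq measure"
  using measurable_compose[OF measurable_Pair[OF that] Suc.prems] by simp
 note [measurable (raw)] = Hc Hc1 Hc2 Hc3
 define K where "K p q = (if \<forall>j<Suc N. zz j p q > 0 then H p q else 0)" for p q
 define Kn where "Kn y h q = (if \<forall>j<N. zz j q h > 0 then H (stepp y q h) q else 0)" for y h q
 have Km [measurable]: "(\<lambda>p. K p q) \<in> borel_measurable borel" for q unfolding K_def by measurable
 have Knm3: "(\<lambda>w. Kn (fst (fst w)) (snd w) (snd (fst w))) \<in> borel_measurable ((lborel \<Otimes>\<^sub>M borel) \<Otimes>\<^sub>M borel)"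
  unfolding Kn_def by measurable
 have Knm2: "(\<lambda>w. Kn y (snd w) (fst w)) \<in> borel_measurable (borel \<Otimes>\<^sub>M borel)" for y
  unfolding Kn_def by measurable
 have Knm1 [measurable]: "(\<lambda>h. Kn y h q) \<in> borel_measurable borel" for y q
  unfolding Kn_def by measurable
 have Kstep: "K (stepp y q h) q = Kn y h q" if "y > 0" "h 0 = 1" for y q h
 proof -
  have "hh (stepp y q h) q = h" using that by (auto simp: hh_def stepp_def)
  moreover have "zz 0 (stepp y q h) q = y" using that by (simp add: stepp_def)
  ultimately show ?thesis using that by (simp add: K_def Kn_def All_less_Suc2)
 qed
 have inner: "LI {1..<Suc (Suc m)} (\<lambda>p. K p q) e0
   = (\<integral>\<^sup>+y. (if y > 0 then ennreal (y ^ m) else 0) * LI {1..<Suc m} (\<lambda>h. Kn y h q) e0 \<partial>lborel)"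
  if q: "q 0 = 1" "!!k. k > d ==> q k = 0" for q
 proof -
  have i1: "{1..<Suc (Suc m)} = insert 1 {2..<Suc (Suc m)}" by auto
  have "LI {1..<Suc (Suc m)} (\<lambda>p. K p q) e0 = (\<integral>\<^sup>+x. LI {2..<Suc (Suc m)} (\<lambda>p. K p q) (e0(1 := x)) \<partial>lborel)"
   unfolding i1 by (rule LI_insert_out) auto
  also have "... = (\<integral>\<^sup>+y. LI {2..<Suc (Suc m)} (\<lambda>p. K p q) (e0(1 := q 1 - y)) \<partial>lborel)"
  proof -
   have "(\<lambda>x. LI {2..<Suc (Suc m)} (\<lambda>p. K p q) (e0(1 := x))) \<in> borel_measurable borel"
    by (rule measurable_compose[OF _ LI_measurable]) measurable
   from nn_integral_real_affine[OF this, of "-1" "q 1"] show ?thesis by simp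
  qed
  also have "... = (\<integral>\<^sup>+y. (if y > 0 then ennreal (y ^ m) else 0) * LI {1..<Suc m} (\<lambda>h. Kn y h q) e0 \<partial>lborel)"
  proof (rule nn_integral_cong)
   fix y :: real
   let ?b = "e0(1 := q 1 - y)"
   show "LI {2..<Suc (Suc m)} (\<lambda>p. K p q) ?b = (if y > 0 then ennreal (y ^ m) else 0) * LI {1..<Suc m} (\<lambda>h. Kn y h q) e0"
   proof (cases "y > 0")
    case False
    have "LI {2..<Suc (Suc m)} (\<lambda>p. K p q) ?b = LI {2..<Suc (Suc m)} (\<lambda>p. 0) ?b"
    proof (rule LI_cong)
     fix p :: rseq assume "!!i. i \<notin> {2..<Suc (Suc m)} ==> p i = ?b i"
     from this[of 1] have "zz 0 p q = y" by simp
     then have "~ (\<forall>j<Suc N. zz j p q > 0)" using False by (metis zero_less_Suc)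
     then show "K p q = 0" unfolding K_def by (rule if_not_P)
    qed
    then show ?thesis using False by (simp add: LI_def)
   next
    case True
    let ?T = "\<lambda>a i. if i \<in> {2..<Suc (Suc m)} then (- y) * a i + q i else a i"
    have Tm [measurable]: "?T \<in> borel \<rightarrow>\<^sub>M (borel :: rseq measure)"
    proof (rule measurable_seqI)
     fix i show "(\<lambda>a. ?T a i) \<in> borel_measurable borel" by (cases "i \<in> {2..<Suc (Suc m)}") simp_all
    qed
    have Tm2: "(\<lambda>a. K (?T a) q) \<in> borel_measurable borel" by (rule measurable_compose[OF Tm Km])
    have "LI {2..<Suc (Suc m)} (\<lambda>p. K p q) ?b
      = ennreal (\<bar>- y\<bar> ^ (Suc (Suc m) - 2)) * LI {2..<Suc (Suc m)} (\<lambda>a. K (?T a) q) ?b"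
     by (rule LI_triangular[where c = "- y" and h = "\<lambda>i _. q i", symmetric]) (use True in auto)
    also have "LI {2..<Suc (Suc m)} (\<lambda>a. K (?T a) q) ?b
      = LI {1..<Suc m} (\<lambda>h. K (?T (\<lambda>i. if i \<in> {2..<Suc (Suc m)} then h (i - 1) else ?b i)) q) e0"
     using LI_shift[OF Tm2, of 1 "Suc m" ?b e0] unfolding Suc_1 by simp
    also have "... = LI {1..<Suc m} (\<lambda>h. Kn y h q) e0"
    proof (rule LI_cong)
     fix h assume "!!i. i \<notin> {1..<Suc m} ==> h i = e0 i"
     then have h: "h 0 = 1" "!!k. k > m ==> h k = 0" by (auto simp: e0_def)
     have "?T (\<lambda>i. if i \<in> {2..<Suc (Suc m)} then h (i - 1) else ?b i) = stepp y q h"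
     proof
      fix k
      consider "k = 0" | "k = 1" | "k \<in> {2..<Suc (Suc m)}" | "k >= Suc (Suc m)" by fastforce
      then show "?T (\<lambda>i. if i \<in> {2..<Suc (Suc m)} then h (i - 1) else ?b i) k = stepp y q h k"
       using h h(2)[of "k - 1"] q(1) q(2)[of k] dm(1) by cases (auto simp: stepp_def e0_def)
     qed
     moreover have "K (stepp y q h) q = Kn y h q" by (rule Kstep) (use True h in auto)
     ultimately show "K (?T (\<lambda>i. if i \<in> {2..<Suc (Suc m)} then h (i - 1) else ?b i)) q = Kn y h q"
      by (simp only:)
    qed
    moreover have "\<bar>- y\<bar> ^ (Suc (Suc m) - 2) = y ^ m" using True by simp
    ultimately show ?thesis using True by (simp only: if_True)
   qed
  qed
  finally show ?thesis .
 qed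
 define c where "c y = (if y > 0 then ennreal (y ^ m) else 0)" for y :: real
 have [measurable]: "c \<in> borel_measurable borel" unfolding c_def by measurable
 have inm: "(\<lambda>w. LI {1..<Suc m} (\<lambda>h. Kn (fst w) h (snd w)) e0) \<in> borel_measurable (lborel \<Otimes>\<^sub>M borel)"
  by (rule LI_measurable_param) (use Knm3 in auto)
 have "LI {1..<Suc d} (\<lambda>q. LI {1..<Suc (Suc m)} (\<lambda>p. K p q) e0) e0
   = LI {1..<Suc d} (\<lambda>q. \<integral>\<^sup>+y. c y * LI {1..<Suc m} (\<lambda>h. Kn y h q) e0 \<partial>lborel) e0"
  unfolding c_def by (rule LI_cong, rule inner) (auto simp: e0_def)
 also have "... = (\<integral>\<^sup>+y. LI {1..<Suc d} (\<lambda>q. c y * LI {1..<Suc m} (\<lambda>h. Kn y h q) e0) e0 \<partial>lborel)"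
  by (rule LI_commute_lborel[symmetric]) (use inm in auto)
 also have "... = (\<integral>\<^sup>+y. c y * LI {1..<Suc m} (\<lambda>h. LI {1..<Suc d} (\<lambda>q. Kn y h q) e0) e0 \<partial>lborel)"
 proof (rule nn_integral_cong)
  fix y
  have "LI {1..<Suc d} (\<lambda>q. c y * LI {1..<Suc m} (\<lambda>h. Kn y h q) e0) e0
   = c y * LI {1..<Suc d} (\<lambda>q. LI {1..<Suc m} (\<lambda>h. Kn y h q) e0) e0"
   by (rule LI_cmult, rule LI_measurable_param) (use Knm2 in auto)
  also have "LI {1..<Suc d} (\<lambda>q. LI {1..<Suc m} (\<lambda>h. Kn y h q) e0) e0 = LI {1..<Suc m} (\<lambda>h. LI {1..<Suc d} (\<lambda>q. Kn y h q) e0) e0"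
   by (rule LI_commute) (use Knm2 in auto)
  finally show "LI {1..<Suc d} (\<lambda>q. c y * LI {1..<Suc m} (\<lambda>h. Kn y h q) e0) e0
   = c y * LI {1..<Suc m} (\<lambda>h. LI {1..<Suc d} (\<lambda>q. Kn y h q) e0) e0" .
 qed
 also have "... = (\<integral>\<^sup>+y. c y * LI {..<N} (\<lambda>v. if \<forall>i<N. v i > 0 then ennreal (\<Prod>i<N. v i ^ (i div 2)) *
    H (stepp y (G v (Suc N)) (G v N)) (G v (Suc N)) else 0) a \<partial>lborel)"
 proof (intro nn_integral_cong arg_cong2[where f = "(*)"] refl)
  fix y
  have "(\<lambda>w. H (stepp y (fst w) (snd w)) (fst w)) \<in> borel_measurable (borel \<Otimes>\<^sub>M borel)" by measurable
  from Suc.IH[OF this, of a]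
  show "LI {1..<Suc m} (\<lambda>h. LI {1..<Suc d} (\<lambda>q. Kn y h q) e0) e0
   = LI {..<N} (\<lambda>v. if \<forall>i<N. v i > 0 then ennreal (\<Prod>i<N. v i ^ (i div 2)) *
    H (stepp y (G v (Suc N)) (G v N)) (G v (Suc N)) else 0) a"
   unfolding Kn_def m_def d_def .
 qed
 also have "... = (\<integral>\<^sup>+y. LI {..<N} (\<lambda>v. if \<forall>i<Suc N. v i > 0 then ennreal (\<Prod>i<Suc N. v i ^ (i div 2)) *
    H (G v (Suc (Suc N))) (G v (Suc N)) else 0) (a(N := y)) \<partial>lborel)"
 proof (rule nn_integral_cong)
  fix y
  let ?f = "\<lambda>v. if \<forall>i<N. v i > 0 then ennreal (\<Prod>i<N. v i ^ (i div 2)) *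
    H (stepp y (G v (Suc N)) (G v N)) (G v (Suc N)) else 0"
  have "c y * LI {..<N} ?f a = LI {..<N} (\<lambda>v. c y * ?f v) a"
   by (rule LI_cmult[symmetric]) measurable
  also have "... = LI {..<N} (\<lambda>v. if \<forall>i<Suc N. v i > 0 then ennreal (\<Prod>i<Suc N. v i ^ (i div 2)) *
    H (G v (Suc (Suc N))) (G v (Suc N)) else 0) (a(N := y))"
  proof (rule LI_cong_base)
   fix b b' :: rseq
   assume b': "!!i. i \<notin> {..<N} ==> b' i = (a(N := y)) i" and bb: "!!i. i \<in> {..<N} ==> b i = b' i"
   have y: "b' N = y" using b'[of N] by simp
   have g: "G b (Suc N) = G b' (Suc N)" "G b N = G b' N" by (intro G_cong; use bb in auto)+
   have pr: "(\<Prod>i<N. b i ^ (i div 2)) = (\<Prod>i<N. b' i ^ (i div 2))" using bb by (intro prod.cong) auto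
   have al: "(\<forall>i<N. b i > 0) \<longleftrightarrow> (\<forall>i<N. b' i > 0)" using bb by auto
   show "c y * ?f b = (if \<forall>i<Suc N. b' i > 0 then ennreal (\<Prod>i<Suc N. b' i ^ (i div 2)) *
    H (G b' (Suc (Suc N))) (G b' (Suc N)) else 0)"
   proof (cases "(\<forall>i<N. b' i > 0) & y > 0")
    case True
    then have "(\<Prod>i<N. b' i ^ (i div 2)) >= 0" by (intro prod_nonneg) (auto simp: less_imp_le)
    then show ?thesis using True unfolding g pr al G_step[of b' N] y c_def
     by (simp add: y less_Suc_eq m_def ennreal_mult mult_ac)
   next
    case False
    then show ?thesis unfolding al c_def by (auto simp: y less_Suc_eq)
   qed
  qed
  finally show "c y * LI {..<N} ?f a = LI {..<N} (\<lambda>v. if \<forall>i<Suc N. v i > 0 then ennreal (\<Prod>i<Suc N. v i ^ (i div 2)) *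
    H (G v (Suc (Suc N))) (G v (Suc N)) else 0) (a(N := y))" .
 qed
 also have "... = LI (insert N {..<N}) (\<lambda>v. if \<forall>i<Suc N. v i > 0 then ennreal (\<Prod>i<Suc N. v i ^ (i div 2)) *
    H (G v (Suc (Suc N))) (G v (Suc N)) else 0) a"
  by (rule LI_insert_out[symmetric]) (auto, measurable)
 also have "insert N {..<N} = {..<Suc N}" by auto
 finally show ?case unfolding dm(2) d_def[symmetric] K_def .
qed

section \<open>The law of the moments\<close>

text \<open>The coefficients of the power series \<open>q / p\<close> for \<open>p\<^sub>0 = 1\<close>.\<close>
function mom :: "rseq => rseq => nat => real" where
 "mom p q k = q k - (\<Sum>j<k. p (k - j) * mom p q j)"
 by auto
termination by (relation "inv_image less_than (\<lambda>(p, q, k). k)") auto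

declare mom.simps [simp del]

lemma mom_unique:
 assumes "p 0 = 1" "!!k. q k = (\<Sum>j\<le>k. p (k - j) * m j)"
 shows "m k = mom p q k"
proof (induction k rule: less_induct)
 case (less k)
 have "q k = (\<Sum>j<k. p (k - j) * m j) + m k"
  using assms(2)[of k] assms(1) by (simp add: lessThan_Suc_atMost[symmetric])
 moreover have "(\<Sum>j<k. p (k - j) * m j) = (\<Sum>j<k. p (k - j) * mom p q j)"
  using less by simp
 ultimately show ?case using mom.simps[of p q k] by simp
qed

lemma mom_measurable [measurable (raw)]:
 assumes p: "p \<in> M \<rightarrow>\<^sub>M (borel :: rseq measure)" and q: "q \<in> M \<rightarrow>\<^sub>M (borel :: rseq measure)"
 shows "(\<lambda>x. mom (p x) (q x)) \<in> M \<rightarrow>\<^sub>M borel"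
proof (rule measurable_seqI)
 fix k show "(\<lambda>x. mom (p x) (q x) k) \<in> borel_measurable M"
 proof (induction k rule: less_induct)
  case (less k)
  have [measurable]: "(\<lambda>x. p x i) \<in> borel_measurable M" "(\<lambda>x. q x i) \<in> borel_measurable M" for i
   by (rule seq_coord_measurable[OF p], rule seq_coord_measurable[OF q])
  have "(\<lambda>x. q x k - (\<Sum>j\<in>{..<k}. p x (k - j) * mom (p x) (q x) j)) \<in> borel_measurable M"
   by (intro borel_measurable_diff borel_measurable_sum borel_measurable_times less) auto
  then show ?case by (subst mom.simps)
 qed
qed

lemma fps_mulp: "Abs_fps (mulp l p) = (1 - fps_const l * fps_X) * Abs_fps p"
proof (rule fps_ext)
 fix k show "fps_nth (Abs_fps (mulp l p)) k = fps_nth ((1 - fps_const l * fps_X) * Abs_fps p) k"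
  by (cases k) (simp_all add: mulp_def left_diff_distrib mult.assoc)
qed

lemma geometric_fps: "(1 - fps_const l * fps_X) * Abs_fps (\<lambda>k. l ^ k) = (1 :: real fps)"
proof (rule fps_ext)
 fix k show "fps_nth ((1 - fps_const l * fps_X) * Abs_fps (\<lambda>k. l ^ k)) k = fps_nth (1 :: real fps) k"
  by (cases k) (simp_all add: left_diff_distrib mult.assoc)
qed

lemma moments_of_atoms:
 "(\<Sum>i\<in>{1..n}. w i * lam i ^ k) = mom (PP lam n) (QQ lam w n) k"
proof -
 define mf where "mf n = Abs_fps (\<lambda>k. \<Sum>i\<in>{1..n}. w i * lam i ^ k)" for n
 have f: "Abs_fps (PP lam n) * mf n = Abs_fps (QQ lam w n)" for n
 proof (induction n)
  case 0
  show ?case by (simp add: fps_eq_iff fps_mult_nth mf_def QQ_0)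
 next
  case (Suc n)
  let ?g = "1 - fps_const (lam (Suc n)) * fps_X"
  have m: "mf (Suc n) = mf n + fps_const (w (Suc n)) * Abs_fps (\<lambda>k. lam (Suc n) ^ k)"
   by (rule fps_ext) (simp add: mf_def)
  have q: "Abs_fps (QQ lam w (Suc n)) = ?g * Abs_fps (QQ lam w n) + fps_const (w (Suc n)) * Abs_fps (PP lam n)"
   unfolding fps_mulp[symmetric] QQ_Suc by (rule fps_ext) simp
  have "Abs_fps (PP lam (Suc n)) * mf (Suc n)
    = ?g * (Abs_fps (PP lam n) * mf n) + fps_const (w (Suc n)) * Abs_fps (PP lam n) * (?g * Abs_fps (\<lambda>k. lam (Suc n) ^ k))"
   unfolding PP_Suc fps_mulp m by (simp add: algebra_simps)
  then show ?case unfolding Suc geometric_fps q by simp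
 qed
 show ?thesis
 proof (rule mom_unique)
  show "PP lam n 0 = 1" by (rule PP_at_0)
  fix k
  have "QQ lam w n k = fps_nth (mf n * Abs_fps (PP lam n)) k"
   using arg_cong[OF f[of n], of "\<lambda>f. fps_nth f k"] by (simp add: mult.commute)
  also have "... = (\<Sum>j\<le>k. PP lam n (k - j) * (\<Sum>i\<in>{1..n}. w i * lam i ^ j))"
   by (simp only: fps_mult_nth mf_def atLeast0AtMost fps_nth_Abs_fps) (simp only: mult.commute)
  finally show "QQ lam w n k = (\<Sum>j\<le>k. PP lam n (k - j) * (\<Sum>i\<in>{1..n}. w i * lam i ^ j))" .
 qed
qed

lemma hh_stepp: "y ~= 0 ==> h 0 = 1 ==> hh (stepp y q h) q = h"
 by (auto simp: hh_def stepp_def)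

lemma G_at_0: "G y i 0 = 1"
 by (simp add: G_def)

lemma zz_G:
 assumes "!!i. i < N ==> y i > 0" "j < N"
 shows "zz j (G y (Suc N)) (G y N) = y (N - 1 - j)"
 using assms
proof (induction j arbitrary: N)
 case 0
 then obtain N' where N: "N = Suc N'" by (cases N) auto
 show ?case unfolding N G_step[of y N'] by (simp add: stepp_def G_at_0)
next
 case (Suc j)
 then obtain N' where N: "N = Suc N'" by (cases N) auto
 have "hh (G y (Suc N)) (G y N) = G y N'"
  unfolding N G_step[of y N'] using Suc.prems(1)[of N'] N by (intro hh_stepp) (auto simp: G_at_0)
 then show ?case using Suc.IH[of N'] Suc.prems unfolding N by simp
qed

text \<open>With positive entries no division fails, so running the division algorithm backwards recovers both polynomials.\<close>
lemma zz_pos_imp_G: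
 assumes "p 0 = 1" "q 0 = 1" "!!k. k > Suc N div 2 ==> p k = 0" "!!k. k > N div 2 ==> q k = 0"
  and "!!j. j < N ==> zz j p q > 0"
 shows "p = G (\<lambda>i. zz (N - 1 - i) p q) (Suc N) & q = G (\<lambda>i. zz (N - 1 - i) p q) N"
 using assms
proof (induction N arbitrary: p q)
 case 0
 then have "p = e0" "q = e0" by (auto simp: e0_def fun_eq_iff)
 then show ?case by (simp add: G_0 G_1)
next
 case (Suc N)
 define y where "y = q 1 - p 1"
 have y: "y > 0" using Suc.prems(5)[of 0] by (simp add: y_def)
 define h where "h = hh p q"
 have p: "p = stepp y q h"
 proof
  fix k show "p k = stepp y q h k"
   using y Suc.prems(1,2) by (cases k) (auto simp: stepp_def h_def hh_def y_def)
 qed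
 have IH: "q = G (\<lambda>i. zz (N - 1 - i) q h) (Suc N) & h = G (\<lambda>i. zz (N - 1 - i) q h) N"
 proof (rule Suc.IH)
  show "q 0 = 1" by fact
  show "h 0 = 1" using y by (simp add: h_def hh_def y_def)
  show "q k = 0" if "k > Suc N div 2" for k using Suc.prems(4) that by simp
  show "h k = 0" if "k > N div 2" for k
   using Suc.prems(3)[of "Suc k"] Suc.prems(4)[of "Suc k"] that by (simp add: h_def hh_def)
  show "zz j q h > 0" if "j < N" for j using Suc.prems(5)[of "Suc j"] that by (simp add: h_def)
 qed
 let ?Y = "\<lambda>i. zz (Suc N - 1 - i) p q"
 have Y: "?Y i = zz (N - 1 - i) q h" if "i < N" for i
 proof -
  have "Suc N - 1 - i = Suc (N - 1 - i)" using that by simp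
  then show ?thesis by (simp add: h_def)
 qed
 have q: "q = G ?Y (Suc N)" using IH G_cong[of "Suc N" ?Y "\<lambda>i. zz (N - 1 - i) q h"] Y by auto
 have h: "h = G ?Y N" using IH G_cong[of N ?Y "\<lambda>i. zz (N - 1 - i) q h"] Y by auto
 have "?Y N = y" by (simp add: y_def)
 then have "G ?Y (Suc (Suc N)) = stepp y (G ?Y (Suc N)) (G ?Y N)" using G_step[of ?Y N] by simp
 then have "p = G ?Y (Suc (Suc N))" unfolding q[symmetric] h[symmetric] using p by simp
 then show ?case using q by simp
qed

abbreviation dirichlet_weight :: "real => nat => rseq => real" where
 "dirichlet_weight \<beta> n v \<equiv> (if (\<forall>i\<in>{1..<n}. 0 < v i) & (\<Sum>i\<in>{1..<n}. v i) < 1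
   then ((\<Prod>i\<in>{1..<n}. v i) * (1 - (\<Sum>i\<in>{1..<n}. v i))) powr (\<beta> / 2 - 1) else 0)"

text \<open>The density of the gamma distribution with shape \<open>a\<close> and scale \<open>2\<close>, up to the constant \<open>gnorm a\<close>.\<close>
definition gdens :: "real => real => real" where
 "gdens a x = (if x > 0 then x powr (a - 1) * exp (- x / 2) else 0)"

definition gnorm :: "real => ennreal" where
 "gnorm a = (\<integral>\<^sup>+x. ennreal (gdens a x) \<partial>lborel)"

definition shape :: "real => real => nat => nat => real" where
 "shape \<beta> g n i = (if even i then g - (real n - 1 - real (i div 2)) * \<beta> / 2 else real ((i + 1) div 2) * \<beta> / 2)"

lemma gdens_measurable [measurable]: "gdens a \<in> borel_measurable borel"
 unfolding gdens_def by measurable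

lemma gdens_nonneg: "gdens a x >= 0" by (simp add: gdens_def)

text \<open>Collecting exponents: an entry with even index \<open>i\<close> occurs in the Jacobian, in the product of weights and Vandermonde factors, and in the product of the atoms; an entry with odd index only in the first two.\<close>
lemma prod_gdens:
 assumes n: "n >= 1" and y: "!!i. i < 2 * n - 1 ==> y i > 0"
 shows "(\<Prod>i<2 * n - 1. y i ^ (i div 2)) *
   ((\<Prod>i<2 * n - 1. y i ^ ((i + 1) div 2)) powr (\<beta> / 2 - 1) * (\<Prod>i<n. y (2 * i)) powr (g - (real n - 1) * \<beta> / 2 - 1)
    * exp (- (\<Sum>i<2 * n - 1. y i) / 2))
   = (\<Prod>i<2 * n - 1. gdens (shape \<beta> g n i) (y i))"
proof -
 define e where "e i = g - (real n - 1) * \<beta> / 2 - 1" for i :: nat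
 have ev: "(\<Prod>i<n. y (2 * i)) powr (g - (real n - 1) * \<beta> / 2 - 1)
   = (\<Prod>i<2 * n - 1. if even i then y i powr (g - (real n - 1) * \<beta> / 2 - 1) else 1)"
 proof -
  have "(\<Prod>i<n. y (2 * i)) powr (g - (real n - 1) * \<beta> / 2 - 1) = (\<Prod>i<n. y (2 * i) powr (g - (real n - 1) * \<beta> / 2 - 1))"
   by (rule prod_powr_distrib)
  also have "... = (\<Prod>i\<in>{i. i < 2 * n - 1 & even i}. y i powr (g - (real n - 1) * \<beta> / 2 - 1))"
   by (rule prod.reindex_bij_witness[of _ "\<lambda>i. i div 2" "\<lambda>i. 2 * i"]) auto
  also have "... = (\<Prod>i<2 * n - 1. if even i then y i powr (g - (real n - 1) * \<beta> / 2 - 1) else 1)"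
   by (rule prod.mono_neutral_cong_left) auto
  finally show ?thesis .
 qed
 have od: "(\<Prod>i<2 * n - 1. y i ^ ((i + 1) div 2)) powr (\<beta> / 2 - 1)
   = (\<Prod>i<2 * n - 1. y i powr (real ((i + 1) div 2) * (\<beta> / 2 - 1)))"
 proof -
  have "(\<Prod>i<2 * n - 1. y i ^ ((i + 1) div 2)) powr (\<beta> / 2 - 1) = (\<Prod>i<2 * n - 1. (y i ^ ((i + 1) div 2)) powr (\<beta> / 2 - 1))"
   by (rule prod_powr_distrib)
  also have "... = (\<Prod>i<2 * n - 1. y i powr (real ((i + 1) div 2) * (\<beta> / 2 - 1)))"
   by (rule prod.cong) (use y in \<open>auto simp: powr_powr powr_realpow[symmetric]\<close>)
  finally show ?thesis .
 qed
 have ex: "exp (- (\<Sum>i<2 * n - 1. y i) / 2) = (\<Prod>i<2 * n - 1. exp (- y i / 2))"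
  by (simp add: exp_sum[symmetric] sum_divide_distrib[symmetric] sum_negf)
 show ?thesis
  unfolding ev od ex prod.distrib[symmetric]
 proof (rule prod.cong)
  fix i assume "i \<in> {..<2 * n - 1}"
  then have yi: "y i > 0" using y by simp
  have p: "y i ^ (i div 2) = y i powr real (i div 2)" using yi by (simp add: powr_realpow)
  show "y i ^ (i div 2) * (y i powr (real ((i + 1) div 2) * (\<beta> / 2 - 1))
    * (if even i then y i powr (g - (real n - 1) * \<beta> / 2 - 1) else 1) * exp (- y i / 2))
   = gdens (shape \<beta> g n i) (y i)"
  proof (cases "even i")
   case True
   then have d: "(i + 1) div 2 = i div 2" by simp
   have "real (i div 2) + (real (i div 2) * (\<beta> / 2 - 1) + (g - (real n - 1) * \<beta> / 2 - 1)) = shape \<beta> g n i - 1"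
    using True by (simp add: shape_def algebra_simps diff_divide_distrib add_divide_distrib)
   then have "y i powr (shape \<beta> g n i - 1) = y i powr real (i div 2) * (y i powr (real (i div 2) * (\<beta> / 2 - 1)) * y i powr (g - (real n - 1) * \<beta> / 2 - 1))"
    by (simp only: powr_add[symmetric])
   then show ?thesis using True yi unfolding p d by (simp add: gdens_def)
  next
   case False
   then have d: "real ((i + 1) div 2) = real (i div 2) + 1" by (auto elim: oddE)
   have "real (i div 2) + (real ((i + 1) div 2) * (\<beta> / 2 - 1)) = shape \<beta> g n i - 1"
    unfolding shape_def d using False d by (simp add: algebra_simps diff_divide_distrib add_divide_distrib)
   then have "y i powr (shape \<beta> g n i - 1) = y i powr real (i div 2) * y i powr (real ((i + 1) div 2) * (\<beta> / 2 - 1))"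
    by (simp only: powr_add[symmetric])
   then show ?thesis using False yi unfolding p by (simp add: gdens_def)
  qed
 qed simp
qed

definition ydens :: "real => real => nat => rseq => real" where
 "ydens \<beta> g n y = (\<Prod>i<2 * n - 1. y i ^ ((i + 1) div 2)) powr (\<beta> / 2 - 1)
   * (\<Prod>i<n. y (2 * i)) powr (g - (real n - 1) * \<beta> / 2 - 1) * exp (- (\<Sum>i<2 * n - 1. y i) / 2)"

definition pqdens :: "real => real => nat => rseq => rseq => ennreal" where
 "pqdens \<beta> g n p q = (if \<forall>j<2 * n - 1. zz j p q > 0 then ennreal (ydens \<beta> g n (\<lambda>i. zz (2 * n - 1 - 1 - i) p q)) else 0)"

lemma poles_of_positive_fraction:
 assumes n: "n >= 1" and "p 0 = 1" "q 0 = 1" "!!k. k > n ==> p k = 0" "!!k. k > n - 1 ==> q k = 0"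
  and z: "!!j. j < 2 * n - 1 ==> zz j p q > 0"
 shows "\<exists>y. (\<forall>i<2 * n - 1. y i = zz (2 * n - 1 - 1 - i) p q & y i > 0) & p = G y (2 * n) & q = G y (2 * n - 1)"
  and "\<exists>\<rho>. inj_on \<rho> {1..n} & p = PP \<rho> n"
proof -
 have S: "Suc (2 * n - 1) = 2 * n" and d: "Suc (2 * n - 1) div 2 = n" "(2 * n - 1) div 2 = n - 1" using n by auto
 define y where "y i = zz (2 * n - 1 - 1 - i) p q" for i
 have y: "y i > 0" if "i < 2 * n - 1" for i unfolding y_def by (rule z) (use that in auto)
 have G: "p = G y (Suc (2 * n - 1)) & q = G y (2 * n - 1)"
  unfolding y_def by (rule zz_pos_imp_G) (use assms d in auto)
 then show "\<exists>y. (\<forall>i<2 * n - 1. y i = zz (2 * n - 1 - 1 - i) p q & y i > 0) & p = G y (2 * n) & q = G y (2 * n - 1)"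
  unfolding S using y by (intro exI[of _ y]) (auto simp: y_def)
 obtain tau where "interl tau (2 * n - 1) (GP y (Suc (2 * n - 1))) (GP y (2 * n - 1))"
  using interl_GP[of "2 * n - 1" y] y by blast
 from atoms_of_interl[OF n this] obtain \<rho> w where r: "inj_on \<rho> {1..n}" "GP y (Suc (2 * n - 1)) = PPp \<rho> n" by blast
 then have "p = PP \<rho> n" using G by (simp add: G_def PP_def)
 then show "\<exists>\<rho>. inj_on \<rho> {1..n} & p = PP \<rho> n" using r by blast
qed

text \<open>If the atoms are distinct and all entries are positive, this is \<open>atoms_GP\<close>. Otherwise both sides vanish: positivity of all entries is equivalent to positivity of the atoms and the weights, and a double atom annihilates both Vandermonde products.\<close>
lemma density_identity:
 assumes n: "n >= 1" and \<beta>: "\<beta> > 0" and w1: "(\<Sum>i\<in>{1..n}. w i) = 1"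
 shows "ennreal (laguerre_weight \<beta> g n lam * (if \<forall>i\<in>{1..n}. w i > 0 then (\<Prod>i\<in>{1..n}. w i) powr (\<beta> / 2 - 1) else 0))
   = ennreal ((van n lam)\<^sup>2) * pqdens \<beta> g n (PP lam n) (QQ lam w n)"
proof -
 have vb: "(\<Prod>j\<in>{1..n}. \<Prod>i\<in>{1..<j}. \<bar>lam i - lam j\<bar> powr \<beta>) = van n lam powr \<beta>"
  unfolding van_def by (simp add: prod_powr_distrib[symmetric] prod_nonneg)
 have S: "Suc (2 * n - 1) = 2 * n" using n by auto
 show ?thesis
 proof (cases "inj_on lam {1..n}")
  case False
  then obtain i j where ij: "i \<in> {1..n}" "j \<in> {1..n}" "lam i = lam j" "i < j"
   by (metis inj_onI nat_neq_iff)
  have "(\<Prod>i\<in>{1..<j}. \<bar>lam i - lam j\<bar>) = 0" using ij by (intro prod_zero bexI[of _ i]) auto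
  then have "van n lam = 0" unfolding van_def by (rule prod_zero[OF finite_atLeastAtMost bexI[OF _ ij(2)]])
  then show ?thesis using \<beta> unfolding laguerre_weight_def vb by simp
 next
  case inj: True
  show ?thesis
  proof (cases "(\<forall>i\<in>{1..n}. lam i > 0) & (\<forall>i\<in>{1..n}. w i > 0)")
   case True
   then have lpos: "!!i. i \<in> {1..n} ==> lam i > 0" and wpos: "!!i. i \<in> {1..n} ==> w i > 0" by auto
   obtain tau where "interl tau (2 * n - 1) (PPp lam n) (QQp lam w n)"
    using interl_of_atoms[OF n inj lpos wpos w1] by blast
   from interl_imp_GP[OF this] obtain y where y: "!!i. i < 2 * n - 1 ==> y i > 0"
    and P: "PPp lam n = GP y (Suc (2 * n - 1))" and Q: "QQp lam w n = GP y (2 * n - 1)" by blast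
   have A3: "(\<Prod>i\<in>{1..n}. lam i) = (\<Prod>i<n. y (2 * i))"
    by (rule atoms_GP(3)[OF n inj P[unfolded S] Q]) (rule y)
   have A4: "(\<Sum>i\<in>{1..n}. lam i) = (\<Sum>i<2 * n - 1. y i)"
    by (rule atoms_GP(4)[OF n inj P[unfolded S] Q]) (rule y)
   have A5: "(\<Prod>i\<in>{1..n}. w i) * (\<Prod>j\<in>{1..n}. \<Prod>i\<in>{1..<j}. \<bar>lam i - lam j\<bar>)\<^sup>2 = (\<Prod>i<2 * n - 1. y i ^ ((i + 1) div 2))"
    by (rule atoms_GP(5)[OF n inj P[unfolded S] Q]) (rule y)
   have z: "zz j (PP lam n) (QQ lam w n) = y (2 * n - 1 - 1 - j)" if "j < 2 * n - 1" for j
    unfolding PP_def QQ_def P Q using zz_G[of "2 * n - 1" y j] y that by (simp add: G_def)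
   have pos: "\<forall>j<2 * n - 1. zz j (PP lam n) (QQ lam w n) > 0" using z y by simp
   have "ydens \<beta> g n (\<lambda>i. zz (2 * n - 1 - 1 - i) (PP lam n) (QQ lam w n)) = ydens \<beta> g n y"
   proof -
    have zi: "zz (2 * n - 1 - 1 - i) (PP lam n) (QQ lam w n) = y i" if "i < 2 * n - 1" for i
    proof -
     have "2 * n - 1 - 1 - (2 * n - 1 - 1 - i) = i" "2 * n - 1 - 1 - i < 2 * n - 1" using that by arith+
     then show ?thesis using z[of "2 * n - 1 - 1 - i"] by simp
    qed
    show ?thesis unfolding ydens_def
     by (intro arg_cong2[where f = "(*)"] arg_cong2[where f = "(powr)"] arg_cong[where f = exp]
       arg_cong2[where f = "(/)"] arg_cong[where f = uminus] prod.cong sum.cong)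
       (use zi in auto)
   qed
   then have pq: "pqdens \<beta> g n (PP lam n) (QQ lam w n) = ennreal (ydens \<beta> g n y)"
    unfolding pqdens_def using pos by simp
   have vpos: "van n lam > 0" by (rule van_pos[OF inj])
   have wp: "(\<Prod>i\<in>{1..n}. w i) > 0" using wpos by (intro prod_pos) auto
   have ind: "(\<Prod>i\<in>{1..n}. lam i powr (g - (real n - 1) * \<beta> / 2 - 1) * exp (- lam i / 2) * indicator {0<..} (lam i))
    = (\<Prod>i\<in>{1..n}. lam i) powr (g - (real n - 1) * \<beta> / 2 - 1) * exp (- (\<Sum>i\<in>{1..n}. lam i) / 2)"
   proof -
    have "(\<Prod>i\<in>{1..n}. lam i powr (g - (real n - 1) * \<beta> / 2 - 1) * exp (- lam i / 2) * indicator {0<..} (lam i))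
     = (\<Prod>i\<in>{1..n}. lam i powr (g - (real n - 1) * \<beta> / 2 - 1) * exp (- lam i / 2))"
     using lpos by (intro prod.cong) auto
    also have "... = (\<Prod>i\<in>{1..n}. lam i) powr (g - (real n - 1) * \<beta> / 2 - 1) * (\<Prod>i\<in>{1..n}. exp (- lam i / 2))"
     unfolding prod.distrib by (subst prod_powr_distrib) (use lpos in \<open>auto simp: less_imp_le\<close>)
    also have "(\<Prod>i\<in>{1..n}. exp (- lam i / 2)) = exp (- (\<Sum>i\<in>{1..n}. lam i) / 2)"
     by (simp add: exp_sum[symmetric] sum_divide_distrib[symmetric] sum_negf)
    finally show ?thesis .
   qed
   have "van n lam powr \<beta> * (\<Prod>i\<in>{1..n}. w i) powr (\<beta> / 2 - 1)
     = (van n lam)\<^sup>2 * ((\<Prod>i\<in>{1..n}. w i) * (van n lam)\<^sup>2) powr (\<beta> / 2 - 1)"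
   proof -
    define V where "V = van n lam"
    have V: "V > 0" using vpos by (simp add: V_def)
    have s: "V\<^sup>2 = V powr 2" using V by simp
    have "2 * (\<beta> / 2 - 1) = \<beta> - 2" by simp
    then have p: "(V\<^sup>2) powr (\<beta> / 2 - 1) = V powr (\<beta> - 2)"
     unfolding s powr_powr by (simp only:)
    have pm: "((\<Prod>i\<in>{1..n}. w i) * V\<^sup>2) powr (\<beta> / 2 - 1) = (\<Prod>i\<in>{1..n}. w i) powr (\<beta> / 2 - 1) * (V\<^sup>2) powr (\<beta> / 2 - 1)"
     using wp by (simp add: powr_mult)
    have "V\<^sup>2 * ((\<Prod>i\<in>{1..n}. w i) * V\<^sup>2) powr (\<beta> / 2 - 1)
      = (V powr 2 * V powr (\<beta> - 2)) * (\<Prod>i\<in>{1..n}. w i) powr (\<beta> / 2 - 1)"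
     unfolding pm p by (simp only: s mult_ac)
    also have "V powr 2 * V powr (\<beta> - 2) = V powr \<beta>"
     unfolding powr_add[symmetric] by simp
    finally show ?thesis unfolding V_def by simp
   qed
   also have "(\<Prod>i\<in>{1..n}. w i) * (van n lam)\<^sup>2 = (\<Prod>i<2 * n - 1. y i ^ ((i + 1) div 2))"
    using A5 by (simp only: van_def)
   finally have fe: "van n lam powr \<beta> * (\<Prod>i\<in>{1..n}. w i) powr (\<beta> / 2 - 1)
    = (van n lam)\<^sup>2 * (\<Prod>i<2 * n - 1. y i ^ ((i + 1) div 2)) powr (\<beta> / 2 - 1)" .
   have "laguerre_weight \<beta> g n lam * (\<Prod>i\<in>{1..n}. w i) powr (\<beta> / 2 - 1)
    = (van n lam powr \<beta> * (\<Prod>i\<in>{1..n}. w i) powr (\<beta> / 2 - 1)) *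
     ((\<Prod>i\<in>{1..n}. lam i) powr (g - (real n - 1) * \<beta> / 2 - 1) * exp (- (\<Sum>i\<in>{1..n}. lam i) / 2))"
    unfolding laguerre_weight_def vb ind by (simp only: mult_ac)
   also have "... = (van n lam)\<^sup>2 * ydens \<beta> g n y"
    unfolding fe A3 A4 ydens_def by (simp only: mult_ac)
   finally have "laguerre_weight \<beta> g n lam * (\<Prod>i\<in>{1..n}. w i) powr (\<beta> / 2 - 1) = (van n lam)\<^sup>2 * ydens \<beta> g n y" .
   then show ?thesis using True unfolding pq by (simp add: ennreal_mult')
  next
   case False
   have "laguerre_weight \<beta> g n lam * (if \<forall>i\<in>{1..n}. w i > 0 then (\<Prod>i\<in>{1..n}. w i) powr (\<beta> / 2 - 1) else 0) = 0"
   proof (cases "\<forall>i\<in>{1..n}. w i > 0")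
    case True
    then obtain i where i: "i \<in> {1..n}" "~ lam i > 0" using False by blast
    have "(\<Prod>i\<in>{1..n}. lam i powr (g - (real n - 1) * \<beta> / 2 - 1) * exp (- lam i / 2) * indicator {0<..} (lam i)) = 0"
     using i by (intro prod_zero bexI[of _ i]) auto
    then show ?thesis unfolding laguerre_weight_def by simp
   qed auto
   moreover have "~ (\<forall>j<2 * n - 1. zz j (PP lam n) (QQ lam w n) > 0)"
   proof
    assume z: "\<forall>j<2 * n - 1. zz j (PP lam n) (QQ lam w n) > 0"
    have "\<exists>y. (\<forall>i<2 * n - 1. y i = zz (2 * n - 1 - 1 - i) (PP lam n) (QQ lam w n) & y i > 0) & PP lam n = G y (2 * n) & QQ lam w n = G y (2 * n - 1)"
     by (rule poles_of_positive_fraction(1)[OF n])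
       (use z n w1 in \<open>simp_all add: PP_at_0 PP_high QQ_at_0 QQ_high\<close>)
    then obtain y where y: "!!i. i < 2 * n - 1 ==> y i > 0" "PP lam n = G y (2 * n)" "QQ lam w n = G y (2 * n - 1)" by blast
    have "PPp lam n = GP y (2 * n)" "QQp lam w n = GP y (2 * n - 1)"
     using y(2,3) unfolding PP_def QQ_def G_def by (simp_all add: poly_eq_iff)
    from atoms_GP(1,2)[OF n inj this y(1)] False show False by blast
   qed
   ultimately show ?thesis unfolding pqdens_def by (simp only: if_False) simp
  qed
 qed
qed


lemma LI_prod:
 assumes "finite J" and "!!i. i \<in> J ==> f i \<in> borel_measurable borel"
 shows "LI J (\<lambda>y. \<Prod>i\<in>J. f i (y i)) a = (\<Prod>i\<in>J. \<integral>\<^sup>+x. f i x \<partial>lborel)"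
proof -
 have "LI J (\<lambda>y. \<Prod>i\<in>J. f i (y i)) a = (\<integral>\<^sup>+x. (\<Prod>i\<in>J. f i (x i)) \<partial>(lebs J))"
  unfolding LI_def by (intro nn_integral_cong prod.cong) auto
 also have "... = (\<Prod>i\<in>J. \<integral>\<^sup>+x. f i x \<partial>lborel)"
  by (rule product_sigma_finite.product_nn_integral_prod[OF product_sigma_finite_lborel assms(1)]) (use assms(2) in auto)
 finally show ?thesis .
qed

text \<open>The density contains the Vandermonde product with exponent \<open>\<beta>\<close>; two factors are split off and absorbed by the Jacobians of \<open>weights_to_coeffs\<close> and \<open>poles_to_coeffs\<close>, and what remains is a function of the entries.\<close>
lemma atoms_to_fraction:
 assumes n: "n >= 1" and \<beta>: "\<beta> > 0" and F [measurable]: "F \<in> borel_measurable borel"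
 shows "LI {1..<Suc n} (\<lambda>lam. LI {1..<n} (\<lambda>v. ennreal (laguerre_weight \<beta> g n lam *
    dirichlet_weight \<beta> n v)
    * F (\<lambda>k. \<Sum>i\<in>{1..n}. (v(n := 1 - (\<Sum>i\<in>{1..<n}. v i))) i * lam i ^ k)) (\<lambda>_. 0)) (\<lambda>_. 0)
  = of_nat (fact n) * LI {..<2 * n - 1} (\<lambda>y. (\<Prod>i<2 * n - 1. ennreal (gdens (shape \<beta> g n i) (y i))) * F (mom (G y (2 * n)) (G y (2 * n - 1)))) (\<lambda>_. 0)"
proof -
 obtain n' where n': "n = Suc n'" using n by (cases n) auto
 have S: "Suc (2 * n - 1) = 2 * n" and d: "Suc (2 * n - 1) div 2 = n" "(2 * n - 1) div 2 = n - 1" using n by auto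
 define z0 :: rseq where "z0 = (\<lambda>_. 0)"
 have z01: "z0(0 := 1) = e0" by (auto simp: z0_def e0_def fun_eq_iff)
 define w where "w v = v(n := 1 - (\<Sum>i\<in>{1..n'}. v i))" for v :: rseq
 have sI: "{1..<n} = {1..n'}" by (auto simp: n')
 define Y where "Y p q i = zz (2 * n - 1 - 1 - i) p q" for p q i
 define D where "D p q = ennreal (ydens \<beta> g n (Y p q)) * F (mom p q)" for p q
 define H where "H p q = (if \<forall>j<2 * n - 1. zz j p q > 0 then D p q else 0)" for p q
 have Dm: "(\<lambda>x. D (f x) (h x)) \<in> borel_measurable M"
  if [measurable]: "f \<in> M \<rightarrow>\<^sub>M borel" "h \<in> M \<rightarrow>\<^sub>M borel" for f h and M :: "'z measure"
  unfolding D_def ydens_def Y_def by measurable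
 have Dm2: "(\<lambda>w. D (fst w) (snd w)) \<in> borel_measurable (borel \<Otimes>\<^sub>M borel)"
  unfolding D_def ydens_def Y_def by measurable
 have Hm2 [measurable]: "(\<lambda>w. H (fst w) (snd w)) \<in> borel_measurable (borel \<Otimes>\<^sub>M borel)"
  unfolding H_def using Dm2 by measurable
 have Hm1 [measurable]: "H p \<in> borel_measurable borel" for p
  unfolding H_def D_def ydens_def Y_def by measurable
 have pq: "pqdens \<beta> g n p q * F (mom p q) = H p q" for p q
 proof (cases "\<forall>j<2 * n - 1. zz j p q > 0")
  case True
  show ?thesis unfolding pqdens_def H_def D_def Y_def if_P[OF True] ..
 next
  case False
  show ?thesis unfolding pqdens_def H_def if_not_P[OF False] by simp
 qed
 have vnn: "van n lam >= 0" for lam unfolding van_def by (intro prod_nonneg) auto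
 have point: "ennreal (laguerre_weight \<beta> g n lam *
    dirichlet_weight \<beta> n v)
    * F (\<lambda>k. \<Sum>i\<in>{1..n}. (v(n := 1 - (\<Sum>i\<in>{1..<n}. v i))) i * lam i ^ k)
   = ennreal ((van n lam)\<^sup>2) * H (PP lam n) (QQ lam (w v) n)" for lam v
 proof -
  have wn: "w v n = 1 - (\<Sum>i\<in>{1..n'}. v i)" and wi: "w v i = v i" if "i \<in> {1..n'}" for i
   using that by (auto simp: w_def n')
  have wn: "w v n = 1 - (\<Sum>i\<in>{1..n'}. v i)" by (simp add: w_def)
  have we: "v(n := 1 - (\<Sum>i\<in>{1..<n}. v i)) = w v" by (simp only: w_def sI)
  have ins: "{1..n} = insert n {1..n'}" by (auto simp: n')
  have nn: "n \<notin> {1..n'}" by (simp add: n')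
  have s1: "(\<Sum>i\<in>{1..n}. w v i) = 1" unfolding ins using wn wi nn by simp
  have p1: "(\<Prod>i\<in>{1..n}. w v i) = (\<Prod>i\<in>{1..<n}. v i) * (1 - (\<Sum>i\<in>{1..<n}. v i))"
   unfolding ins sI using wn wi nn by (simp add: mult.commute)
  have c1: "(\<forall>i\<in>{1..n}. w v i > 0) \<longleftrightarrow> (\<forall>i\<in>{1..<n}. 0 < v i) & (\<Sum>i\<in>{1..<n}. v i) < 1"
   unfolding ins sI using wn wi by auto
  show ?thesis
   unfolding we moments_of_atoms density_identity[OF n \<beta> s1, unfolded c1 p1] pq[symmetric] mult.assoc ..
 qed
 define K where "K p = LI {1..<n} (H p) e0" for p
 have Km [measurable]: "K \<in> borel_measurable borel"
  unfolding K_def by (rule LI_measurable_param) (use Hm2 in auto)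
 have inner: "LI {1..<n} (\<lambda>v. ennreal ((van n lam)\<^sup>2) * H (PP lam n) (QQ lam (w v) n)) z0
   = K (PP lam n) * ennreal (van n lam)" for lam
 proof (cases "inj_on lam {1..n}")
  case False
  then obtain i j where ij: "i \<in> {1..n}" "j \<in> {1..n}" "lam i = lam j" "i < j"
   by (metis inj_onI nat_neq_iff)
  have "(\<Prod>i\<in>{1..<j}. \<bar>lam i - lam j\<bar>) = 0" using ij by (intro prod_zero bexI[of _ i]) auto
  then have "van n lam = 0" unfolding van_def by (rule prod_zero[OF finite_atLeastAtMost bexI[OF _ ij(2)]])
  then show ?thesis by (simp add: LI_def)
 next
  case True
  have wm: "w \<in> borel \<rightarrow>\<^sub>M borel" unfolding w_def by measurable
  have qm: "(\<lambda>v. H (PP lam n) (QQ lam (w v) n)) \<in> borel_measurable borel"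
   by (rule measurable_compose[OF QQ_measurable Hm1]) (use wm in simp_all)
  have "LI {1..<n} (\<lambda>v. ennreal ((van n lam)\<^sup>2) * H (PP lam n) (QQ lam (w v) n)) z0
   = ennreal (van n lam) * (ennreal (van n lam) * LI {1..<n} (\<lambda>v. H (PP lam n) (QQ lam (w v) n)) z0)"
   by (subst LI_cmult[OF qm]) (simp add: power2_eq_square ennreal_mult vnn mult.assoc)
  also have "ennreal (van n lam) * LI {1..<n} (\<lambda>v. H (PP lam n) (QQ lam (w v) n)) z0 = K (PP lam n)"
   using weights_to_coeffs[OF Hm1, of lam n' "PP lam n" 1] True
   unfolding K_def z01[symmetric] unfolding n' w_def z0_def by simp
  finally show ?thesis by (simp only: mult.commute)
 qed
 have "LI {1..<Suc n} (\<lambda>lam. LI {1..<n} (\<lambda>v. ennreal ((van n lam)\<^sup>2) * H (PP lam n) (QQ lam (w v) n)) z0) z0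
   = LI {1..<Suc n} (\<lambda>lam. K (PP lam n) * ennreal (van n lam)) (\<lambda>_. 0)"
  unfolding inner unfolding z0_def ..
 also have "... = of_nat (fact n) * LI {1..<Suc n} K e0"
 proof (rule poles_to_coeffs[OF Km])
  fix p :: rseq assume p: "p 0 = 1" "!!k. n < k ==> p k = 0" "K p ~= 0"
  have "\<exists>q. (\<forall>i. i \<notin> {1..<n} --> q i = e0 i) & H p q ~= 0"
  proof (rule ccontr)
   assume "~ ?thesis"
   then have "LI {1..<n} (H p) e0 = LI {1..<n} (\<lambda>_. 0) e0" by (intro LI_cong) blast
   then show False using p(3) by (simp add: K_def LI_def)
  qed
  then obtain q where q: "!!i. i \<notin> {1..<n} ==> q i = e0 i" "H p q ~= 0" by blast
  have "\<forall>j<2 * n - 1. zz j p q > 0" using q(2) unfolding H_def by (metis (full_types))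
  then show "\<exists>\<rho>. inj_on \<rho> {1..n} & p = PP \<rho> n"
   by (intro poles_of_positive_fraction(2)[where q = q, OF n]) (use q(1) p(1,2) in \<open>auto simp: e0_def\<close>)
 qed
 also have "LI {1..<Suc n} K e0 = LI {1..<n} (\<lambda>q. LI {1..<Suc n} (\<lambda>p. H p q) e0) e0"
  unfolding K_def by (rule LI_commute) (use Hm2 in auto)
 also have "... = LI {1..<Suc ((2 * n - 1) div 2)} (\<lambda>q. LI {1..<Suc (Suc (2 * n - 1) div 2)} (\<lambda>p. if \<forall>j<2 * n - 1. zz j p q > 0 then D p q else 0) e0) e0"
  unfolding d H_def by (simp add: n')
 also have "... = LI {..<2 * n - 1} (\<lambda>y. if \<forall>i<2 * n - 1. y i > 0 then ennreal (\<Prod>i<2 * n - 1. y i ^ (i div 2)) *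
    D (G y (Suc (2 * n - 1))) (G y (2 * n - 1)) else 0) z0"
  by (rule coeffs_to_fraction[OF Dm2])
 also have "... = LI {..<2 * n - 1} (\<lambda>y. (\<Prod>i<2 * n - 1. ennreal (gdens (shape \<beta> g n i) (y i))) * F (mom (G y (2 * n)) (G y (2 * n - 1)))) z0"
 proof (rule LI_cong)
  fix y :: rseq
  show "(if \<forall>i<2 * n - 1. y i > 0 then ennreal (\<Prod>i<2 * n - 1. y i ^ (i div 2)) *
    D (G y (Suc (2 * n - 1))) (G y (2 * n - 1)) else 0)
   = (\<Prod>i<2 * n - 1. ennreal (gdens (shape \<beta> g n i) (y i))) * F (mom (G y (2 * n)) (G y (2 * n - 1)))"
  proof (cases "\<forall>i<2 * n - 1. y i > 0")
   case True
   then have y: "!!i. i < 2 * n - 1 ==> y i > 0" by blast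
   have zi: "Y (G y (Suc (2 * n - 1))) (G y (2 * n - 1)) i = y i" if "i < 2 * n - 1" for i
   proof -
    have "2 * n - 1 - 1 - (2 * n - 1 - 1 - i) = i" "2 * n - 1 - 1 - i < 2 * n - 1" using that by arith+
    then show ?thesis using zz_G[of "2 * n - 1" y "2 * n - 1 - 1 - i"] y by (simp add: Y_def)
   qed
   have "ydens \<beta> g n (Y (G y (Suc (2 * n - 1))) (G y (2 * n - 1))) = ydens \<beta> g n y"
    unfolding ydens_def
    by (intro arg_cong2[where f = "(*)"] arg_cong2[where f = "(powr)"] arg_cong[where f = exp]
       arg_cong2[where f = "(/)"] arg_cong[where f = uminus] prod.cong sum.cong)
       (use zi in auto)
   moreover have "ennreal (\<Prod>i<2 * n - 1. y i ^ (i div 2)) * ennreal (ydens \<beta> g n y)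
     = (\<Prod>i<2 * n - 1. ennreal (gdens (shape \<beta> g n i) (y i)))"
   proof -
    have "(\<Prod>i<2 * n - 1. ennreal (gdens (shape \<beta> g n i) (y i))) = ennreal (\<Prod>i<2 * n - 1. gdens (shape \<beta> g n i) (y i))"
     by (rule prod_ennreal) (rule gdens_nonneg)
    also have "(\<Prod>i<2 * n - 1. gdens (shape \<beta> g n i) (y i)) = (\<Prod>i<2 * n - 1. y i ^ (i div 2)) * ydens \<beta> g n y"
     unfolding ydens_def by (rule prod_gdens[OF n y, symmetric])
    also have "ennreal ... = ennreal (\<Prod>i<2 * n - 1. y i ^ (i div 2)) * ennreal (ydens \<beta> g n y)"
     by (rule ennreal_mult') (auto intro!: prod_nonneg simp: y less_imp_le)
    finally show ?thesis by simp
   qed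
   ultimately show ?thesis using True unfolding D_def S by (simp add: mult.assoc[symmetric])
  next
   case False
   then obtain i where i: "i < 2 * n - 1" "~ y i > 0" by blast
   then have "(\<Prod>i<2 * n - 1. ennreal (gdens (shape \<beta> g n i) (y i))) = 0"
    by (intro prod_zero bexI[of _ i]) (auto simp: gdens_def)
   then show ?thesis using False by (simp only: if_False mult_zero_left)
  qed
 qed
 finally show ?thesis unfolding point z0_def .
qed

text \<open>The unnormalised law of all moments. The constant \<open>C\<close> is left implicit; it is recovered from total mass one where it is needed.\<close>
lemma moment_law:
 assumes n: "n >= 1" and \<beta>: "\<beta> > 0" and M: "prob_space M"
  and lag: "laguerre_ensemble \<beta> g n M L" and dir: "dirichlet_weights \<beta> n M W"
  and ind: "prob_space.indep_var M
      (\<Pi>\<^sub>M i\<in>{1..n}. borel) (\<lambda>\<omega>. \<lambda>i\<in>{1..n}. L i \<omega>)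
      (\<Pi>\<^sub>M i\<in>{1..n}. borel) (\<lambda>\<omega>. \<lambda>i\<in>{1..n}. W i \<omega>)"
 shows "\<exists>C. \<forall>F\<in>borel_measurable borel.
   (\<integral>\<^sup>+\<omega>. F (\<lambda>k. \<Sum>i\<in>{1..n}. W i \<omega> * L i \<omega> ^ k) \<partial>M)
   = C * LI {..<2 * n - 1} (\<lambda>y. (\<Prod>i<2 * n - 1. ennreal (gdens (shape \<beta> g n i) (y i))) * F (mom (G y (2 * n)) (G y (2 * n - 1)))) (\<lambda>_. 0)"
proof -
 interpret prob_space M by fact
 obtain c where c: "c > 0" and dL: "distributed M (lebs {1..n}) (\<lambda>\<omega>. \<lambda>i\<in>{1..n}. L i \<omega>) (\<lambda>l. ennreal (c * laguerre_weight \<beta> g n l))"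
  using lag by (auto simp: laguerre_ensemble_def)
 have dW: "distributed M (lebs {1..<n}) (\<lambda>\<omega>. \<lambda>i\<in>{1..<n}. W i \<omega>) (\<lambda>v. ennreal (dirichlet_density \<beta> n v))"
  and aeW: "AE \<omega> in M. W n \<omega> = 1 - (\<Sum>i\<in>{1..<n}. W i \<omega>)"
  using dir by (auto simp: dirichlet_weights_def)
 define cd where "cd = Gamma (real n * \<beta> / 2) / Gamma (\<beta> / 2) ^ n"
 have cd: "cd > 0" unfolding cd_def using \<beta> n by (intro divide_pos_pos zero_less_power Gamma_real_pos) auto
 define X1 where "X1 \<omega> = (\<lambda>i\<in>{1..n}. L i \<omega>)" for \<omega>
 define X2 where "X2 \<omega> = (\<lambda>i\<in>{1..<n}. W i \<omega>)" for \<omega>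
 have PB: "(\<Pi>\<^sub>M i\<in>J. borel :: real measure) \<rightarrow>\<^sub>M lebs J = lebs J \<rightarrow>\<^sub>M lebs J" for J
  by (rule measurable_cong_sets) (auto intro!: sets_PiM_cong)
 have ind2: "indep_var (lebs {1..n}) X1 (lebs {1..<n}) X2"
 proof -
  have "indep_var (lebs {1..n}) ((\<lambda>x. x) \<circ> (\<lambda>\<omega>. \<lambda>i\<in>{1..n}. L i \<omega>)) (lebs {1..<n}) ((\<lambda>x. restrict x {1..<n}) \<circ> (\<lambda>\<omega>. \<lambda>i\<in>{1..n}. W i \<omega>))"
  proof (rule indep_var_compose[OF ind])
   show "(\<lambda>x. x) \<in> (\<Pi>\<^sub>M i\<in>{1..n}. borel) \<rightarrow>\<^sub>M lebs {1..n}" unfolding PB by simp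
   have "(\<lambda>x. restrict x {1..<n}) \<in> (\<Pi>\<^sub>M i\<in>{1..n}. borel :: real measure) \<rightarrow>\<^sub>M (\<Pi>\<^sub>M i\<in>{1..<n}. borel :: real measure)"
    by (rule measurable_restrict_subset) auto
   also have "(\<Pi>\<^sub>M i\<in>{1..n}. borel :: real measure) \<rightarrow>\<^sub>M (\<Pi>\<^sub>M i\<in>{1..<n}. borel :: real measure) = (\<Pi>\<^sub>M i\<in>{1..n}. borel) \<rightarrow>\<^sub>M lebs {1..<n}"
    by (rule measurable_cong_sets) (auto intro!: sets_PiM_cong)
   finally show "(\<lambda>x. restrict x {1..<n}) \<in> (\<Pi>\<^sub>M i\<in>{1..n}. borel) \<rightarrow>\<^sub>M lebs {1..<n}" .
  qed
  moreover have "(\<lambda>x. restrict x {1..<n}) \<circ> (\<lambda>\<omega>. \<lambda>i\<in>{1..n}. W i \<omega>) = X2"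
   by (auto simp: X2_def fun_eq_iff restrict_def)
  moreover have "(\<lambda>x. x) \<circ> (\<lambda>\<omega>. \<lambda>i\<in>{1..n}. L i \<omega>) = X1" by (auto simp: X1_def fun_eq_iff)
  ultimately show ?thesis by simp
 qed
 have X1m [measurable]: "X1 \<in> M \<rightarrow>\<^sub>M lebs {1..n}" and X2m [measurable]: "X2 \<in> M \<rightarrow>\<^sub>M lebs {1..<n}"
  using indep_var_rv1[OF ind2] indep_var_rv2[OF ind2] by auto
 have D1: "distr M (lebs {1..n}) X1 = density (lebs {1..n}) (\<lambda>l. ennreal (c * laguerre_weight \<beta> g n l))"
  unfolding X1_def by (rule distributed_distr_eq_density[OF dL])
 have D2: "distr M (lebs {1..<n}) X2 = density (lebs {1..<n}) (\<lambda>v. ennreal (dirichlet_density \<beta> n v))"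
  unfolding X2_def by (rule distributed_distr_eq_density[OF dW])
 have m1 [measurable]: "(\<lambda>l. ennreal (c * laguerre_weight \<beta> g n l)) \<in> borel_measurable (lebs {1..n})"
  by (rule distributed_borel_measurable[OF dL])
 have m2 [measurable]: "(\<lambda>v. ennreal (dirichlet_density \<beta> n v)) \<in> borel_measurable (lebs {1..<n})"
  by (rule distributed_borel_measurable[OF dW])
 interpret P2: prob_space "distr M (lebs {1..<n}) X2" by (rule prob_space_distr) measurable
 define em where "em J x = (\<lambda>i. if i \<in> J then x i else (0::real))" for J and x :: rseq
 have emm [measurable]: "em J \<in> lebs J \<rightarrow>\<^sub>M borel" for J
  unfolding em_def by (rule merge_measurable) simp_all
 show ?thesis
 proof (intro exI[of _ "ennreal (c * cd) * of_nat (fact n)"] ballI)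
  fix F :: "rseq => ennreal" assume F [measurable]: "F \<in> borel_measurable borel"
  define \<Phi> where "\<Phi> l v = F (\<lambda>k. \<Sum>i\<in>{1..n}. (v(n := 1 - (\<Sum>i\<in>{1..<n}. v i))) i * l i ^ k)" for l v
  define pf where "pf w = (\<lambda>k. \<Sum>i\<in>{1..n}. ((snd w)(n := 1 - (\<Sum>i\<in>{1..<n}. snd w i))) i * fst w i ^ k)" for w :: "rseq \<times> rseq"
  have pfm: "pf \<in> borel \<Otimes>\<^sub>M borel \<rightarrow>\<^sub>M borel"
   unfolding pf_def
  proof (rule measurable_seqI)
   fix k
   have [measurable]: "(\<lambda>w. ((snd w)(n := 1 - (\<Sum>i\<in>{1..<n}. snd w i :: real))) j) \<in> borel_measurable (borel \<Otimes>\<^sub>M borel)" for j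
    by (rule seq_coord_measurable) measurable
   show "(\<lambda>w. \<Sum>i\<in>{1..n}. ((snd w)(n := 1 - (\<Sum>i\<in>{1..<n}. snd w i))) i * fst w i ^ k) \<in> borel_measurable (borel \<Otimes>\<^sub>M (borel :: rseq measure))"
    by measurable
  qed
  have \<Phi>m: "(\<lambda>w. \<Phi> (fst w) (snd w)) \<in> borel_measurable (borel \<Otimes>\<^sub>M borel)"
   using measurable_compose[OF pfm F] unfolding pf_def \<Phi>_def by simp
  have \<Phi>em: "\<Phi> (em {1..n} l) (em {1..<n} v) = \<Phi> l v" for l v
  proof -
   have "(\<Sum>i\<in>{1..<n}. em {1..<n} v i) = (\<Sum>i\<in>{1..<n}. v i)" by (intro sum.cong) (auto simp: em_def)
   then show ?thesis unfolding \<Phi>_def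
    by (intro arg_cong[of _ _ F] ext sum.cong) (auto simp: em_def)
  qed
  have mp: "(\<lambda>w. \<Phi> (fst w) (snd w)) \<in> borel_measurable (lebs {1..n} \<Otimes>\<^sub>M lebs {1..<n})"
  proof -
   have "(\<lambda>w. \<Phi> (em {1..n} (fst w)) (em {1..<n} (snd w))) \<in> borel_measurable (lebs {1..n} \<Otimes>\<^sub>M lebs {1..<n})"
   proof -
    have "(\<lambda>w. (em {1..n} (fst w), em {1..<n} (snd w))) \<in> lebs {1..n} \<Otimes>\<^sub>M lebs {1..<n} \<rightarrow>\<^sub>M borel \<Otimes>\<^sub>M borel"
     by measurable
    from measurable_compose[OF this \<Phi>m] show ?thesis by simp
   qed
   then show ?thesis unfolding \<Phi>em .
  qed
  have "(\<integral>\<^sup>+\<omega>. F (\<lambda>k. \<Sum>i\<in>{1..n}. W i \<omega> * L i \<omega> ^ k) \<partial>M) = (\<integral>\<^sup>+\<omega>. \<Phi> (X1 \<omega>) (X2 \<omega>) \<partial>M)"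
  proof (rule nn_integral_cong_AE)
   show "AE \<omega> in M. F (\<lambda>k. \<Sum>i\<in>{1..n}. W i \<omega> * L i \<omega> ^ k) = \<Phi> (X1 \<omega>) (X2 \<omega>)"
    using aeW
   proof eventually_elim
    case (elim \<omega>)
    have "(\<Sum>i\<in>{1..<n}. X2 \<omega> i) = (\<Sum>i\<in>{1..<n}. W i \<omega>)" by (intro sum.cong) (auto simp: X2_def)
    then have "((X2 \<omega>)(n := 1 - (\<Sum>i\<in>{1..<n}. X2 \<omega> i))) i * X1 \<omega> i ^ k = W i \<omega> * L i \<omega> ^ k" if "i \<in> {1..n}" for i k
     using that elim by (auto simp: X2_def X1_def)
    then show ?case unfolding \<Phi>_def by (intro arg_cong[of _ _ F] ext sum.cong) auto
   qed
  qed
  also have "... = (\<integral>\<^sup>+w. \<Phi> (fst w) (snd w) \<partial>distr M (lebs {1..n} \<Otimes>\<^sub>M lebs {1..<n}) (\<lambda>\<omega>. (X1 \<omega>, X2 \<omega>)))"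
  proof (subst nn_integral_distr)
   show "(\<lambda>\<omega>. (X1 \<omega>, X2 \<omega>)) \<in> M \<rightarrow>\<^sub>M lebs {1..n} \<Otimes>\<^sub>M lebs {1..<n}"
    by (rule measurable_Pair[OF X1m X2m])
   then show "(\<lambda>w. \<Phi> (fst w) (snd w)) \<in> borel_measurable (distr M (lebs {1..n} \<Otimes>\<^sub>M lebs {1..<n}) (\<lambda>\<omega>. (X1 \<omega>, X2 \<omega>)))"
    using mp by simp
  qed simp
  also have "distr M (lebs {1..n} \<Otimes>\<^sub>M lebs {1..<n}) (\<lambda>\<omega>. (X1 \<omega>, X2 \<omega>))
   = distr M (lebs {1..n}) X1 \<Otimes>\<^sub>M distr M (lebs {1..<n}) X2"
   using ind2 unfolding indep_var_distribution_eq by simp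
  also have "(\<integral>\<^sup>+w. \<Phi> (fst w) (snd w) \<partial>(distr M (lebs {1..n}) X1 \<Otimes>\<^sub>M distr M (lebs {1..<n}) X2))
   = (\<integral>\<^sup>+l. \<integral>\<^sup>+v. \<Phi> l v \<partial>distr M (lebs {1..<n}) X2 \<partial>distr M (lebs {1..n}) X1)"
   by (subst P2.nn_integral_fst[symmetric]) (use mp in auto)
  also have "... = (\<integral>\<^sup>+l. (\<integral>\<^sup>+v. ennreal (dirichlet_density \<beta> n v) * \<Phi> l v \<partial>lebs {1..<n}) \<partial>distr M (lebs {1..n}) X1)"
  proof (rule nn_integral_cong)
   fix l assume "l \<in> space (distr M (lebs {1..n}) X1)"
   then have "\<Phi> l \<in> borel_measurable (lebs {1..<n})"
    using measurable_compose[OF measurable_Pair1' mp] by simp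
   then show "(\<integral>\<^sup>+v. \<Phi> l v \<partial>distr M (lebs {1..<n}) X2) = (\<integral>\<^sup>+v. ennreal (dirichlet_density \<beta> n v) * \<Phi> l v \<partial>lebs {1..<n})"
    unfolding D2 by (rule nn_integral_density[OF m2])
  qed
  also have "... = (\<integral>\<^sup>+l. ennreal (c * laguerre_weight \<beta> g n l) * (\<integral>\<^sup>+v. ennreal (dirichlet_density \<beta> n v) * \<Phi> l v \<partial>lebs {1..<n}) \<partial>lebs {1..n})"
  proof -
   interpret sigma_finite_measure "lebs {1..<n}" by (rule sigma_finite_PiM_lborel) simp
   have "(\<lambda>w. ennreal (dirichlet_density \<beta> n (snd w)) * \<Phi> (fst w) (snd w)) \<in> borel_measurable (lebs {1..n} \<Otimes>\<^sub>M lebs {1..<n})"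
    using measurable_compose[OF measurable_snd m2] mp by measurable
   then have "(\<lambda>l. \<integral>\<^sup>+v. ennreal (dirichlet_density \<beta> n v) * \<Phi> l v \<partial>lebs {1..<n}) \<in> borel_measurable (lebs {1..n})"
    by (intro borel_measurable_nn_integral) (simp add: case_prod_unfold)
   then show ?thesis unfolding D1 by (rule nn_integral_density[OF m1])
  qed
  also have "... = (\<integral>\<^sup>+l. (\<integral>\<^sup>+v. ennreal (c * cd) * (ennreal (laguerre_weight \<beta> g n l *
    dirichlet_weight \<beta> n v) * \<Phi> l v) \<partial>lebs {1..<n}) \<partial>lebs {1..n})"
  proof (rule nn_integral_cong)
   fix l assume "l \<in> space (lebs {1..n})"
   then have "\<Phi> l \<in> borel_measurable (lebs {1..<n})"
    using measurable_compose[OF measurable_Pair1' mp] by simp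
   then have "ennreal (c * laguerre_weight \<beta> g n l) * (\<integral>\<^sup>+v. ennreal (dirichlet_density \<beta> n v) * \<Phi> l v \<partial>lebs {1..<n})
    = (\<integral>\<^sup>+v. ennreal (c * laguerre_weight \<beta> g n l) * (ennreal (dirichlet_density \<beta> n v) * \<Phi> l v) \<partial>lebs {1..<n})"
    by (intro nn_integral_cmult[symmetric] borel_measurable_times_ennreal m2)
   also have "... = (\<integral>\<^sup>+v. ennreal (c * cd) * (ennreal (laguerre_weight \<beta> g n l *
    dirichlet_weight \<beta> n v) * \<Phi> l v) \<partial>lebs {1..<n})"
   proof (rule nn_integral_cong)
    fix v
    have lw: "laguerre_weight \<beta> g n l >= 0" unfolding laguerre_weight_def by (intro mult_nonneg_nonneg prod_nonneg) auto
    define dd where "dd = dirichlet_weight \<beta> n v"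
    have dd: "dd >= 0" by (simp add: dd_def)
    have e: "dirichlet_density \<beta> n v = cd * dd" by (simp add: dirichlet_density_def cd_def dd_def)
    show "ennreal (c * laguerre_weight \<beta> g n l) * (ennreal (dirichlet_density \<beta> n v) * \<Phi> l v)
     = ennreal (c * cd) * (ennreal (laguerre_weight \<beta> g n l * dirichlet_weight \<beta> n v) * \<Phi> l v)"
     unfolding dd_def[symmetric] e using lw dd c cd by (simp add: ennreal_mult mult_ac)
   qed
   finally show "ennreal (c * laguerre_weight \<beta> g n l) * (\<integral>\<^sup>+v. ennreal (dirichlet_density \<beta> n v) * \<Phi> l v \<partial>lebs {1..<n})
    = (\<integral>\<^sup>+v. ennreal (c * cd) * (ennreal (laguerre_weight \<beta> g n l *
    dirichlet_weight \<beta> n v) * \<Phi> l v) \<partial>lebs {1..<n})" .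
  qed
  also have "... = LI {1..<Suc n} (\<lambda>l. LI {1..<n} (\<lambda>v. ennreal (c * cd) * (ennreal (laguerre_weight \<beta> g n l *
    dirichlet_weight \<beta> n v) * \<Phi> l v)) (\<lambda>_. 0)) (\<lambda>_. 0)"
  proof -
   have i: "{1..<Suc n} = {1..n}" by auto
   have lw: "laguerre_weight \<beta> g n (em {1..n} l) = laguerre_weight \<beta> g n l" for l
    unfolding laguerre_weight_def by (intro arg_cong2[where f = "(*)"] prod.cong) (auto simp: em_def)
   have dd: "(if (\<forall>i\<in>{1..<n}. 0 < em {1..<n} v i) & (\<Sum>i\<in>{1..<n}. em {1..<n} v i) < 1 then ((\<Prod>i\<in>{1..<n}. em {1..<n} v i) * (1 - (\<Sum>i\<in>{1..<n}. em {1..<n} v i))) powr (\<beta> / 2 - 1) else 0)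
    = dirichlet_weight \<beta> n v" for v
   proof -
    have "(\<Sum>i\<in>{1..<n}. em {1..<n} v i) = (\<Sum>i\<in>{1..<n}. v i)" "(\<Prod>i\<in>{1..<n}. em {1..<n} v i) = (\<Prod>i\<in>{1..<n}. v i)"
     "(\<forall>i\<in>{1..<n}. 0 < em {1..<n} v i) \<longleftrightarrow> (\<forall>i\<in>{1..<n}. 0 < v i)"
     by (auto simp: em_def intro!: sum.cong prod.cong)
    then show ?thesis by simp
   qed
   have LIe: "LI J f (\<lambda>_. 0) = (\<integral>\<^sup>+x. f (em J x) \<partial>lebs J)" for J f
    by (simp add: LI_def em_def)
   show ?thesis unfolding LIe i dd lw \<Phi>em ..
  qed
  also have "... = LI {1..<Suc n} (\<lambda>l. ennreal (c * cd) * LI {1..<n} (\<lambda>v. ennreal (laguerre_weight \<beta> g n l *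
    dirichlet_weight \<beta> n v) * \<Phi> l v) (\<lambda>_. 0)) (\<lambda>_. 0)"
  proof (rule LI_cong, rule LI_cmult)
   fix l
   have [measurable]: "\<Phi> l \<in> borel_measurable borel"
   proof -
    have "(\<lambda>v. (l, v)) \<in> borel \<rightarrow>\<^sub>M borel \<Otimes>\<^sub>M borel"
     by (rule measurable_Pair[OF measurable_const measurable_ident_sets[OF refl]]) simp
    from measurable_compose[OF this \<Phi>m] show ?thesis by simp
   qed
   show "(\<lambda>v. ennreal (laguerre_weight \<beta> g n l *
    dirichlet_weight \<beta> n v) * \<Phi> l v) \<in> borel_measurable borel"
    by measurable
  qed
  also have "... = ennreal (c * cd) * LI {1..<Suc n} (\<lambda>l. LI {1..<n} (\<lambda>v. ennreal (laguerre_weight \<beta> g n l *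
    dirichlet_weight \<beta> n v) * \<Phi> l v) (\<lambda>_. 0)) (\<lambda>_. 0)"
  proof (rule LI_cmult, rule LI_measurable_param)
   show "(\<lambda>w. ennreal (laguerre_weight \<beta> g n (fst w) *
    (if (\<forall>i\<in>{1..<n}. 0 < snd w i) & (\<Sum>i\<in>{1..<n}. snd w i) < 1 then ((\<Prod>i\<in>{1..<n}. snd w i) * (1 - (\<Sum>i\<in>{1..<n}. snd w i))) powr (\<beta> / 2 - 1) else 0)) * \<Phi> (fst w) (snd w))
     \<in> borel_measurable (borel \<Otimes>\<^sub>M borel)"
    using \<Phi>m unfolding laguerre_weight_def by measurable
  qed simp_all
  finally show "(\<integral>\<^sup>+\<omega>. F (\<lambda>k. \<Sum>i\<in>{1..n}. W i \<omega> * L i \<omega> ^ k) \<partial>M)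
   = ennreal (c * cd) * of_nat (fact n) * LI {..<2 * n - 1} (\<lambda>y. (\<Prod>i<2 * n - 1. ennreal (gdens (shape \<beta> g n i) (y i))) * F (mom (G y (2 * n)) (G y (2 * n - 1)))) (\<lambda>_. 0)"
   unfolding \<Phi>_def atoms_to_fraction[OF n \<beta> F] by (simp only: mult.assoc)
 qed
qed

section \<open>Perturbations of the free Jacobi matrix\<close>

text \<open>The action of a Jacobi matrix in the normalisation with ones below the diagonal, \<open>a\<close> on it and \<open>b\<close> above it. This avoids square roots and leaves the corner entries of powers unchanged.\<close>
definition jact :: "rseq => rseq => rseq => nat => real" where
 "jact a b v i = (if i = 0 then 0 else v (i - 1)) + a i * v i + b i * v (Suc i)"

text \<open>The first column of the Chebyshev polynomial of degree \<open>j\<close> applied to the Jacobi matrix.\<close>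
fun jcheb :: "rseq => rseq => nat => nat => real" where
 "jcheb a b 0 = (\<lambda>i. if i = 0 then 1 else 0)"
| "jcheb a b (Suc 0) = jact a b (\<lambda>i. if i = 0 then 1 else 0)"
| "jcheb a b (Suc (Suc j)) = (\<lambda>i. jact a b (jcheb a b (Suc j)) i - jcheb a b j i)"

text \<open>The linearised recursion is a discrete wave equation in \<open>(j, i)\<close> whose source terms are the entries of the perturbation. As in d'Alembert's formula, the solution sums the sources over a characteristic line, here with reflection at the boundary.\<close>
definition dal :: "rseq => rseq => nat => nat => real" where
 "dal A B j i = (if i < j then
   (\<Sum>s\<le>i. let m = j - i + 2 * s in if odd m then A (m div 2) else B (m div 2 - 1)) else 0)"

lemma dal_rec:
 "dal A B (Suc (Suc j)) i = (if i = 0 then 0 else dal A B (Suc j) (i - 1)) + dal A B (Suc j) (Suc i)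
   - dal A B j i + (if i = Suc j then A (Suc j) else if i = j then B j else 0)"
proof -
 define X where "X m = (if odd m then A (m div 2) else B (m div 2 - 1))" for m :: nat
 have d: "dal A B j i = (if i < j then (\<Sum>s\<le>i. X (j - i + 2 * s)) else 0)" for j i
  by (simp add: dal_def X_def Let_def)
 consider "i < j" | "i = j" | "i = Suc j" | "i > Suc j" by linarith
 then show ?thesis
 proof cases
  case 1
  show ?thesis
  proof (cases "i = 0")
   case True
   have "dal A B (Suc j) (Suc i) = X j + (if j >= 2 \<or> j = 1 then X (j + 2) else 0)" if "i < j"
    using that True 1 by (cases "Suc 0 < Suc j") (auto simp: d)
   then show ?thesis using 1 True by (auto simp: d)
  next
   case False
   then obtain i' where i': "i = Suc i'" by (cases i) auto
   have "Suc i < Suc j" using 1 by simp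
   have 2: "Suc j - i' = Suc (Suc j) - i" "Suc j - Suc i = j - i" "i' < Suc j" using 1 i' by auto
   have e: "Suc (Suc j) - i + 2 * s = j - i + 2 * Suc s" for s using 1 by simp
   have s1: "(\<Sum>s\<le>Suc i. X (j - i + 2 * s)) = (\<Sum>s\<le>i. X (j - i + 2 * s)) + X (j - i + 2 * Suc i)"
    by simp
   have s2: "(\<Sum>s\<le>i. X (Suc (Suc j) - i + 2 * s))
     = (\<Sum>s\<le>i'. X (Suc (Suc j) - i + 2 * s)) + X (Suc (Suc j) - i + 2 * i)"
    using sum.atMost_Suc[of "\<lambda>s. X (Suc (Suc j) - i + 2 * s)" i'] by (simp only: i'[symmetric])
   have s3: "X (Suc (Suc j) - i + 2 * i) = X (j - i + 2 * Suc i)"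
    using e[of i] by (rule arg_cong)
   have s4: "dal A B (Suc (Suc j)) i = (\<Sum>s\<le>i. X (Suc (Suc j) - i + 2 * s))"
    "dal A B (Suc j) (i - 1) = (\<Sum>s\<le>i'. X (Suc (Suc j) - i + 2 * s))"
    "dal A B (Suc j) (Suc i) = (\<Sum>s\<le>Suc i. X (j - i + 2 * s))"
    "dal A B j i = (\<Sum>s\<le>i. X (j - i + 2 * s))"
    using 1 2 i' by (simp_all only: d) auto
   show ?thesis using 1 False unfolding s4 s1 s2 s3 by simp
  qed
 next
  case 2
  show ?thesis
  proof (cases "i = 0")
   case True
   then show ?thesis using 2 by (simp add: d X_def)
  next
   case False
   then obtain i' where i': "i = Suc i'" by (cases i) auto
   have s2: "(\<Sum>s\<le>i. X (2 + 2 * s)) = (\<Sum>s\<le>i'. X (2 + 2 * s)) + X (2 + 2 * i)"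
    unfolding i' by simp
   have "X (2 + 2 * i) = B i" by (simp add: X_def)
   moreover have "j - Suc 0 = i'" using 2 i' by simp
   ultimately show ?thesis using 2 s2 by (auto simp: d)
  qed
 next
  case 3
  have s2: "(\<Sum>s\<le>Suc j. X (Suc (2 * s))) = (\<Sum>s\<le>j. X (Suc (2 * s))) + X (Suc (2 * Suc j))"
   by simp
  have "X (Suc (2 * Suc j)) = A (Suc j)" by (simp add: X_def)
  then show ?thesis using 3 s2 by (simp add: d)
 next
  case 4
  then show ?thesis by (auto simp: d)
 qed
qed

lemma dal_0 [simp]: "dal A B 0 i = 0" "dal A B (Suc 0) i = (if i = 0 then A 0 else 0)"
 by (auto simp: dal_def)

text \<open>At the boundary the characteristic meets a single source: each Chebyshev polynomial sees exactly one entry of the perturbation.\<close>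
lemma dal_first: "dal A B (Suc j) 0 = (if even j then A (j div 2) else B (j div 2))"
 by (auto simp: dal_def elim!: oddE)

lemma jcheb_support: "i > j ==> jcheb a b j i = 0"
proof (induction j arbitrary: i rule: less_induct)
 case (less j)
 consider "j = 0" | "j = 1" | k where "j = Suc (Suc k)"
  by (metis One_nat_def not0_implies_Suc)
 then show ?case
 proof cases
  case 3 then show ?thesis using less by (simp add: jact_def)
 qed (use less.prems in \<open>auto simp: jact_def\<close>)
qed

text \<open>For the free matrix (\<open>\<epsilon> = 0\<close>) the columns are unit vectors, and the difference quotient satisfies the recursion of \<open>dal\<close> up to terms of order \<open>\<epsilon>\<close>.\<close>
lemma jcheb_linear:
 fixes A B :: "nat => nat => real" and \<epsilon> :: rseq
 assumes e: "\<epsilon> \<longlonglongrightarrow> 0" and nz: "!!n. \<epsilon> n ~= 0"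
  and A: "!!l. Bseq (\<lambda>n. A n l)" and B: "!!l. Bseq (\<lambda>n. B n l)"
 shows "(\<lambda>n. (jcheb (\<lambda>l. \<epsilon> n * A n l) (\<lambda>l. 1 + \<epsilon> n * B n l) j i - (if i = j then 1 else 0)) / \<epsilon> n
      - dal (A n) (B n) j i) \<longlonglongrightarrow> 0"
proof -
 define v where "v n = jcheb (\<lambda>l. \<epsilon> n * A n l) (\<lambda>l. 1 + \<epsilon> n * B n l)" for n
 define D where "D n j i = (v n j i - (if i = j then 1 else 0)) / \<epsilon> n" for n j i
 have v: "v n j i = (if i = j then 1 else 0) + \<epsilon> n * D n j i" for n j i
  by (simp add: D_def nz)
 have small: "(\<lambda>n. \<epsilon> n * f n) \<longlonglongrightarrow> 0" if "Bseq f" for f :: rseq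
  using bounded_bilinear.Zfun_prod_Bfun[OF bounded_bilinear_mult, of \<epsilon> sequentially f] e that
  by (simp add: tendsto_Zfun_iff)
 have Bplus: "Bseq (\<lambda>n. f n + g n)" if f: "Bseq f" and g: "Bseq g" for f g :: rseq
 proof -
  obtain K L where "!!n. norm (f n) <= K" "!!n. norm (g n) <= L"
   using f g by (auto simp: Bseq_def)
  then have "norm (f n + g n) <= K + L" for n
   by (meson norm_triangle_le add_mono)
  then show ?thesis by (rule BseqI')
 qed
 have dalB: "Bseq (\<lambda>n. dal (A n) (B n) j i)" for j i
 proof -
  have "Bseq (\<lambda>n. \<Sum>s\<le>k. let m = j - i + 2 * s in if odd m then A n (m div 2) else B n (m div 2 - 1))" for k
  proof (induction k)
   case 0 then show ?case using A B by (cases "odd (j - i)") (auto simp: Let_def)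
  next
   case (Suc k)
   have "Bseq (\<lambda>n. let m = j - i + 2 * Suc k in if odd m then A n (m div 2) else B n (m div 2 - 1))"
    using A B by (cases "odd (j - i + 2 * Suc k)") (auto simp: Let_def)
   then show ?case unfolding sum.atMost_Suc by (rule Bplus[OF Suc])
  qed
  then show ?thesis by (cases "i < j") (simp_all add: dal_def)
 qed
 have DB: "Bseq (\<lambda>n. D n j i)" if "(\<lambda>n. D n j i - dal (A n) (B n) j i) \<longlonglongrightarrow> 0" for j i
  using Bplus[OF convergent_imp_Bseq[OF convergentI[OF that]] dalB[of j i]] by simp
 have "(\<lambda>n. D n j i - dal (A n) (B n) j i) \<longlonglongrightarrow> 0"
 proof (induction j arbitrary: i rule: less_induct)
  case (less j)
  consider "j = 0" | "j = 1" | k where "j = Suc (Suc k)"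
   by (metis One_nat_def not0_implies_Suc)
  then show ?case
  proof cases
   case 1
   then show ?thesis by (simp add: D_def v_def)
  next
   case 2
   have "D n 1 i - dal (A n) (B n) 1 i = 0" for n
    using nz[of n] by (auto simp: D_def v_def jact_def)
   then show ?thesis using 2 by simp
  next
   case (3 k)
   define K where "K n w i = A n i * w i + B n i * w (Suc i)" for n w and i :: nat
   have v2: "v n (Suc (Suc k)) i = (if i = 0 then 0 else v n (Suc k) (i - 1)) + v n (Suc k) (Suc i) - v n k i
     + \<epsilon> n * K n (v n (Suc k)) i" for n i
    by (simp add: v_def jact_def K_def algebra_simps)
   have rec: "D n (Suc (Suc k)) i = (if i = 0 then 0 else D n (Suc k) (i - 1)) + D n (Suc k) (Suc i) - D n k i
     + (if i = Suc k then A n (Suc k) else if i = k then B n k else 0)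
     + \<epsilon> n * K n (D n (Suc k)) i" for n i
   proof -
    have "\<epsilon> n * D n (Suc (Suc k)) i = \<epsilon> n * ((if i = 0 then 0 else D n (Suc k) (i - 1)) + D n (Suc k) (Suc i) - D n k i
     + (if i = Suc k then A n (Suc k) else if i = k then B n k else 0)
     + \<epsilon> n * K n (D n (Suc k)) i)"
     using v2[of n i] unfolding K_def v by (auto simp: algebra_simps split: if_splits)
    then show ?thesis using nz[of n] by simp
   qed
   have IH: "(\<lambda>n. D n (Suc k) i - dal (A n) (B n) (Suc k) i) \<longlonglongrightarrow> 0"
        "(\<lambda>n. D n k i - dal (A n) (B n) k i) \<longlonglongrightarrow> 0" for i
    using less.IH 3 by auto
   have "D n (Suc (Suc k)) i - dal (A n) (B n) (Suc (Suc k)) i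
     = (if i = 0 then 0 else D n (Suc k) (i - 1) - dal (A n) (B n) (Suc k) (i - 1))
      + (D n (Suc k) (Suc i) - dal (A n) (B n) (Suc k) (Suc i)) - (D n k i - dal (A n) (B n) k i)
      + \<epsilon> n * K n (D n (Suc k)) i" for n
    unfolding rec dal_rec by auto
   moreover have "(\<lambda>n. if i = 0 then 0 else D n (Suc k) (i - 1) - dal (A n) (B n) (Suc k) (i - 1)) \<longlonglongrightarrow> 0"
    using IH(1) by (cases "i = 0") auto
   moreover have "(\<lambda>n. \<epsilon> n * K n (D n (Suc k)) i) \<longlonglongrightarrow> 0"
    unfolding K_def by (intro small Bplus Bseq_mult A B DB IH)
   ultimately have "(\<lambda>n. D n (Suc (Suc k)) i - dal (A n) (B n) (Suc (Suc k)) i) \<longlonglongrightarrow> 0 + 0 - 0 + 0"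
    using IH by (simp only:) (intro tendsto_add tendsto_diff)
   then show ?thesis using 3 by simp
  qed
 qed
 then show ?thesis by (simp add: D_def v_def)
qed

section \<open>Signed measures\<close>

text \<open>The set function in the definition of the Jordan decomposition. Its superadditivity is clear from unions of subsets; countable additivity makes it a measure, so that \<open>jordan_pos\<close> takes these values.\<close>
definition pos_var :: "(real set => real) => real set => ennreal" where
 "pos_var \<nu> A = (SUP B\<in>{B \<in> sets borel. B \<subseteq> A}. ennreal (\<nu> B))"

lemma signed_measure_finite_additive:
 assumes s: "signed_measure \<nu>" and A: "!!i. A i \<in> sets borel" and d: "disjoint_family (A :: nat => real set)"
 shows "\<nu> (\<Union>i<n. A i) = (\<Sum>i<n. \<nu> (A i))"
proof -
 have e: "\<nu> {} = 0" using s by (simp add: signed_measure_def)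
 define B where "B i = (if i < n then A i else {})" for i
 have "range B \<subseteq> sets borel" "disjoint_family B"
  using A d by (auto simp: B_def disjoint_family_on_def)
 then have "(\<lambda>i. \<nu> (B i)) sums \<nu> (\<Union>i. B i)" using s by (simp add: signed_measure_def)
 moreover have "(\<Union>i. B i) = (\<Union>i<n. A i)" by (auto simp: B_def split: if_splits)
 moreover have "(\<lambda>i. \<nu> (B i)) sums (\<Sum>i<n. \<nu> (B i))"
  by (rule sums_finite) (auto simp: B_def e)
 ultimately have "\<nu> (\<Union>i<n. A i) = (\<Sum>i<n. \<nu> (B i))" using sums_unique2 by metis
 then show ?thesis by (simp add: B_def)
qed

lemma signed_measure_add:
 assumes s: "signed_measure \<nu>" and A: "A \<in> sets borel" "B \<in> sets borel" "A \<inter> B = {}"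
 shows "\<nu> (A \<union> B) = \<nu> A + \<nu> B"
proof -
 define F where "F i = (if i = 0 then A else if i = 1 then B else {})" for i :: nat
 have "disjoint_family F" using A(3) by (auto simp: F_def disjoint_family_on_def)
 moreover have "F i \<in> sets borel" for i using A by (auto simp: F_def)
 ultimately have "\<nu> (\<Union>i<2. F i) = (\<Sum>i<2. \<nu> (F i))" by (intro signed_measure_finite_additive[OF s])
 moreover have "(\<Union>i<2. F i) = A \<union> B" by (auto simp: F_def less_2_cases_iff)
 moreover have "(\<Sum>i<2. \<nu> (F i)) = \<nu> A + \<nu> B" by (simp add: F_def numeral_2_eq_2)
 ultimately show ?thesis by simp
qed

lemma signed_measure_uminus: "signed_measure \<nu> ==> signed_measure (\<lambda>A. - \<nu> A)"
 by (auto simp: signed_measure_def intro: sums_minus)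

lemma pos_var_upper: "B \<in> sets borel ==> B \<subseteq> A ==> ennreal (\<nu> B) <= pos_var \<nu> A"
 unfolding pos_var_def by (rule SUP_upper) auto

lemma pos_var_mono: "A \<subseteq> B ==> pos_var \<nu> A <= pos_var \<nu> B"
 unfolding pos_var_def by (rule SUP_subset_mono) auto

lemma pos_var_superadditive:
 assumes s: "signed_measure \<nu>" and A: "A \<inter> B = {}"
 shows "pos_var \<nu> A + pos_var \<nu> B <= pos_var \<nu> (A \<union> B)"
proof -
 have "pos_var \<nu> A + ennreal (\<nu> D) <= pos_var \<nu> (A \<union> B)" if D: "D \<in> sets borel" "D \<subseteq> B" for D
 proof -
  have "ennreal (\<nu> C) + ennreal (\<nu> D) <= pos_var \<nu> (A \<union> B)" if C: "C \<in> sets borel" "C \<subseteq> A" for C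
  proof -
   have u: "pos_var \<nu> (A \<union> B) >= ennreal (\<nu> C)" "pos_var \<nu> (A \<union> B) >= ennreal (\<nu> D)" "pos_var \<nu> (A \<union> B) >= ennreal (\<nu> (C \<union> D))"
    using C D by (auto intro!: pos_var_upper)
   show ?thesis
   proof (cases "\<nu> C >= 0 & \<nu> D >= 0")
    case True
    have "\<nu> (C \<union> D) = \<nu> C + \<nu> D" using A C D by (intro signed_measure_add[OF s]) auto
    then show ?thesis using u(3) True by (simp add: ennreal_plus)
   next
    case False
    then show ?thesis using u(1,2) by (auto simp: not_le ennreal_neg)
   qed
  qed
  then show ?thesis
   unfolding pos_var_def[of \<nu> A] by (subst ennreal_SUP_add_left[symmetric]) (auto intro!: SUP_least)
 qed
 then show ?thesis
  unfolding pos_var_def[of \<nu> B] by (subst ennreal_SUP_add_right) (auto intro!: SUP_least)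
qed

lemma pos_var_empty: "signed_measure \<nu> ==> pos_var \<nu> {} = 0"
 unfolding pos_var_def by (auto simp: signed_measure_def intro!: antisym SUP_least)

lemma pos_var_countably_additive:
 assumes s: "signed_measure \<nu>"
 shows "countably_additive (sets borel) (pos_var \<nu>)"
proof (rule countably_additiveI)
 fix A :: "nat => real set" assume A: "range A \<subseteq> sets borel" "disjoint_family A" "(\<Union>i. A i) \<in> sets borel"
 show "(\<Sum>i. pos_var \<nu> (A i)) = pos_var \<nu> (\<Union>i. A i)"
 proof (rule antisym)
  have "(\<Sum>i<n. pos_var \<nu> (A i)) <= pos_var \<nu> (\<Union>i<n. A i)" for n
  proof (induction n)
   case 0 then show ?case by simp
  next
   case (Suc n)
   have "A i \<inter> A n = {}" if "i < n" for i using A(2) that by (simp add: disjoint_family_on_def)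
   then have "(\<Union>i<n. A i) \<inter> A n = {}" by auto
   then have "pos_var \<nu> (\<Union>i<n. A i) + pos_var \<nu> (A n) <= pos_var \<nu> ((\<Union>i<n. A i) \<union> A n)"
    by (rule pos_var_superadditive[OF s])
   moreover have "(\<Union>i<n. A i) \<union> A n = (\<Union>i<Suc n. A i)" by (auto simp: less_Suc_eq)
   ultimately show ?case using Suc by simp (meson add_right_mono order_trans)
  qed
  also have "pos_var \<nu> (\<Union>i<n. A i) <= pos_var \<nu> (\<Union>i. A i)" for n by (rule pos_var_mono) auto
  finally show "(\<Sum>i. pos_var \<nu> (A i)) <= pos_var \<nu> (\<Union>i. A i)" by (intro suminf_le_const) auto
 next
  show "pos_var \<nu> (\<Union>i. A i) <= (\<Sum>i. pos_var \<nu> (A i))"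
   unfolding pos_var_def[of \<nu> "\<Union>i. A i"]
  proof (rule SUP_least)
   fix B assume B: "B \<in> {B \<in> sets borel. B \<subseteq> (\<Union>i. A i)}"
   have "range (\<lambda>i. B \<inter> A i) \<subseteq> sets borel" "disjoint_family (\<lambda>i. B \<inter> A i)"
    using A B by (auto simp: disjoint_family_on_def)
   then have "(\<lambda>i. \<nu> (B \<inter> A i)) sums \<nu> (\<Union>i. B \<inter> A i)" using s unfolding signed_measure_def by blast
   moreover have "(\<Union>i. B \<inter> A i) = B" using B by auto
   ultimately have su: "(\<lambda>i. \<nu> (B \<inter> A i)) sums \<nu> B" by simp
   have "ennreal (\<Sum>i<n. \<nu> (B \<inter> A i)) <= (\<Sum>i. pos_var \<nu> (A i))" for n
   proof -
    have "ennreal (\<Sum>i<n. \<nu> (B \<inter> A i)) <= (\<Sum>i<n. ennreal (\<nu> (B \<inter> A i)))"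
    proof (induction n)
     case (Suc n)
     have "ennreal (x + y) <= ennreal x + ennreal y" for x y :: real
      by (cases "x >= 0"; cases "y >= 0") (auto simp: ennreal_plus[symmetric] ennreal_neg intro!: ennreal_leI simp del: ennreal_plus)
     then show ?case using Suc by simp (meson add_right_mono order_trans)
    qed simp
    also have "... <= (\<Sum>i<n. pos_var \<nu> (A i))" using A B by (intro sum_mono pos_var_upper) auto
    also have "... <= (\<Sum>i. pos_var \<nu> (A i))" by (rule sum_le_suminf) auto
    finally show ?thesis .
   qed
   moreover have "(\<lambda>n. ennreal (\<Sum>i<n. \<nu> (B \<inter> A i))) \<longlonglongrightarrow> ennreal (\<nu> B)"
    using su unfolding sums_def by (intro tendsto_ennrealI)
   ultimately show "ennreal (\<nu> B) <= (\<Sum>i. pos_var \<nu> (A i))"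
    by (intro LIMSEQ_le_const2[of _ "ennreal (\<nu> B)"]) auto
  qed
 qed
qed

lemma jordan_pos_sets [simp]: "sets (jordan_pos \<nu>) = sets borel" "space (jordan_pos \<nu>) = UNIV"
 by (simp_all add: jordan_pos_def sets_measure_of_conv space_measure_of_conv sets.sigma_sets_eq[of borel, simplified])

lemma emeasure_jordan_pos:
 assumes s: "signed_measure \<nu>" and A: "A \<in> sets borel"
 shows "emeasure (jordan_pos \<nu>) A = pos_var \<nu> A"
proof -
 have "jordan_pos \<nu> = measure_of UNIV (sets borel) (pos_var \<nu>)"
  by (simp add: jordan_pos_def pos_var_def[abs_def])
 moreover have "emeasure (measure_of UNIV (sets borel) (pos_var \<nu>)) A = pos_var \<nu> A"
  by (rule emeasure_measure_of_sigma)
    (use A sets.sigma_algebra_axioms[of borel, simplified] in \<open>auto simp: pos_var_countably_additive[OF s] pos_var_empty[OF s] positive_def\<close>)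
 ultimately show ?thesis by simp
qed

text \<open>For \<open>B \<subseteq> A\<close> one has \<open>\<nu> B = \<nu> A + (- \<nu>) (A - B)\<close>; taking suprema on both sides gives the claim.\<close>
lemma jordan_decomposition:
 assumes s: "signed_measure \<nu>" and fin: "emeasure (jordan_pos \<nu>) UNIV < \<infinity>" "emeasure (jordan_neg \<nu>) UNIV < \<infinity>"
  and A: "A \<in> sets borel"
 shows "\<nu> A = measure (jordan_pos \<nu>) A - measure (jordan_neg \<nu>) A"
proof -
 note s' = signed_measure_uminus[OF s]
 let ?P = "pos_var \<nu> A" and ?N = "pos_var (\<lambda>A. - \<nu> A) A"
 have eP: "emeasure (jordan_pos \<nu>) A = ?P" and eN: "emeasure (jordan_neg \<nu>) A = ?N"
  unfolding jordan_neg_def using emeasure_jordan_pos[OF s A] emeasure_jordan_pos[OF s' A] by auto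
 have "?P <= pos_var \<nu> UNIV" "?N <= pos_var (\<lambda>A. - \<nu> A) UNIV" by (rule pos_var_mono; simp)+
 then have f: "?P < \<infinity>" "?N < \<infinity>"
  using fin emeasure_jordan_pos[OF s, of UNIV] emeasure_jordan_pos[OF s', of UNIV] unfolding jordan_neg_def by auto
 obtain p where p: "?P = ennreal p" "p >= 0" using f(1) by (cases ?P) auto
 obtain q where q: "?N = ennreal q" "q >= 0" using f(2) by (cases ?N) auto
 have 1: "\<nu> A <= p - q"
 proof -
  have "?N <= ennreal (p - \<nu> A)"
   unfolding pos_var_def[of "\<lambda>A. - \<nu> A"]
  proof (rule SUP_least)
   fix B assume B: "B \<in> {B \<in> sets borel. B \<subseteq> A}"
   have "ennreal (\<nu> (A - B)) <= ?P" using A B by (intro pos_var_upper) auto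
   then have "\<nu> (A - B) <= p" using p by (auto simp: ennreal_le_iff2)
   moreover have "\<nu> (B \<union> (A - B)) = \<nu> B + \<nu> (A - B)" using A B by (intro signed_measure_add[OF s]) auto
   moreover have "B \<union> (A - B) = A" using B by auto
   ultimately show "ennreal (- \<nu> B) <= ennreal (p - \<nu> A)" by (intro ennreal_leI) simp
  qed
  moreover have "ennreal (\<nu> A) <= ?P" using A by (intro pos_var_upper) auto
  ultimately show ?thesis using p q by (auto simp: ennreal_le_iff2)
 qed
 have 2: "- \<nu> A <= q - p"
 proof -
  have "?P <= ennreal (q + \<nu> A)"
   unfolding pos_var_def[of \<nu>]
  proof (rule SUP_least)
   fix B assume B: "B \<in> {B \<in> sets borel. B \<subseteq> A}"
   have "ennreal (- \<nu> (A - B)) <= ?N" using A B pos_var_upper[of "A - B" A "\<lambda>A. - \<nu> A"] by auto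
   then have "- \<nu> (A - B) <= q" using q by (auto simp: ennreal_le_iff2)
   moreover have "\<nu> (B \<union> (A - B)) = \<nu> B + \<nu> (A - B)" using A B by (intro signed_measure_add[OF s]) auto
   moreover have "B \<union> (A - B) = A" using B by auto
   ultimately show "ennreal (\<nu> B) <= ennreal (q + \<nu> A)" by (intro ennreal_leI) simp
  qed
  moreover have "ennreal (- \<nu> A) <= ?N" using A pos_var_upper[of A A "\<lambda>A. - \<nu> A"] by auto
  ultimately show ?thesis using p q by (auto simp: ennreal_le_iff2)
 qed
 show ?thesis using 1 2 p q by (simp add: measure_def eP eN)
qed

definition madd :: "real measure => real measure => real measure" where
 "madd M N = measure_of UNIV (sets borel) (\<lambda>A. emeasure M A + emeasure N A)"

lemma sets_madd [simp]: "sets (madd M N) = sets borel" "space (madd M N) = UNIV"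
 by (simp_all add: madd_def sets_measure_of_conv space_measure_of_conv sets.sigma_sets_eq[of borel, simplified])

lemma emeasure_madd:
 assumes M: "sets M = sets borel" and N: "sets N = sets borel" and A: "A \<in> sets borel"
 shows "emeasure (madd M N) A = emeasure M A + emeasure N A"
 unfolding madd_def
proof (rule emeasure_measure_of_sigma)
 show "sigma_algebra UNIV (sets (borel :: real measure))" using sets.sigma_algebra_axioms[of "borel :: real measure"] by simp
 show "countably_additive (sets borel) (\<lambda>A. emeasure M A + emeasure N A)"
 proof (rule countably_additiveI)
  fix A :: "nat => real set" assume A: "range A \<subseteq> sets borel" "disjoint_family A"
  have "(\<Sum>i. emeasure M (A i)) = emeasure M (\<Union>i. A i)" "(\<Sum>i. emeasure N (A i)) = emeasure N (\<Union>i. A i)"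
   using A by (intro suminf_emeasure; simp add: M N)+
  then show "(\<Sum>i. emeasure M (A i) + emeasure N (A i)) = emeasure M (\<Union>i. A i) + emeasure N (\<Union>i. A i)"
   by (subst suminf_add[symmetric]) auto
 qed
qed (use A in \<open>auto simp: positive_def\<close>)

lemma borelI: "f \<in> borel_measurable borel ==> sets M = sets borel ==> f \<in> borel_measurable M"
 using measurable_cong_sets[of M borel borel borel] by auto

lemma borelD: "f \<in> borel_measurable M ==> sets M = sets borel ==> f \<in> borel_measurable borel"
 using measurable_cong_sets[of M borel borel borel] by auto

lemma nn_integral_madd:
 assumes M: "sets M = sets borel" and N: "sets N = sets borel" and h: "h \<in> borel_measurable borel"
 shows "(\<integral>\<^sup>+x. h x \<partial>madd M N) = (\<integral>\<^sup>+x. h x \<partial>M) + (\<integral>\<^sup>+x. h x \<partial>N)"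
 using h
proof (induction h rule: borel_measurable_induct)
 case (cong f g)
 then have "f = g" by auto
 then show ?case using cong by simp
next
 case (set A)
 then show ?case by (simp add: emeasure_madd M N)
next
 case (mult u c)
 have m: "u \<in> borel_measurable M" "u \<in> borel_measurable N" "u \<in> borel_measurable (madd M N)"
  by (rule borelI[OF mult(2)]; simp add: M N)+
 show ?case unfolding nn_integral_cmult[OF m(1)] nn_integral_cmult[OF m(2)] nn_integral_cmult[OF m(3)] mult(4) distrib_left ..
next
 case (add u v)
 have m: "u \<in> borel_measurable M" "u \<in> borel_measurable N" "u \<in> borel_measurable (madd M N)"
  "v \<in> borel_measurable M" "v \<in> borel_measurable N" "v \<in> borel_measurable (madd M N)"
  by (rule borelI[OF add(1)] borelI[OF add(3)]; simp add: M N)+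
 have c: "a + b + (c + d) = (a + c) + (b + d)" for a b c d :: ennreal by (simp add: ac_simps)
 show ?case
  unfolding nn_integral_add[OF m(4) m(1)] nn_integral_add[OF m(5) m(2)] nn_integral_add[OF m(6) m(3)] add.IH by (rule c)
next
 case (seq U)
 have m: "U i \<in> borel_measurable M" "U i \<in> borel_measurable N" "U i \<in> borel_measurable (madd M N)" for i
  by (rule borelI[OF seq(1)]; simp add: M N)+
 have inc0: "incseq U" by fact
 have inc: "incseq (\<lambda>i. integral\<^sup>N K (U i))" for K
  using inc0 by (auto simp: incseq_def le_fun_def intro!: nn_integral_mono)
 have S: "(Sup (range U)) = (\<lambda>x. SUP i. U i x)" by (auto simp: fun_eq_iff image_comp)
 have i: "(\<integral>\<^sup>+x. Sup (range U) x \<partial>K) = (SUP i. integral\<^sup>N K (U i))" if "!!i. U i \<in> borel_measurable K" for K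
  unfolding S by (rule nn_integral_monotone_convergence_SUP[OF inc0 that])
 show ?case
  unfolding i[OF m(1)] i[OF m(2)] i[OF m(3)] seq.IH by (rule ennreal_SUP_add[OF inc inc])
qed

lemma finite_measure_madd:
 assumes "sets M = sets borel" "sets N = sets borel" "finite_measure M" "finite_measure N"
 shows "finite_measure (madd M N)" and "A \<in> sets borel ==> measure (madd M N) A = measure M A + measure N A"
proof -
 interpret M: finite_measure M by fact
 interpret N: finite_measure N by fact
 have e: "emeasure (madd M N) A = ennreal (measure M A + measure N A)" if "A \<in> sets borel" for A
  using that assms by (simp add: emeasure_madd M.emeasure_eq_measure N.emeasure_eq_measure ennreal_plus)
 show "finite_measure (madd M N)" by (rule finite_measureI) (simp add: e)
 show "A \<in> sets borel ==> measure (madd M N) A = measure M A + measure N A"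
  by (simp add: measure_def[of "madd M N"] e del: ennreal_plus)
qed

lemma integral_madd:
 fixes f :: "real => real"
 assumes M: "sets M = sets borel" and N: "sets N = sets borel" and f: "integrable M f" "integrable N f"
 shows "integrable (madd M N) f" "(\<integral>x. f x \<partial>madd M N) = (\<integral>x. f x \<partial>M) + (\<integral>x. f x \<partial>N)"
proof -
 have fm [measurable]: "f \<in> borel_measurable borel" by (rule borelD[OF borel_measurable_integrable[OF f(1)] M])
 have p: "(\<integral>\<^sup>+x. ennreal (f x) \<partial>madd M N) = (\<integral>\<^sup>+x. ennreal (f x) \<partial>M) + (\<integral>\<^sup>+x. ennreal (f x) \<partial>N)"
  "(\<integral>\<^sup>+x. ennreal (- f x) \<partial>madd M N) = (\<integral>\<^sup>+x. ennreal (- f x) \<partial>M) + (\<integral>\<^sup>+x. ennreal (- f x) \<partial>N)"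
  by (rule nn_integral_madd[OF M N]; measurable)+
 show i: "integrable (madd M N) f"
  using f borelI[OF fm, of "madd M N"] by (auto simp: real_integrable_def p)
 show "(\<integral>x. f x \<partial>madd M N) = (\<integral>x. f x \<partial>M) + (\<integral>x. f x \<partial>N)"
  using f i by (auto simp: real_lebesgue_integral_def p real_integrable_def enn2real_plus less_top)
qed

text \<open>A signed measure may be integrated through any representation as a difference of finite measures: if \<open>\<nu> = M - N\<close>, then \<open>M\<close> plus the negative part equals \<open>N\<close> plus the positive part as measures. Minimality of the Jordan decomposition gives integrability.\<close>
lemma signed_integral_diff:
 fixes M N :: "real measure"
 assumes M: "sets M = sets borel" "finite_measure M" and N: "sets N = sets borel" "finite_measure N"
  and \<nu>: "!!A. A \<in> sets borel ==> \<nu> A = measure M A - measure N A"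
  and f: "integrable M f" "integrable N f"
 shows "signed_measure \<nu>" "signed_integrable \<nu> f" "signed_integral \<nu> f = (\<integral>x. f x \<partial>M) - (\<integral>x. f x \<partial>N)"
  "emeasure (jordan_pos \<nu>) UNIV < \<infinity>" "emeasure (jordan_neg \<nu>) UNIV < \<infinity>"
proof -
 interpret M: finite_measure M by fact
 interpret N: finite_measure N by fact
 show s: "signed_measure \<nu>"
  unfolding signed_measure_def
 proof (intro conjI allI impI)
  show "\<nu> {} = 0" using \<nu>[of "{}"] by simp
  fix A :: "nat => real set" assume A: "range A \<subseteq> sets borel & disjoint_family A"
  then have "(\<lambda>i. measure M (A i)) sums measure M (\<Union>i. A i)" "(\<lambda>i. measure N (A i)) sums measure N (\<Union>i. A i)"
   by (intro M.finite_measure_UNION N.finite_measure_UNION; simp add: M N)+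
  then have "(\<lambda>i. measure M (A i) - measure N (A i)) sums (measure M (\<Union>i. A i) - measure N (\<Union>i. A i))"
   by (rule sums_diff)
  moreover have "\<nu> (A i) = measure M (A i) - measure N (A i)" for i using A by (intro \<nu>) auto
  moreover have "\<nu> (\<Union>i. A i) = measure M (\<Union>i. A i) - measure N (\<Union>i. A i)" using A by (intro \<nu>) auto
  ultimately show "(\<lambda>i. \<nu> (A i)) sums \<nu> (\<Union>i. A i)" by simp
 qed
 note s' = signed_measure_uminus[OF s]
 let ?P = "jordan_pos \<nu>" and ?N = "jordan_neg \<nu>"
 have sN: "sets ?N = sets borel" by (simp add: jordan_neg_def)
 have leP: "emeasure ?P A <= emeasure M A" for A
 proof (cases "A \<in> sets borel")
  case True
  show ?thesis
   unfolding emeasure_jordan_pos[OF s True] pos_var_def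
  proof (rule SUP_least)
   fix B assume B: "B \<in> {B \<in> sets borel. B \<subseteq> A}"
   have "\<nu> B <= measure M B" using B \<nu>[of B] by simp
   also have "... <= measure M A" using B True by (intro M.finite_measure_mono) (auto simp: M)
   finally show "ennreal (\<nu> B) <= emeasure M A" by (simp add: M.emeasure_eq_measure ennreal_leI)
  qed
 qed (simp add: emeasure_notin_sets)
 have leN: "emeasure ?N A <= emeasure N A" for A
 proof (cases "A \<in> sets borel")
  case True
  show ?thesis
   unfolding jordan_neg_def emeasure_jordan_pos[OF s' True] pos_var_def
  proof (rule SUP_least)
   fix B assume B: "B \<in> {B \<in> sets borel. B \<subseteq> A}"
   have "- \<nu> B <= measure N B" using B \<nu>[of B] by simp
   also have "... <= measure N A" using B True by (intro N.finite_measure_mono) (auto simp: N)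
   finally show "ennreal (- \<nu> B) <= emeasure N A" by (simp add: N.emeasure_eq_measure ennreal_leI)
  qed
 qed (simp add: emeasure_notin_sets sN)
 show fin: "emeasure ?P UNIV < \<infinity>" "emeasure ?N UNIV < \<infinity>"
  using leP[of UNIV] leN[of UNIV] M.emeasure_finite[of UNIV] N.emeasure_finite[of UNIV]
  by (auto simp: less_top[symmetric] top_unique)
 have lePm: "?P <= M" and leNm: "?N <= N"
  using leP leN by (auto simp: le_measure_iff M N sN sets_eq_imp_space_eq[OF M(1)] sets_eq_imp_space_eq[OF N(1)]
    sets_eq_imp_space_eq[OF sN] le_fun_def)
 have intP: "integrable ?P f" and intN: "integrable ?N f"
 proof -
  have fm: "f \<in> borel_measurable borel" by (rule borelD[OF borel_measurable_integrable[OF f(1)] M(1)])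
  have "(\<integral>\<^sup>+x. ennreal (norm (f x)) \<partial>?P) <= (\<integral>\<^sup>+x. ennreal (norm (f x)) \<partial>M)"
   by (rule nn_integral_mono_measure) (use lePm in \<open>auto simp: M\<close>)
  then show "integrable ?P f" using f(1) borelI[OF fm jordan_pos_sets(1)] by (auto simp: integrable_iff_bounded)
  have "(\<integral>\<^sup>+x. ennreal (norm (f x)) \<partial>?N) <= (\<integral>\<^sup>+x. ennreal (norm (f x)) \<partial>N)"
   by (rule nn_integral_mono_measure) (use leNm in \<open>auto simp: N sN\<close>)
  then show "integrable ?N f" using f(2) borelI[OF fm sN] by (auto simp: integrable_iff_bounded)
 qed
 then show "signed_integrable \<nu> f" by (simp add: signed_integrable_def)
 have eq: "emeasure M A + emeasure ?N A = emeasure ?P A + emeasure N A" if A: "A \<in> sets borel" for A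
 proof -
  have "measure M A + measure ?N A = measure ?P A + measure N A"
   using jordan_decomposition[OF s fin A] \<nu>[OF A] by simp
  moreover have "emeasure ?P A ~= \<infinity>" "emeasure ?N A ~= \<infinity>"
   using leP[of A] leN[of A] M.emeasure_finite[of A] N.emeasure_finite[of A] by (auto simp: top_unique)
  ultimately show ?thesis
   by (simp add: M.emeasure_eq_measure N.emeasure_eq_measure emeasure_eq_ennreal_measure ennreal_plus[symmetric] del: ennreal_plus)
 qed
 have "madd M ?N = madd ?P N"
  by (rule measure_eqI) (simp_all add: emeasure_madd M N sN eq)
 then have "(\<integral>x. f x \<partial>M) + (\<integral>x. f x \<partial>?N) = (\<integral>x. f x \<partial>?P) + (\<integral>x. f x \<partial>N)"
  using integral_madd(2)[OF M(1) sN f(1) intN] integral_madd(2)[OF jordan_pos_sets(1) N(1) intP f(2)] by simp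
 then show "signed_integral \<nu> f = (\<integral>x. f x \<partial>M) - (\<integral>x. f x \<partial>N)"
  by (simp add: signed_integral_def)
qed

section \<open>Chebyshev polynomials and the semicircle law\<close>

text \<open>Chebyshev polynomials of the second kind, rescaled to the interval \<open>[-2, 2]\<close>.\<close>
fun chb :: "nat => real poly" where
 "chb 0 = 1"
| "chb (Suc 0) = [:0, 1:]"
| "chb (Suc (Suc k)) = pCons 0 (chb (Suc k)) - chb k"

lemma chb_degree: "degree (chb k) = k & coeff (chb k) k = 1"
proof (induction k rule: chb.induct)
 case (3 k)
 have "coeff (chb (Suc (Suc k))) (Suc (Suc k)) = 1"
  using 3 by (simp add: coeff_eq_0)
 moreover have "degree (chb (Suc (Suc k))) <= Suc (Suc k)"
  using 3 by (auto intro!: degree_diff_le simp: degree_pCons_le le_trans[OF degree_pCons_le])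
 ultimately show ?case by (metis le_antisym le_degree one_neq_zero)
qed auto

lemma chb_trig: "poly (chb k) (2 * cos t) * sin t = sin (real (Suc k) * t)"
proof (induction k rule: chb.induct)
 case 2 show ?case using sin_double[of t] by simp
next
 case (3 k)
 have "sin (real (Suc (Suc (Suc k))) * t) + sin (real (Suc k) * t) = 2 * cos t * sin (real (Suc (Suc k)) * t)"
 proof -
  have "sin (real (Suc (Suc k)) * t + t) + sin (real (Suc (Suc k)) * t - t) = 2 * cos t * sin (real (Suc (Suc k)) * t)"
   unfolding sin_add sin_diff by simp
  moreover have "real (Suc (Suc k)) * t + t = real (Suc (Suc (Suc k))) * t" "real (Suc (Suc k)) * t - t = real (Suc k) * t"
   by (simp_all add: algebra_simps)
  ultimately show ?thesis by simp
 qed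
 then show ?case using 3 by (simp add: left_diff_distrib mult.assoc)
qed simp

text \<open>Differences of polynomials of the second kind are polynomials of the first kind, that is, pure cosines.\<close>
lemma chb_diff_trig: "poly (chb (Suc (Suc k)) - chb k) (2 * cos t) = 2 * cos (real (Suc (Suc k)) * t)"
proof (induction k rule: less_induct)
 case (less k)
 consider "k = 0" | "k = 1" | j where "k = Suc (Suc j)" by (metis One_nat_def not0_implies_Suc)
 then show ?case
 proof cases
  case 1 then show ?thesis using cos_double_cos[of t] by (simp add: power2_eq_square)
 next
  case 2
  have "3 * t = 2 * t + t" by simp
  have "cos (3 * t) = 4 * cos t ^ 3 - 3 * cos t" by (rule cos_treble_cos)
  then show ?thesis using 2 by (simp add: power3_eq_cube algebra_simps)
 next
  case (3 j)
  have a: "poly (chb (Suc (Suc (Suc j))) - chb (Suc j)) (2 * cos t) = 2 * cos (real (Suc (Suc (Suc j))) * t)"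
   using less[of "Suc j"] 3 by simp
  have b: "poly (chb (Suc (Suc j)) - chb j) (2 * cos t) = 2 * cos (real (Suc (Suc j)) * t)"
   using less[of j] 3 by simp
  have c: "cos (real (Suc (Suc (Suc (Suc j)))) * t) + cos (real (Suc (Suc j)) * t) = 2 * cos t * cos (real (Suc (Suc (Suc j))) * t)"
  proof -
   have "cos (real (Suc (Suc (Suc j))) * t + t) + cos (real (Suc (Suc (Suc j))) * t - t) = 2 * cos t * cos (real (Suc (Suc (Suc j))) * t)"
    unfolding cos_add cos_diff by simp
   moreover have "real (Suc (Suc (Suc j))) * t + t = real (Suc (Suc (Suc (Suc j)))) * t" "real (Suc (Suc (Suc j))) * t - t = real (Suc (Suc j)) * t"
    by (simp_all add: algebra_simps)
   ultimately show ?thesis by simp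
  qed
  have "poly (chb (Suc (Suc k)) - chb k) (2 * cos t)
   = 2 * cos t * poly (chb (Suc (Suc (Suc j))) - chb (Suc j)) (2 * cos t) - poly (chb (Suc (Suc j)) - chb j) (2 * cos t)"
   unfolding 3 by (simp add: algebra_simps)
  also have "... = 2 * cos (real (Suc (Suc k)) * t)" unfolding a b 3 using c by simp
  finally show ?thesis .
 qed
qed

lemma cos_integral:
 "integrable lborel (\<lambda>t. cos (real m * t) * indicator {-pi..0} t)"
 "(\<integral>t. cos (real m * t) * indicator {-pi..0} t \<partial>lborel) = (if m = 0 then pi else 0)"
proof -
 have "has_bochner_integral lborel (\<lambda>t. cos (real m * t) * indicator {-pi..0} t) (if m = 0 then pi else 0)"
 proof (cases "m = 0")
  case True
  have "has_bochner_integral lborel (\<lambda>t. 1 * indicator {-pi..0} t) (0 - (- pi))"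
   by (rule has_bochner_integral_FTC_Icc_real[where F = "\<lambda>t. t"]) (auto intro!: derivative_eq_intros)
  then show ?thesis using True by simp
 next
  case False
  have "has_bochner_integral lborel (\<lambda>t. cos (real m * t) * indicator {-pi..0} t) (sin (real m * 0) / real m - sin (real m * (- pi)) / real m)"
   by (rule has_bochner_integral_FTC_Icc_real[where F = "\<lambda>t. sin (real m * t) / real m"])
     (use False in \<open>auto intro!: derivative_eq_intros continuous_intros\<close>)
  then show ?thesis using False by simp
 qed
 then show "integrable lborel (\<lambda>t. cos (real m * t) * indicator {-pi..0} t)"
  "(\<integral>t. cos (real m * t) * indicator {-pi..0} t \<partial>lborel) = (if m = 0 then pi else 0)"
  by (auto simp: has_bochner_integral_iff)
qed

lemma four_minus_square: "x \<in> {-2..2} ==> 0 <= 4 - x\<^sup>2" for x :: real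
 using abs_le_square_iff[of x 2] by auto

lemma sqrt_cos: "t \<in> {-pi..0} ==> sqrt (4 - (2 * cos t)\<^sup>2) = - 2 * sin t"
proof -
 assume t: "t \<in> {-pi..0}"
 then have "sin (- t) >= 0" by (intro sin_ge_zero) auto
 moreover have "4 - (2 * cos t)\<^sup>2 = (2 * sin t)\<^sup>2" by (simp add: power_mult_distrib sin_squared_eq)
 moreover have "sqrt ((2 * sin t)\<^sup>2) = \<bar>2 * sin t\<bar>" by (rule real_sqrt_abs)
 ultimately show ?thesis by (simp only:) simp
qed

text \<open>The substitution \<open>x = 2 cos t\<close>, increasing on \<open>[- pi, 0]\<close>, turns the arcsine weight into Lebesgue measure.\<close>
lemma arcsine_integral:
 fixes r :: "real poly"
 shows "integrable lborel (\<lambda>x. poly r x / sqrt (4 - x\<^sup>2) * indicator {-2..2} x)"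
  "(\<integral>x. poly r x / sqrt (4 - x\<^sup>2) * indicator {-2..2} x \<partial>lborel) = (\<integral>t. poly r (2 * cos t) * indicator {-pi..0} t \<partial>lborel)"
proof -
 have dg: "((\<lambda>t. 2 * cos t) has_real_derivative (- 2 * sin t)) (at t)" for t
  by (auto intro!: derivative_eq_intros)
 have cg: "continuous_on {-pi..0} (\<lambda>t. - 2 * sin t)" by (intro continuous_intros)
 have pg: "- 2 * sin t >= 0" if "t \<in> {-pi..0}" for t
 proof -
  have "sin (- t) >= 0" using that by (intro sin_ge_zero) auto
  then show ?thesis by simp
 qed
 have [measurable]: "(\<lambda>x. poly q x) \<in> borel_measurable borel" for q :: "real poly"
  by (intro borel_measurable_continuous_onI continuous_intros)
 have ae: "AE t in lborel. t ~= - pi & t ~= (0::real)" by (intro AE_conjI AE_lborel_singleton)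
 have simpl: "a / sqrt (4 - (2 * cos t)\<^sup>2) * (- 2 * sin t) * indicator {-pi..0} t = a * indicator {-pi..0} t"
  if "t ~= - pi & t ~= 0" for a t :: real
 proof (cases "t \<in> {-pi..0}")
  case True
  then have "sin (- t) > 0" using that by (intro sin_gt_zero) auto
  then show ?thesis using True sqrt_cos[OF True] by simp
 qed simp
 have "(\<integral>\<^sup>+x. ennreal (1 / sqrt (4 - x\<^sup>2)) * indicator {2 * cos (-pi)..2 * cos 0} x \<partial>lborel)
   = (\<integral>\<^sup>+t. ennreal (1 / sqrt (4 - (2 * cos t)\<^sup>2)) * ennreal (- 2 * sin t) * indicator {-pi..0} t \<partial>lborel)"
  by (rule nn_integral_substitution_aux[OF _ _ dg cg pg]) auto
 also have "... = (\<integral>\<^sup>+t. indicator {-pi..0} t \<partial>lborel)"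
 proof (rule nn_integral_cong_AE, use ae in eventually_elim)
  fix t :: real assume t: "t ~= - pi & t ~= 0"
  show "ennreal (1 / sqrt (4 - (2 * cos t)\<^sup>2)) * ennreal (- 2 * sin t) * indicator {-pi..0} t = indicator {-pi..0} t"
  proof (cases "t \<in> {-pi..0}")
   case True
   then have "1 / sqrt (4 - (2 * cos t)\<^sup>2) * (- 2 * sin t) = 1" using simpl[OF t, of 1] by simp
   then show ?thesis using True pg[OF True] by (simp add: ennreal_mult''[symmetric] del: ennreal_1)
  qed simp
 qed
 also have "... < \<infinity>" by simp
 finally have fin: "(\<integral>\<^sup>+x. ennreal (1 / sqrt (4 - x\<^sup>2)) * indicator {-2..2} x \<partial>lborel) < \<infinity>" by simp
 have i1: "integrable lborel (\<lambda>x. 1 / sqrt (4 - x\<^sup>2) * indicator {-2..2} x :: real)"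
 proof (rule integrableI_bounded)
  have "ennreal (norm (1 / sqrt (4 - x\<^sup>2) * indicator {-2..2} x :: real)) = ennreal (1 / sqrt (4 - x\<^sup>2)) * indicator {-2..2} x" for x :: real
  proof (cases "x \<in> {-2..2}")
   case True
   then have "1 / sqrt (4 - x\<^sup>2) >= 0" using four_minus_square[OF True] by simp
   then have "norm (1 / sqrt (4 - x\<^sup>2)) = 1 / sqrt (4 - x\<^sup>2)" by (simp only: real_norm_def abs_of_nonneg)
   then show ?thesis using True by simp
  qed simp
  then show "(\<integral>\<^sup>+x. ennreal (norm (1 / sqrt (4 - x\<^sup>2) * indicator {-2..2} x :: real)) \<partial>lborel) < \<infinity>" using fin by simp
 qed measurable
 obtain B where B: "!!x. x \<in> {-2..2::real} ==> \<bar>poly r x\<bar> <= B"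
 proof -
  have "compact (poly r ` {-2..2})" by (intro compact_continuous_image continuous_intros) auto
  then have "bounded (poly r ` {-2..2})" by (rule compact_imp_bounded)
  then obtain a where a: "\<forall>x\<in>poly r ` {-2..2}. \<bar>x\<bar> <= a" unfolding bounded_real by blast
  show ?thesis by (rule that[of a]) (use a in blast)
 qed
 show i: "integrable lborel (\<lambda>x. poly r x / sqrt (4 - x\<^sup>2) * indicator {-2..2} x)"
 proof (rule Bochner_Integration.integrable_bound[where f = "\<lambda>x. B * (1 / sqrt (4 - x\<^sup>2) * indicator {-2..2} x)"])
  show "integrable lborel (\<lambda>x. B * (1 / sqrt (4 - x\<^sup>2) * indicator {-2..2} x))" by (rule integrable_mult_right[OF i1])
  show "AE x in lborel. norm (poly r x / sqrt (4 - x\<^sup>2) * indicator {-2..2} x) <= norm (B * (1 / sqrt (4 - x\<^sup>2) * indicator {-2..2} x))"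
  proof (rule AE_I2)
   fix x :: real
   show "norm (poly r x / sqrt (4 - x\<^sup>2) * indicator {-2..2} x) <= norm (B * (1 / sqrt (4 - x\<^sup>2) * indicator {-2..2} x))"
    using B[of x] by (auto split: split_indicator simp: abs_mult intro!: divide_right_mono)
  qed
 qed measurable
 have si: "set_integrable lborel {2 * cos (-pi)..2 * cos 0} (\<lambda>x. poly r x / sqrt (4 - x\<^sup>2))"
  using i by (simp add: set_integrable_def mult.commute)
 have "(\<integral>x. (poly r x / sqrt (4 - x\<^sup>2)) * indicator {2 * cos (-pi)..2 * cos 0} x \<partial>lborel)
  = (\<integral>t. (poly r (2 * cos t) / sqrt (4 - (2 * cos t)\<^sup>2)) * (- 2 * sin t) * indicator {-pi..0} t \<partial>lborel)"
  by (rule integral_substitution(2)[OF si dg cg pg]) auto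
 also have "... = (\<integral>t. poly r (2 * cos t) * indicator {-pi..0} t \<partial>lborel)"
  by (rule integral_cong_AE, measurable, use ae in eventually_elim) (rule simpl)
 finally show "(\<integral>x. poly r x / sqrt (4 - x\<^sup>2) * indicator {-2..2} x \<partial>lborel) = (\<integral>t. poly r (2 * cos t) * indicator {-pi..0} t \<partial>lborel)"
  by simp
qed

lemma semicircle_integral:
 fixes r :: "real poly"
 shows "integrable semicircle (poly r)"
  "(\<integral>x. poly r x \<partial>semicircle) = (2 / pi) * (\<integral>t. poly r (2 * cos t) * (sin t)\<^sup>2 * indicator {-pi..0} t \<partial>lborel)"
proof -
 let ?s = "r * [:4, 0, -1:]"
 have [measurable]: "(\<lambda>x. poly q x) \<in> borel_measurable borel" for q :: "real poly"
  by (intro borel_measurable_continuous_onI continuous_intros)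
 have nn: "0 <= 1 / (2 * pi) * sqrt (4 - x\<^sup>2) * indicator {-2..2} x" for x :: real
  using four_minus_square[of x] by (cases "x \<in> {-2..2}") auto
 have e: "(1 / (2 * pi) * sqrt (4 - x\<^sup>2) * indicator {-2..2} x) * poly r x
   = 1 / (2 * pi) * (poly ?s x / sqrt (4 - x\<^sup>2) * indicator {-2..2} x)" for x :: real
 proof -
  have "poly ?s x = poly r x * (4 - x\<^sup>2)" by (simp add: power2_eq_square algebra_simps)
  moreover have "(4 - x\<^sup>2) / sqrt (4 - x\<^sup>2) = sqrt (4 - x\<^sup>2)" if "x \<in> {-2..2}"
   using four_minus_square[OF that] by (simp add: real_div_sqrt)
  ultimately have "poly ?s x / sqrt (4 - x\<^sup>2) = poly r x * sqrt (4 - x\<^sup>2)" if "x \<in> {-2..2}"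
   using that by (simp only: times_divide_eq_right[symmetric])
  note pe = this
  show ?thesis
  proof (cases "x \<in> {-2..2}")
   case True
   then have i: "indicator {-2..2} x = (1 :: real)" by (rule indicator_simps(1))
   show ?thesis unfolding i pe[OF True] by (simp only: mult_1_right mult_ac)
  next
   case False
   then have i: "indicator {-2..2} x = (0 :: real)" by (rule indicator_simps(2))
   show ?thesis unfolding i by simp
  qed
 qed
 show "integrable semicircle (poly r)"
  unfolding semicircle_def
 proof (subst integrable_real_density)
  show "integrable lborel (\<lambda>x. (1 / (2 * pi) * sqrt (4 - x\<^sup>2) * indicator {-2..2} x) * poly r x)"
   unfolding e by (rule integrable_mult_right) (rule arcsine_integral(1))
 qed (use nn in auto)
 have "(\<integral>x. poly r x \<partial>semicircle) = (\<integral>x. (1 / (2 * pi) * sqrt (4 - x\<^sup>2) * indicator {-2..2} x) * poly r x \<partial>lborel)"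
  unfolding semicircle_def by (rule integral_real_density) (use nn in auto)
 also have "... = 1 / (2 * pi) * (\<integral>t. poly ?s (2 * cos t) * indicator {-pi..0} t \<partial>lborel)"
  unfolding e integral_mult_right_zero arcsine_integral(2) ..
 also have "... = 1 / (2 * pi) * (\<integral>t. 4 * (poly r (2 * cos t) * (sin t)\<^sup>2 * indicator {-pi..0} t) \<partial>lborel)"
 proof (rule arg_cong2[where f = "(*)", OF refl], rule Bochner_Integration.integral_cong[OF refl])
  fix t :: real
  have "poly [:4, 0, -1:] (2 * cos t) = 4 - 4 * (cos t)\<^sup>2" by (simp add: power2_eq_square)
  then have "poly [:4, 0, -1:] (2 * cos t) = 4 * (sin t)\<^sup>2" using sin_squared_eq[of t] by simp
  then show "poly ?s (2 * cos t) * indicator {-pi..0} t = 4 * (poly r (2 * cos t) * (sin t)\<^sup>2 * indicator {-pi..0} t)"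
   unfolding poly_mult by simp
 qed
 also have "... = (2 / pi) * (\<integral>t. poly r (2 * cos t) * (sin t)\<^sup>2 * indicator {-pi..0} t \<partial>lborel)"
  unfolding integral_mult_right_zero by (simp add: field_simps)
 finally show "(\<integral>x. poly r x \<partial>semicircle) = (2 / pi) * (\<integral>t. poly r (2 * cos t) * (sin t)\<^sup>2 * indicator {-pi..0} t \<partial>lborel)" .
qed

text \<open>In the angle variable the integrand is \<open>sin ((j + 1) t) sin ((k + 1) t)\<close>.\<close>
lemma chb_orthonormal: "(\<integral>x. poly (chb j * chb k) x \<partial>semicircle) = (if j = k then 1 else 0)"
proof -
 define d where "d = (if j <= k then k - j else j - k)"
 have "poly (chb j * chb k) (2 * cos t) * (sin t)\<^sup>2 = (cos (real d * t) - cos (real (j + k + 2) * t)) / 2" for t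
 proof -
  have "poly (chb j * chb k) (2 * cos t) * (sin t)\<^sup>2 = sin (real (Suc j) * t) * sin (real (Suc k) * t)"
   unfolding chb_trig[symmetric] by (simp add: power2_eq_square)
  also have "... = (cos (real (Suc j) * t - real (Suc k) * t) - cos (real (Suc j) * t + real (Suc k) * t)) / 2"
   by (rule sin_times_sin)
  also have "cos (real (Suc j) * t - real (Suc k) * t) = cos (real d * t)"
  proof (cases "j <= k")
   case True
   then have "real (Suc j) * t - real (Suc k) * t = - (real d * t)" by (simp add: d_def of_nat_diff algebra_simps)
   then show ?thesis by (simp only: cos_minus)
  next
   case False
   then have "real (Suc j) * t - real (Suc k) * t = real d * t" by (simp add: d_def of_nat_diff algebra_simps)
   then show ?thesis by simp
  qed
  also have "real (Suc j) * t + real (Suc k) * t = real (j + k + 2) * t" by (simp add: algebra_simps)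
  finally show ?thesis .
 qed
 note pt = this
 have "(\<integral>x. poly (chb j * chb k) x \<partial>semicircle)
   = (2 / pi) * (\<integral>t. (cos (real d * t) * indicator {-pi..0} t - cos (real (j + k + 2) * t) * indicator {-pi..0} t) / 2 \<partial>lborel)"
  unfolding semicircle_integral(2) by (rule arg_cong2[where f = "(*)", OF refl], rule Bochner_Integration.integral_cong[OF refl]) (simp only: pt left_diff_distrib times_divide_eq_left)
 also have "... = (2 / pi) * (((if d = 0 then pi else 0) - 0) / 2)"
  unfolding integral_divide_zero
  by (subst Bochner_Integration.integral_diff[OF cos_integral(1) cos_integral(1)]) (simp only: cos_integral(2), simp)
 also have "... = (if j = k then 1 else 0)" by (auto simp: d_def)
 finally show ?thesis .
qed

definition rho_dens :: "real => real => real" where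
 "rho_dens \<xi> x = \<xi> / (2 * pi) * (x * (x\<^sup>2 - 3) / sqrt (4 - x\<^sup>2)) * indicator {-2..2} x"

lemma rho_dens_integral:
 "integrable lborel (\<lambda>x. rho_dens \<xi> x * poly r x)"
 "(\<integral>x. rho_dens \<xi> x * poly r x \<partial>lborel) = \<xi> / (2 * pi) * (\<integral>t. 2 * cos (3 * t) * poly r (2 * cos t) * indicator {-pi..0} t \<partial>lborel)"
proof -
 let ?s = "[:0, -3, 0, 1:] * r"
 have e: "rho_dens \<xi> x * poly r x = \<xi> / (2 * pi) * (poly ?s x / sqrt (4 - x\<^sup>2) * indicator {-2..2} x)" for x
  unfolding rho_dens_def poly_mult by (simp add: power2_eq_square algebra_simps)
 show "integrable lborel (\<lambda>x. rho_dens \<xi> x * poly r x)"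
  unfolding e by (rule integrable_mult_right) (rule arcsine_integral(1))
 have t: "poly ?s (2 * cos t) = 2 * cos (3 * t) * poly r (2 * cos t)" for t
  unfolding poly_mult cos_treble_cos by (simp add: power3_eq_cube algebra_simps)
 show "(\<integral>x. rho_dens \<xi> x * poly r x \<partial>lborel) = \<xi> / (2 * pi) * (\<integral>t. 2 * cos (3 * t) * poly r (2 * cos t) * indicator {-pi..0} t \<partial>lborel)"
  unfolding e integral_mult_right_zero arcsine_integral(2) t ..
qed

text \<open>At \<open>x = 2 cos t\<close> the numerator \<open>x (x\<^sup>2 - 3)\<close> is \<open>2 cos (3 t)\<close>, so the integral extracts the frequency \<open>3\<close>. The polynomial of degree \<open>k\<close> is a sum of cosines of the frequencies \<open>k, k - 2, \<dots>\<close>, and these contain \<open>3\<close> exactly for odd \<open>k \<ge> 3\<close>.\<close>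
lemma rho_chb: "(\<integral>x. rho_dens \<xi> x * poly (chb k) x \<partial>lborel) = (if odd k & k >= 3 then \<xi> else 0)"
proof (induction k rule: less_induct)
 case (less k)
 have cc: "(\<integral>t. 2 * cos (3 * t) * (2 * cos (real m * t)) * indicator {-pi..0} t \<partial>lborel) = (if m = 3 then 2 * pi else 0)" for m :: nat
 proof -
  define d where "d = (if m <= 3 then 3 - m else m - 3)"
  have "2 * cos (3 * t) * (2 * cos (real m * t)) * indicator {-pi..0} t
    = 2 * (cos (real d * t) * indicator {-pi..0} t) + 2 * (cos (real (m + 3) * t) * indicator {-pi..0} t)" for t :: real
  proof -
   have "cos (3 * t) * cos (real m * t) = (cos (3 * t - real m * t) + cos (3 * t + real m * t)) / 2" by (rule cos_times_cos)
   moreover have "cos (3 * t - real m * t) = cos (real d * t)"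
   proof (cases "m <= 3")
    case True
    then have "3 * t - real m * t = real d * t" by (simp add: d_def of_nat_diff algebra_simps)
    then show ?thesis by simp
   next
    case False
    then have "3 * t - real m * t = - (real d * t)" by (simp add: d_def of_nat_diff algebra_simps)
    then show ?thesis by (simp only: cos_minus)
   qed
   moreover have "3 * t + real m * t = real (m + 3) * t" by (simp add: algebra_simps)
   ultimately show ?thesis by (simp add: algebra_simps)
  qed
  then have "(\<integral>t. 2 * cos (3 * t) * (2 * cos (real m * t)) * indicator {-pi..0} t \<partial>lborel)
   = (\<integral>t. 2 * (cos (real d * t) * indicator {-pi..0} t) \<partial>lborel) + (\<integral>t. 2 * (cos (real (m + 3) * t) * indicator {-pi..0} t) \<partial>lborel)"
   by (simp only:) (rule Bochner_Integration.integral_add; rule integrable_mult_right; rule cos_integral(1))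
  also have "... = 2 * (if d = 0 then pi else 0)" unfolding integral_mult_right_zero cos_integral(2) by simp
  finally show ?thesis by (auto simp: d_def)
 qed
 have c1: "(\<integral>t. 2 * cos (3 * t) * indicator {-pi..0} t \<partial>lborel) = 0"
 proof -
  have "(\<integral>t. 2 * cos (3 * t) * indicator {-pi..0} t \<partial>lborel) = 2 * (\<integral>t. cos (real 3 * t) * indicator {-pi..0} t \<partial>lborel)"
   by (subst integral_mult_right_zero[symmetric]) (simp add: mult.assoc)
  then show ?thesis unfolding cos_integral(2) by simp
 qed
 consider "k = 0" | "k = 1" | j where "k = Suc (Suc j)" by (metis One_nat_def not0_implies_Suc)
 then show ?case
 proof cases
  case 1
  show ?thesis unfolding rho_dens_integral(2) 1 using c1 by simp
 next
  case 2
  show ?thesis unfolding rho_dens_integral(2) 2 using cc[of 1] by simp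
 next
  case (3 j)
  have "(\<integral>x. rho_dens \<xi> x * poly (chb (Suc (Suc j)) - chb j) x \<partial>lborel)
    = (\<integral>x. rho_dens \<xi> x * poly (chb (Suc (Suc j))) x \<partial>lborel) - (\<integral>x. rho_dens \<xi> x * poly (chb j) x \<partial>lborel)"
   unfolding poly_diff right_diff_distrib by (rule Bochner_Integration.integral_diff[OF rho_dens_integral(1) rho_dens_integral(1)])
  moreover have "(\<integral>x. rho_dens \<xi> x * poly (chb (Suc (Suc j)) - chb j) x \<partial>lborel) = (if j = 1 then \<xi> else 0)"
   unfolding rho_dens_integral(2) chb_diff_trig using cc[of "Suc (Suc j)"] by simp
  moreover have "(\<integral>x. rho_dens \<xi> x * poly (chb j) x \<partial>lborel) = (if odd j & j >= 3 then \<xi> else 0)"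
   using less[of j] 3 by simp
  ultimately show ?thesis unfolding 3 by (auto elim!: oddE split: if_splits)
 qed
qed


lemma poly_basis_expansion:
 fixes b :: "nat => real poly"
 assumes b: "!!k. degree (b k) = k" and nz: "b 0 ~= 0"
 shows "degree r <= k ==> \<exists>c. r = (\<Sum>j\<le>k. smult (c j) (b j))"
proof (induction k arbitrary: r)
 case 0
 obtain u where u: "b 0 = [:u:]" using b[of 0] by (metis degree_eq_zeroE)
 obtain v where v: "r = [:v:]" using 0 by (metis degree_eq_zeroE le_zero_eq)
 have "u ~= 0" using nz u by auto
 then show ?case by (intro exI[of _ "\<lambda>_. v / u"]) (simp add: u v)
next
 case (Suc k)
 let ?b = "b (Suc k)"
 have lc: "coeff ?b (Suc k) ~= 0" using b[of "Suc k"] by (metis degree_0 leading_coeff_0_iff nat.distinct(1))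
 define d where "d = coeff r (Suc k) / coeff ?b (Suc k)"
 have "degree (r - smult d ?b) <= k"
 proof (rule degree_le, intro allI impI)
  fix i assume "k < i"
  show "coeff (r - smult d ?b) i = 0"
  proof (cases "i = Suc k")
   case True then show ?thesis using lc by (simp add: d_def)
  next
   case False
   then have "coeff r i = 0" "coeff ?b i = 0"
    using \<open>k < i\<close> Suc.prems b[of "Suc k"] by (auto intro!: coeff_eq_0)
   then show ?thesis by simp
  qed
 qed
 from Suc.IH[OF this] obtain c where c: "r - smult d ?b = (\<Sum>j\<le>k. smult (c j) (b j))" by blast
 have "(\<Sum>j\<le>k. smult ((c(Suc k := d)) j) (b j)) = (\<Sum>j\<le>k. smult (c j) (b j))"
  by (intro sum.cong) auto
 then have "r = (\<Sum>j\<le>Suc k. smult ((c(Suc k := d)) j) (b j))"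
  using c by (simp add: algebra_simps)
 then show ?case by blast
qed

definition ip :: "real poly => real poly => real" where
 "ip p q = (\<integral>x. poly (p * q) x \<partial>semicircle)"

lemma ip_commute: "ip p q = ip q p"
 by (simp add: ip_def mult.commute)

lemma ip_sum_right: "ip p (\<Sum>j\<in>A. smult (c j) (b j)) = (\<Sum>j\<in>A. c j * ip p (b j))"
proof -
 have "poly (p * (\<Sum>j\<in>A. smult (c j) (b j))) = (\<lambda>x. \<Sum>j\<in>A. c j * poly (p * b j) x)"
  by (simp add: fun_eq_iff poly_sum sum_distrib_left mult_ac)
 then show ?thesis unfolding ip_def
  by (simp only:) (subst Bochner_Integration.integral_sum, auto intro!: integrable_mult_right semicircle_integral(1) simp del: poly_mult)
qed

text \<open>A polynomial of degree \<open>k\<close> that is orthogonal to all lower degrees is a multiple of the Chebyshev polynomial, and the norm fixes the factor up to sign. The rate function contains squares only, so the sign is harmless.\<close>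
lemma orthonormal_unique:
 assumes q: "orthonormal_polynomials semicircle q"
 shows "q k = chb k \<or> q k = - chb k"
proof -
 have dq: "degree (q k) = k" and oq: "ip (q j) (q k) = (if j = k then 1 else 0)" for j k
  using q by (auto simp: orthonormal_polynomials_def ip_def)
 have oc: "ip (chb j) (chb k) = (if j = k then 1 else 0)" for j k
  unfolding ip_def by (rule chb_orthonormal)
 have q0: "q 0 ~= 0" using oq[of 0 0] by (auto simp: ip_def)
 have orth: "ip (q k) (chb j) = 0" if "j < k" for j
 proof -
  obtain c where c: "chb j = (\<Sum>i\<le>j. smult (c i) (q i))"
   using poly_basis_expansion[of q "chb j" j] dq q0 chb_degree[of j] by auto
  show ?thesis unfolding c ip_sum_right using that by (simp add: oq)
 qed
 obtain d where d: "q k = (\<Sum>j\<le>k. smult (d j) (chb j))"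
  using poly_basis_expansion[of chb "q k" k] dq[of k] chb_degree by auto
 have dj: "ip (chb j) (q k) = d j" if "j <= k" for j
 proof -
  have "(\<Sum>i\<le>k. d i * ip (chb j) (chb i)) = (\<Sum>i\<le>k. if i = j then d i else 0)"
   by (intro sum.cong) (auto simp: oc)
  then show ?thesis unfolding d ip_sum_right using that by simp
 qed
 have "d j = 0" if "j < k" for j using dj[of j] orth[OF that] that by (simp add: ip_commute)
 then have "(\<Sum>j\<le>k. smult (d j) (chb j)) = smult (d k) (chb k)"
  by (subst sum.mono_neutral_right[of "{..k}" "{k}"]) auto
 then have qk: "q k = smult (d k) (chb k)" using d by simp
 have "1 = ip (q k) (q k)" by (simp add: oq)
 also have "... = ip (q k) (\<Sum>j\<in>{k}. smult (d j) (chb j))" using qk by simp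
 also have "... = d k * ip (chb k) (q k)" unfolding ip_sum_right by (simp add: ip_commute)
 also have "... = d k * d k" by (simp add: dj)
 finally have "d k = 1 \<or> d k = -1" by (metis mult.right_neutral square_eq_1_iff)
 then show ?thesis using qk by auto
qed

section \<open>The rate function in Chebyshev coordinates\<close>

text \<open>The integral of \<open>p\<close> against a signed measure with total mass zero and moments \<open>m\<close>. The mass removes the constant coefficient, and \<open>m (j - 1)\<close> is the moment of order \<open>j\<close>.\<close>
definition mfun :: "rseq => real poly => real" where
 "mfun m p = (\<Sum>j\<in>{1..degree p}. coeff p j * m (j - 1))"

lemma signed_integral_poly:
 assumes "!!k. signed_integrable \<nu> (\<lambda>x. x ^ k)"
 shows "signed_integrable \<nu> (poly p)" "signed_integral \<nu> (poly p) = (\<Sum>j\<le>degree p. coeff p j * moment j \<nu>)"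
proof -
 have i: "integrable (jordan_pos \<nu>) (\<lambda>x. x ^ k)" "integrable (jordan_neg \<nu>) (\<lambda>x. x ^ k)" for k
  using assms[of k] by (auto simp: signed_integrable_def)
 have p: "poly p = (\<lambda>x. \<Sum>j\<le>degree p. coeff p j * x ^ j)" by (simp add: poly_altdef fun_eq_iff)
 show "signed_integrable \<nu> (poly p)" unfolding p signed_integrable_def using i by auto
 show "signed_integral \<nu> (poly p) = (\<Sum>j\<le>degree p. coeff p j * moment j \<nu>)"
  unfolding p signed_integral_def moment_def using i
  by (subst (1 2) Bochner_Integration.integral_sum) (auto simp: sum_subtractf[symmetric] right_diff_distrib[symmetric])
qed

abbreviation rho_part :: "real => real => real measure" where
 "rho_part \<xi> s \<equiv> density lborel (\<lambda>x. ennreal (s * rho_dens \<xi> x))"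

lemma rho_parts:
 shows "finite_measure (rho_part \<xi> s)"
  "integrable (rho_part \<xi> s) (poly r)"
  "(\<integral>x. poly r x \<partial>density lborel (\<lambda>x. ennreal (s * rho_dens \<xi> x))) = (\<integral>x. max 0 (s * rho_dens \<xi> x) * poly r x \<partial>lborel)"
  "A \<in> sets borel ==> measure (rho_part \<xi> s) A = (\<integral>x. max 0 (s * rho_dens \<xi> x) * indicator A x \<partial>lborel)"
  "integrable lborel (\<lambda>x. max 0 (s * rho_dens \<xi> x) * poly r x)"
proof -
 let ?d = "\<lambda>x. max 0 (s * rho_dens \<xi> x)"
 have rm [measurable]: "rho_dens \<xi> \<in> borel_measurable borel" unfolding rho_dens_def by measurable
 have [measurable]: "(\<lambda>x. poly q x) \<in> borel_measurable borel" for q :: "real poly"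
  by (intro borel_measurable_continuous_onI continuous_intros)
 have D: "density lborel (\<lambda>x. ennreal (s * rho_dens \<xi> x)) = density lborel (\<lambda>x. ennreal (?d x))"
  by (intro density_cong) (auto simp: max_def ennreal_neg)
 show i: "integrable lborel (\<lambda>x. ?d x * poly r x)" for r
 proof (rule Bochner_Integration.integrable_bound[where f = "\<lambda>x. s * (rho_dens \<xi> x * poly r x)"])
  show "integrable lborel (\<lambda>x. s * (rho_dens \<xi> x * poly r x))" by (intro integrable_mult_right rho_dens_integral(1))
  show "AE x in lborel. norm (?d x * poly r x) <= norm (s * (rho_dens \<xi> x * poly r x))"
  proof (rule AE_I2)
   fix x
   have "\<bar>?d x\<bar> <= \<bar>s * rho_dens \<xi> x\<bar>" by (simp add: max_def)
   from mult_right_mono[OF this, of "\<bar>poly r x\<bar>"] show "norm (?d x * poly r x) <= norm (s * (rho_dens \<xi> x * poly r x))"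
    by (simp add: abs_mult mult.assoc)
  qed
 qed measurable
 show ip: "integrable (rho_part \<xi> s) (poly r)" for r
  unfolding D by (subst integrable_real_density) (auto intro: i)
 show "(\<integral>x. poly r x \<partial>density lborel (\<lambda>x. ennreal (s * rho_dens \<xi> x))) = (\<integral>x. ?d x * poly r x \<partial>lborel)"
  unfolding D by (rule integral_real_density) auto
 have i1: "integrable lborel ?d" using i[of 1] by simp
 have e: "emeasure (rho_part \<xi> s) A = ennreal (\<integral>x. ?d x * indicator A x \<partial>lborel)" if A [measurable]: "A \<in> sets borel" for A
 proof -
  have "emeasure (rho_part \<xi> s) A = (\<integral>\<^sup>+x. ennreal (?d x * indicator A x) \<partial>lborel)"
   unfolding D by (subst emeasure_density) (auto intro!: nn_integral_cong split: split_indicator)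
  also have "... = ennreal (\<integral>x. ?d x * indicator A x \<partial>lborel)"
   by (rule nn_integral_eq_integral, rule integrable_real_mult_indicator[OF _ i1]) (use that in auto)
  finally show ?thesis .
 qed
 show "finite_measure (rho_part \<xi> s)"
  by (rule finite_measureI) (use e[of UNIV] in simp)
 show "A \<in> sets borel ==> measure (rho_part \<xi> s) A = (\<integral>x. ?d x * indicator A x \<partial>lborel)"
  by (simp add: measure_def e integral_nonneg)
qed

text \<open>Both \<open>\<sigma>\<close> and \<open>\<rho>\<^sub>\<xi>\<close> are differences of finite measures, so \<open>signed_integral_diff\<close> separates the integral. The result depends on \<open>\<sigma>\<close> only through its moments.\<close>
lemma rate_coordinate:
 assumes \<sigma>: "\<sigma> \<in> M0f" "moments \<sigma> = m"
 shows "signed_integral (\<lambda>A. \<sigma> A - rho \<xi> A) (poly p) = mfun m p - (\<integral>x. rho_dens \<xi> x * poly p x \<partial>lborel)"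
proof -
 have s: "signed_measure \<sigma>" and fin0: "emeasure (jordan_pos \<sigma>) UNIV + emeasure (jordan_neg \<sigma>) UNIV < \<infinity>" and u0: "\<sigma> UNIV = 0"
  and mi: "!!k. signed_integrable \<sigma> (\<lambda>x. x ^ k)" using \<sigma>(1) by (auto simp: M0f_def)
 have fin: "emeasure (jordan_pos \<sigma>) UNIV < \<infinity>" "emeasure (jordan_neg \<sigma>) UNIV < \<infinity>" using fin0 by (auto simp: ennreal_add_less_top)
 let ?P = "jordan_pos \<sigma>" and ?N = "jordan_neg \<sigma>"
 have sN: "sets ?N = sets borel" "space ?N = UNIV" by (simp_all add: jordan_neg_def)
 have fP: "finite_measure ?P" and fN: "finite_measure ?N" using fin sN by (auto intro!: finite_measureI)
 define R where "R s = density lborel (\<lambda>x. ennreal (s * rho_dens \<xi> x))" for s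
 have sR: "sets (R s) = sets borel" for s by (simp add: R_def)
 note RP = rho_parts[where \<xi> = \<xi>, folded R_def]
 have mm: "max 0 (1 * x) - max 0 ((-1) * x) = x" for x :: real by (simp add: max_def)
 have rho_eq: "rho \<xi> A = measure (R 1) A - measure (R (-1)) A" if A: "A \<in> sets borel" for A
 proof -
  have ii: "integrable lborel (\<lambda>x. max 0 (s * rho_dens \<xi> x) * indicator A x)" for s
   by (rule integrable_real_mult_indicator) (use A RP(5)[of s 1] in auto)
  have "rho \<xi> A = (\<integral>x. max 0 (1 * rho_dens \<xi> x) * indicator A x - max 0 ((-1) * rho_dens \<xi> x) * indicator A x \<partial>lborel)"
   unfolding rho_def left_diff_distrib[symmetric] mm by (simp add: rho_dens_def mult.commute)
  also have "... = measure (R 1) A - measure (R (-1)) A"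
   unfolding RP(4)[OF A] by (rule Bochner_Integration.integral_diff[OF ii ii])
  finally show ?thesis .
 qed
 have ip: "integrable ?P (poly p)" "integrable ?N (poly p)" using signed_integral_poly(1)[OF mi, of p] by (auto simp: signed_integrable_def)
 have "signed_integral (\<lambda>A. \<sigma> A - rho \<xi> A) (poly p) = (\<integral>x. poly p x \<partial>madd ?P (R (-1))) - (\<integral>x. poly p x \<partial>madd ?N (R 1))"
 proof (rule signed_integral_diff(3))
  show "finite_measure (madd ?P (R (-1)))" "finite_measure (madd ?N (R 1))"
   by (intro finite_measure_madd(1) fP fN RP(1); simp add: sR sN)+
  show "integrable (madd ?P (R (-1))) (poly p)" "integrable (madd ?N (R 1)) (poly p)"
   by (intro integral_madd(1) ip RP(2); simp add: sR sN)+
  show "\<sigma> A - rho \<xi> A = measure (madd ?P (R (-1))) A - measure (madd ?N (R 1)) A" if A: "A \<in> sets borel" for A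
   using finite_measure_madd(2)[OF _ sR fP RP(1) A, of "-1"] finite_measure_madd(2)[OF sN(1) sR fN RP(1) A, of 1]
   by (simp add: jordan_decomposition[OF s fin A] rho_eq[OF A])
 qed simp_all
 also have "... = signed_integral \<sigma> (poly p) - ((\<integral>x. poly p x \<partial>R 1) - (\<integral>x. poly p x \<partial>R (-1)))"
  using integral_madd(2)[OF _ sR ip(1) RP(2), of "-1"] integral_madd(2)[OF sN(1) sR ip(2) RP(2), of 1]
  by (simp add: signed_integral_def)
 also have "(\<integral>x. poly p x \<partial>R 1) - (\<integral>x. poly p x \<partial>R (-1)) = (\<integral>x. rho_dens \<xi> x * poly p x \<partial>lborel)"
  unfolding RP(3) by (subst Bochner_Integration.integral_diff[OF RP(5) RP(5), symmetric]) (simp only: left_diff_distrib[symmetric] mm)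
 also have "signed_integral \<sigma> (poly p) = mfun m p"
 proof -
  have m0: "moment 0 \<sigma> = 0"
  proof -
   have "moment 0 \<sigma> = measure ?P UNIV - measure ?N UNIV" by (simp add: moment_def signed_integral_def sN)
   then show ?thesis using jordan_decomposition[OF s fin, of UNIV] u0 by simp
  qed
  have mk: "moment j \<sigma> = m (j - 1)" if "j \<in> {1..degree p}" for j
   using fun_cong[OF \<sigma>(2), of "j - 1"] that by (simp add: moments_def)
  have "{..degree p} = insert 0 {1..degree p}" by auto
  then have "(\<Sum>j\<le>degree p. coeff p j * moment j \<sigma>) = (\<Sum>j\<in>{1..degree p}. coeff p j * moment j \<sigma>)"
   using m0 by simp
  then show ?thesis unfolding signed_integral_poly(2)[OF mi] mfun_def using mk by simp
 qed
 finally show ?thesis .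
qed

section \<open>Moments of the rescaled signed measures\<close>

lemma discrete_measure:
 fixes x v :: rseq
 assumes v: "!!i. i \<in> {1..n} ==> v i >= 0"
 defines "D \<equiv> distr (density (count_space {1..n}) (\<lambda>i. ennreal (v i))) borel x"
 shows "sets D = sets borel" "finite_measure D" "A \<in> sets borel ==> measure D A = (\<Sum>i\<in>{1..n}. v i * indicator A (x i))"
  "f \<in> borel_measurable borel ==> integrable D f" "f \<in> borel_measurable borel ==> (\<integral>y. f y \<partial>D) = (\<Sum>i\<in>{1..n}. v i * f (x i) :: real)"
proof -
 show "sets D = sets borel" by (simp add: D_def)
 have xm: "x \<in> density (count_space {1..n}) (\<lambda>i. ennreal (v i)) \<rightarrow>\<^sub>M borel" by simp
 have e: "emeasure D A = ennreal (\<Sum>i\<in>{1..n}. v i * indicator A (x i))" if A: "A \<in> sets borel" for A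
 proof -
  have "emeasure D A = (\<integral>\<^sup>+i. ennreal (v i) * indicator (x -` A \<inter> {1..n}) i \<partial>count_space {1..n})"
   unfolding D_def by (subst emeasure_distr[OF xm]) (use A in \<open>auto simp: emeasure_density\<close>)
  also have "... = (\<Sum>i\<in>{1..n}. ennreal (v i * indicator A (x i)))"
  proof -
   have "(\<integral>\<^sup>+i. ennreal (v i) * indicator (x -` A \<inter> {1..n}) i \<partial>count_space {1..n}) = (\<Sum>i\<in>{1..n}. ennreal (v i) * indicator (x -` A \<inter> {1..n}) i)"
    by (rule nn_integral_count_space_finite) simp
   also have "... = (\<Sum>i\<in>{1..n}. ennreal (v i * indicator A (x i)))"
    by (rule sum.cong) (auto split: split_indicator)
   finally show ?thesis .
  qed
  also have "... = ennreal (\<Sum>i\<in>{1..n}. v i * indicator A (x i))" using v by (intro sum_ennreal) auto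
  finally show ?thesis .
 qed
 show "finite_measure D"
 proof (rule finite_measureI)
  have "space D = UNIV" by (simp add: D_def)
  then show "emeasure D (space D) ~= \<infinity>" by (simp add: e[of UNIV])
 qed
 show "A \<in> sets borel ==> measure D A = (\<Sum>i\<in>{1..n}. v i * indicator A (x i))"
  by (simp only: measure_def e) (rule enn2real_ennreal, rule sum_nonneg, simp add: v)
 show "f \<in> borel_measurable borel ==> integrable D f"
  unfolding D_def using v
  by (subst integrable_distr_eq[OF xm]) (auto simp: integrable_real_density integrable_count_space AE_count_space)
 show "f \<in> borel_measurable borel ==> (\<integral>y. f y \<partial>D) = (\<Sum>i\<in>{1..n}. v i * f (x i))"
  unfolding D_def using v
  by (subst integral_distr[OF xm]) (auto simp: integral_real_density AE_count_space lebesgue_integral_count_space_finite)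
qed

text \<open>The weights are nonnegative only almost surely, so the spectral measure is treated as a difference of two discrete measures; the formula then holds at every sample point.\<close>
lemma moment_nu:
 "moment k (nu \<beta> g b n l w) = sqrt (real n * \<beta> / (2 * b)) *
   ((\<Sum>i\<in>{1..n}. w i * rescale \<beta> g n (l i) ^ k) - (\<integral>x. x ^ k \<partial>semicircle))" if cn: "real n * \<beta> / (2 * b) >= 0"
proof -
 define c where "c = sqrt (real n * \<beta> / (2 * b))"
 have c: "c >= 0" using cn by (simp add: c_def)
 let ?x = "\<lambda>i. rescale \<beta> g n (l i)"
 define D where "D s = distr (density (count_space {1..n}) (\<lambda>i. ennreal (c * max 0 (s * w i)))) borel ?x" for s
 have vs: "c * max 0 (s * w i) >= 0" for s i using c by simp
 note DM = discrete_measure[where x = ?x and n = n and v = "\<lambda>i. c * max 0 (s * w i)" for s, OF vs, folded D_def]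
 define S where "S = density semicircle (\<lambda>_. ennreal c)"
 have ss: "sets semicircle = sets borel" "space semicircle = UNIV" by (simp_all add: semicircle_def)
 have pw: "(\<lambda>x::real. x ^ k) = poly (monom (1::real) k)" for k :: nat by (rule ext) (simp add: poly_monom)
 have isc: "integrable semicircle (\<lambda>x. x ^ k)" for k :: nat unfolding pw by (rule semicircle_integral(1))
 have fsc: "finite_measure semicircle"
  using isc[of 0] by (intro finite_measureI) (simp add: integrable_iff_bounded ss less_top)
 interpret sc: finite_measure semicircle by fact
 have sS: "sets S = sets borel" by (simp add: S_def ss)
 have mS: "emeasure S A = ennreal (c * measure semicircle A)" if "A \<in> sets borel" for A
  using that c by (simp add: S_def emeasure_density_const ss sc.emeasure_eq_measure ennreal_mult)
 have fS: "finite_measure S" proof (rule finite_measureI)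
  have "space S = UNIV" by (simp add: S_def ss)
  then show "emeasure S (space S) ~= \<infinity>" by (simp add: mS[of UNIV])
 qed
 have mS2: "measure S A = c * measure semicircle A" if "A \<in> sets borel" for A using mS[OF that] c by (simp add: measure_def)
 have iS: "integrable S (\<lambda>x. x ^ k)" "(\<integral>x. x ^ k \<partial>S) = c * (\<integral>x. x ^ k \<partial>semicircle)" for k :: nat
 proof -
  have m: "(\<lambda>x::real. x ^ k) \<in> borel_measurable semicircle" using isc[of k] by (rule borel_measurable_integrable)
  show "integrable S (\<lambda>x. x ^ k)" unfolding S_def by (subst integrable_real_density) (use m c isc[of k] in auto)
  show "(\<integral>x. x ^ k \<partial>S) = c * (\<integral>x. x ^ k \<partial>semicircle)" unfolding S_def by (subst integral_real_density) (use m c in auto)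
 qed
 have mm: "c * max 0 (1 * x) - c * max 0 ((-1) * x) = c * x" for x :: real by (simp add: max_def)
 have "signed_integral (nu \<beta> g b n l w) (\<lambda>x. x ^ k) = (\<integral>x. x ^ k \<partial>D 1) - (\<integral>x. x ^ k \<partial>madd (D (-1)) S)"
 proof (rule signed_integral_diff(3))
  show "finite_measure (D 1)" by (rule DM(2))
  show "sets (D 1) = sets borel" by (rule DM(1))
  show "finite_measure (madd (D (-1)) S)" by (rule finite_measure_madd(1)[OF DM(1) sS DM(2) fS])
  show "integrable (D 1) (\<lambda>x. x ^ k)" by (rule DM(4)) simp
  show "integrable (madd (D (-1)) S) (\<lambda>x. x ^ k)" by (rule integral_madd(1)[OF DM(1) sS DM(4) iS(1)]) simp
  show "nu \<beta> g b n l w A = measure (D 1) A - measure (madd (D (-1)) S) A" if A: "A \<in> sets borel" for A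
  proof -
   have "measure (D 1) A - measure (D (-1)) A = (\<Sum>i\<in>{1..n}. (c * max 0 (1 * w i) - c * max 0 ((-1) * w i)) * indicator A (?x i))"
    unfolding DM(3)[OF A] sum_subtractf[symmetric] left_diff_distrib ..
   also have "... = c * spectral_measure \<beta> g n l w A" unfolding mm spectral_measure_def by (simp only: sum_distrib_left mult.assoc)
   finally show ?thesis
    unfolding finite_measure_madd(2)[OF DM(1) sS DM(2) fS A] mS2[OF A] nu_def c_def[symmetric] by (simp add: right_diff_distrib)
  qed
 qed simp
 also have "... = (\<integral>x. x ^ k \<partial>D 1) - ((\<integral>x. x ^ k \<partial>D (-1)) + c * (\<integral>x. x ^ k \<partial>semicircle))"
  using integral_madd(2)[OF DM(1) sS DM(4) iS(1), of k "-1"] by (simp add: iS(2))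
 also have "(\<integral>x. x ^ k \<partial>D 1) - ((\<integral>x. x ^ k \<partial>D (-1)) + z) = (\<Sum>i\<in>{1..n}. (c * max 0 (1 * w i) - c * max 0 ((-1) * w i)) * ?x i ^ k) - z" for z
  using DM(5)[of "\<lambda>x. x ^ k"] by (simp add: sum_subtractf left_diff_distrib)
 finally show ?thesis unfolding mm moment_def c_def[symmetric] by (simp add: sum_distrib_left right_diff_distrib mult.assoc)
qed

section \<open>Laplace asymptotics of the gamma factors\<close>

text \<open>The exponent of the density of \<open>t\<close> if \<open>2 k (1 + sqrt (b / k) t)\<close> has the gamma law with shape \<open>k - c\<close>; it has no constant term.\<close>
definition gexp :: "real => real => real => real => real" where
 "gexp k b c t = (k - c - 1) * ln (1 + sqrt (b / k) * t) - k * sqrt (b / k) * t"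

definition fdens :: "real => real => real => real => real" where
 "fdens k b c t = (if 0 < 1 + sqrt (b / k) * t then exp (gexp k b c t) else 0)"

definition tlaw :: "real => real => real => real measure" where
 "tlaw k b a = distr (density lborel (\<lambda>y. ennreal (gdens a y) / gnorm a)) borel (\<lambda>y. (y - 2 * k) / (2 * sqrt (k * b)))"

lemma fdens_measurable [measurable]: "fdens k b c \<in> borel_measurable borel"
 unfolding fdens_def gexp_def by measurable

lemma fdens_nonneg: "fdens k b c t >= 0" by (simp add: fdens_def)

lemma sets_tlaw [simp]: "sets (tlaw k b a) = sets borel" "space (tlaw k b a) = UNIV" by (simp_all add: tlaw_def)

lemma gdens_fdens:
 assumes "k > 0" "b > 0"
 shows "gdens (k - c) (2 * k + 2 * sqrt (k * b) * t) = (2 * k) powr (k - c - 1) * exp (- k) * fdens k b c t"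
proof -
 let ?u = "1 + sqrt (b / k) * t"
 have s: "sqrt (k * b) = k * sqrt (b / k)"
 proof -
  have "k * b = k\<^sup>2 * (b / k)" using assms by (simp add: power2_eq_square)
  then show ?thesis using assms by (simp only: real_sqrt_mult) simp
 qed
 have e: "2 * k + 2 * sqrt (k * b) * t = (2 * k) * ?u" unfolding s by (simp only: distrib_left mult_1_right mult_ac)
 show ?thesis
 proof (cases "?u > 0")
  case True
  have "(2 * k * ?u) powr (k - c - 1) = (2 * k) powr (k - c - 1) * ?u powr (k - c - 1)" by (simp only: powr_mult)
  moreover have "?u powr (k - c - 1) = exp ((k - c - 1) * ln ?u)" using True by (simp add: powr_def)
  moreover have "exp (- (2 * k * ?u) / 2) = exp (- k) * exp (- (k * sqrt (b / k) * t))"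
  proof -
   have "- (2 * k * (1 + w)) / 2 = - k + - (k * w)" for w by (simp add: field_simps)
   from this[of "sqrt (b / k) * t"] show ?thesis by (simp only: exp_add mult.assoc)
  qed
  moreover have "2 * k * ?u > 0" using True assms by simp
  moreover have "exp (gexp k b c t) = exp ((k - c - 1) * ln ?u) * exp (- (k * sqrt (b / k) * t))"
   by (simp add: gexp_def exp_add [symmetric])
  ultimately show ?thesis using True unfolding gdens_def fdens_def e by (simp only: if_True mult_ac)
 next
  case False
  then have "~ 2 * k * ?u > 0" using assms by (simp add: zero_less_mult_iff)
  then show ?thesis using False unfolding gdens_def fdens_def e by simp
 qed
qed

lemma ennreal_divide_cancel:
 fixes x y s :: ennreal assumes "s ~= 0" "s ~= \<infinity>" shows "(s * x) / (s * y) = x / y"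
 using assms ennreal_divide_times by (metis ennreal_mult_divide_eq ennreal_times_divide infinity_ennreal_def mult.commute divide_mult_eq mult_divide_eq_ennreal top.extremum_unique)

lemma nn_integral_tlaw:
 assumes k: "k > 0" "b > 0" and f: "f \<in> borel_measurable borel"
 shows "(\<integral>\<^sup>+t. f t \<partial>tlaw k b (k - c)) = (\<integral>\<^sup>+t. ennreal (fdens k b c t) * f t \<partial>lborel) / (\<integral>\<^sup>+t. ennreal (fdens k b c t) \<partial>lborel)"
proof -
 let ?s = "2 * sqrt (k * b)" and ?a = "k - c"
 let ?K = "ennreal (?s * ((2 * k) powr (?a - 1) * exp (- k)))"
 have s: "?s > 0" using k by simp
 have K: "?K ~= 0" "?K ~= \<infinity>" using s k by simp_all
 have t: "(2 * k + ?s * t - 2 * k) / ?s = t" for t using s by (simp only: add_diff_cancel_left' nonzero_mult_div_cancel_left less_imp_neq[THEN not_sym] simp_thms)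
 have *: "(\<integral>\<^sup>+y. ennreal (gdens ?a y) * g ((y - 2 * k) / ?s) \<partial>lborel) = ?K * (\<integral>\<^sup>+t. ennreal (fdens k b c t) * g t \<partial>lborel)"
  if g [measurable]: "g \<in> borel_measurable borel" for g
 proof -
  have "(\<integral>\<^sup>+y. ennreal (gdens ?a y) * g ((y - 2 * k) / ?s) \<partial>lborel)
    = ennreal \<bar>?s\<bar> * (\<integral>\<^sup>+t. ennreal (gdens ?a (2 * k + ?s * t)) * g ((2 * k + ?s * t - 2 * k) / ?s) \<partial>lborel)"
   by (rule nn_integral_real_affine) (use s in \<open>auto\<close>)
  also have "(\<lambda>t. ennreal (gdens ?a (2 * k + ?s * t)) * g ((2 * k + ?s * t - 2 * k) / ?s))
    = (\<lambda>t. ennreal ((2 * k) powr (?a - 1) * exp (- k)) * (ennreal (fdens k b c t) * g t))"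
   unfolding t gdens_fdens[OF k] by (rule ext) (simp add: ennreal_mult fdens_nonneg mult.assoc)
  also have "(\<integral>\<^sup>+t. ... t \<partial>lborel) = ennreal ((2 * k) powr (?a - 1) * exp (- k)) * (\<integral>\<^sup>+t. ennreal (fdens k b c t) * g t \<partial>lborel)"
   by (rule nn_integral_cmult) simp
  also have "ennreal \<bar>?s\<bar> * (ennreal ((2 * k) powr (?a - 1) * exp (- k)) * (\<integral>\<^sup>+t. ennreal (fdens k b c t) * g t \<partial>lborel))
    = ?K * (\<integral>\<^sup>+t. ennreal (fdens k b c t) * g t \<partial>lborel)"
   using s by (simp add: ennreal_mult mult.assoc)
  finally show ?thesis .
 qed
 note f[measurable]
 have "(\<integral>\<^sup>+t. f t \<partial>tlaw k b ?a) = (\<integral>\<^sup>+y. ennreal (gdens ?a y) / gnorm ?a * f ((y - 2 * k) / ?s) \<partial>lborel)"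
  unfolding tlaw_def by (subst nn_integral_distr) (auto simp: nn_integral_density)
 also have "... = (\<integral>\<^sup>+y. inverse (gnorm ?a) * (ennreal (gdens ?a y) * f ((y - 2 * k) / ?s)) \<partial>lborel)"
  by (simp add: divide_ennreal_def mult_ac)
 also have "... = (\<integral>\<^sup>+y. (ennreal (gdens ?a y) * f ((y - 2 * k) / ?s)) \<partial>lborel) / gnorm ?a"
  by (subst nn_integral_cmult) (auto simp: divide_ennreal_def mult_ac)
 also have "gnorm ?a = (\<integral>\<^sup>+y. ennreal (gdens ?a y) * (\<lambda>_. 1) ((y - 2 * k) / ?s) \<partial>lborel)" by (simp add: gnorm_def)
 finally show ?thesis by (simp only: *[OF f] *[of "\<lambda>_. 1", simplified] borel_measurable_const ennreal_divide_cancel[OF K] mult_1_right)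
qed

lemma ln_second_order:
 fixes u :: real assumes "\<bar>u\<bar> <= 1/2" shows "\<bar>ln (1 + u) - u + u\<^sup>2 / 2\<bar> <= 2 * \<bar>u\<bar> ^ 3"
proof -
 define g where "g = (\<lambda>x::real. ln (1 + x) - x + x\<^sup>2 / 2)"
 have d: "(g has_field_derivative (x\<^sup>2 / (1 + x))) (at x within {- \<bar>u\<bar>..\<bar>u\<bar>})" if "x \<in> {- \<bar>u\<bar>..\<bar>u\<bar>}" for x
 proof -
  have p: "1 + x > 0" using that assms by auto
  have "(g has_field_derivative (1 / (1 + x) - 1 + x)) (at x within {- \<bar>u\<bar>..\<bar>u\<bar>})"
   unfolding g_def using p by (auto intro!: derivative_eq_intros simp: field_simps)
  moreover have "1 / (1 + x) - 1 + x = x\<^sup>2 / (1 + x)" using p by (simp add: field_simps power2_eq_square)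
  ultimately show ?thesis by simp
 qed
 have bd: "norm (x\<^sup>2 / (1 + x)) <= 2 * u\<^sup>2" if "x \<in> {- \<bar>u\<bar>..\<bar>u\<bar>}" for x
 proof -
  have p: "1 + x >= 1/2" using that assms by auto
  have "x\<^sup>2 <= u\<^sup>2" using that by (simp add: abs_le_square_iff [symmetric] abs_le_iff)
  moreover have "x\<^sup>2 / (1 + x) <= x\<^sup>2 / (1/2)" using p by (intro divide_left_mono) auto
  ultimately show ?thesis using p by simp
 qed
 have "norm (g u - g 0) <= 2 * u\<^sup>2 * norm (u - 0)"
  by (rule field_differentiable_bound[where S = "{- \<bar>u\<bar>..\<bar>u\<bar>}", OF _ d bd]) auto
 then show ?thesis by (simp add: g_def power3_eq_cube power2_eq_square abs_mult)
qed

text \<open>Second order expansion of the logarithm: the linear terms cancel except for one of order \<open>1\<close>, and the quadratic term is exactly \<open>- b t\<^sup>2 / 2\<close>.\<close>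
lemma gexp_local:
 assumes k: "k > 0" "b > 0" and t: "\<bar>t\<bar> <= R" and R: "sqrt (b / k) * R <= 1/2"
 shows "\<bar>gexp k b c t + b * t\<^sup>2 / 2\<bar> <= 2 * b * sqrt (b / k) * R ^ 3 + \<bar>c + 1\<bar>" "1 + sqrt (b / k) * t > 0"
proof -
 define e where "e = sqrt (b / k)"
 define u where "u = e * t"
 have e: "e > 0" "k * e\<^sup>2 = b" using k by (simp_all add: e_def)
 have au: "\<bar>u\<bar> <= e * R" using t e by (simp add: u_def abs_mult)
 then have u: "\<bar>u\<bar> <= 1/2" using R by (simp add: e_def)
 show "1 + sqrt (b / k) * t > 0" using u unfolding u_def e_def by linarith
 have "b * t\<^sup>2 = k * u\<^sup>2" using e(2) by (simp add: u_def power_mult_distrib)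
 then have 1: "gexp k b c t + b * t\<^sup>2 / 2 = k * (ln (1 + u) - u + u\<^sup>2 / 2) - (c + 1) * ln (1 + u)"
  unfolding gexp_def e_def[symmetric] mult.assoc[of k e t] u_def[symmetric] by (simp add: algebra_simps)
 have "\<bar>u\<bar> ^ 3 <= (e * R) ^ 3" by (rule power_mono[OF au]) simp
 then have "k * (2 * \<bar>u\<bar> ^ 3) <= k * (2 * (e * R) ^ 3)" using k by simp
 also have "... = 2 * (k * e\<^sup>2) * e * R ^ 3" by (simp add: power_mult_distrib power2_eq_square power3_eq_cube)
 also have "... = 2 * b * e * R ^ 3" by (simp only: e(2))
 finally have f: "k * (2 * \<bar>u\<bar> ^ 3) <= 2 * b * e * R ^ 3" .
 have "\<bar>k * (ln (1 + u) - u + u\<^sup>2 / 2)\<bar> = k * \<bar>ln (1 + u) - u + u\<^sup>2 / 2\<bar>" using k by (simp only: abs_mult abs_of_pos)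
 also have "... <= k * (2 * \<bar>u\<bar> ^ 3)" by (rule mult_left_mono[OF ln_second_order[OF u]]) (use k in simp)
 also note f
 finally have 2: "\<bar>k * (ln (1 + u) - u + u\<^sup>2 / 2)\<bar> <= 2 * b * e * R ^ 3" .
 have "\<bar>ln (1 + u) - u\<bar> <= 2 * u\<^sup>2" by (rule abs_ln_one_plus_x_minus_x_bound[OF u])
 moreover have "u\<^sup>2 <= (1/2) * \<bar>u\<bar>" using mult_right_mono[OF u, of "\<bar>u\<bar>"] by (simp add: power2_eq_square)
 ultimately have "\<bar>ln (1 + u)\<bar> <= 1" using u by linarith
 then have "\<bar>c + 1\<bar> * \<bar>ln (1 + u)\<bar> <= \<bar>c + 1\<bar> * 1" by (intro mult_left_mono) auto
 then have "\<bar>(c + 1) * ln (1 + u)\<bar> <= \<bar>c + 1\<bar>" by (simp add: abs_mult)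
 with 2 show "\<bar>gexp k b c t + b * t\<^sup>2 / 2\<bar> <= 2 * b * sqrt (b / k) * R ^ 3 + \<bar>c + 1\<bar>"
  unfolding 1 e_def[symmetric] by linarith
qed

text \<open>The exponent is concave and vanishes at the origin, so beyond \<open>R\<close> it lies below the chord through the origin, whose slope is controlled by \<open>gexp_local\<close>.\<close>
lemma gexp_tail:
 assumes k: "k > 0" "b > 0" "k >= c + 1" and R: "R > 0" "sqrt (b / k) * R <= 1/2" "2 * b * sqrt (b / k) * R ^ 3 + \<bar>c + 1\<bar> <= b * R\<^sup>2 / 4"
  and t: "\<bar>t\<bar> >= R" "1 + sqrt (b / k) * t > 0"
 shows "gexp k b c t <= - (b * R / 4) * \<bar>t\<bar>"
proof -
 define e where "e = sqrt (b / k)"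
 \<comment> \<open>The point \<open>s t\<close> has modulus \<open>R\<close> and lies between the origin and \<open>t\<close>.\<close>
 define s where "s = R / \<bar>t\<bar>"
 have s: "0 < s" "s <= 1" using R t by (simp_all add: s_def)
 have st: "\<bar>s * t\<bar> = R" using R t by (simp add: s_def abs_mult)
 have "ln ((1 - s) *\<^sub>R 1 + s *\<^sub>R (1 + e * t)) >= (1 - s) * ln 1 + s * ln (1 + e * t)"
  by (rule concave_onD[OF ln_concave]) (use s t in \<open>auto simp: e_def\<close>)
 then have l: "s * ln (1 + e * t) <= ln (1 + e * (s * t))" by (simp add: algebra_simps)
 have "s * gexp k b c t <= gexp k b c (s * t)"
 proof -
  have "(k - c - 1) * (s * ln (1 + e * t)) <= (k - c - 1) * ln (1 + e * (s * t))" using l k by (intro mult_left_mono) auto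
  then show ?thesis by (simp add: gexp_def e_def algebra_simps)
 qed
 also have "... <= - (b * (s * t)\<^sup>2 / 2) + b * R\<^sup>2 / 4"
  using gexp_local(1)[OF k(1,2) eq_refl[OF st] R(2), of c] R(3) by linarith
 also have "(s * t)\<^sup>2 = R\<^sup>2" using st by (metis power2_abs)
 finally have "s * gexp k b c t <= - (b * R\<^sup>2 / 4)" by simp
 also have "... = s * (- (b * R / 4) * \<bar>t\<bar>)" using R t by (simp add: s_def power2_eq_square)
 finally show ?thesis using s by (simp only: mult_le_cancel_left_pos)
qed

lemma nn_integral_exp_tail:
 fixes a R :: real assumes "a > 0"
 shows "(\<integral>\<^sup>+t. ennreal (exp (- a * \<bar>t\<bar>)) * indicator {t. R < \<bar>t\<bar>} t \<partial>lborel) <= ennreal (2 / a * exp (- a * R))"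
proof -
 have 1: "(\<integral>\<^sup>+t. ennreal (exp (- a * t)) * indicator {R..} t \<partial>lborel) = ennreal (0 - (- exp (- a * R) / a))"
 proof (rule nn_integral_FTC_atLeast)
  show "((\<lambda>t. - exp (- a * t) / a) has_real_derivative exp (- a * t)) (at t)" for t
   using assms by (auto intro!: derivative_eq_intros)
  show "((\<lambda>t. - exp (- a * t) / a) \<longlongrightarrow> 0) at_top"
   using assms by real_asymp
 qed auto
 have 2: "(\<integral>\<^sup>+t. ennreal (exp (a * t)) * indicator {..-R} t \<partial>lborel) = (\<integral>\<^sup>+t. ennreal (exp (- a * t)) * indicator {R..} t \<partial>lborel)"
  using nn_integral_real_affine[of "\<lambda>t. ennreal (exp (a * t)) * indicator {..-R} t" "-1" 0]
  by (auto simp: indicator_def intro!: nn_integral_cong)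
 have "(\<integral>\<^sup>+t. ennreal (exp (- a * \<bar>t\<bar>)) * indicator {t. R < \<bar>t\<bar>} t \<partial>lborel)
   <= (\<integral>\<^sup>+t. ennreal (exp (- a * t)) * indicator {R..} t + ennreal (exp (a * t)) * indicator {..-R} t \<partial>lborel)"
  by (intro nn_integral_mono) (auto split: split_indicator simp: abs_if)
 also have "... = (\<integral>\<^sup>+t. ennreal (exp (- a * t)) * indicator {R..} t \<partial>lborel) + (\<integral>\<^sup>+t. ennreal (exp (a * t)) * indicator {..-R} t \<partial>lborel)"
  by (rule nn_integral_add) auto
 also have "... = ennreal (2 / a * exp (- a * R))"
  unfolding 2 1 using assms by (simp flip: ennreal_plus)
 finally show ?thesis .
qed

locale gamma_scaling =
 fixes k b :: rseq and c :: real
 assumes k_lim: "filterlim k at_top sequentially" and b_lim: "filterlim b at_top sequentially"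
  and bk_lim: "(\<lambda>n. b n / k n) \<longlonglongrightarrow> 0"
begin

lemma ev_pos: "eventually (\<lambda>n. k n > 0 & b n > 0 & k n >= c + 1) sequentially"
 using filterlim_at_top_dense[THEN iffD1, OF k_lim, rule_format, of 0] filterlim_at_top_dense[THEN iffD1, OF b_lim, rule_format, of 0]
  filterlim_at_top[THEN iffD1, OF k_lim, rule_format, of "c + 1"]
 by eventually_elim auto

lemma eps_lim: "(\<lambda>n. sqrt (b n / k n)) \<longlonglongrightarrow> 0"
 using tendsto_real_sqrt[OF bk_lim] by simp

lemma ev_big: "eventually (\<lambda>n. x <= b n * y) sequentially" if "y > 0"
 using filterlim_at_top[THEN iffD1, OF b_lim, rule_format, of "x / y"] by eventually_elim (use that in \<open>simp add: field_simps\<close>)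

lemma ev_local:
 assumes "R > 0" "\<eta> > 0"
 shows "eventually (\<lambda>n. sqrt (b n / k n) * R <= 1/2 & 2 * b n * sqrt (b n / k n) * R ^ 3 + \<bar>c + 1\<bar> <= b n * \<eta>) sequentially"
proof -
 have "(\<lambda>n. sqrt (b n / k n) * R) \<longlonglongrightarrow> 0" using tendsto_mult_right[OF eps_lim, of R] by simp
 then have 1: "eventually (\<lambda>n. sqrt (b n / k n) * R < 1/2) sequentially" by (rule order_tendstoD) simp
 have "(\<lambda>n. sqrt (b n / k n) * (2 * R ^ 3)) \<longlonglongrightarrow> 0" using tendsto_mult_right[OF eps_lim, of "2 * R ^ 3"] by simp
 then have 2: "eventually (\<lambda>n. sqrt (b n / k n) * (2 * R ^ 3) < \<eta> / 2) sequentially" by (rule order_tendstoD) (use assms in simp)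
 have 3: "eventually (\<lambda>n. \<bar>c + 1\<bar> <= b n * (\<eta> / 2)) sequentially" by (rule ev_big) (use assms in simp)
 from 1 2 3 ev_pos show ?thesis
 proof eventually_elim
  case (elim n)
  have "b n * (sqrt (b n / k n) * (2 * R ^ 3)) <= b n * (\<eta> / 2)" using elim by (intro mult_left_mono) auto
  moreover have "2 * b n * sqrt (b n / k n) * R ^ 3 = b n * (sqrt (b n / k n) * (2 * R ^ 3))" by simp
  ultimately have "2 * b n * sqrt (b n / k n) * R ^ 3 + \<bar>c + 1\<bar> <= b n * (\<eta> / 2) + b n * (\<eta> / 2)" using elim by linarith
  moreover have "b n * (\<eta> / 2) + b n * (\<eta> / 2) = b n * \<eta>" by (simp add: field_simps)
  ultimately show ?case using elim by (intro conjI) linarith+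
 qed
qed

abbreviation "F n \<equiv> fdens (k n) (b n) c"

lemma fdens_lower:
 assumes "\<delta> > 0" "\<eta> > 0"
 shows "eventually (\<lambda>n. ennreal (exp (- b n * (x\<^sup>2 / 2 + \<eta>))) <= (\<integral>\<^sup>+t. ennreal (F n t) * indicator {t. \<bar>t - x\<bar> < \<delta>} t \<partial>lborel)) sequentially"
proof -
 define d where "d = min (min \<delta> 1) (\<eta> / (3 * (\<bar>x\<bar> + 1)))"
 have d: "d > 0" "d <= \<delta>" "d <= 1" "d * (\<bar>x\<bar> + 1) <= \<eta> / 3"
 proof -
  show "d > 0" "d <= \<delta>" "d <= 1" using assms by (auto simp: d_def)
  have "d * (\<bar>x\<bar> + 1) <= \<eta> / (3 * (\<bar>x\<bar> + 1)) * (\<bar>x\<bar> + 1)" by (intro mult_right_mono) (auto simp: d_def)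
  also have "... = \<eta> / 3" using abs_ge_zero[of x] by (simp add: divide_simps)
  finally show "d * (\<bar>x\<bar> + 1) <= \<eta> / 3" .
 qed
 have sq: "t\<^sup>2 / 2 <= x\<^sup>2 / 2 + \<eta> / 3" if "\<bar>t - x\<bar> < d" for t
 proof -
  have "t\<^sup>2 - x\<^sup>2 = (t - x) * (2 * x + (t - x))" by (simp add: power2_eq_square algebra_simps)
  also have "... <= \<bar>t - x\<bar> * \<bar>2 * x + (t - x)\<bar>" by (metis abs_mult abs_ge_self)
  also have "... <= d * (2 * (\<bar>x\<bar> + 1))" using that d by (intro mult_mono) auto
  finally show ?thesis using d(4) by linarith
 qed
 have e1: "eventually (\<lambda>n. - ln (2 * d) <= b n * (\<eta> / 3)) sequentially" by (rule ev_big) (use assms in simp)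
 have e2: "eventually (\<lambda>n. sqrt (b n / k n) * (\<bar>x\<bar> + 1) <= 1/2 & 2 * b n * sqrt (b n / k n) * (\<bar>x\<bar> + 1) ^ 3 + \<bar>c + 1\<bar> <= b n * (\<eta> / 3)) sequentially"
  by (rule ev_local) (use assms in auto)
 from e1 e2 ev_pos show ?thesis
 proof eventually_elim
  case (elim n)
  have low: "exp (- b n * (x\<^sup>2 / 2 + 2 * \<eta> / 3)) <= F n t" if t: "\<bar>t - x\<bar> < d" for t
  proof -
   have tR: "\<bar>t\<bar> <= \<bar>x\<bar> + 1" using t d by linarith
   note gl = gexp_local(1)[OF _ _ tR, of "k n" "b n" c] gexp_local(2)[OF _ _ tR, of "k n" "b n"]
   have "b n * (t\<^sup>2 / 2) <= b n * (x\<^sup>2 / 2 + \<eta> / 3)" using sq[OF t] elim by (intro mult_left_mono) auto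
   then have "- b n * (x\<^sup>2 / 2 + 2 * \<eta> / 3) <= gexp (k n) (b n) c t" using gl(1) elim by (auto simp: algebra_simps abs_le_iff)
   then show ?thesis using gl(2) elim by (simp add: fdens_def)
  qed
  have "exp (- b n * (x\<^sup>2 / 2 + \<eta>)) = exp (- b n * (x\<^sup>2 / 2 + 2 * \<eta> / 3)) * exp (- (b n * (\<eta> / 3)))"
   by (simp add: exp_add [symmetric] algebra_simps)
  also have "exp (- (b n * (\<eta> / 3))) <= 2 * d"
  proof -
   have "exp (- (b n * (\<eta> / 3))) <= exp (ln (2 * d))" using elim(1) by simp
   then show ?thesis using d by simp
  qed
  finally have "ennreal (exp (- b n * (x\<^sup>2 / 2 + \<eta>))) <= ennreal (exp (- b n * (x\<^sup>2 / 2 + 2 * \<eta> / 3)) * (2 * d))"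
   by (simp add: ennreal_leI)
  also have "... = (\<integral>\<^sup>+t. ennreal (exp (- b n * (x\<^sup>2 / 2 + 2 * \<eta> / 3))) * indicator {x - d<..<x + d} t \<partial>lborel)"
   using d by (subst nn_integral_cmult_indicator) (auto simp: ennreal_mult)
  also have "... <= (\<integral>\<^sup>+t. ennreal (F n t) * indicator {t. \<bar>t - x\<bar> < \<delta>} t \<partial>lborel)"
  proof (rule nn_integral_mono)
   fix t show "ennreal (exp (- b n * (x\<^sup>2 / 2 + 2 * \<eta> / 3))) * indicator {x - d<..<x + d} t <= ennreal (F n t) * indicator {t. \<bar>t - x\<bar> < \<delta>} t"
   proof (cases "\<bar>t - x\<bar> < d")
    case True
    then show ?thesis using d low[OF True] by (auto simp: indicator_def intro!: ennreal_leI)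
   next
    case False
    then have "t \<notin> {x - d<..<x + d}" by auto
    then show ?thesis by simp
   qed
  qed
  finally show ?case .
 qed
qed

lemma fdens_gauss:
 assumes "R > 0" "\<eta> > 0"
 shows "eventually (\<lambda>n. (\<integral>\<^sup>+t. ennreal (F n t) * (ennreal (exp (b n * t\<^sup>2 / 2)) * indicator {t. \<bar>t\<bar> <= R} t) \<partial>lborel) <= ennreal (exp (b n * \<eta>))) sequentially"
proof -
 have e1: "eventually (\<lambda>n. ln (2 * R) <= b n * (\<eta> / 2)) sequentially" by (rule ev_big) (use assms in simp)
 have e2: "eventually (\<lambda>n. sqrt (b n / k n) * R <= 1/2 & 2 * b n * sqrt (b n / k n) * R ^ 3 + \<bar>c + 1\<bar> <= b n * (\<eta> / 2)) sequentially"
  by (rule ev_local) (use assms in auto)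
 from e1 e2 ev_pos show ?thesis
 proof eventually_elim
  case (elim n)
  have "(\<integral>\<^sup>+t. ennreal (F n t) * (ennreal (exp (b n * t\<^sup>2 / 2)) * indicator {t. \<bar>t\<bar> <= R} t) \<partial>lborel)
    <= (\<integral>\<^sup>+t. ennreal (exp (b n * (\<eta> / 2))) * indicator {-R..R} t \<partial>lborel)"
  proof (rule nn_integral_mono)
   fix t
   show "ennreal (F n t) * (ennreal (exp (b n * t\<^sup>2 / 2)) * indicator {t. \<bar>t\<bar> <= R} t) <= ennreal (exp (b n * (\<eta> / 2))) * indicator {-R..R} t"
   proof (cases "\<bar>t\<bar> <= R")
    case True
    have "F n t * exp (b n * t\<^sup>2 / 2) <= exp (b n * (\<eta> / 2))"
    proof -
     have "gexp (k n) (b n) c t + b n * t\<^sup>2 / 2 <= b n * (\<eta> / 2)"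
      using gexp_local(1)[OF _ _ True, of "k n" "b n" c] elim by linarith
     then show ?thesis by (simp add: fdens_def exp_add [symmetric])
    qed
    then have "ennreal (F n t) * ennreal (exp (b n * t\<^sup>2 / 2)) <= ennreal (exp (b n * (\<eta> / 2)))"
     using fdens_nonneg[of "k n" "b n" c t] by (simp add: ennreal_mult [symmetric] ennreal_leI)
    then show ?thesis using True by (auto simp: indicator_def abs_le_iff)
   qed (auto simp: indicator_def)
  qed
  also have "... = ennreal (exp (b n * (\<eta> / 2)) * (2 * R))"
   using assms by (subst nn_integral_cmult_indicator) (auto simp: ennreal_mult)
  also have "... <= ennreal (exp (b n * (\<eta> / 2)) * exp (b n * (\<eta> / 2)))"
  proof -
   have "2 * R = exp (ln (2 * R))" using assms by simp
   also have "... <= exp (b n * (\<eta> / 2))" using elim(1) by simp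
   finally show ?thesis by (intro ennreal_leI mult_left_mono) auto
  qed
  also have "exp (b n * (\<eta> / 2)) * exp (b n * (\<eta> / 2)) = exp (b n * \<eta>)" by (simp add: exp_add [symmetric])
  finally show ?case .
 qed
qed

lemma fdens_tail:
 assumes "R > 0"
 shows "eventually (\<lambda>n. (\<integral>\<^sup>+t. ennreal (F n t) * indicator {t. R < \<bar>t\<bar>} t \<partial>lborel) <= ennreal (exp (- b n * (R\<^sup>2 / 4)))) sequentially"
proof -
 have e1: "eventually (\<lambda>n. 8 <= b n * R) sequentially" by (rule ev_big) (use assms in simp)
 have e2: "eventually (\<lambda>n. sqrt (b n / k n) * R <= 1/2 & 2 * b n * sqrt (b n / k n) * R ^ 3 + \<bar>c + 1\<bar> <= b n * (R\<^sup>2 / 4)) sequentially"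
  by (rule ev_local) (use assms in auto)
 from e1 e2 ev_pos show ?thesis
 proof eventually_elim
  case (elim n)
  let ?a = "b n * R / 4"
  have a: "?a > 0" using elim assms by simp
  have "(\<integral>\<^sup>+t. ennreal (F n t) * indicator {t. R < \<bar>t\<bar>} t \<partial>lborel) <= (\<integral>\<^sup>+t. ennreal (exp (- ?a * \<bar>t\<bar>)) * indicator {t. R < \<bar>t\<bar>} t \<partial>lborel)"
   using gexp_tail[of "k n" "b n" c R] elim assms
   by (intro nn_integral_mono) (auto split: split_indicator simp: fdens_def intro!: ennreal_leI)
  also have "... <= ennreal (2 / ?a * exp (- ?a * R))" by (rule nn_integral_exp_tail[OF a])
  also have "2 / ?a <= 1" using elim a by (simp add: field_simps)
  then have "ennreal (2 / ?a * exp (- ?a * R)) <= ennreal (1 * exp (- ?a * R))" by (intro ennreal_leI mult_right_mono) auto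
  also have "1 * exp (- ?a * R) = exp (- b n * (R\<^sup>2 / 4))" by (simp add: power2_eq_square)
  finally show ?case .
 qed
qed

text \<open>The normalising constant is subexponential in \<open>b\<close>, so bounds for the unnormalised density carry over to the law.\<close>
lemma fdens_total:
 assumes "\<eta> > 0"
 shows "eventually (\<lambda>n. ennreal (exp (- b n * \<eta>)) <= (\<integral>\<^sup>+t. ennreal (F n t) \<partial>lborel) & (\<integral>\<^sup>+t. ennreal (F n t) \<partial>lborel) <= ennreal (exp (b n * \<eta>))) sequentially"
proof -
 have e1: "eventually (\<lambda>n. ln 2 <= b n * (\<eta> / 2)) sequentially" by (rule ev_big) (use assms in simp)
 have h: "\<eta> / 2 > 0" using assms by simp
 from fdens_lower[OF zero_less_one assms, of 0] fdens_gauss[OF zero_less_one h] fdens_tail[OF zero_less_one] e1 ev_pos show ?thesis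
 proof eventually_elim
  case (elim n)
  have "(\<integral>\<^sup>+t. ennreal (F n t) * indicator {t. \<bar>t - 0\<bar> < 1} t \<partial>lborel) <= (\<integral>\<^sup>+t. ennreal (F n t) \<partial>lborel)"
   by (intro nn_integral_mono) (auto split: split_indicator)
  then have 1: "ennreal (exp (- b n * \<eta>)) <= (\<integral>\<^sup>+t. ennreal (F n t) \<partial>lborel)" using elim(1) by simp
  have "(\<integral>\<^sup>+t. ennreal (F n t) \<partial>lborel) <= (\<integral>\<^sup>+t. ennreal (F n t) * (ennreal (exp (b n * t\<^sup>2 / 2)) * indicator {t. \<bar>t\<bar> <= 1} t)
     + ennreal (F n t) * indicator {t. 1 < \<bar>t\<bar>} t \<partial>lborel)"
  proof (rule nn_integral_mono)
   fix t
   have "1 <= ennreal (exp (b n * t\<^sup>2 / 2))" using elim by (simp add: ennreal_1[symmetric] ennreal_leI del: ennreal_1)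
   then have "ennreal (F n t) * 1 <= ennreal (F n t) * ennreal (exp (b n * t\<^sup>2 / 2))" by (intro mult_left_mono) auto
   then show "ennreal (F n t) <= ennreal (F n t) * (ennreal (exp (b n * t\<^sup>2 / 2)) * indicator {t. \<bar>t\<bar> <= 1} t)
     + ennreal (F n t) * indicator {t. 1 < \<bar>t\<bar>} t" by (auto simp: indicator_def)
  qed
  also have "... = (\<integral>\<^sup>+t. ennreal (F n t) * (ennreal (exp (b n * t\<^sup>2 / 2)) * indicator {t. \<bar>t\<bar> <= 1} t) \<partial>lborel)
    + (\<integral>\<^sup>+t. ennreal (F n t) * indicator {t. 1 < \<bar>t\<bar>} t \<partial>lborel)"
   by (rule nn_integral_add) auto
  also have "... <= ennreal (exp (b n * (\<eta> / 2))) + ennreal (exp (- b n * (1\<^sup>2 / 4)))" by (intro add_mono elim)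
  also have "... = ennreal (exp (b n * (\<eta> / 2)) + exp (- b n * (1\<^sup>2 / 4)))" by (simp add: ennreal_plus)
  also have "... <= ennreal (exp (b n * (\<eta> / 2)) * exp (b n * (\<eta> / 2)))"
  proof -
   have "exp (- b n * (1\<^sup>2 / 4)) <= exp (b n * (\<eta> / 2))" proof -
    have "b n * (\<eta> / 2) >= 0" "b n * (1\<^sup>2 / 4) >= 0" using elim assms by auto
    then show ?thesis by (simp del: power_one)
   qed
   moreover have "2 <= exp (b n * (\<eta> / 2))" using elim(4) by (metis exp_le_cancel_iff exp_ln zero_less_numeral)
   then have "2 * exp (b n * (\<eta> / 2)) <= exp (b n * (\<eta> / 2)) * exp (b n * (\<eta> / 2))" by (intro mult_right_mono) auto
   ultimately show ?thesis by (intro ennreal_leI) linarith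
  qed
  also have "exp (b n * (\<eta> / 2)) * exp (b n * (\<eta> / 2)) = exp (b n * \<eta>)" by (simp add: exp_add [symmetric])
  finally show ?case using 1 by simp
 qed
qed

abbreviation "T n \<equiv> tlaw (k n) (b n) (k n - c)"

lemma ennreal_inverse_anti: "x <= y ==> inverse y <= inverse (x :: ennreal)"
 by (simp add: less_eq_ennreal.rep_eq inverse_ennreal.rep_eq ereal_inverse_antimono)

lemma ennreal_divide_exp_le:
 fixes X Z :: ennreal assumes "X <= ennreal (exp u)" "ennreal (exp v) <= Z" shows "X / Z <= ennreal (exp (u - v))"
proof -
 have "X / Z <= ennreal (exp u) / ennreal (exp v)" using assms by (simp add: divide_ennreal_def mult_mono ennreal_inverse_anti)
 also have "... = ennreal (exp (u - v))" by (simp add: divide_ennreal exp_diff)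
 finally show ?thesis .
qed

lemma ennreal_divide_exp_ge:
 fixes X Z :: ennreal assumes "ennreal (exp u) <= X" "Z <= ennreal (exp v)" shows "ennreal (exp (u - v)) <= X / Z"
proof -
 have "ennreal (exp u) / ennreal (exp v) <= X / Z" using assms by (simp add: divide_ennreal_def mult_mono ennreal_inverse_anti)
 then show ?thesis by (simp add: divide_ennreal exp_diff)
qed

lemma tlaw_lower:
 assumes "\<delta> > 0" "\<eta> > 0"
 shows "eventually (\<lambda>n. ennreal (exp (- b n * (x\<^sup>2 / 2 + \<eta>))) <= (\<integral>\<^sup>+t. indicator {t. \<bar>t - x\<bar> < \<delta>} t \<partial>T n)) sequentially"
proof -
 have h: "\<eta> / 2 > 0" using assms by simp
 from fdens_lower[OF assms(1) h, of x] fdens_total[OF h] ev_pos show ?thesis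
 proof eventually_elim
  case (elim n)
  have "ennreal (exp (- b n * (x\<^sup>2 / 2 + \<eta> / 2) - b n * (\<eta> / 2))) <= (\<integral>\<^sup>+t. indicator {t. \<bar>t - x\<bar> < \<delta>} t \<partial>T n)"
   using elim by (subst nn_integral_tlaw) (auto intro!: ennreal_divide_exp_ge)
  then show ?case by (simp add: algebra_simps)
 qed
qed

lemma tlaw_gauss:
 assumes "R > 0" "\<eta> > 0"
 shows "eventually (\<lambda>n. (\<integral>\<^sup>+t. ennreal (exp (b n * t\<^sup>2 / 2)) * indicator {t. \<bar>t\<bar> <= R} t \<partial>T n) <= ennreal (exp (b n * \<eta>))) sequentially"
proof -
 have h: "\<eta> / 2 > 0" using assms by simp
 from fdens_gauss[OF assms(1) h] fdens_total[OF h] ev_pos show ?thesis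
 proof eventually_elim
  case (elim n)
  have "(\<integral>\<^sup>+t. ennreal (exp (b n * t\<^sup>2 / 2)) * indicator {t. \<bar>t\<bar> <= R} t \<partial>T n) <= ennreal (exp (b n * (\<eta> / 2) - (- b n * (\<eta> / 2))))"
  proof (subst nn_integral_tlaw)
   show "k n > 0" "b n > 0" using elim by auto
  qed (simp, rule ennreal_divide_exp_le, use elim in blast, use elim in blast)
  then show ?case by (simp add: algebra_simps)
 qed
qed

lemma tlaw_tail:
 assumes "R > 0"
 shows "eventually (\<lambda>n. (\<integral>\<^sup>+t. indicator {t. R < \<bar>t\<bar>} t \<partial>T n) <= ennreal (exp (- b n * (R\<^sup>2 / 8)))) sequentially"
proof -
 have h: "R\<^sup>2 / 8 > 0" using assms by simp
 from fdens_tail[OF assms(1)] fdens_total[OF h] ev_pos show ?thesis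
 proof eventually_elim
  case (elim n)
  have "(\<integral>\<^sup>+t. indicator {t. R < \<bar>t\<bar>} t \<partial>T n) <= ennreal (exp (- b n * (R\<^sup>2 / 4) - (- b n * (R\<^sup>2 / 8))))"
  proof (subst nn_integral_tlaw)
   show "k n > 0" "b n > 0" using elim by auto
  qed (simp, rule ennreal_divide_exp_le, use elim in blast, use elim in blast)
  then show ?case by (simp add: algebra_simps)
 qed
qed

end

section \<open>Large deviations of asymptotically independent coordinates\<close>

lemma prod_mono_ennreal:
 fixes f g :: "'a => ennreal"
 shows "(!!i. i \<in> A ==> f i <= g i) ==> prod f A <= prod g A"
 by (induction A rule: infinite_finite_induct) (auto intro!: mult_mono)

text \<open>The rate function of independent standard Gaussian coordinates.\<close>
definition quad_rate :: "rseq => ennreal" where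
 "quad_rate y = ennreal (1 / 2) * (\<Sum>k. ennreal ((y k)\<^sup>2))"

lemma quad_rate_le_iff:
 assumes "r >= 0"
 shows "quad_rate y <= ennreal r \<longleftrightarrow> (\<forall>K. (\<Sum>k<K. (y k)\<^sup>2) / 2 <= r)"
proof -
 have "quad_rate y = (SUP K. ennreal (1 / 2) * (\<Sum>k<K. ennreal ((y k)\<^sup>2)))"
  unfolding quad_rate_def by (subst suminf_eq_SUP) (rule SUP_mult_left_ennreal)
 also have "(\<lambda>K. ennreal (1 / 2) * (\<Sum>k<K. ennreal ((y k)\<^sup>2))) = (\<lambda>K. ennreal ((\<Sum>k<K. (y k)\<^sup>2) / 2))"
 proof
  fix K show "ennreal (1 / 2) * (\<Sum>k<K. ennreal ((y k)\<^sup>2)) = ennreal ((\<Sum>k<K. (y k)\<^sup>2) / 2)"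
  proof -
   have "(\<Sum>k<K. ennreal ((y k)\<^sup>2)) = ennreal (\<Sum>k<K. (y k)\<^sup>2)" by (rule sum_ennreal) simp
   then show ?thesis using ennreal_mult'[of "1/2" "\<Sum>k<K. (y k)\<^sup>2"] by (simp only: mult_1 times_divide_eq_left)
  qed
 qed
 finally show ?thesis using assms by (simp add: SUP_le_iff)
qed

lemma continuous_coordinate: "continuous_on UNIV (\<lambda>y :: nat => real. y k)"
 by (rule continuous_on_product_coordinates)

lemma closed_quad_rate: "closed {y. quad_rate y <= c}"
proof (cases c)
 case (real r)
 have "{y. quad_rate y <= c} = (\<Inter>K. {y. (\<Sum>k<K. (y k)\<^sup>2) / 2 <= r})"
  using real quad_rate_le_iff by auto
 also have "closed ..."
  by (intro closed_INT ballI closed_Collect_le continuous_intros continuous_coordinate) auto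
 finally show ?thesis .
qed simp

lemma compact_box: "compact {y :: nat => real. \<forall>k. \<bar>y k\<bar> <= s}"
proof -
 have "{y :: nat => real. \<forall>k. \<bar>y k\<bar> <= s} = (\<Pi>\<^sub>E k\<in>UNIV. {-s..s})" by (auto simp: PiE_UNIV_domain abs_le_iff Pi_iff) (metis minus_le_iff)+
 moreover have "compactin (product_topology (\<lambda>_. euclidean) UNIV) (\<Pi>\<^sub>E k\<in>(UNIV :: nat set). {-s..s})"
  by (subst compactin_PiE) simp
 ultimately show ?thesis by (simp add: euclidean_product_topology)
qed

lemma compact_quad_rate: "compact {y. quad_rate y <= ennreal r}" if "r >= 0"
proof -
 have "\<bar>y k\<bar> <= sqrt (2 * r)" if y: "quad_rate y <= ennreal r" for y k
 proof -
  have "(y k)\<^sup>2 <= (\<Sum>k<Suc k. (y k)\<^sup>2)" by (rule member_le_sum) auto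
  moreover have "(\<Sum>k<Suc k. (y k)\<^sup>2) / 2 <= r" using y quad_rate_le_iff[OF \<open>r >= 0\<close>] by blast
  ultimately have "(y k)\<^sup>2 <= 2 * r" by linarith
  then show ?thesis by (rule real_le_rsqrt [of "\<bar>y k\<bar>", simplified])
 qed
 then have "{y. quad_rate y <= ennreal r} = {y. \<forall>k. \<bar>y k\<bar> <= sqrt (2 * r)} \<inter> {y. quad_rate y <= ennreal r}" by blast
 then show ?thesis using compact_Int_closed[OF compact_box closed_quad_rate] by metis
qed

lemma open_contains_cylinder:
 fixes x :: rseq
 assumes "open U" "x \<in> U"
 obtains K \<delta> where "\<delta> > 0" "!!z. (!!k. k < K ==> \<bar>z k - x k\<bar> < \<delta>) ==> z \<in> U"
proof -
 have "openin (product_topology (\<lambda>_. euclidean) UNIV) U" using assms by (simp add: euclidean_product_topology)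
 from product_topology_open_contains_basis[OF this assms(2)] obtain X where
  X: "x \<in> (\<Pi>\<^sub>E i\<in>UNIV. X i)" "!!i. open (X i)" "finite {i. X i ~= UNIV}" "(\<Pi>\<^sub>E i\<in>UNIV. X i) \<subseteq> U"
  by auto
 have "\<exists>d>0. \<forall>z. \<bar>z - x i\<bar> < d --> z \<in> X i" for i
  using X(1) X(2)[of i] by (auto simp: open_dist PiE_iff dist_real_def)
 then obtain d where d: "!!i. d i > 0" "!!i z. \<bar>z - x i\<bar> < d i ==> z \<in> X i" by metis
 obtain K where K: "!!i. X i ~= UNIV ==> i < K" using X(3) finite_nat_set_iff_bounded by auto
 define e where "e = Min (insert 1 (d ` {..<K}))"
 have e: "e > 0" "!!i. i < K ==> e <= d i" using d(1) by (auto simp: e_def)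
 have "z \<in> U" if "!!k. k < K ==> \<bar>z k - x k\<bar> < e" for z
 proof -
  have "z i \<in> X i" for i
  proof (cases "i < K")
   case True
   then show ?thesis using that[OF True] e(2)[OF True] d(2)[of "z i" i] by linarith
  next
   case False
   then show ?thesis using K by auto
  qed
  then show ?thesis using X(4) by auto
 qed
 with e(1) show ?thesis by (rule that)
qed

text \<open>A closed set that avoids a compact level set avoids a whole cylinder neighbourhood of it, so finitely many coordinates decide. Otherwise points of the set and of the level set would approach each other coordinatewise along a sequence, and a limit point would lie in both sets.\<close>
lemma closed_separated:
 assumes C: "closed C" and a: "\<alpha> >= 0" and dis: "!!y. y \<in> C ==> ennreal \<alpha> < quad_rate y"
 obtains K \<delta> where "\<delta> > 0" "!!y z. y \<in> C ==> (!!k. k < K ==> \<bar>y k - z k\<bar> < \<delta>) ==> ennreal \<alpha> < quad_rate z"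
proof (rule ccontr)
 assume "~ thesis"
 then have "\<forall>m :: nat. \<exists>y z. y \<in> C & (\<forall>k<m. \<bar>y k - z k\<bar> < 1 / real (Suc m)) & quad_rate z <= ennreal \<alpha>"
  using that[of "1 / real (Suc _)"] by (metis not_le of_nat_0_less_iff zero_less_Suc zero_less_divide_1_iff)
 then obtain y z where yz: "!!m. y m \<in> C" "!!m k. k < m ==> \<bar>y m k - z m k\<bar> < 1 / real (Suc m)" "!!m. quad_rate (z m) <= ennreal \<alpha>"
  by metis
 have "seq_compact {y. quad_rate y <= ennreal \<alpha>}" by (rule compact_imp_seq_compact[OF compact_quad_rate[OF a]])
 then obtain l r where l: "quad_rate l <= ennreal \<alpha>" and r: "strict_mono r" and lim: "(z \<circ> r) \<longlonglongrightarrow> l"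
  using yz(3) unfolding seq_compact_def by (metis mem_Collect_eq)
 have "l \<in> - C" using l dis by (auto simp: not_less [symmetric])
 then obtain K \<delta> where cyl: "\<delta> > 0" "!!z. (!!k. k < K ==> \<bar>z k - l k\<bar> < \<delta>) ==> z \<in> - C"
  using open_contains_cylinder[of "- C" l] C by (metis open_Compl)
 have co: "eventually (\<lambda>m. \<bar>z (r m) k - l k\<bar> < \<delta> / 2) sequentially" for k
 proof -
  have "(\<lambda>m. z (r m) k) \<longlonglongrightarrow> l k"
   using continuous_on_tendsto_compose[OF continuous_coordinate lim, of k] by (simp add: o_def)
  from tendstoD[OF this, of "\<delta> / 2"] show ?thesis using cyl(1) by (simp add: dist_real_def)
 qed
 then have "eventually (\<lambda>m. \<forall>k\<in>{..<K}. \<bar>z (r m) k - l k\<bar> < \<delta> / 2) sequentially"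
  by (intro eventually_ball_finite) auto
 moreover have "eventually (\<lambda>m. 1 / real (Suc m) < \<delta> / 2) sequentially"
  by (rule order_tendstoD[OF LIMSEQ_Suc[OF lim_1_over_n]]) (use cyl in simp)
 moreover have "eventually (\<lambda>m. K <= m) sequentially" by (rule eventually_ge_at_top)
 ultimately have "eventually (\<lambda>m. False) sequentially"
 proof eventually_elim
  case (elim m)
  have rm: "m <= r m" by (rule seq_suble[OF r])
  have "y (r m) \<in> - C"
  proof (rule cyl(2))
   fix k assume k: "k < K"
   have "\<bar>y (r m) k - z (r m) k\<bar> < 1 / real (Suc (r m))" using yz(2)[of k "r m"] k elim rm by simp
   also have "... <= 1 / real (Suc m)" using rm by (intro divide_left_mono) auto
   finally have "\<bar>y (r m) k - z (r m) k\<bar> < 1 / real (Suc m)" .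
   moreover have "\<bar>z (r m) k - l k\<bar> < \<delta> / 2" using elim(1) k by blast
   ultimately show "\<bar>y (r m) k - l k\<bar> < \<delta>" using elim(2) by linarith
  qed
  then show False using yz(1) by simp
 qed
 then show False by simp
qed

text \<open>The coordinates \<open>t\<^sub>j\<close> are asymptotically independent with laws \<open>N n j\<close> that have Gaussian large deviations with speed \<open>b\<close>, and \<open>Y\<close> differs from the identity by an error that is small uniformly on boxes. Finitely many \<open>t\<^sub>j\<close> may enter each coordinate of \<open>Y\<close>, which is why \<open>J\<close> depends on \<open>K\<close>.\<close>
locale asymptotic_product =
 fixes P :: "nat => rseq measure" and N :: "nat => nat => real measure"
  and Y :: "nat => rseq => nat => real" and b :: rseq
 assumes P_sets [measurable_cong]: "!!n. sets (P n) = sets borel"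
  and Y_meas: "!!n. Y n \<in> borel \<rightarrow>\<^sub>M borel"
  and N_prob: "!!j. eventually (\<lambda>n. prob_space (N n j)) sequentially"
  and b_lim: "filterlim b at_top sequentially"
  and prod_law: "!!K. eventually (\<lambda>n. \<forall>f. (\<forall>j<K. f j \<in> borel_measurable borel) -->
    (\<integral>\<^sup>+t. (\<Prod>j<K. f j (t j)) \<partial>P n) = (\<Prod>j<K. \<integral>\<^sup>+x. f j x \<partial>N n j)) sequentially"
  and N_lower: "!!j x \<delta> \<eta>. \<delta> > 0 ==> \<eta> > 0 ==>
    eventually (\<lambda>n. ennreal (exp (- b n * (x\<^sup>2 / 2 + \<eta>))) <= (\<integral>\<^sup>+t. indicator {t. \<bar>t - x\<bar> < \<delta>} t \<partial>N n j)) sequentially"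
  and N_gauss: "!!j R \<eta>. R > 0 ==> \<eta> > 0 ==>
    eventually (\<lambda>n. (\<integral>\<^sup>+t. ennreal (exp (b n * t\<^sup>2 / 2)) * indicator {t. \<bar>t\<bar> <= R} t \<partial>N n j) <= ennreal (exp (b n * \<eta>))) sequentially"
  and N_tail: "!!j R. R > 0 ==>
    eventually (\<lambda>n. (\<integral>\<^sup>+t. indicator {t. R < \<bar>t\<bar>} t \<partial>N n j) <= ennreal (exp (- b n * (R\<^sup>2 / 8)))) sequentially"
  and approx: "!!K. \<exists>J. \<forall>R>0. \<forall>\<delta>>0. eventually (\<lambda>n. \<forall>t. (\<forall>j<J. \<bar>t j\<bar> <= R) --> (\<forall>k<K. \<bar>Y n t k - t k\<bar> < \<delta>)) sequentially"
begin

lemma approx_ge: "\<exists>J\<ge>K. \<forall>R>0. \<forall>\<delta>>0. eventually (\<lambda>n. \<forall>t. (\<forall>j<J. \<bar>t j\<bar> <= R) --> (\<forall>k<K. \<bar>Y n t k - t k\<bar> < \<delta>)) sequentially"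
proof -
 obtain J where J: "\<forall>R>0. \<forall>\<delta>>0. eventually (\<lambda>n. \<forall>t. (\<forall>j<J. \<bar>t j\<bar> <= R) --> (\<forall>k<K. \<bar>Y n t k - t k\<bar> < \<delta>)) sequentially"
  using approx by blast
 have "eventually (\<lambda>n. \<forall>t. (\<forall>j<max J K. \<bar>t j\<bar> <= R) --> (\<forall>k<K. \<bar>Y n t k - t k\<bar> < \<delta>)) sequentially" if "R > 0" "\<delta> > 0" for R \<delta>
  using J[rule_format, OF that] by eventually_elim auto
 then show ?thesis by (intro exI[of _ "max J K"]) auto
qed

lemma b_large: "y > 0 ==> eventually (\<lambda>n. x <= b n * y) sequentially"
 using filterlim_at_top[THEN iffD1, OF b_lim, rule_format, of "x / y"] by (auto elim!: eventually_mono simp: field_simps)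

lemma b_pos: "eventually (\<lambda>n. b n > 0) sequentially"
 using filterlim_at_top_dense[THEN iffD1, OF b_lim] by blast

lemma coord_tail:
 assumes "R > 0"
 shows "eventually (\<lambda>n. emeasure (P n) {t. R < \<bar>t j\<bar>} <= ennreal (exp (- b n * (R\<^sup>2 / 8)))) sequentially"
proof -
 have pr: "eventually (\<lambda>n. \<forall>i\<in>{..<j}. prob_space (N n i)) sequentially" by (rule eventually_ball_finite) (auto intro: N_prob)
 from prod_law[of "Suc j"] N_tail[OF assms, of j] pr show ?thesis
 proof eventually_elim
  case (elim n)
  let ?f = "\<lambda>i x. if i = j then indicator {t. R < \<bar>t\<bar>} x else (1 :: ennreal)"
  have "emeasure (P n) {t. R < \<bar>t j\<bar>} = (\<integral>\<^sup>+t. indicator {t. R < \<bar>t j\<bar>} t \<partial>P n)"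
   by (rule nn_integral_indicator[symmetric]) measurable
  also have "... = (\<integral>\<^sup>+t. (\<Prod>i<Suc j. ?f i (t i)) \<partial>P n)"
   by (rule nn_integral_cong) (simp add: lessThan_Suc indicator_def)
  also have "... = (\<Prod>i<Suc j. \<integral>\<^sup>+x. ?f i x \<partial>N n i)"
   by (rule elim(1)[rule_format]) auto
  also have "... = (\<integral>\<^sup>+x. indicator {t. R < \<bar>t\<bar>} x \<partial>N n j)"
   using elim(3) by (simp add: lessThan_Suc prob_space.emeasure_space_1)
  finally show ?case using elim(2) by simp
 qed
qed

text \<open>Outside a large box the tails suffice. Inside it, \<open>Y\<close> in the closed set forces \<open>(\<Sum>k<K. t\<^sub>k\<^sup>2) / 2 \<ge> \<alpha>\<close> by \<open>closed_separated\<close>, and the exponential Markov inequality with the exponent \<open>b (\<Sum>k<K. t\<^sub>k\<^sup>2) / 2\<close> applies, whose truncated expectation factorises into subexponential terms.\<close>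
lemma upper_bound:
 assumes C: "closed C" and a: "\<alpha> >= 0" and dis: "!!y. y \<in> C ==> ennreal \<alpha> < quad_rate y" and eta: "\<eta> > 0"
 shows "eventually (\<lambda>n. emeasure (P n) {t. Y n t \<in> C} <= ennreal (exp (- b n * (\<alpha> - \<eta>)))) sequentially"
proof -
 obtain K \<delta> where sep: "\<delta> > 0" "!!y z. y \<in> C ==> (!!k. k < K ==> \<bar>y k - z k\<bar> < \<delta>) ==> ennreal \<alpha> < quad_rate z"
  using closed_separated[OF C a dis] by metis
 obtain J where J: "J >= K" "!!R \<delta>. R > 0 ==> \<delta> > 0 ==> eventually (\<lambda>n. \<forall>t. (\<forall>j<J. \<bar>t j\<bar> <= R) --> (\<forall>k<K. \<bar>Y n t k - t k\<bar> < \<delta>)) sequentially"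
  using approx_ge[of K] by blast
 \<comment> \<open>Chosen such that the tail exponent \<open>R\<^sup>2 / 8\<close> exceeds \<open>\<alpha>\<close>.\<close>
 define R where "R = sqrt (8 * (\<alpha> + 1))"
 have R: "R > 0" "R\<^sup>2 / 8 >= \<alpha>" using a by (auto simp: R_def)
 define h where "h = \<eta> / (2 * (real K + 1))"
 have h: "h > 0" "real K * h <= \<eta> / 2" using eta by (auto simp: h_def field_simps)
 have 1: "eventually (\<lambda>n. \<forall>j\<in>{..<J}. emeasure (P n) {t. R < \<bar>t j\<bar>} <= ennreal (exp (- b n * (R\<^sup>2 / 8)))) sequentially"
  by (intro eventually_ball_finite ballI coord_tail R(1) finite_lessThan)
 have 2: "eventually (\<lambda>n. \<forall>j\<in>{..<K}. (\<integral>\<^sup>+t. ennreal (exp (b n * t\<^sup>2 / 2)) * indicator {t. \<bar>t\<bar> <= R} t \<partial>N n j) <= ennreal (exp (b n * h))) sequentially"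
  by (intro eventually_ball_finite ballI N_gauss R(1) h(1) finite_lessThan)
 have 3: "eventually (\<lambda>n. ln (real J + 1) <= b n * (\<eta> / 2)) sequentially" by (rule b_large) (use eta in simp)
 from 1 2 3 b_pos J(2)[OF R(1) sep(1)] prod_law[of K] show ?thesis
 proof eventually_elim
  case (elim n)
  have coord [measurable]: "(\<lambda>t. t j) \<in> borel_measurable (P n)" for j by simp
  let ?A = "\<lambda>j. {t :: nat => real. R < \<bar>t j\<bar>}"
  let ?B = "{t :: nat => real. (\<forall>k<K. \<bar>t k\<bar> <= R) & \<alpha> <= (\<Sum>k<K. (t k)\<^sup>2) / 2}"
  have A: "?A j \<in> sets (P n)" for j
  proof -
   have "{t\<in>space (P n). R < \<bar>t j\<bar>} \<in> sets (P n)" by measurable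
   then show ?thesis by (simp add: sets_eq_imp_space_eq[OF P_sets])
  qed
  have B: "?B \<in> sets (P n)"
  proof -
   have "{t\<in>space (P n). (\<forall>k\<in>{..<K}. \<bar>t k\<bar> <= R) & \<alpha> <= (\<Sum>k<K. (t k)\<^sup>2) / 2} \<in> sets (P n)" by measurable
   then show ?thesis by (simp add: sets_eq_imp_space_eq[OF P_sets])
  qed
  have sub: "{t. Y n t \<in> C} \<subseteq> (\<Union>j\<in>{..<J}. ?A j) \<union> ?B"
  proof
   fix t assume t: "t \<in> {t. Y n t \<in> C}"
   show "t \<in> (\<Union>j\<in>{..<J}. ?A j) \<union> ?B"
   proof (cases "\<forall>j<J. \<bar>t j\<bar> <= R")
    case True
    \<comment> \<open>Cutting off the higher coordinates does not affect the cylinder condition, and it makes the rate a finite sum.\<close>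
    define z where "z k = (if k < K then t k else 0)" for k
    have "ennreal \<alpha> < quad_rate z"
    proof (rule sep(2))
     show "Y n t \<in> C" using t by simp
     show "\<bar>Y n t k - z k\<bar> < \<delta>" if "k < K" for k using elim(5) True that by (simp add: z_def)
    qed
    then obtain K' where K': "\<alpha> < (\<Sum>k<K'. (z k)\<^sup>2) / 2"
    proof -
     have "~ (\<forall>K. (\<Sum>k<K. (z k)\<^sup>2) / 2 <= \<alpha>)" using \<open>ennreal \<alpha> < quad_rate z\<close> quad_rate_le_iff[OF a, of z] by (metis not_le)
     then show ?thesis using that by (metis not_le)
    qed
    have "(\<Sum>k<K'. (z k)\<^sup>2) = (\<Sum>k\<in>{..<K'} \<inter> {..<K}. (t k)\<^sup>2)"
     unfolding z_def by (subst sum.inter_restrict) (auto intro!: sum.cong)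
    also have "... <= (\<Sum>k<K. (t k)\<^sup>2)" by (rule sum_mono2) auto
    finally have "\<alpha> <= (\<Sum>k<K. (t k)\<^sup>2) / 2" using K' by linarith
    then show ?thesis using True J(1) by auto
   qed (auto simp: not_le)
  qed
  have bb: "emeasure (P n) ?B <= ennreal (exp (- b n * (\<alpha> - \<eta> / 2)))"
  proof -
   let ?g = "\<lambda>k x. ennreal (exp (b n * x\<^sup>2 / 2)) * indicator {t. \<bar>t\<bar> <= R} x"
   have "emeasure (P n) ?B = (\<integral>\<^sup>+t. indicator ?B t \<partial>P n)" by (rule nn_integral_indicator[symmetric, OF B])
   also have "... <= (\<integral>\<^sup>+t. ennreal (exp (- b n * \<alpha>)) * (\<Prod>k<K. ?g k (t k)) \<partial>P n)"
   proof (rule nn_integral_mono)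
    fix t :: rseq
    show "indicator ?B t <= ennreal (exp (- b n * \<alpha>)) * (\<Prod>k<K. ?g k (t k))"
    proof (cases "t \<in> ?B")
     case True
     have "(\<Prod>k<K. ?g k (t k)) = (\<Prod>k<K. ennreal (exp (b n * (t k)\<^sup>2 / 2)))" using True by (intro prod.cong) auto
     also have "... = ennreal (\<Prod>k<K. exp (b n * (t k)\<^sup>2 / 2))" by (rule prod_ennreal) simp
     also have "(\<Prod>k<K. exp (b n * (t k)\<^sup>2 / 2)) = exp (b n * ((\<Sum>k<K. (t k)\<^sup>2) / 2))"
      by (simp add: exp_sum[symmetric] sum_distrib_left sum_divide_distrib)
     finally have e: "(\<Prod>k<K. ?g k (t k)) = ennreal (exp (b n * ((\<Sum>k<K. (t k)\<^sup>2) / 2)))" .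
     have "ennreal (exp (- b n * \<alpha>)) * (\<Prod>k<K. ?g k (t k)) = ennreal (exp (- b n * \<alpha> + b n * ((\<Sum>k<K. (t k)\<^sup>2) / 2)))"
      unfolding e by (simp only: exp_add ennreal_mult[OF exp_ge_zero exp_ge_zero])
     moreover have "b n * \<alpha> <= b n * ((\<Sum>k<K. (t k)\<^sup>2) / 2)" using True elim(4) by (intro mult_left_mono) auto
     then have "1 <= exp (- b n * \<alpha> + b n * ((\<Sum>k<K. (t k)\<^sup>2) / 2))" by simp
     then have "ennreal 1 <= ennreal (exp (- b n * \<alpha> + b n * ((\<Sum>k<K. (t k)\<^sup>2) / 2)))" by (rule ennreal_leI)
     ultimately show ?thesis using True by simp
    qed simp
   qed
   also have "... = ennreal (exp (- b n * \<alpha>)) * (\<integral>\<^sup>+t. (\<Prod>k<K. ?g k (t k)) \<partial>P n)"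
    by (rule nn_integral_cmult) (simp add: borel_measurable_prod_ennreal)
   also have "(\<integral>\<^sup>+t. (\<Prod>k<K. ?g k (t k)) \<partial>P n) = (\<Prod>k<K. \<integral>\<^sup>+x. ?g k x \<partial>N n k)"
    by (rule elim(6)[rule_format]) simp
   also have "... <= (\<Prod>k<K. ennreal (exp (b n * h)))" using elim(2) by (intro prod_mono_ennreal) auto
   also have "... = ennreal (exp (b n * (real K * h)))" by (simp add: ennreal_power exp_of_nat_mult[symmetric] mult_ac)
   also have "... <= ennreal (exp (b n * (\<eta> / 2)))" using h elim(4) by (intro ennreal_leI) simp
   finally have "emeasure (P n) ?B <= ennreal (exp (- b n * \<alpha>)) * ennreal (exp (b n * (\<eta> / 2)))" by (simp add: mult_left_mono)
   also have "... = ennreal (exp (- b n * (\<alpha> - \<eta> / 2)))" by (simp add: ennreal_mult[symmetric] exp_add[symmetric] algebra_simps)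
   finally show ?thesis .
  qed
  have "emeasure (P n) (\<Union>j\<in>{..<J}. ?A j) <= (\<Sum>j<J. emeasure (P n) (?A j))"
   by (rule emeasure_subadditive_finite) (use A in auto)
  also have "... <= (\<Sum>j<J. ennreal (exp (- b n * (\<alpha> - \<eta> / 2))))"
  proof (rule sum_mono)
   fix j assume "j \<in> {..<J}"
   then have "emeasure (P n) (?A j) <= ennreal (exp (- b n * (R\<^sup>2 / 8)))" using elim(1) by blast
   also have "\<alpha> - \<eta> / 2 <= R\<^sup>2 / 8" using R(2) eta by linarith
   then have "b n * (\<alpha> - \<eta> / 2) <= b n * (R\<^sup>2 / 8)" using elim(4) by (intro mult_left_mono) auto
   then have "ennreal (exp (- b n * (R\<^sup>2 / 8))) <= ennreal (exp (- b n * (\<alpha> - \<eta> / 2)))" by (intro ennreal_leI) simp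
   finally show "emeasure (P n) (?A j) <= ennreal (exp (- b n * (\<alpha> - \<eta> / 2)))" .
  qed
  also have "(\<Sum>j<J. ennreal (exp (- b n * (\<alpha> - \<eta> / 2)))) = ennreal (real J * exp (- b n * (\<alpha> - \<eta> / 2)))"
   by (subst sum_ennreal) auto
  finally have uu: "emeasure (P n) (\<Union>j\<in>{..<J}. ?A j) <= ennreal (real J * exp (- b n * (\<alpha> - \<eta> / 2)))" .
  have "emeasure (P n) {t. Y n t \<in> C} <= emeasure (P n) ((\<Union>j\<in>{..<J}. ?A j) \<union> ?B)"
   by (rule emeasure_mono[OF sub]) (use A B in \<open>intro sets.Un sets.finite_UN; auto\<close>)
  also have "... <= emeasure (P n) (\<Union>j\<in>{..<J}. ?A j) + emeasure (P n) ?B"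
   by (rule emeasure_subadditive) (use A B in \<open>auto intro: sets.finite_UN\<close>)
  also have "... <= ennreal (real J * exp (- b n * (\<alpha> - \<eta> / 2))) + ennreal (exp (- b n * (\<alpha> - \<eta> / 2)))"
   by (rule add_mono[OF uu bb])
  also have "... = ennreal ((real J + 1) * exp (- b n * (\<alpha> - \<eta> / 2)))" by (simp add: ennreal_plus[symmetric] distrib_right del: ennreal_plus)
  also have "... <= ennreal (exp (b n * (\<eta> / 2)) * exp (- b n * (\<alpha> - \<eta> / 2)))"
  proof -
   have "real J + 1 = exp (ln (real J + 1))" by simp
   also have "... <= exp (b n * (\<eta> / 2))" using elim(3) by (simp del: exp_ln)
   finally show ?thesis by (intro ennreal_leI mult_right_mono) auto
  qed
  also have "... = ennreal (exp (- b n * (\<alpha> - \<eta>)))" by (simp add: exp_add[symmetric] algebra_simps)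
  finally show ?case .
 qed
qed

text \<open>A cylinder neighbourhood of \<open>y\<close> in the coordinates of \<open>t\<close> is mapped into the open set by \<open>Y\<close>, and its probability is a product.\<close>
lemma lower_bound:
 assumes U: "open U" "y \<in> U" and i: "\<iota> >= 0" "quad_rate y <= ennreal \<iota>" and eta: "\<eta> > 0"
 shows "eventually (\<lambda>n. ennreal (exp (- b n * (\<iota> + \<eta>))) <= emeasure (P n) {t. Y n t \<in> U}) sequentially"
proof -
 obtain K \<delta> where cyl: "\<delta> > 0" "!!z. (!!k. k < K ==> \<bar>z k - y k\<bar> < \<delta>) ==> z \<in> U"
  using open_contains_cylinder[OF U] by metis
 obtain J where J: "J >= K" "!!R \<delta>. R > 0 ==> \<delta> > 0 ==> eventually (\<lambda>n. \<forall>t. (\<forall>j<J. \<bar>t j\<bar> <= R) --> (\<forall>k<K. \<bar>Y n t k - t k\<bar> < \<delta>)) sequentially"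
  using approx_ge[of K] by blast
 define R where "R = (\<Sum>j<J. \<bar>y j\<bar>) + \<delta>"
 have yR: "\<bar>y j\<bar> + \<delta> <= R" if "j < J" for j
  using member_le_sum[of j "{..<J}" "\<lambda>j. \<bar>y j\<bar>"] that by (simp add: R_def)
 have R: "R > 0" using cyl(1) by (simp add: R_def sum_nonneg add_nonneg_pos)
 define h where "h = \<eta> / (real J + 1)"
 have h: "h > 0" "real J * h <= \<eta>" using eta by (auto simp: h_def field_simps)
 have d: "\<delta> / 2 > 0" using cyl by simp
 have 1: "eventually (\<lambda>n. \<forall>j\<in>{..<J}. ennreal (exp (- b n * ((y j)\<^sup>2 / 2 + h))) <= (\<integral>\<^sup>+t. indicator {t. \<bar>t - y j\<bar> < \<delta> / 2} t \<partial>N n j)) sequentially"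
  by (intro eventually_ball_finite ballI N_lower d h(1) finite_lessThan)
 from 1 b_pos J(2)[OF R d] prod_law[of J] show ?thesis
 proof eventually_elim
  case (elim n)
  have coord [measurable]: "(\<lambda>t. t j) \<in> borel_measurable (P n)" for j by simp
  note Y_meas[measurable]
  let ?A = "{t :: nat => real. \<forall>j<J. \<bar>t j - y j\<bar> < \<delta> / 2}"
  have sub: "?A \<subseteq> {t. Y n t \<in> U}"
  proof
   fix t assume t: "t \<in> ?A"
   have "\<bar>t j\<bar> <= R" if "j < J" for j
   proof -
    have "\<bar>t j - y j\<bar> < \<delta> / 2" using t that by blast
    then show ?thesis using yR[OF that] d by linarith
   qed
   then have a: "\<bar>Y n t k - t k\<bar> < \<delta> / 2" if "k < K" for k using elim(3) that by blast
   have "Y n t \<in> U"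
   proof (rule cyl(2))
    fix k assume k: "k < K"
    then have "\<bar>t k - y k\<bar> < \<delta> / 2" using t J(1) by auto
    then show "\<bar>Y n t k - y k\<bar> < \<delta>" using a[OF k] by linarith
   qed
   then show "t \<in> {t. Y n t \<in> U}" by simp
  qed
  have "(\<Sum>j<J. (y j)\<^sup>2) / 2 <= \<iota>" using i quad_rate_le_iff[OF i(1)] by blast
  then have "(\<Sum>j<J. (y j)\<^sup>2 / 2 + h) <= \<iota> + \<eta>" using h(2) by (simp add: sum.distrib sum_divide_distrib)
  then have "b n * (\<Sum>j<J. (y j)\<^sup>2 / 2 + h) <= b n * (\<iota> + \<eta>)" using elim(2) by (intro mult_left_mono) auto
  then have "ennreal (exp (- b n * (\<iota> + \<eta>))) <= ennreal (exp (- (b n * (\<Sum>j<J. (y j)\<^sup>2 / 2 + h))))" by (intro ennreal_leI) simp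
  also have "... = ennreal (\<Prod>j<J. exp (- b n * ((y j)\<^sup>2 / 2 + h)))"
   by (simp add: exp_sum[symmetric] sum_distrib_left sum_negf[symmetric] del: sum.distrib)
  also have "... = (\<Prod>j<J. ennreal (exp (- b n * ((y j)\<^sup>2 / 2 + h))))" by (rule prod_ennreal[symmetric]) simp
  also have "... <= (\<Prod>j<J. \<integral>\<^sup>+t. indicator {t. \<bar>t - y j\<bar> < \<delta> / 2} t \<partial>N n j)" using elim(1) by (intro prod_mono_ennreal) auto
  also have "... = (\<integral>\<^sup>+t. (\<Prod>j<J. indicator {t. \<bar>t - y j\<bar> < \<delta> / 2} (t j)) \<partial>P n)"
   by (rule elim(4)[rule_format, symmetric]) simp
  also have "... <= (\<integral>\<^sup>+t. indicator {t. Y n t \<in> U} t \<partial>P n)"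
  proof (rule nn_integral_mono)
   fix t :: rseq
   show "(\<Prod>j<J. indicator {t. \<bar>t - y j\<bar> < \<delta> / 2} (t j)) <= (indicator {t. Y n t \<in> U} t :: ennreal)"
   proof (cases "t \<in> ?A")
    case True
    then have "indicator {t. Y n t \<in> U} t = (1 :: ennreal)" using sub by auto
    moreover have "(\<Prod>j<J. indicator {t. \<bar>t - y j\<bar> < \<delta> / 2} (t j)) <= (\<Prod>j<J. (1 :: ennreal))" by (intro prod_mono_ennreal) (auto simp: indicator_def)
    ultimately show ?thesis by simp
   next
    case False
    then obtain j where j: "j < J" "~ \<bar>t j - y j\<bar> < \<delta> / 2" by auto
    then have "indicator {t. \<bar>t - y j\<bar> < \<delta> / 2} (t j) = (0 :: ennreal)" by simp
    then have "(\<Prod>j<J. indicator {t. \<bar>t - y j\<bar> < \<delta> / 2} (t j)) = (0 :: ennreal)" using j(1) by (intro prod_zero) blast+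
    then show ?thesis by (simp only: zero_le)
   qed
  qed
  also have "... = emeasure (P n) {t. Y n t \<in> U}"
  proof (rule nn_integral_indicator)
   have "Y n -` U \<inter> space borel \<in> sets borel" by (rule measurable_sets[OF Y_meas]) (use U in simp)
   then show "{t. Y n t \<in> U} \<in> sets (P n)" by (simp add: P_sets vimage_def)
  qed
  finally show ?case .
 qed
qed

end

text \<open>Bounds with an arbitrary exponential loss \<open>\<eta>\<close> for real levels suffice, because level and loss disappear in the limit.\<close>
lemma ldpI:
 assumes M: "!!n. n >= 1 ==> prob_space (M n)" and X: "!!n. n >= 1 ==> X n \<in> M n \<rightarrow>\<^sub>M borel"
  and b: "!!n. n >= 1 ==> 0 < b n" "filterlim b at_top sequentially"
  and I: "!!c. closed {x. I x <= c}"
  and up: "!!C \<alpha> \<eta>. closed C ==> \<alpha> >= 0 ==> (!!x. x \<in> C ==> ennreal \<alpha> < I x) ==> \<eta> > 0 ==>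
   eventually (\<lambda>n. measure (M n) {\<omega> \<in> space (M n). X n \<omega> \<in> C} <= exp (- b n * (\<alpha> - \<eta>))) sequentially"
  and lo: "!!U x \<iota> \<eta>. open U ==> x \<in> U ==> \<iota> >= 0 ==> I x <= ennreal \<iota> ==> \<eta> > 0 ==>
   eventually (\<lambda>n. exp (- b n * (\<iota> + \<eta>)) <= measure (M n) {\<omega> \<in> space (M n). X n \<omega> \<in> U}) sequentially"
 shows "ldp M X b I"
proof -
 define p where "p S n = measure (M n) {\<omega> \<in> space (M n). X n \<omega> \<in> S}" for S n
 have ev1: "eventually (\<lambda>n. n >= (1::nat)) sequentially" by (rule eventually_ge_at_top)
 have el: "ereal (1 / a) * elog q <= ereal x" if "a > 0" "q <= exp (a * x)" for a q x
 proof (cases "q <= 0")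
  case False
  then have "ln q <= ln (exp (a * x))" using that by (subst ln_le_cancel_iff) auto
  then show ?thesis using False that by (simp add: elog_def field_simps)
 qed (use that in \<open>simp add: elog_def\<close>)
 have eg: "ereal x <= ereal (1 / a) * elog q" if "a > 0" "exp (a * x) <= q" for a q x
 proof -
  have q: "q > 0" using that(2) by (meson exp_gt_zero less_le_trans)
  have "ln (exp (a * x)) <= ln q" using that q by (subst ln_le_cancel_iff) auto
  then show ?thesis using q that by (simp add: elog_def field_simps)
 qed
 have upper: "limsup (\<lambda>n. ereal (1 / b n) * elog (p C n)) <= - enn2ereal (INF x\<in>C. I x)" if C: "closed C" for C
 proof (rule ccontr)
  let ?L = "limsup (\<lambda>n. ereal (1 / b n) * elog (p C n))"
  assume "~ ?L <= - enn2ereal (INF x\<in>C. I x)"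
  then have less: "- ?L < enn2ereal (INF x\<in>C. I x)" by (metis ereal_minus_less_minus ereal_uminus_uminus not_le)
  have "?L <= ereal 0"
  proof (rule Limsup_bounded)
   show "eventually (\<lambda>n. ereal (1 / b n) * elog (p C n) <= ereal 0) sequentially"
    using ev1
   proof eventually_elim
    case (elim n)
    interpret prob_space "M n" by (rule M[OF elim])
    show ?case by (rule el[OF b(1)[OF elim]]) (simp add: p_def)
   qed
  qed
  then have L0: "0 <= - ?L" by (metis ereal_0_le_uminus_iff zero_ereal_def)
  from ereal_dense2[OF less] obtain \<alpha> where a: "- ?L < ereal \<alpha>" "ereal \<alpha> < enn2ereal (INF x\<in>C. I x)" by blast
  have a0: "\<alpha> >= 0" using L0 a(1) by (metis ereal_less_eq(5) less_imp_le order_trans)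
  have "enn2ereal (ennreal \<alpha>) < enn2ereal (INF x\<in>C. I x)" using a(2) a0 by simp
  then have aI: "ennreal \<alpha> < (INF x\<in>C. I x)" by (simp add: less_ennreal.rep_eq)
  have lt: "ennreal \<alpha> < I x" if "x \<in> C" for x using aI INF_lower[OF that, of I] by (rule less_le_trans)
  have upC: "eventually (\<lambda>n. measure (M n) {\<omega> \<in> space (M n). X n \<omega> \<in> C} <= exp (- b n * (\<alpha> - \<eta>))) sequentially" if "\<eta> > 0" for \<eta>
   by (rule up[OF C a0 _ that]) (rule lt)
  have "?L <= ereal (- \<alpha>) + ereal \<eta>" if "\<eta> > 0" for \<eta>
  proof (rule Limsup_bounded)
   show "eventually (\<lambda>n. ereal (1 / b n) * elog (p C n) <= ereal (- \<alpha>) + ereal \<eta>) sequentially"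
    using upC[OF that] ev1
   proof eventually_elim
    case (elim n)
    have "ereal (1 / b n) * elog (p C n) <= ereal (- (\<alpha> - \<eta>))"
     by (rule el[OF b(1)[OF elim(2)]]) (use elim(1) in \<open>simp only: p_def mult_minus_right mult_minus_left\<close>)
    then show ?case by simp
   qed
  qed
  then have "?L <= ereal (- \<alpha>)" using ereal_le_epsilon2[of ?L "ereal (- \<alpha>)"] by blast
  then have "?L <= - ereal \<alpha>" by simp
  then have "- (- ereal \<alpha>) <= - ?L" by (rule ereal_minus_le_minus[THEN iffD2])
  then have "ereal \<alpha> <= - ?L" by simp
  with a(1) show False by simp
 qed
 have lower: "liminf (\<lambda>n. ereal (1 / b n) * elog (p U n)) >= - enn2ereal (INF x\<in>U. I x)" if U: "open U" for U
 proof (rule ccontr)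
  let ?L = "liminf (\<lambda>n. ereal (1 / b n) * elog (p U n))"
  assume "~ ?L >= - enn2ereal (INF x\<in>U. I x)"
  then have "enn2ereal (INF x\<in>U. I x) < - ?L" by (metis ereal_minus_less_minus ereal_uminus_uminus not_le)
  from ereal_dense2[OF this] obtain z where z: "enn2ereal (INF x\<in>U. I x) < ereal z" "ereal z < - ?L" by blast
  have z0: "z >= 0" using z(1) enn2ereal_nonneg by (metis ereal_less_eq(5) less_imp_le order_trans)
  have "enn2ereal (INF x\<in>U. I x) < enn2ereal (ennreal z)" using z(1) z0 by simp
  then have "(INF x\<in>U. I x) < ennreal z" by (simp add: less_ennreal.rep_eq)
  then obtain x where x: "x \<in> U" "I x < ennreal z" by (auto simp: INF_less_iff)
  have "ereal (- z) - ereal \<eta> <= ?L" if "\<eta> > 0" for \<eta>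
  proof (rule Liminf_bounded)
   show "eventually (\<lambda>n. ereal (- z) - ereal \<eta> <= ereal (1 / b n) * elog (p U n)) sequentially"
    using lo[OF U x(1) z0 less_imp_le[OF x(2)] that] ev1
   proof eventually_elim
    case (elim n)
    have "ereal (- (z + \<eta>)) <= ereal (1 / b n) * elog (p U n)"
     by (rule eg[OF b(1)[OF elim(2)]]) (use elim(1) in \<open>simp only: p_def mult_minus_right mult_minus_left\<close>)
    then show ?case by simp
   qed
  qed
  then have "ereal (- z) <= ?L + ereal \<eta>" if "\<eta> > 0" for \<eta> using that ereal_minus_le[of "ereal \<eta>" "ereal (- z)" ?L] by simp
  then have "ereal (- z) <= ?L" using ereal_le_epsilon2[of "ereal (- z)" ?L] by blast
  then have "- ereal z <= ?L" by simp
  then have "- ?L <= ereal z" by (rule ereal_uminus_le_reorder[THEN iffD1])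
  with z(2) show False by simp
 qed
 show ?thesis
  unfolding ldp_def using M X b I upper lower unfolding p_def by blast
qed

section \<open>From the continued fraction to Chebyshev moments\<close>

text \<open>The linear extension of \<open>X\<^sup>k \<mapsto> m\<^sub>k\<close> to polynomials.\<close>
definition lfun :: "rseq => real poly => real" where
 "lfun m p = (\<Sum>k\<le>degree p. coeff p k * m k)"

lemma lfun_le: "degree p <= K ==> lfun m p = (\<Sum>k\<le>K. coeff p k * m k)"
 unfolding lfun_def by (rule sum.mono_neutral_left) (auto simp: coeff_eq_0)

lemma lfun_add: "lfun m (p + q) = lfun m p + lfun m q"
proof -
 let ?K = "max (degree p) (degree q)"
 have "degree (p + q) <= ?K" by (rule degree_add_le) auto
 then show ?thesis
  by (simp add: lfun_le[of "p + q" ?K] lfun_le[of p ?K] lfun_le[of q ?K] distrib_right sum.distrib)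
qed

lemma lfun_smult: "lfun m (smult c p) = c * lfun m p"
 using lfun_le[of "smult c p" "degree p" m] by (simp add: lfun_def sum_distrib_left mult.assoc)

lemma lfun_diff: "lfun m (p - q) = lfun m p - lfun m q"
proof -
 let ?K = "max (degree p) (degree q)"
 have "degree (p - q) <= ?K" by (rule degree_diff_le) auto
 then show ?thesis
  by (simp add: lfun_le[of "p - q" ?K] lfun_le[of p ?K] lfun_le[of q ?K] left_diff_distrib sum_subtractf)
qed

lemma lfun_pCons_0: "lfun m (pCons 0 p) = lfun (\<lambda>k. m (Suc k)) p"
proof -
 have "lfun m (pCons 0 p) = (\<Sum>k\<le>Suc (degree p). coeff (pCons 0 p) k * m k)" by (rule lfun_le) (rule degree_pCons_le)
 also have "... = (\<Sum>k\<le>degree p. coeff p k * m (Suc k))" by (subst sum.atMost_Suc_shift) simp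
 finally show ?thesis by (simp add: lfun_def)
qed

lemma lfun_sum: "lfun m (\<Sum>i\<in>A. f i) = (\<Sum>i\<in>A. lfun m (f i))"
 by (induction A rule: infinite_finite_induct) (simp_all add: lfun_add, simp_all add: lfun_def)

lemma lfun_atoms: "lfun (\<lambda>k. \<Sum>i\<in>A. w i * x i ^ k) p = (\<Sum>i\<in>A. w i * poly p (x i))"
proof -
 have "lfun (\<lambda>k. \<Sum>i\<in>A. w i * x i ^ k) p = (\<Sum>k\<le>degree p. \<Sum>i\<in>A. w i * (coeff p k * x i ^ k))"
  by (simp add: lfun_def sum_distrib_left mult_ac)
 also have "... = (\<Sum>i\<in>A. w i * poly p (x i))" by (subst sum.swap) (simp add: poly_altdef sum_distrib_left)
 finally show ?thesis .
qed

context
 fixes y :: rseq and N :: nat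
begin

text \<open>Every tail of the continued fraction, multiplied by the earlier ones, is a quotient with the same denominator. The power series \<open>frac_ratio 0\<close> is the generating function of the moments.\<close>
definition frac_ratio :: "nat => real fps" where
 "frac_ratio j = Abs_fps (G y (N - j)) * inverse (Abs_fps (G y (Suc N)))"

text \<open>The entries numbered from the outermost one; the value \<open>0\<close> at index \<open>0\<close> makes the first diagonal entry of the Jacobi matrix fit the general formula.\<close>
definition zrev :: rseq where
 "zrev l = (if l = 0 then 0 else y (N - l))"

definition jac_a :: rseq where "jac_a j = zrev (2 * j) + zrev (Suc (2 * j))"
definition jac_b :: rseq where "jac_b j = zrev (Suc (2 * j)) * zrev (Suc (Suc (2 * j)))"

lemma G_inverse: "Abs_fps (G y i) * inverse (Abs_fps (G y i)) = 1"
 by (subst mult.commute, rule inverse_mult_eq_1) (simp add: G_at_0)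

lemma frac_ratio_0: "fps_nth (frac_ratio j) 0 = 1"
 by (simp add: frac_ratio_def G_at_0)

lemma mom_frac_ratio: "mom (G y (Suc N)) (G y N) k = fps_nth (frac_ratio 0) k"
proof (rule mom_unique[symmetric])
 show "G y (Suc N) 0 = 1" by (rule G_at_0)
 fix k
 have "frac_ratio 0 * Abs_fps (G y (Suc N)) = Abs_fps (G y N) * (Abs_fps (G y (Suc N)) * inverse (Abs_fps (G y (Suc N))))"
  by (simp add: frac_ratio_def mult_ac)
 then have "frac_ratio 0 * Abs_fps (G y (Suc N)) = Abs_fps (G y N)" by (simp add: G_inverse)
 from arg_cong[OF this, of "\<lambda>f. fps_nth f k"]
 show "G y N k = (\<Sum>j\<le>k. G y (Suc N) (k - j) * fps_nth (frac_ratio 0) j)"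
  by (simp add: fps_mult_nth atLeast0AtMost mult.commute)
qed

lemma fps_stepp: "Abs_fps (stepp c q h) = Abs_fps q - fps_const c * (fps_X * Abs_fps h)"
 by (rule fps_ext) (simp add: stepp_def)

lemma frac_ratio_step:
 assumes "j < N"
 shows "fps_nth (frac_ratio j) (Suc k) = (if j = 0 then 0 else fps_nth (frac_ratio (j - 1)) (Suc k)) + zrev (Suc j) * fps_nth (frac_ratio (Suc j)) k"
proof -
 define i where "i = N - Suc j"
 have i: "N - j = Suc i" "Suc (N - j) = Suc (Suc i)" using assms by (simp_all add: i_def)
 let ?D = "inverse (Abs_fps (G y (Suc N)))"
 have "Abs_fps (G y (Suc i)) = Abs_fps (G y (Suc (Suc i))) + fps_const (y i) * (fps_X * Abs_fps (G y i))"
  unfolding G_step fps_stepp by simp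
 then have "frac_ratio j = Abs_fps (G y (Suc (N - j))) * ?D + fps_const (y i) * (fps_X * frac_ratio (Suc j))"
  unfolding frac_ratio_def i i_def[symmetric] by (simp add: algebra_simps)
 moreover have "Abs_fps (G y (Suc (N - j))) * ?D = (if j = 0 then 1 else frac_ratio (j - 1))"
 proof (cases "j = 0")
  case False
  then have "Suc (N - j) = N - (j - 1)" using assms by simp
  then show ?thesis using False by (simp add: frac_ratio_def)
 qed (simp add: G_inverse)
 ultimately have "frac_ratio j = (if j = 0 then 1 else frac_ratio (j - 1)) + fps_const (y i) * (fps_X * frac_ratio (Suc j))" by simp
 from arg_cong[OF this, of "\<lambda>f. fps_nth f (Suc k)"] show ?thesis by (simp add: zrev_def i_def)
qed

text \<open>Contracting the Stieltjes continued fraction to its even part gives the Jacobi matrix with diagonal \<open>z\<^sub>2\<^sub>j + z\<^sub>2\<^sub>j\<^sub>+\<^sub>1\<close> and off-diagonal \<open>z\<^sub>2\<^sub>j\<^sub>+\<^sub>1 z\<^sub>2\<^sub>j\<^sub>+\<^sub>2\<close>. The coefficients of the series \<open>frac_ratio (2 j)\<close> satisfy the same recursion as the first columns of its powers, as long as the fraction has not terminated.\<close>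
lemma jacobi_powers:
 "2 * k + 2 <= N ==> (jact jac_a jac_b ^^ k) e0 j = (if j <= k then fps_nth (frac_ratio (2 * j)) (k - j) else 0)"
proof (induction k arbitrary: j)
 case 0
 show ?case by (simp add: e0_def frac_ratio_0)
next
 case (Suc k)
 define A where "A j = (if j <= k then fps_nth (frac_ratio (2 * j)) (k - j) else 0)" for j
 have IH: "(jact jac_a jac_b ^^ k) e0 = A" using Suc by (auto simp: A_def fun_eq_iff)
 have odd: "fps_nth (frac_ratio (Suc (2 * j))) (k - j) = A j + zrev (Suc (Suc (2 * j))) * A (Suc j)" if j: "j <= k" for j
 proof (cases "k - j")
  case 0
  then show ?thesis using j by (simp add: A_def frac_ratio_0)
 next
  case (Suc r)
  then have "r = k - Suc j" "Suc j <= k" by auto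
  then show ?thesis using frac_ratio_step[of "Suc (2 * j)" r] j Suc Suc.prems by (simp add: A_def)
 qed
 have "jact jac_a jac_b A j = (if j <= Suc k then fps_nth (frac_ratio (2 * j)) (Suc k - j) else 0)"
 proof (cases "j <= k")
  case True
  then have kj: "Suc k - j = Suc (k - j)" by simp
  have e: "(if j = 0 then 0 else fps_nth (frac_ratio (2 * j - 1)) (Suc (k - j))) = (if j = 0 then 0 else A (j - 1) + zrev (2 * j) * A j)"
  proof (cases j)
   case (Suc i)
   then have "Suc (k - j) = k - i" using True by simp
   then show ?thesis using odd[of i] Suc True by simp
  qed simp
  have "fps_nth (frac_ratio (2 * j)) (Suc (k - j)) = (if j = 0 then 0 else fps_nth (frac_ratio (2 * j - 1)) (Suc (k - j))) + zrev (Suc (2 * j)) * fps_nth (frac_ratio (Suc (2 * j))) (k - j)"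
   using frac_ratio_step[of "2 * j" "k - j"] True Suc.prems by simp
  also have "... = jact jac_a jac_b A j"
   unfolding e odd[OF True] by (simp add: jact_def jac_a_def jac_b_def zrev_def[of 0] algebra_simps)
  finally show ?thesis using True kj by simp
 next
  case False
  then show ?thesis
   by (auto simp: jact_def A_def frac_ratio_0 le_Suc_eq)
 qed
 then show ?case by (simp add: IH)
qed

end

lemma lfun_jact: "lfun (\<lambda>k. (jact a b ^^ Suc k) v i) p = jact a b (\<lambda>i. lfun (\<lambda>k. (jact a b ^^ k) v i) p) i"
proof -
 have "lfun (\<lambda>k. (jact a b ^^ Suc k) v i) p = (\<Sum>k\<le>degree p. coeff p k * ((if i = 0 then 0 else (jact a b ^^ k) v (i - 1)) + a i * (jact a b ^^ k) v i + b i * (jact a b ^^ k) v (Suc i)))"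
  unfolding lfun_def by (rule sum.cong) (simp_all add: jact_def[of a b "(jact a b ^^ _) v"])
 also have "... = jact a b (\<lambda>i. lfun (\<lambda>k. (jact a b ^^ k) v i) p) i"
  by (cases i) (simp_all add: jact_def lfun_def distrib_left sum.distrib sum_distrib_left mult_ac)
 finally show ?thesis .
qed

text \<open>An affine change of the argument acts on the matrix by shift and scaling; conjugation with the powers of \<open>s\<close> restores the ones below the diagonal.\<close>
lemma jcheb_conjugate:
 assumes s: "s ~= 0"
 shows "lfun (\<lambda>k. (jact a b ^^ k) e0 i) (pcompose (chb j) [:- h / s, 1 / s:]) * s ^ i
    = jcheb (\<lambda>l. (a l - h) / s) (\<lambda>l. b l / s\<^sup>2) j i"
proof -
 define V where "V p i = lfun (\<lambda>k. (jact a b ^^ k) e0 i) p" for p i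
 let ?q = "[:- h / s, 1 / s:]" and ?J = "jact (\<lambda>l. (a l - h) / s) (\<lambda>l. b l / s\<^sup>2)"
 have V1: "V 1 = e0" by (rule ext) (simp add: V_def lfun_def)
 have mult: "V (?q * p) i * s ^ i = ?J (\<lambda>i. V p i * s ^ i) i" for p i
 proof -
  have "?q * p = smult (- h / s) p + pCons 0 (smult (1 / s) p)" by simp
  then have "V (?q * p) i = - h / s * V p i + 1 / s * jact a b (V p) i"
   unfolding V_def by (simp only: lfun_add lfun_smult lfun_pCons_0 lfun_jact) (simp add: jact_def lfun_smult algebra_simps add_divide_distrib)
  then show ?thesis using s by (simp only:) (cases i; simp add: jact_def field_simps power2_eq_square)
 qed
 have "V (pcompose (chb j) ?q) i * s ^ i = jcheb (\<lambda>l. (a l - h) / s) (\<lambda>l. b l / s\<^sup>2) j i" for i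
 proof (induction j arbitrary: i rule: chb.induct)
  case 1
  have "pcompose (chb 0) ?q = 1" by (simp add: one_pCons pcompose_pCons)
  then show ?case by (simp add: V1 e0_def)
 next
  case 2
  have "pcompose (chb (Suc 0)) ?q = ?q * 1" by (simp add: pcompose_pCons)
  moreover have "(\<lambda>i. V 1 i * s ^ i) = (\<lambda>i. if i = 0 then 1 else 0)" by (auto simp: V1 e0_def)
  ultimately show ?case by (simp only: mult jcheb.simps)
 next
  case (3 k)
  have "pcompose (chb (Suc (Suc k))) ?q = ?q * pcompose (chb (Suc k)) ?q - pcompose (chb k) ?q"
   by (simp add: pcompose_diff pcompose_pCons)
  then have "V (pcompose (chb (Suc (Suc k))) ?q) i * s ^ i = V (?q * pcompose (chb (Suc k)) ?q) i * s ^ i - V (pcompose (chb k) ?q) i * s ^ i"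
   by (simp only: V_def lfun_diff left_diff_distrib)
  also have "... = jcheb (\<lambda>l. (a l - h) / s) (\<lambda>l. b l / s\<^sup>2) (Suc (Suc k)) i"
   unfolding mult 3 jcheb.simps ..
  finally show ?case .
 qed
 then show ?thesis by (simp only: V_def)
qed

lemma moments_jcheb:
 assumes s: "s ~= 0" and N: "2 * j + 2 <= N"
 shows "lfun (mom (G y (Suc N)) (G y N)) (pcompose (chb j) [:- h / s, 1 / s:])
    = jcheb (\<lambda>l. (jac_a y N l - h) / s) (\<lambda>l. jac_b y N l / s\<^sup>2) j 0"
proof -
 have d: "degree (pcompose (chb j) [:- h / s, 1 / s:]) = j" using s by (simp add: degree_pcompose chb_degree)
 have "lfun (mom (G y (Suc N)) (G y N)) (pcompose (chb j) [:- h / s, 1 / s:])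
   = lfun (\<lambda>k. (jact (jac_a y N) (jac_b y N) ^^ k) e0 0) (pcompose (chb j) [:- h / s, 1 / s:])"
  unfolding lfun_def d
 proof (rule sum.cong[OF refl])
  fix k assume "k \<in> {..j}"
  then have "2 * k + 2 <= N" using N by simp
  from jacobi_powers[OF this, of y 0]
  show "coeff (pcompose (chb j) [:- h / s, 1 / s:]) k * mom (G y (Suc N)) (G y N) k
    = coeff (pcompose (chb j) [:- h / s, 1 / s:]) k * (jact (jac_a y N) (jac_b y N) ^^ k) e0 0"
   by (simp add: mom_frac_ratio)
 qed
 also have "... = jcheb (\<lambda>l. (jac_a y N l - h) / s) (\<lambda>l. jac_b y N l / s\<^sup>2) j 0"
  using jcheb_conjugate[OF s, of "jac_a y N" "jac_b y N" 0 j h] by simp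
 finally show ?thesis .
qed

text \<open>The polynomial of degree \<open>j\<close> only moves \<open>j\<close> steps away from the corner, so it sees only the first \<open>j\<close> entries.\<close>
lemma jcheb_cong:
 "(!!l. l < j ==> a l = a' l) ==> (!!l. l < j ==> b l = b' l) ==> jcheb a b j = jcheb a' b' j"
proof (induction j rule: chb.induct)
 case 2
 then show ?case by (auto simp: jact_def fun_eq_iff)
next
 case (3 k)
 have 1: "jcheb a b (Suc k) = jcheb a' b' (Suc k)" and 2: "jcheb a b k = jcheb a' b' k" using 3 by auto
 have "jact a b (jcheb a' b' (Suc k)) i = jact a' b' (jcheb a' b' (Suc k)) i" for i
 proof (cases "i < Suc (Suc k)")
  case True
  then show ?thesis using 3(3,4) by (simp add: jact_def)
 next
  case False
  then show ?thesis by (simp add: jact_def jcheb_support)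
 qed
 then show ?case by (simp add: 1 2)
qed simp

text \<open>The exact first order entries of the Jacobi matrix in terms of the variables \<open>t\<close>: \<open>x\<close> stands for a quantity that tends to \<open>\<xi>\<close>, and \<open>r\<close> and \<open>e\<close> tend to zero.\<close>
definition lin_a :: "real => real => rseq => nat => real" where
 "lin_a x r t l = t (2 * l) + (if l = 0 then 0 else x + r * t (2 * l - 1))"

definition lin_b :: "real => real => rseq => nat => real" where
 "lin_b e r t l = t (Suc (2 * l)) + r * t (2 * l) + e * r * t (2 * l) * t (Suc (2 * l))"

text \<open>The convergence is uniform on boxes because \<open>jcheb_linear\<close> covers arbitrary bounded sequences of perturbations, in particular a sequence of worst points.\<close>
lemma chebyshev_moment_asymptotics:
 fixes e r x :: rseq
 assumes e: "e \<longlonglongrightarrow> 0" "!!n. e n ~= 0" and r: "r \<longlonglongrightarrow> 0" and x: "x \<longlonglongrightarrow> \<xi>" and R: "R > 0" and \<delta>: "\<delta> > 0"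
 shows "eventually (\<lambda>n. \<forall>t. (\<forall>j<2 * k + 2. \<bar>t j\<bar> <= R) -->
  \<bar>jcheb (\<lambda>l. e n * lin_a (x n) (r n) t l) (\<lambda>l. 1 + e n * lin_b (e n) (r n) t l) (Suc k) 0 / e n
    - (if even k & k >= 2 then \<xi> else 0) - t k\<bar> < \<delta>) sequentially"
proof -
 define D where "D n t = jcheb (\<lambda>l. e n * lin_a (x n) (r n) t l) (\<lambda>l. 1 + e n * lin_b (e n) (r n) t l) (Suc k) 0 / e n
    - (if even k & k >= 2 then \<xi> else 0) - t k" for n t
 define bad where "bad n t \<longleftrightarrow> (\<forall>j<2 * k + 2. \<bar>t j\<bar> <= R) & ~ \<bar>D n t\<bar> < \<delta>" for n t
 \<comment> \<open>A worst point for each \<open>n\<close>, then cut off to the coordinates that matter so that all of them are bounded.\<close>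
 define tt where "tt n = (if \<exists>t. bad n t then SOME t. bad n t else (\<lambda>_. 0))" for n
 define tr where "tr n j = (if j < 2 * k + 2 then tt n j else 0)" for n j
 have ttR: "\<bar>tt n j\<bar> <= R" if "j < 2 * k + 2" for n j
  using that R someI_ex[of "bad n"] by (auto simp: tt_def bad_def)
 have trR: "\<bar>tr n j\<bar> <= R" for n j using ttR R by (auto simp: tr_def)
 obtain X where X: "!!n. \<bar>x n\<bar> <= X" using convergent_imp_Bseq[OF convergentI[OF x]] by (auto simp: Bseq_def)
 obtain Q where Q: "!!n. \<bar>r n\<bar> <= Q" using convergent_imp_Bseq[OF convergentI[OF r]] by (auto simp: Bseq_def)
 obtain E where E: "!!n. \<bar>e n\<bar> <= E" using convergent_imp_Bseq[OF convergentI[OF e(1)]] by (auto simp: Bseq_def)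
 have Q0: "Q >= 0" and E0: "E >= 0" and X0: "X >= 0" using Q[of 0] E[of 0] X[of 0] by auto
 have pr: "\<bar>r n * tr n j\<bar> <= Q * R" "\<bar>r n * tr n j\<bar> <= \<bar>r n\<bar> * R" "\<bar>e n * r n * tr n i * tr n j\<bar> <= E * Q * R * R"
  "\<bar>e n * r n * tr n i * tr n j\<bar> <= \<bar>r n\<bar> * (E * R * R)" for n i j
 proof -
  show "\<bar>r n * tr n j\<bar> <= Q * R" unfolding abs_mult by (intro mult_mono Q trR) (use Q0 in auto)
  show "\<bar>r n * tr n j\<bar> <= \<bar>r n\<bar> * R" unfolding abs_mult by (intro mult_mono trR) auto
  show "\<bar>e n * r n * tr n i * tr n j\<bar> <= E * Q * R * R" unfolding abs_mult by (intro mult_mono E Q trR) (use Q0 E0 R in auto)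
  have "\<bar>e n\<bar> * \<bar>r n\<bar> * \<bar>tr n i\<bar> * \<bar>tr n j\<bar> <= E * \<bar>r n\<bar> * R * R" by (intro mult_mono E trR) (use E0 R in auto)
  then show "\<bar>e n * r n * tr n i * tr n j\<bar> <= \<bar>r n\<bar> * (E * R * R)" by (simp add: abs_mult mult_ac)
 qed
 have A: "Bseq (\<lambda>n. lin_a (x n) (r n) (tr n) l)" for l
 proof (rule BseqI')
  fix n
  show "norm (lin_a (x n) (r n) (tr n) l) <= R + (X + Q * R)"
   using trR[of n "2 * l"] X[of n] pr(1)[of n "2 * l - 1"] Q0 X0 R by (auto simp: lin_a_def abs_le_iff)
 qed
 have B: "Bseq (\<lambda>n. lin_b (e n) (r n) (tr n) l)" for l
 proof (rule BseqI')
  fix n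
  show "norm (lin_b (e n) (r n) (tr n) l) <= R + Q * R + E * Q * R * R"
   using trR[of n "Suc (2 * l)"] pr(1)[of n "2 * l"] pr(3)[of n "2 * l" "Suc (2 * l)"] unfolding lin_b_def real_norm_def by linarith
 qed
 let ?d = "\<lambda>n. dal (lin_a (x n) (r n) (tr n)) (lin_b (e n) (r n) (tr n)) (Suc k) 0"
 have 1: "(\<lambda>n. (jcheb (\<lambda>l. e n * lin_a (x n) (r n) (tr n) l) (\<lambda>l. 1 + e n * lin_b (e n) (r n) (tr n) l) (Suc k) 0 - (if 0 = Suc k then 1 else 0)) / e n - ?d n) \<longlonglongrightarrow> 0"
  by (rule jcheb_linear[OF e A B])
 have 2: "(\<lambda>n. ?d n - (if even k & k >= 2 then \<xi> else 0) - tr n k) \<longlonglongrightarrow> 0"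
 proof (rule Lim_null_comparison)
  show "(\<lambda>n. \<bar>x n - \<xi>\<bar> + \<bar>r n\<bar> * R + \<bar>r n\<bar> * (E * R * R)) \<longlonglongrightarrow> 0"
  proof -
   have "(\<lambda>n. \<bar>x n - \<xi>\<bar>) \<longlonglongrightarrow> 0" using x by (simp add: LIM_zero tendsto_rabs_zero)
   moreover have "(\<lambda>n. \<bar>r n\<bar>) \<longlonglongrightarrow> 0" using r by (rule tendsto_rabs_zero)
   ultimately have "(\<lambda>n. \<bar>x n - \<xi>\<bar> + \<bar>r n\<bar> * R + \<bar>r n\<bar> * (E * R * R)) \<longlonglongrightarrow> 0 + 0 * R + 0 * (E * R * R)" by (intro tendsto_intros)
   then show ?thesis by simp
  qed
  show "eventually (\<lambda>n. norm (?d n - (if even k & k >= 2 then \<xi> else 0) - tr n k) <= \<bar>x n - \<xi>\<bar> + \<bar>r n\<bar> * R + \<bar>r n\<bar> * (E * R * R)) sequentially"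
  proof (rule always_eventually, rule allI)
   fix n
   have nn: "\<bar>r n\<bar> * R >= 0" "\<bar>r n\<bar> * (E * R * R) >= 0" using R E0 by auto
   show "norm (?d n - (if even k & k >= 2 then \<xi> else 0) - tr n k) <= \<bar>x n - \<xi>\<bar> + \<bar>r n\<bar> * R + \<bar>r n\<bar> * (E * R * R)"
   proof (cases "even k")
    case True
    then obtain l where l: "k = 2 * l" by (auto elim: evenE)
    have "?d n - (if even k & k >= 2 then \<xi> else 0) - tr n k = (if l = 0 then 0 else x n - \<xi> + r n * tr n (2 * l - 1))"
     using l by (auto simp: lin_a_def dal_first)
    moreover have "\<bar>x n - \<xi> + r n * tr n (2 * l - 1)\<bar> <= \<bar>x n - \<xi>\<bar> + \<bar>r n\<bar> * R + \<bar>r n\<bar> * (E * R * R)"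
     using pr(2)[of n "2 * l - 1"] nn by linarith
    ultimately show ?thesis using nn by simp
   next
    case False
    then obtain l where l: "k = Suc (2 * l)" by (auto elim: oddE)
    have "?d n - (if even k & k >= 2 then \<xi> else 0) - tr n k = r n * tr n (2 * l) + e n * r n * tr n (2 * l) * tr n (Suc (2 * l))"
     using l by (auto simp: lin_b_def dal_first)
    then show ?thesis using pr(2)[of n "2 * l"] pr(4)[of n "2 * l" "Suc (2 * l)"] nn by (simp only: real_norm_def) linarith
   qed
  qed
 qed
 have Deq: "D n (tt n) = jcheb (\<lambda>l. e n * lin_a (x n) (r n) (tr n) l) (\<lambda>l. 1 + e n * lin_b (e n) (r n) (tr n) l) (Suc k) 0 / e n
    - (if even k & k >= 2 then \<xi> else 0) - tr n k" for n
 proof -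
  have "jcheb (\<lambda>l. e n * lin_a (x n) (r n) (tt n) l) (\<lambda>l. 1 + e n * lin_b (e n) (r n) (tt n) l) (Suc k)
    = jcheb (\<lambda>l. e n * lin_a (x n) (r n) (tr n) l) (\<lambda>l. 1 + e n * lin_b (e n) (r n) (tr n) l) (Suc k)"
   by (rule jcheb_cong) (auto simp: lin_a_def lin_b_def tr_def)
  then show ?thesis by (simp add: D_def tr_def)
 qed
 have "D n (tt n) = (jcheb (\<lambda>l. e n * lin_a (x n) (r n) (tr n) l) (\<lambda>l. 1 + e n * lin_b (e n) (r n) (tr n) l) (Suc k) 0 - (if 0 = Suc k then 1 else 0)) / e n - ?d n
   + (?d n - (if even k & k >= 2 then \<xi> else 0) - tr n k)" for n
  unfolding Deq by simp
 then have "(\<lambda>n. D n (tt n)) \<longlonglongrightarrow> 0" using tendsto_add[OF 1 2] by (simp only: add_0)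
 from tendstoD[OF this \<delta>] have "eventually (\<lambda>n. \<bar>D n (tt n)\<bar> < \<delta>) sequentially" by (simp add: dist_real_def)
 then have "eventually (\<lambda>n. \<forall>t. (\<forall>j<2 * k + 2. \<bar>t j\<bar> <= R) --> \<bar>D n t\<bar> < \<delta>) sequentially"
 proof eventually_elim
  case (elim n)
  have "~ (\<exists>t. bad n t)"
  proof
   assume ex: "\<exists>t. bad n t"
   then have "bad n (tt n)" unfolding tt_def by (simp add: someI_ex)
   then show False using elim by (simp add: bad_def)
  qed
  then show ?case by (auto simp: bad_def)
 qed
 then show ?thesis unfolding D_def .
qed

section \<open>Chebyshev coordinates on moment sequences\<close>

text \<open>The integral of the Chebyshev polynomial of degree \<open>k + 1\<close> against \<open>\<rho>\<^sub>\<xi>\<close>, see \<open>rho_chb\<close>.\<close>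
definition rho_coord :: "real => nat => real" where
 "rho_coord \<xi> k = (if even k & k >= 2 then \<xi> else 0)"

definition to_cheb :: "real => rseq => nat => real" where
 "to_cheb \<xi> m k = mfun m (chb (Suc k)) - rho_coord \<xi> k"

text \<open>The Chebyshev polynomials are monic, so the coordinate map is triangular with unit diagonal and can be inverted coordinate by coordinate.\<close>
function from_cheb :: "real => rseq => nat => real" where
 "from_cheb \<xi> y k = y k + rho_coord \<xi> k - (\<Sum>j<k. coeff (chb (Suc k)) (Suc j) * from_cheb \<xi> y j)"
 by auto
termination by (relation "inv_image less_than (\<lambda>(x, y, k). k)") auto

declare from_cheb.simps [simp del]

lemma mfun_chb: "mfun m (chb (Suc k)) = (\<Sum>j<k. coeff (chb (Suc k)) (Suc j) * m j) + m k"
proof -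
 have "mfun m (chb (Suc k)) = (\<Sum>j\<in>{0..k}. coeff (chb (Suc k)) (Suc j) * m j)"
  unfolding mfun_def by (simp only: chb_degree One_nat_def sum.shift_bounds_cl_Suc_ivl diff_Suc_Suc diff_zero)
 also have "{0..k} = insert k {..<k}" by auto
 finally show ?thesis by (simp add: chb_degree)
qed

lemma to_from_cheb: "to_cheb \<xi> (from_cheb \<xi> y) = y"
proof
 fix k show "to_cheb \<xi> (from_cheb \<xi> y) k = y k"
  unfolding to_cheb_def mfun_chb by (subst (2) from_cheb.simps) simp
qed

lemma from_to_cheb: "from_cheb \<xi> (to_cheb \<xi> m) = m"
proof
 fix k show "from_cheb \<xi> (to_cheb \<xi> m) k = m k"
 proof (induction k rule: less_induct)
  case (less k)
  have "(\<Sum>j<k. coeff (chb (Suc k)) (Suc j) * from_cheb \<xi> (to_cheb \<xi> m) j) = (\<Sum>j<k. coeff (chb (Suc k)) (Suc j) * m j)"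
   using less by simp
  then show ?case by (subst from_cheb.simps) (simp add: to_cheb_def mfun_chb)
 qed
qed

lemma continuous_from_cheb: "continuous_on UNIV (from_cheb \<xi>)"
proof (rule continuous_on_coordinatewise_then_product)
 fix k show "continuous_on UNIV (\<lambda>y. from_cheb \<xi> y k)"
 proof (induction k rule: less_induct)
  case (less k)
  have "continuous_on UNIV (\<lambda>y. y k + rho_coord \<xi> k - (\<Sum>j\<in>{..<k}. coeff (chb (Suc k)) (Suc j) * from_cheb \<xi> y j))"
   by (intro continuous_intros continuous_coordinate less) auto
  then show ?case by (subst from_cheb.simps)
 qed
qed

lemma continuous_to_cheb: "continuous_on UNIV (to_cheb \<xi>)"
 by (rule continuous_on_coordinatewise_then_product, unfold to_cheb_def mfun_chb) (intro continuous_intros continuous_coordinate)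

lemma rate_function_quad_rate:
 assumes q: "orthonormal_polynomials semicircle q" and \<sigma>: "\<sigma> m \<in> M0f" "moments (\<sigma> m) = m"
 shows "rate_function \<xi> q \<sigma> m = quad_rate (to_cheb \<xi> m)"
proof -
 define f where "f k = (signed_integral (\<lambda>A. \<sigma> m A - rho \<xi> A) (poly (q k)))\<^sup>2" for k
 have f: "f k = (mfun m (chb k) - (if odd k & k >= 3 then \<xi> else 0))\<^sup>2" for k
 proof -
  have neg: "mfun m (- chb k) = - mfun m (chb k)" by (simp add: mfun_def sum_negf)
  have "f k = (mfun m (q k) - (\<integral>x. rho_dens \<xi> x * poly (q k) x \<partial>lborel))\<^sup>2"
   by (simp only: f_def rate_coordinate[OF \<sigma>])
  also have "... = (mfun m (chb k) - (\<integral>x. rho_dens \<xi> x * poly (chb k) x \<partial>lborel))\<^sup>2"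
   using orthonormal_unique[OF q, of k]
  proof
   assume "q k = - chb k"
   then have "mfun m (q k) - (\<integral>x. rho_dens \<xi> x * poly (q k) x \<partial>lborel) = - (mfun m (chb k) - (\<integral>x. rho_dens \<xi> x * poly (chb k) x \<partial>lborel))"
    by (simp add: neg)
   then show ?thesis by (simp only: power2_minus)
  qed simp
  finally show ?thesis by (simp only: rho_chb)
 qed
 have f0: "(\<Sum>i<1. ennreal (f i)) = 0" unfolding f by (simp add: mfun_def)
 have f1: "f (k + 1) = (to_cheb \<xi> m k)\<^sup>2" for k
 proof -
  have "(odd (k + 1) & k + 1 >= 3) = (even k & k >= 2)" by auto
  then show ?thesis unfolding f to_cheb_def rho_coord_def by (simp only: Suc_eq_plus1)
 qed
 have "(\<Sum>k. ennreal (f k)) = (\<Sum>k. ennreal (f (k + 1))) + (\<Sum>i<1. ennreal (f i))"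
  by (rule suminf_offset) (rule summableI)
 then have "(\<Sum>k. ennreal (f k)) = (\<Sum>k. ennreal ((to_cheb \<xi> m k)\<^sup>2))"
  unfolding f0 f1 by (simp only: add_0_right)
 then show ?thesis by (simp only: rate_function_def quad_rate_def f_def)
qed

section \<open>Independent variables with Gaussian large deviations\<close>

text \<open>The entry \<open>z\<^sub>j\<^sub>+\<^sub>1\<close> of the continued fraction has the gamma law with shape \<open>kap \<beta> g n j - cshift \<beta> j\<close> and scale \<open>2\<close>: the leading part \<open>kap\<close> grows, the correction does not depend on \<open>n\<close>. The maps \<open>tcoord\<close> and \<open>ycoord\<close> pass between the entries and their centred and scaled versions and reverse the numbering.\<close>
definition kap :: "real => real => nat => nat => real" where
 "kap \<beta> g n j = (if even j then g else real n * \<beta> / 2)"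

definition cshift :: "real => nat => real" where
 "cshift \<beta> j = real (Suc j div 2) * \<beta> / 2"

definition tcoord :: "real => real => real => nat => rseq => nat => real" where
 "tcoord \<beta> g b n y j = (if j < 2 * n - 1 then (y (2 * n - 1 - Suc j) - 2 * kap \<beta> g n j) / (2 * sqrt (kap \<beta> g n j * b)) else 0)"

definition ycoord :: "real => real => real => nat => rseq => nat => real" where
 "ycoord \<beta> g b n t i = (if i < 2 * n - 1 then 2 * kap \<beta> g n (2 * n - 1 - Suc i) + 2 * sqrt (kap \<beta> g n (2 * n - 1 - Suc i) * b) * t (2 * n - 1 - Suc i) else 0)"

abbreviation chain_mom :: "real => real => real => nat => rseq => nat => real" where
 "chain_mom \<beta> g b n t \<equiv> mom (G (ycoord \<beta> g b n t) (2 * n)) (G (ycoord \<beta> g b n t) (2 * n - 1))"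

abbreviation step_law :: "real => real => real => nat => nat => real measure" where
 "step_law \<beta> g b n j \<equiv> tlaw (kap \<beta> g n j) b (kap \<beta> g n j - cshift \<beta> j)"

lemma shape_kap: "j < 2 * n - 1 ==> shape \<beta> g n (2 * n - 1 - Suc j) = kap \<beta> g n j - cshift \<beta> j"
proof (cases "even j")
 case True
 assume j: "j < 2 * n - 1"
 obtain i where i: "j = 2 * i" using True by (auto elim: evenE)
 have e: "2 * n - 1 - Suc j = 2 * (n - 1 - i)" using j i by simp
 have "real (n - 1 - i) = real n - 1 - real i" using j i by (simp add: of_nat_diff)
 then show ?thesis unfolding e by (simp add: shape_def kap_def cshift_def i field_simps)
next
 case False
 assume j: "j < 2 * n - 1"
 obtain i where i: "j = Suc (2 * i)" using False by (auto elim: oddE)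
 have e: "2 * n - 1 - Suc j = Suc (2 * (n - 2 - i))" using j i by simp
 have "real (Suc (n - 2 - i)) = real n - 1 - real i" using j i by (simp add: of_nat_diff)
 moreover have "(Suc (2 * (n - 2 - i)) + 1) div 2 = Suc (n - 2 - i)" by simp
 ultimately show ?thesis unfolding e by (simp add: shape_def kap_def cshift_def i field_simps)
qed

lemma ycoord_tcoord:
 assumes "kap \<beta> g n 0 > 0" "kap \<beta> g n 1 > 0" "b > 0" "i < 2 * n - 1"
 shows "ycoord \<beta> g b n (tcoord \<beta> g b n y) i = y i"
proof -
 let ?j = "2 * n - 1 - Suc i"
 have "kap \<beta> g n ?j > 0" using assms by (auto simp: kap_def split: if_splits)
 then have s: "sqrt (kap \<beta> g n ?j * b) > 0" using assms by simp
 have j: "?j < 2 * n - 1" "2 * n - 1 - Suc ?j = i" using assms(4) by auto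
 have "ycoord \<beta> g b n (tcoord \<beta> g b n y) i = 2 * kap \<beta> g n ?j + 2 * sqrt (kap \<beta> g n ?j * b) * ((y i - 2 * kap \<beta> g n ?j) / (2 * sqrt (kap \<beta> g n ?j * b)))"
  unfolding ycoord_def tcoord_def if_P[OF assms(4)] if_P[OF j(1)] j(2) ..
 also have "x + 2 * z * ((w - x) / (2 * z)) = w" if "z > 0" for x z w :: real using that by simp
 from this[OF s] have "2 * kap \<beta> g n ?j + 2 * sqrt (kap \<beta> g n ?j * b) * ((y i - 2 * kap \<beta> g n ?j) / (2 * sqrt (kap \<beta> g n ?j * b))) = y i" .
 finally show ?thesis .
qed

lemma ycoord_measurable [measurable]: "ycoord \<beta> g b n \<in> borel \<rightarrow>\<^sub>M borel"
proof (rule measurable_seqI)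
 fix i
 show "(\<lambda>t. ycoord \<beta> g b n t i) \<in> borel_measurable borel"
  unfolding ycoord_def by (cases "i < 2 * n - 1") simp_all
qed

lemma tcoord_measurable: "tcoord \<beta> g b n \<in> lebs {..<2 * n - 1} \<rightarrow>\<^sub>M borel"
proof (rule measurable_seqI)
 fix j
 show "(\<lambda>y. tcoord \<beta> g b n y j) \<in> borel_measurable (lebs {..<2 * n - 1})"
 proof (cases "j < 2 * n - 1")
  case True
  then have [measurable]: "(\<lambda>y. y (2 * n - 1 - Suc j)) \<in> borel_measurable (lebs {..<2 * n - 1})"
   using measurable_component_singleton[of "2 * n - 1 - Suc j" "{..<2 * n - 1}" "\<lambda>_. lborel"] by simp
  show ?thesis unfolding tcoord_def if_P[OF True] by measurable
 qed (simp add: tcoord_def)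
qed


text \<open>The law of \<open>moment_law\<close>, normalised and written in the centred variables. Total mass one identifies the constant and shows that all gamma integrals are positive and finite.\<close>
lemma chain_law_exists:
 assumes n: "n >= 1" and \<beta>: "\<beta> > 0" and g: "g > 0" and b: "b > 0" and M: "prob_space M"
  and lag: "laguerre_ensemble \<beta> g n M L" and dir: "dirichlet_weights \<beta> n M W"
  and ind: "prob_space.indep_var M
      (\<Pi>\<^sub>M i\<in>{1..n}. borel) (\<lambda>\<omega>. \<lambda>i\<in>{1..n}. L i \<omega>)
      (\<Pi>\<^sub>M i\<in>{1..n}. borel) (\<lambda>\<omega>. \<lambda>i\<in>{1..n}. W i \<omega>)"
 shows "\<exists>P. sets P = sets borel &
  (\<forall>F\<in>borel_measurable borel. (\<integral>\<^sup>+\<omega>. F (\<lambda>k. \<Sum>i\<in>{1..n}. W i \<omega> * L i \<omega> ^ k) \<partial>M)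
    = (\<integral>\<^sup>+t. F (chain_mom \<beta> g b n t) \<partial>P)) &
  (\<forall>K\<le>2 * n - 1. \<forall>f. (\<forall>j<K. f j \<in> borel_measurable borel) -->
    (\<integral>\<^sup>+t. (\<Prod>j<K. f j (t j)) \<partial>P) = (\<Prod>j<K. \<integral>\<^sup>+x. f j x \<partial>step_law \<beta> g b n j))"
proof -
 interpret prob_space M by fact
 define N where "N = 2 * n - 1"
 define a where "a i = shape \<beta> g n i" for i
 define D where "D y = (\<Prod>i<N. ennreal (gdens (a i) (y i)))" for y
 from moment_law[OF n \<beta> M lag dir ind] obtain C where
  C: "!!F. F \<in> borel_measurable borel ==> (\<integral>\<^sup>+\<omega>. F (\<lambda>k. \<Sum>i\<in>{1..n}. W i \<omega> * L i \<omega> ^ k) \<partial>M)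
   = C * LI {..<N} (\<lambda>y. D y * F (mom (G y (2 * n)) (G y (2 * n - 1)))) (\<lambda>_. 0)"
  unfolding D_def a_def N_def by blast
 have "1 = C * LI {..<N} D (\<lambda>_. 0)" using C[of "\<lambda>_. 1"] emeasure_space_1 by simp
 also have "LI {..<N} D (\<lambda>_. 0) = (\<Prod>i<N. gnorm (a i))"
  unfolding D_def gnorm_def by (rule LI_prod) auto
 finally have C1: "C * (\<Prod>i<N. gnorm (a i)) = 1" by simp
 have nz: "gnorm (a i) ~= 0" if "i < N" for i
 proof
  assume "gnorm (a i) = 0"
  then have "(\<Prod>i<N. gnorm (a i)) = 0" using that by (intro prod_zero) auto
  with C1 show False by simp
 qed
 have nt: "gnorm (a i) ~= \<infinity>" if "i < N" for i
 proof
  assume inf: "gnorm (a i) = \<infinity>"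
  have "(\<Prod>j\<in>{..<N}. gnorm (a j)) = gnorm (a i) * (\<Prod>j\<in>{..<N} - {i}. gnorm (a j))" using that by (intro prod.remove) auto
  moreover have "(\<Prod>j\<in>{..<N} - {i}. gnorm (a j)) ~= 0" using nz by (auto simp: prod_zero_iff)
  ultimately have "(\<Prod>j<N. gnorm (a j)) = \<infinity>" using inf by (simp add: ennreal_top_mult)
  moreover have "C ~= 0" using C1 by auto
  ultimately show False using C1 by (simp add: ennreal_mult_top)
 qed
 have kp: "kap \<beta> g n j > 0" for j using n \<beta> g by (simp add: kap_def)
 define P where "P = distr (density (lebs {..<N}) (\<lambda>x. C * D x)) borel (tcoord \<beta> g b n)"
 have Dm: "D \<in> borel_measurable (lebs {..<N})"
  unfolding D_def
 proof (rule borel_measurable_prod_ennreal)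
  fix i assume "i \<in> {..<N}"
  then have [measurable]: "(\<lambda>y. y i) \<in> borel_measurable (lebs {..<N})"
   using measurable_component_singleton[of i "{..<N}" "\<lambda>_. lborel"] by simp
  show "(\<lambda>x. ennreal (gdens (a i) (x i))) \<in> borel_measurable (lebs {..<N})" by measurable
 qed
 have tm: "tcoord \<beta> g b n \<in> lebs {..<N} \<rightarrow>\<^sub>M borel" unfolding N_def by (rule tcoord_measurable)
 have P: "(\<integral>\<^sup>+t. F t \<partial>P) = C * LI {..<N} (\<lambda>y. D y * F (tcoord \<beta> g b n y)) (\<lambda>_. 0)" if F: "F \<in> borel_measurable borel" for F
 proof -
  have Fm: "(\<lambda>x. F (tcoord \<beta> g b n x)) \<in> borel_measurable (lebs {..<N})" by (rule measurable_compose[OF tm F])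
  have "(\<integral>\<^sup>+t. F t \<partial>P) = (\<integral>\<^sup>+x. F (tcoord \<beta> g b n x) \<partial>density (lebs {..<N}) (\<lambda>x. C * D x))"
   unfolding P_def by (rule nn_integral_distr) (use tm F in simp_all)
  also have "... = (\<integral>\<^sup>+x. (C * D x) * F (tcoord \<beta> g b n x) \<partial>lebs {..<N})"
   by (rule nn_integral_density) (use Dm Fm in \<open>auto intro: borel_measurable_times_ennreal\<close>)
  also have "... = (\<integral>\<^sup>+x. C * (D x * F (tcoord \<beta> g b n x)) \<partial>lebs {..<N})" by (simp only: mult.assoc)
  also have "... = C * (\<integral>\<^sup>+x. D x * F (tcoord \<beta> g b n x) \<partial>lebs {..<N})"
   by (rule nn_integral_cmult) (use Dm Fm in \<open>auto intro: borel_measurable_times_ennreal\<close>)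
  also have "(\<integral>\<^sup>+x. D x * F (tcoord \<beta> g b n x) \<partial>lebs {..<N}) = LI {..<N} (\<lambda>y. D y * F (tcoord \<beta> g b n y)) (\<lambda>_. 0)"
  proof -
   have "D (\<lambda>i. if i \<in> {..<N} then x i else 0) = D x" for x unfolding D_def by (rule prod.cong) auto
   moreover have "tcoord \<beta> g b n (\<lambda>i. if i \<in> {..<N} then x i else 0) = tcoord \<beta> g b n x" for x by (auto simp: tcoord_def N_def fun_eq_iff)
   ultimately show ?thesis unfolding LI_def by simp
  qed
  finally show ?thesis .
 qed
 have law: "(\<integral>\<^sup>+\<omega>. F (\<lambda>k. \<Sum>i\<in>{1..n}. W i \<omega> * L i \<omega> ^ k) \<partial>M)
    = (\<integral>\<^sup>+t. F (chain_mom \<beta> g b n t) \<partial>P)"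
  if F: "F \<in> borel_measurable borel" for F
 proof -
  have Gy: "G (ycoord \<beta> g b n (tcoord \<beta> g b n y)) i = G y i" if "i <= 2 * n" for y i
   by (rule G_cong) (rule ycoord_tcoord[OF kp kp b], use that in simp)
  have "(\<lambda>t. F (chain_mom \<beta> g b n t)) \<in> borel_measurable borel"
   by (rule measurable_compose[OF _ F]) measurable
  from P[OF this] show ?thesis unfolding C[OF F] by (simp only: Gy order_refl diff_le_self)
 qed
 have prodlaw: "(\<integral>\<^sup>+t. (\<Prod>j<K. f j (t j)) \<partial>P) = (\<Prod>j<K. \<integral>\<^sup>+x. f j x \<partial>step_law \<beta> g b n j)"
  if K: "K <= 2 * n - 1" and f: "!!j. j < K ==> f j \<in> borel_measurable borel" for K f
 proof -
  let ?tau = "\<lambda>j x. (x - 2 * kap \<beta> g n j) / (2 * sqrt (kap \<beta> g n j * b))"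
  define h where "h j x = (if j < K then f j (?tau j x) else 1)" for j x
  define I where "I j = (if j < K then (\<integral>\<^sup>+x. f j x \<partial>step_law \<beta> g b n j) else 1)" for j
  have hm: "h j \<in> borel_measurable borel" for j
  proof (cases "j < K")
   case True
   have "(\<lambda>x. f j (?tau j x)) \<in> borel_measurable borel" by (rule measurable_compose[OF _ f[OF True]]) simp
   moreover have "h j = (\<lambda>x. f j (?tau j x))" using True by (simp add: h_def fun_eq_iff)
   ultimately show ?thesis by simp
  next
   case False
   then have "h j = (\<lambda>x. 1)" by (simp add: h_def fun_eq_iff)
   then show ?thesis by simp
  qed
  have cut: "(\<Prod>j<N. if j < K then u j else 1) = (\<Prod>j<K. u j)" for u :: "nat => ennreal"
  proof -
   have "(\<Prod>j<N. if j < K then u j else 1) = (\<Prod>j\<in>{..<N} \<inter> {..<K}. u j)"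
    by (subst prod.inter_restrict) auto
   moreover have "{..<N} \<inter> {..<K} = {..<K}" using K by (auto simp: N_def)
   ultimately show ?thesis by simp
  qed
  have hp: "(\<Prod>j<K. f j (tcoord \<beta> g b n y j)) = (\<Prod>i<N. h (N - Suc i) (y i))" for y
  proof -
   have "(\<Prod>j<K. f j (tcoord \<beta> g b n y j)) = (\<Prod>j<K. f j (?tau j (y (N - Suc j))))"
    using K by (intro prod.cong) (auto simp: tcoord_def N_def)
   also have "... = (\<Prod>j<N. h j (y (N - Suc j)))" unfolding h_def by (rule cut[symmetric])
   also have "... = (\<Prod>j<N. h (N - Suc (N - Suc j)) (y (N - Suc j)))" by (rule prod.cong) auto
   also have "... = (\<Prod>i<N. h (N - Suc i) (y i))" by (rule prod.nat_diff_reindex)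
   finally show ?thesis .
  qed
  have one: "(\<integral>\<^sup>+x. ennreal (gdens (a i) x) * h (N - Suc i) x \<partial>lborel) = gnorm (a i) * I (N - Suc i)" if i: "i < N" for i
  proof (cases "N - Suc i < K")
   case True
   let ?j = "N - Suc i"
   have ai: "a i = kap \<beta> g n ?j - cshift \<beta> ?j"
   proof -
    have "?j < 2 * n - 1" "2 * n - 1 - Suc ?j = i" using i by (auto simp: N_def)
    from shape_kap[OF this(1), of \<beta> g] this(2) show ?thesis by (simp only: a_def)
   qed
   have [measurable]: "f ?j \<in> borel_measurable borel" by (rule f[OF True])
   have "(\<integral>\<^sup>+x. f ?j x \<partial>tlaw (kap \<beta> g n ?j) b (a i)) = (\<integral>\<^sup>+x. ennreal (gdens (a i) x) / gnorm (a i) * f ?j (?tau ?j x) \<partial>lborel)"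
    unfolding tlaw_def by (subst nn_integral_distr) (auto simp: nn_integral_density)
   also have "... = (\<integral>\<^sup>+x. inverse (gnorm (a i)) * (ennreal (gdens (a i) x) * h ?j x) \<partial>lborel)"
    using True by (simp add: h_def divide_ennreal_def mult_ac)
   also have "... = inverse (gnorm (a i)) * (\<integral>\<^sup>+x. ennreal (gdens (a i) x) * h ?j x \<partial>lborel)"
    by (rule nn_integral_cmult) (use hm[of ?j] in simp)
   finally have "gnorm (a i) * I ?j = gnorm (a i) * inverse (gnorm (a i)) * (\<integral>\<^sup>+x. ennreal (gdens (a i) x) * h ?j x \<partial>lborel)"
    using True by (simp add: I_def ai[symmetric] mult.assoc)
   moreover have "gnorm (a i) * inverse (gnorm (a i)) = 1"
    using nz[OF i] nt[OF i] by (metis divide_ennreal_def ennreal_divide_self infinity_ennreal_def top.not_eq_extremum)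
   ultimately show ?thesis by simp
  next
   case False
   then show ?thesis by (simp add: h_def I_def gnorm_def)
  qed
  have "(\<lambda>t. \<Prod>j<K. f j (t j)) \<in> borel_measurable borel"
   by (rule borel_measurable_prod_ennreal) (rule measurable_compose[OF measurable_product_coordinates], simp add: f)
  from P[OF this] have "(\<integral>\<^sup>+t. (\<Prod>j<K. f j (t j)) \<partial>P) = C * LI {..<N} (\<lambda>y. \<Prod>i<N. ennreal (gdens (a i) (y i)) * h (N - Suc i) (y i)) (\<lambda>_. 0)"
   unfolding hp D_def prod.distrib .
  also have "LI {..<N} (\<lambda>y. \<Prod>i<N. ennreal (gdens (a i) (y i)) * h (N - Suc i) (y i)) (\<lambda>_. 0)
    = (\<Prod>i<N. \<integral>\<^sup>+x. ennreal (gdens (a i) x) * h (N - Suc i) x \<partial>lborel)"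
   by (rule LI_prod[where f = "\<lambda>i x. ennreal (gdens (a i) x) * h (N - Suc i) x"]) (use hm in auto)
  also have "... = (\<Prod>i<N. gnorm (a i) * I (N - Suc i))" by (rule prod.cong) (use one in auto)
  also have "... = (\<Prod>i<N. gnorm (a i)) * (\<Prod>i<N. I i)" unfolding prod.distrib prod.nat_diff_reindex[of I N] ..
  also have "(\<Prod>i<N. I i) = (\<Prod>j<K. \<integral>\<^sup>+x. f j x \<partial>step_law \<beta> g b n j)"
   unfolding I_def by (rule cut)
  finally show ?thesis by (simp only: mult.assoc[symmetric] C1 mult_1)
 qed
 show ?thesis
  by (rule exI[of _ P]) (use law prodlaw in \<open>auto simp: P_def\<close>)
qed

section \<open>Chebyshev coordinates as functions of the independent variables\<close>

definition aff :: "real => real => nat => real poly" where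
 "aff \<beta> g n = [:- (2 * g) / sqrt (2 * g * real n * \<beta>), 1 / sqrt (2 * g * real n * \<beta>):]"

text \<open>The moments of \<open>\<nu>\<^sub>n\<close> as a function of the moments \<open>M\<close> of the unscaled spectral measure.\<close>
definition phi :: "real => real => real => nat => rseq => nat => real" where
 "phi \<beta> g b n M k = sqrt (real n * \<beta> / (2 * b)) * (lfun M (aff \<beta> g n ^ Suc k) - (\<integral>x. x ^ Suc k \<partial>semicircle))"

lemma moments_nu:
 assumes "\<beta> > 0" "b > 0"
 shows "moments (nu \<beta> g b n l w) = phi \<beta> g b n (\<lambda>k. \<Sum>i\<in>{1..n}. w i * l i ^ k)"
proof
 fix k
 have "poly (aff \<beta> g n) x = rescale \<beta> g n x" for x by (simp add: aff_def rescale_def diff_divide_distrib)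
 then show "moments (nu \<beta> g b n l w) k = phi \<beta> g b n (\<lambda>k. \<Sum>i\<in>{1..n}. w i * l i ^ k) k"
  unfolding moments_def phi_def lfun_atoms poly_power by (subst moment_nu) (use assms in simp_all)
qed

lemma phi_measurable [measurable]: "phi \<beta> g b n \<in> borel \<rightarrow>\<^sub>M borel"
proof (rule measurable_seqI)
 fix k show "(\<lambda>M. phi \<beta> g b n M k) \<in> borel_measurable borel" unfolding phi_def lfun_def by measurable
qed

lemma to_cheb_measurable [measurable]: "to_cheb \<xi> \<in> borel \<rightarrow>\<^sub>M borel"
 by (rule borel_measurable_continuous_onI[OF continuous_to_cheb])

text \<open>A Chebyshev polynomial of positive degree has mean zero under the semicircle law, and since the spectral measure has mass one (\<open>M 0 = 1\<close>), the missing constant coefficients of both measures cancel.\<close>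
lemma to_cheb_phi:
 assumes M0: "M 0 = 1"
 shows "to_cheb \<xi> (phi \<beta> g b n M) k = sqrt (real n * \<beta> / (2 * b)) * lfun M (pcompose (chb (Suc k)) (aff \<beta> g n)) - rho_coord \<xi> k"
proof -
 let ?c = "sqrt (real n * \<beta> / (2 * b))" and ?p = "chb (Suc k)" and ?A = "aff \<beta> g n"
 have d: "degree ?p = Suc k" by (simp add: chb_degree)
 have pw: "(\<lambda>x::real. x ^ j) = poly (monom (1::real) j)" for j :: nat by (rule ext) (simp add: poly_monom)
 have int: "integrable semicircle (\<lambda>x. x ^ j)" for j :: nat unfolding pw by (rule semicircle_integral(1))
 have one: "(\<integral>x. x ^ 0 \<partial>semicircle) = 1" using chb_orthonormal[of 0 0] by simp
 have pc: "pcompose ?p ?A = (\<Sum>j\<le>Suc k. smult (coeff ?p j) (?A ^ j))"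
  by (rule poly_eq_poly_eq_iff[THEN iffD1], rule ext) (simp only: poly_pcompose poly_altdef[of ?p] poly_sum d poly_smult poly_power)
 have l: "lfun M (pcompose ?p ?A) = (\<Sum>j\<le>Suc k. coeff ?p j * lfun M (?A ^ j))"
  unfolding pc lfun_sum lfun_smult ..
 have "0 = (\<integral>x. poly ?p x \<partial>semicircle)" using chb_orthonormal[of 0 "Suc k"] by simp
 also have "... = (\<integral>x. (\<Sum>j\<le>Suc k. coeff ?p j * x ^ j) \<partial>semicircle)" by (simp only: poly_altdef d)
 also have "... = (\<Sum>j\<le>Suc k. coeff ?p j * (\<integral>x. x ^ j \<partial>semicircle))"
  by (subst Bochner_Integration.integral_sum) (auto intro: int)
 finally have z: "(\<Sum>j\<le>Suc k. coeff ?p j * (\<integral>x. x ^ j \<partial>semicircle)) = 0" by simp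
 have "lfun M (?A ^ 0) = 1" using M0 by (simp add: lfun_def)
 then have "(\<Sum>j\<in>{1..Suc k}. coeff ?p j * (lfun M (?A ^ j) - (\<integral>x. x ^ j \<partial>semicircle)))
   = (\<Sum>j\<le>Suc k. coeff ?p j * (lfun M (?A ^ j) - (\<integral>x. x ^ j \<partial>semicircle)))"
  using one by (intro sum.mono_neutral_left) (auto simp: not_le)
 also have "... = lfun M (pcompose ?p ?A)" unfolding l right_diff_distrib sum_subtractf z by simp
 finally have s: "(\<Sum>j\<in>{1..Suc k}. coeff ?p j * (lfun M (?A ^ j) - (\<integral>x. x ^ j \<partial>semicircle))) = lfun M (pcompose ?p ?A)" .
 have "mfun (phi \<beta> g b n M) ?p = (\<Sum>j\<in>{1..Suc k}. ?c * (coeff ?p j * (lfun M (?A ^ j) - (\<integral>x. x ^ j \<partial>semicircle))))"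
  unfolding mfun_def d by (rule sum.cong) (auto simp: phi_def)
 then show ?thesis unfolding to_cheb_def by (simp only: sum_distrib_left[symmetric] s)
qed

text \<open>Here \<open>p = sqrt \<gamma>\<^sub>n\<close>, \<open>u = sqrt (n \<beta> / 2)\<close> and \<open>v = sqrt b\<^sub>n\<close>; the choice \<open>e = v / u\<close> makes the coefficient of the leading variable equal to one in both lines.\<close>
lemma jacobi_linearised:
 fixes p u v :: real
 assumes p: "p > 0" and u: "u > 0" and v: "v > 0"
  and z: "!!j. j <= Suc (2 * l) ==> zrev y N (Suc j) = (if even j then 2 * p\<^sup>2 + 2 * (p * v) * t j else 2 * u\<^sup>2 + 2 * (u * v) * t j)"
 shows "(jac_a y N l - 2 * p\<^sup>2) / (2 * p * u) = v / u * lin_a (u\<^sup>2 / (v * p)) (u / p) t l"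
  "jac_b y N l / (2 * p * u)\<^sup>2 = 1 + v / u * lin_b (v / u) (u / p) t l"
proof -
 show "(jac_a y N l - 2 * p\<^sup>2) / (2 * p * u) = v / u * lin_a (u\<^sup>2 / (v * p)) (u / p) t l"
 proof (cases l)
  case 0
  then show ?thesis using z[of 0] p u v by (simp add: jac_a_def zrev_def[of _ _ 0] lin_a_def field_simps power2_eq_square)
 next
  case (Suc i)
  then have "zrev y N (2 * l) = 2 * u\<^sup>2 + 2 * (u * v) * t (2 * l - 1)" "zrev y N (Suc (2 * l)) = 2 * p\<^sup>2 + 2 * (p * v) * t (2 * l)"
   using z[of "2 * l - 1"] z[of "2 * l"] by auto
  then show ?thesis using Suc p u v by (simp add: jac_a_def lin_a_def field_simps power2_eq_square)
 qed
 show "jac_b y N l / (2 * p * u)\<^sup>2 = 1 + v / u * lin_b (v / u) (u / p) t l"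
  using z[of "2 * l"] z[of "Suc (2 * l)"] p u v by (simp add: jac_b_def lin_b_def field_simps power2_eq_square)
qed

text \<open>The Chebyshev coordinates of \<open>\<nu>\<^sub>n - \<rho>\<^sub>\<xi>\<close> as a function of the independent variables.\<close>
definition cheb_chain :: "real => real => real => real => nat => rseq => nat => real" where
 "cheb_chain \<xi> \<beta> g b n t = to_cheb \<xi> (phi \<beta> g b n (chain_mom \<beta> g b n t))"

lemma cheb_chain_measurable: "cheb_chain \<xi> \<beta> g b n \<in> borel \<rightarrow>\<^sub>M borel"
 unfolding cheb_chain_def by measurable

text \<open>The bound on \<open>n\<close> ensures that the first \<open>2 k + 2\<close> entries of the continued fraction are present.\<close>
lemma cheb_chain_jcheb:
 fixes \<beta> g b :: real
 assumes n: "n >= k + 3" and \<beta>: "\<beta> > 0" and g: "g > 0" and b: "b > 0"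
 defines "e \<equiv> sqrt (2 * b / (real n * \<beta>))" and "r \<equiv> sqrt (real n * \<beta> / (2 * g))" and "x \<equiv> real n * \<beta> / (2 * sqrt (b * g))"
 shows "cheb_chain \<xi> \<beta> g b n t k = jcheb (\<lambda>l. e * lin_a x r t l) (\<lambda>l. 1 + e * lin_b e r t l) (Suc k) 0 / e - rho_coord \<xi> k"
proof -
 define p u v where "p = sqrt g" and "u = sqrt (real n * \<beta> / 2)" and "v = sqrt b"
 have nb: "real n * \<beta> > 0" using n \<beta> by simp
 have pos: "p > 0" "u > 0" "v > 0" using g b nb by (simp_all add: p_def u_def v_def)
 have sq: "p\<^sup>2 = g" "u\<^sup>2 = real n * \<beta> / 2" "v\<^sup>2 = b" using g b nb by (simp_all add: p_def u_def v_def)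
 have s: "sqrt (2 * g * real n * \<beta>) = 2 * p * u"
  by (rule real_sqrt_unique) (use pos in \<open>simp_all add: power_mult_distrib sq\<close>)
 have e: "e = v / u" unfolding e_def by (rule real_sqrt_unique) (use pos in \<open>simp_all add: power_divide sq\<close>)
 have r: "r = u / p" unfolding r_def by (rule real_sqrt_unique) (use pos in \<open>simp_all add: power_divide sq\<close>)
 have x: "x = u\<^sup>2 / (v * p)" unfolding x_def sq by (simp add: real_sqrt_mult p_def v_def)
 have c: "sqrt (real n * \<beta> / (2 * b)) = 1 / e"
  unfolding e by (rule real_sqrt_unique) (use pos in \<open>simp_all add: power_divide sq\<close>)
 have kv: "sqrt (kap \<beta> g n j * b) = (if even j then p * v else u * v)" "kap \<beta> g n j = (if even j then p\<^sup>2 else u\<^sup>2)" for j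
  unfolding sq by (auto simp: kap_def real_sqrt_mult p_def u_def v_def)
 let ?y = "ycoord \<beta> g b n t" and ?N = "2 * n - 1"
 have N: "Suc ?N = 2 * n" using n by simp
 have z: "zrev ?y ?N (Suc j) = (if even j then 2 * p\<^sup>2 + 2 * (p * v) * t j else 2 * u\<^sup>2 + 2 * (u * v) * t j)" if "j <= Suc (2 * k)" for j
 proof -
  have "?N - Suc j < 2 * n - 1" "2 * n - 1 - Suc (?N - Suc j) = j" using that n by auto
  then have "zrev ?y ?N (Suc j) = 2 * kap \<beta> g n j + 2 * sqrt (kap \<beta> g n j * b) * t j" unfolding zrev_def ycoord_def by simp
  then show ?thesis unfolding kv(1) unfolding kv(2) by simp
 qed
 have "lfun (mom (G ?y (Suc ?N)) (G ?y ?N)) (pcompose (chb (Suc k)) [:- (2 * g) / (2 * p * u), 1 / (2 * p * u):])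
   = jcheb (\<lambda>l. (jac_a ?y ?N l - 2 * g) / (2 * p * u)) (\<lambda>l. jac_b ?y ?N l / (2 * p * u)\<^sup>2) (Suc k) 0"
  by (rule moments_jcheb) (use pos n in auto)
 then have "lfun (mom (G ?y (2 * n)) (G ?y (2 * n - 1))) (pcompose (chb (Suc k)) (aff \<beta> g n))
   = jcheb (\<lambda>l. (jac_a ?y ?N l - 2 * g) / (2 * p * u)) (\<lambda>l. jac_b ?y ?N l / (2 * p * u)\<^sup>2) (Suc k) 0"
  unfolding aff_def s by (simp only: N)
 also have "jcheb (\<lambda>l. (jac_a ?y ?N l - 2 * g) / (2 * p * u)) (\<lambda>l. jac_b ?y ?N l / (2 * p * u)\<^sup>2) (Suc k)
   = jcheb (\<lambda>l. e * lin_a x r t l) (\<lambda>l. 1 + e * lin_b e r t l) (Suc k)"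
 proof (rule jcheb_cong)
  fix l assume "l < Suc k"
  then have z': "zrev ?y ?N (Suc j) = (if even j then 2 * p\<^sup>2 + 2 * (p * v) * t j else 2 * u\<^sup>2 + 2 * (u * v) * t j)" if "j <= Suc (2 * l)" for j
   using that by (intro z) simp
  show "(jac_a ?y ?N l - 2 * g) / (2 * p * u) = e * lin_a x r t l"
   using jacobi_linearised(1)[OF pos z'] unfolding e r x sq(1) by simp
  show "jac_b ?y ?N l / (2 * p * u)\<^sup>2 = 1 + e * lin_b e r t l"
   using jacobi_linearised(2)[OF pos z'] unfolding e r by simp
 qed
 finally show ?thesis unfolding cheb_chain_def
  by (subst to_cheb_phi) (simp_all add: c mom.simps[of _ _ 0] G_at_0)
qed

lemma (in gamma_scaling) tlaw_prob: "eventually (\<lambda>n. prob_space (T n)) sequentially"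
 using fdens_total[OF zero_less_one] ev_pos
proof eventually_elim
 case (elim n)
 let ?Z = "\<integral>\<^sup>+t. ennreal (F n t) \<partial>lborel"
 have "0 < ennreal (exp (- b n * 1))" by simp
 then have Z: "?Z ~= 0" using elim(1) by (metis leD)
 have Z': "?Z ~= \<infinity>" using elim(1) by (metis ennreal_less_top infinity_ennreal_def leD)
 have "(\<integral>\<^sup>+t. 1 \<partial>T n) = ?Z / ?Z" using elim(2) by (subst nn_integral_tlaw) auto
 also have "... = 1" using Z Z' by (simp add: ennreal_divide_self less_top)
 finally show "prob_space (T n)" by (intro prob_spaceI) simp
qed

lemma nn_integral_indicator_event:
 assumes Z: "Z \<in> Q \<rightarrow>\<^sub>M borel" and S: "S \<in> sets borel"
 shows "(\<integral>\<^sup>+\<omega>. indicator S (Z \<omega>) \<partial>Q) = emeasure Q {\<omega> \<in> space Q. Z \<omega> \<in> S}"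
proof -
 have "Z -` S \<inter> space Q \<in> sets Q" by (rule measurable_sets[OF Z S])
 moreover have "Z -` S \<inter> space Q = {\<omega> \<in> space Q. Z \<omega> \<in> S}" by auto
 ultimately have m: "{\<omega> \<in> space Q. Z \<omega> \<in> S} \<in> sets Q" by simp
 have "(\<integral>\<^sup>+\<omega>. indicator S (Z \<omega>) \<partial>Q) = (\<integral>\<^sup>+\<omega>. indicator {\<omega> \<in> space Q. Z \<omega> \<in> S} \<omega> \<partial>Q)"
  by (rule nn_integral_cong) (simp add: indicator_def)
 then show ?thesis using m by simp
qed

section \<open>The large deviation principle\<close>

theorem theorem2p2:
  fixes \<beta> \<xi> :: real
    and \<gamma> b :: "nat \<Rightarrow> real"
    and M :: "nat \<Rightarrow> 'w measure"
    and L W :: "nat \<Rightarrow> nat \<Rightarrow> 'w \<Rightarrow> real"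
    and q :: "nat \<Rightarrow> real poly"
    and \<sigma> :: "(nat \<Rightarrow> real) \<Rightarrow> real set \<Rightarrow> real"
  assumes "\<beta> > 0"
    and "\<And>n. n \<ge> 1 \<Longrightarrow> \<gamma> n > (real n - 1) * \<beta> / 2"
    and "filterlim (\<lambda>n. \<gamma> n / real n) at_top sequentially"
    and "\<And>n. n \<ge> 1 \<Longrightarrow> b n > 0"
    and "filterlim b at_top sequentially"
    and "(\<lambda>n. b n / real n) \<longlonglongrightarrow> 0"
    and "\<xi> \<ge> 0"
    and "(\<lambda>n. real n * \<beta> / (2 * sqrt (b n * \<gamma> n))) \<longlonglongrightarrow> \<xi>"
    and "\<And>n. n \<ge> 1 \<Longrightarrow> prob_space (M n)"
    and "\<And>n. n \<ge> 1 \<Longrightarrow> laguerre_ensemble \<beta> (\<gamma> n) n (M n) (L n)"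
    and "\<And>n. n \<ge> 1 \<Longrightarrow> dirichlet_weights \<beta> n (M n) (W n)"
    and "\<And>n. n \<ge> 1 \<Longrightarrow> prob_space.indep_var (M n)
           (\<Pi>\<^sub>M i\<in>{1..n}. borel) (\<lambda>\<omega>. \<lambda>i\<in>{1..n}. L n i \<omega>)
           (\<Pi>\<^sub>M i\<in>{1..n}. borel) (\<lambda>\<omega>. \<lambda>i\<in>{1..n}. W n i \<omega>)"
    and "orthonormal_polynomials semicircle q"
    and "\<And>m. \<sigma> m \<in> M0f \<and> moments (\<sigma> m) = m"
  shows "ldp M (\<lambda>n \<omega>. moments (nu \<beta> (\<gamma> n) (b n) n (\<lambda>i. L n i \<omega>) (\<lambda>i. W n i \<omega>))) b
           (rate_function \<xi> q \<sigma>) \<and>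
         good_rate_function (rate_function \<xi> q \<sigma>)"
proof -
 note \<beta> = assms(1) and b_pos = assms(4) and b_lim = assms(5) and b_n = assms(6) and x_lim = assms(8) and prob = assms(9)
 have g_pos: "\<gamma> n > 0" if "n >= 1" for n
 proof -
  have "(real n - 1) * \<beta> / 2 >= 0" using that \<beta> by simp
  then show ?thesis using assms(2)[OF that] by linarith
 qed
 have ev1: "eventually (\<lambda>n. n >= (1::nat)) sequentially" by (rule eventually_ge_at_top)
 have "\<forall>n. \<exists>P. sets P = sets borel & (n >= 1 -->
  (\<forall>F\<in>borel_measurable borel. (\<integral>\<^sup>+\<omega>. F (\<lambda>k. \<Sum>i\<in>{1..n}. W n i \<omega> * L n i \<omega> ^ k) \<partial>M n)
    = (\<integral>\<^sup>+t. F (chain_mom \<beta> (\<gamma> n) (b n) n t) \<partial>P)) &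
  (\<forall>K\<le>2 * n - 1. \<forall>f. (\<forall>j<K. f j \<in> borel_measurable borel) -->
    (\<integral>\<^sup>+t. (\<Prod>j<K. f j (t j)) \<partial>P) = (\<Prod>j<K. \<integral>\<^sup>+x. f j x \<partial>step_law \<beta> (\<gamma> n) (b n) n j)))" (is "\<forall>n. ?Q n")
 proof
  fix n
  show "?Q n"
  proof (cases "n >= 1")
   case True
   from chain_law_exists[OF True \<beta> g_pos[OF True] b_pos[OF True] prob[OF True] assms(10)[OF True] assms(11)[OF True] assms(12)[OF True]]
   show ?thesis by blast
  qed auto
 qed
 from choice[OF this] obtain P where P: "!!n. sets (P n) = sets borel"
  "!!n F. n >= 1 ==> F \<in> borel_measurable borel ==> (\<integral>\<^sup>+\<omega>. F (\<lambda>k. \<Sum>i\<in>{1..n}. W n i \<omega> * L n i \<omega> ^ k) \<partial>M n)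
    = (\<integral>\<^sup>+t. F (chain_mom \<beta> (\<gamma> n) (b n) n t) \<partial>P n)"
  "!!n K f. n >= 1 ==> K <= 2 * n - 1 ==> \<forall>j<K. f j \<in> borel_measurable borel ==>
    (\<integral>\<^sup>+t. (\<Prod>j<K. f j (t j)) \<partial>P n) = (\<Prod>j<K. \<integral>\<^sup>+x. f j x \<partial>step_law \<beta> (\<gamma> n) (b n) n j)"
  by blast
 have g_lim: "filterlim \<gamma> at_top sequentially"
 proof (rule filterlim_at_top_mono[OF assms(3)])
  show "eventually (\<lambda>n. \<gamma> n / real n <= \<gamma> n) sequentially"
   using ev1
  proof eventually_elim
   case (elim n)
   have "\<gamma> n * 1 <= \<gamma> n * real n" using elim g_pos[OF elim] by (intro mult_left_mono) auto
   then show ?case using elim by (simp add: divide_le_eq)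
  qed
 qed
 have gi: "(\<lambda>n. inverse (\<gamma> n / real n)) \<longlonglongrightarrow> 0" by (rule tendsto_inverse_0_at_top[OF assms(3)])
 have scaling: "gamma_scaling (\<lambda>n. kap \<beta> (\<gamma> n) n j) b" for j
 proof
  show "filterlim b at_top sequentially" by (rule b_lim)
  show "filterlim (\<lambda>n. kap \<beta> (\<gamma> n) n j) at_top sequentially"
  proof (cases "even j")
   case False
   have "filterlim (\<lambda>n. (\<beta> / 2) * real n) at_top sequentially"
    by (rule filterlim_tendsto_pos_mult_at_top[OF tendsto_const _ filterlim_real_sequentially]) (use \<beta> in simp)
   then show ?thesis using False by (simp add: kap_def mult.commute)
  qed (use g_lim in \<open>simp add: kap_def\<close>)
  show "(\<lambda>n. b n / kap \<beta> (\<gamma> n) n j) \<longlonglongrightarrow> 0"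
  proof (cases "even j")
   case True
   have "(\<lambda>n. (b n / real n) * inverse (\<gamma> n / real n)) \<longlonglongrightarrow> 0 * 0" by (rule tendsto_mult[OF b_n gi])
   moreover have "eventually (\<lambda>n. (b n / real n) * inverse (\<gamma> n / real n) = b n / kap \<beta> (\<gamma> n) n j) sequentially"
    using ev1 by eventually_elim (use True in \<open>simp add: kap_def inverse_eq_divide\<close>)
   ultimately show ?thesis by (simp add: tendsto_cong)
  next
   case False
   have "(\<lambda>n. (b n / real n) * (2 / \<beta>)) \<longlonglongrightarrow> 0 * (2 / \<beta>)" by (rule tendsto_mult[OF b_n tendsto_const])
   moreover have "(\<lambda>n. (b n / real n) * (2 / \<beta>)) = (\<lambda>n. b n / kap \<beta> (\<gamma> n) n j)" using False by (simp add: kap_def fun_eq_iff)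
   ultimately show ?thesis by (simp only: mult_zero_left)
  qed
 qed
 \<comment> \<open>The value at \<open>n = 0\<close> only serves to keep \<open>e\<close> nonzero everywhere.\<close>
 define e where "e n = (if n = 0 then 1 else sqrt (2 * b n / (real n * \<beta>)))" for n
 define r where "r n = sqrt (real n * \<beta> / (2 * \<gamma> n))" for n
 have e_nz: "e n ~= 0" for n using b_pos[of n] \<beta> by (auto simp: e_def)
 have e_lim: "e \<longlonglongrightarrow> 0"
 proof -
  have "(\<lambda>n. sqrt ((b n / real n) * (2 / \<beta>))) \<longlonglongrightarrow> sqrt (0 * (2 / \<beta>))" by (intro tendsto_real_sqrt tendsto_mult b_n tendsto_const)
  moreover have "eventually (\<lambda>n. sqrt ((b n / real n) * (2 / \<beta>)) = e n) sequentially"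
   using ev1 by eventually_elim (simp add: e_def mult.commute)
  ultimately show ?thesis by (simp add: tendsto_cong)
 qed
 have r_lim: "r \<longlonglongrightarrow> 0"
 proof -
  have "(\<lambda>n. sqrt ((\<beta> / 2) * inverse (\<gamma> n / real n))) \<longlonglongrightarrow> sqrt ((\<beta> / 2) * 0)" by (intro tendsto_real_sqrt tendsto_mult gi tendsto_const)
  moreover have "(\<lambda>n. sqrt ((\<beta> / 2) * inverse (\<gamma> n / real n))) = r" by (simp add: r_def fun_eq_iff inverse_eq_divide mult.commute)
  ultimately show ?thesis by simp
 qed
 interpret ap: asymptotic_product P "\<lambda>n j. step_law \<beta> (\<gamma> n) (b n) n j"
  "\<lambda>n. cheb_chain \<xi> \<beta> (\<gamma> n) (b n) n" b
 proof
  show "sets (P n) = sets borel" for n by (rule P(1))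
  show "cheb_chain \<xi> \<beta> (\<gamma> n) (b n) n \<in> borel \<rightarrow>\<^sub>M borel" for n by (rule cheb_chain_measurable)
  show "filterlim b at_top sequentially" by (rule b_lim)
  show "eventually (\<lambda>n. prob_space (step_law \<beta> (\<gamma> n) (b n) n j)) sequentially" for j
   by (rule gamma_scaling.tlaw_prob[OF scaling])
  show "eventually (\<lambda>n. \<forall>f. (\<forall>j<K. f j \<in> borel_measurable borel) -->
    (\<integral>\<^sup>+t. (\<Prod>j<K. f j (t j)) \<partial>P n) = (\<Prod>j<K. \<integral>\<^sup>+x. f j x \<partial>step_law \<beta> (\<gamma> n) (b n) n j)) sequentially" for K
   using eventually_ge_at_top[of "Suc K"]
  proof eventually_elim
   case (elim n)
   then have "n >= 1" "K <= 2 * n - 1" by auto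
   then show ?case using P(3) by blast
  qed
  show "eventually (\<lambda>n. ennreal (exp (- b n * (x\<^sup>2 / 2 + \<eta>))) <= (\<integral>\<^sup>+t. indicator {t. \<bar>t - x\<bar> < \<delta>} t \<partial>step_law \<beta> (\<gamma> n) (b n) n j)) sequentially"
   if "\<delta> > 0" "\<eta> > 0" for j x \<delta> \<eta> by (rule gamma_scaling.tlaw_lower[OF scaling that])
  show "eventually (\<lambda>n. (\<integral>\<^sup>+t. ennreal (exp (b n * t\<^sup>2 / 2)) * indicator {t. \<bar>t\<bar> <= R} t \<partial>step_law \<beta> (\<gamma> n) (b n) n j) <= ennreal (exp (b n * \<eta>))) sequentially"
   if "R > 0" "\<eta> > 0" for j R \<eta> by (rule gamma_scaling.tlaw_gauss[OF scaling that])
  show "eventually (\<lambda>n. (\<integral>\<^sup>+t. indicator {t. R < \<bar>t\<bar>} t \<partial>step_law \<beta> (\<gamma> n) (b n) n j) <= ennreal (exp (- b n * (R\<^sup>2 / 8)))) sequentially"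
   if "R > 0" for j R by (rule gamma_scaling.tlaw_tail[OF scaling that])
  show "\<exists>J. \<forall>R>0. \<forall>\<delta>>0. eventually (\<lambda>n. \<forall>t. (\<forall>j<J. \<bar>t j\<bar> <= R) --> (\<forall>k<K. \<bar>cheb_chain \<xi> \<beta> (\<gamma> n) (b n) n t k - t k\<bar> < \<delta>)) sequentially" for K
  proof (intro exI[of _ "2 * K + 2"] allI impI)
   fix R \<delta> :: real assume R: "R > 0" and \<delta>: "\<delta> > 0"
   have "eventually (\<lambda>n. \<forall>k\<in>{..<K}. \<forall>t. (\<forall>j<2 * k + 2. \<bar>t j\<bar> <= R) -->
    \<bar>jcheb (\<lambda>l. e n * lin_a (real n * \<beta> / (2 * sqrt (b n * \<gamma> n))) (r n) t l) (\<lambda>l. 1 + e n * lin_b (e n) (r n) t l) (Suc k) 0 / e n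
      - (if even k & k >= 2 then \<xi> else 0) - t k\<bar> < \<delta>) sequentially"
    by (intro eventually_ball_finite ballI chebyshev_moment_asymptotics[OF e_lim e_nz r_lim x_lim R \<delta>] finite_lessThan)
   with eventually_ge_at_top[of "K + 3"]
   show "eventually (\<lambda>n. \<forall>t. (\<forall>j<2 * K + 2. \<bar>t j\<bar> <= R) --> (\<forall>k<K. \<bar>cheb_chain \<xi> \<beta> (\<gamma> n) (b n) n t k - t k\<bar> < \<delta>)) sequentially"
   proof eventually_elim
    case (elim n)
    then have n: "n >= 1" by simp
    then have en: "e n = sqrt (2 * b n / (real n * \<beta>))" by (simp add: e_def)
    show ?case
    proof (intro allI impI)
     fix t k assume t: "\<forall>j<2 * K + 2. \<bar>t j\<bar> <= R" and k: "k < K"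
     have "n >= k + 3" using elim(1) k by simp
     note cc = cheb_chain_jcheb[OF this \<beta> g_pos[OF n] b_pos[OF n], of \<xi> t, folded en r_def[of n], unfolded rho_coord_def]
     have "\<forall>j<2 * k + 2. \<bar>t j\<bar> <= R" using t k by auto
     then show "\<bar>cheb_chain \<xi> \<beta> (\<gamma> n) (b n) n t k - t k\<bar> < \<delta>" unfolding cc using elim(2) k by blast
    qed
   qed
  qed
 qed
 define X where "X n \<omega> = moments (nu \<beta> (\<gamma> n) (b n) n (\<lambda>i. L n i \<omega>) (\<lambda>i. W n i \<omega>))" for n \<omega>
 define Mom where "Mom n \<omega> k = (\<Sum>i\<in>{1..n}. W n i \<omega> * L n i \<omega> ^ k)" for n \<omega> and k :: nat
 have XM: "X n \<omega> = phi \<beta> (\<gamma> n) (b n) n (Mom n \<omega>)" if "n >= 1" for n \<omega>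
  unfolding X_def moments_nu[OF \<beta> b_pos[OF that]] Mom_def ..
 have Mom_meas: "Mom n \<in> M n \<rightarrow>\<^sub>M borel" if n: "n >= 1" for n
 proof (rule measurable_seqI)
  fix k
  interpret prob_space "M n" by (rule prob[OF n])
  note rv = indep_var_rv1[OF assms(12)[OF n]] indep_var_rv2[OF assms(12)[OF n]]
  have "L n i \<in> borel_measurable (M n)" "W n i \<in> borel_measurable (M n)" if i: "i \<in> {1..n}" for i
   using measurable_compose[OF rv(1) measurable_component_singleton[OF i]] measurable_compose[OF rv(2) measurable_component_singleton[OF i]] i
   by simp_all
  then show "(\<lambda>\<omega>. Mom n \<omega> k) \<in> borel_measurable (M n)"
   unfolding Mom_def by (intro borel_measurable_sum borel_measurable_times borel_measurable_power) auto
 qed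
 have X_meas: "X n \<in> M n \<rightarrow>\<^sub>M borel" if n: "n >= 1" for n
  using measurable_compose[OF Mom_meas[OF n] phi_measurable] XM[OF n] by (simp cong: measurable_cong)
 have transfer: "emeasure (M n) {\<omega> \<in> space (M n). X n \<omega> \<in> S} = emeasure (P n) {t. cheb_chain \<xi> \<beta> (\<gamma> n) (b n) n t \<in> from_cheb \<xi> -` S}"
  if n: "n >= 1" and S: "S \<in> sets borel" for n S
 proof -
  let ?m = "\<lambda>t. chain_mom \<beta> (\<gamma> n) (b n) n t"
  have F: "(\<lambda>m. indicator S (phi \<beta> (\<gamma> n) (b n) n m) :: ennreal) \<in> borel_measurable borel"
   by (rule measurable_compose[OF phi_measurable]) (use S in simp)
  have "?m \<in> borel \<rightarrow>\<^sub>M borel" by measurable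
  then have mm: "?m \<in> P n \<rightarrow>\<^sub>M borel" by (simp add: measurable_cong_sets[OF P(1) refl])
  have "emeasure (M n) {\<omega> \<in> space (M n). X n \<omega> \<in> S} = (\<integral>\<^sup>+\<omega>. indicator S (X n \<omega>) \<partial>M n)"
   by (rule nn_integral_indicator_event[symmetric, OF X_meas[OF n] S])
  also have "... = (\<integral>\<^sup>+t. indicator S (phi \<beta> (\<gamma> n) (b n) n (?m t)) \<partial>P n)"
   unfolding XM[OF n] Mom_def by (rule P(2)[OF n F])
  also have "... = emeasure (P n) {t \<in> space (P n). phi \<beta> (\<gamma> n) (b n) n (?m t) \<in> S}"
   by (rule nn_integral_indicator_event[OF measurable_compose[OF mm phi_measurable] S])
  also have "{t \<in> space (P n). phi \<beta> (\<gamma> n) (b n) n (?m t) \<in> S} = {t. cheb_chain \<xi> \<beta> (\<gamma> n) (b n) n t \<in> from_cheb \<xi> -` S}"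
   using sets_eq_imp_space_eq[OF P(1), of n] by (simp add: cheb_chain_def from_to_cheb)
  finally show ?thesis .
 qed
 have I: "rate_function \<xi> q \<sigma> m = quad_rate (to_cheb \<xi> m)" for m
  using rate_function_quad_rate[OF assms(13)] assms(14)[of m] by blast
 have "ldp M X b (rate_function \<xi> q \<sigma>)"
 proof (rule ldpI)
  show "prob_space (M n)" "X n \<in> M n \<rightarrow>\<^sub>M borel" "0 < b n" if "n >= 1" for n
   using prob[OF that] X_meas[OF that] b_pos[OF that] by auto
  show "filterlim b at_top sequentially" by (rule b_lim)
  show "closed {m. rate_function \<xi> q \<sigma> m <= c}" for c
   using closed_vimage[OF closed_quad_rate[of c] continuous_to_cheb[of \<xi>]] by (simp add: I vimage_def)
 next
  fix C \<alpha> \<eta> assume C: "closed C" and \<alpha>: "(\<alpha>::real) >= 0" and less: "!!m. m \<in> C ==> ennreal \<alpha> < rate_function \<xi> q \<sigma> m" and \<eta>: "(\<eta>::real) > 0"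
  have "eventually (\<lambda>n. emeasure (P n) {t. cheb_chain \<xi> \<beta> (\<gamma> n) (b n) n t \<in> from_cheb \<xi> -` C} <= ennreal (exp (- b n * (\<alpha> - \<eta>)))) sequentially"
  proof (rule ap.upper_bound[OF _ \<alpha> _ \<eta>])
   show "closed (from_cheb \<xi> -` C)" by (rule closed_vimage[OF C continuous_from_cheb])
   show "ennreal \<alpha> < quad_rate y" if "y \<in> from_cheb \<xi> -` C" for y
    using less[of "from_cheb \<xi> y"] that by (simp add: I to_from_cheb)
  qed
  then show "eventually (\<lambda>n. measure (M n) {\<omega> \<in> space (M n). X n \<omega> \<in> C} <= exp (- b n * (\<alpha> - \<eta>))) sequentially"
   using ev1
  proof eventually_elim
   case (elim n)
   interpret prob_space "M n" by (rule prob[OF elim(2)])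
   have "emeasure (M n) {\<omega> \<in> space (M n). X n \<omega> \<in> C} <= ennreal (exp (- b n * (\<alpha> - \<eta>)))"
    using elim(1) transfer[OF elim(2), of C] C by simp
   then show ?case by (simp add: emeasure_eq_measure)
  qed
 next
  fix U m \<iota> \<eta> assume U: "open U" "m \<in> U" and \<iota>: "(\<iota>::real) >= 0" "rate_function \<xi> q \<sigma> m <= ennreal \<iota>" and \<eta>: "(\<eta>::real) > 0"
  have "eventually (\<lambda>n. ennreal (exp (- b n * (\<iota> + \<eta>))) <= emeasure (P n) {t. cheb_chain \<xi> \<beta> (\<gamma> n) (b n) n t \<in> from_cheb \<xi> -` U}) sequentially"
  proof (rule ap.lower_bound[OF _ _ \<iota>(1) _ \<eta>])
   show "open (from_cheb \<xi> -` U)" by (rule open_vimage[OF U(1) continuous_from_cheb])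
   show "to_cheb \<xi> m \<in> from_cheb \<xi> -` U" using U(2) by (simp add: from_to_cheb)
   show "quad_rate (to_cheb \<xi> m) <= ennreal \<iota>" using \<iota>(2) by (simp only: I)
  qed
  then show "eventually (\<lambda>n. exp (- b n * (\<iota> + \<eta>)) <= measure (M n) {\<omega> \<in> space (M n). X n \<omega> \<in> U}) sequentially"
   using ev1
  proof eventually_elim
   case (elim n)
   interpret prob_space "M n" by (rule prob[OF elim(2)])
   have "ennreal (exp (- b n * (\<iota> + \<eta>))) <= emeasure (M n) {\<omega> \<in> space (M n). X n \<omega> \<in> U}"
    using elim(1) transfer[OF elim(2), of U] U by simp
   then show ?case by (simp add: emeasure_eq_measure)
  qed
 qed
 moreover have "good_rate_function (rate_function \<xi> q \<sigma>)"
  unfolding good_rate_function_def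
 proof (intro allI impI)
  fix c :: real assume c: "c >= 0"
  have "compact (from_cheb \<xi> ` {y. quad_rate y <= ennreal c})"
   by (rule compact_continuous_image[OF continuous_on_subset[OF continuous_from_cheb subset_UNIV] compact_quad_rate[OF c]])
  moreover have "from_cheb \<xi> ` {y. quad_rate y <= ennreal c} = {m. rate_function \<xi> q \<sigma> m <= ennreal c}"
  proof (rule set_eqI)
   fix m
   show "m \<in> from_cheb \<xi> ` {y. quad_rate y <= ennreal c} \<longleftrightarrow> m \<in> {m. rate_function \<xi> q \<sigma> m <= ennreal c}"
    unfolding mem_Collect_eq I image_iff by (metis from_to_cheb to_from_cheb mem_Collect_eq)
  qed
  ultimately show "compact {m. rate_function \<xi> q \<sigma> m <= ennreal c}" by simp
 qed
 ultimately show ?thesis unfolding X_def ..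
qed

end
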